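(* Let the setting, notation and standing assumptions of the context hold and assume (A). Then, for every $v\in\mathcal{W}(I)$, $$\rho_{\mathcal{E}}^2(v)=\eta_{\mathcal{E}}^2(v),\qquad\text{where}\quad\rho_{\mathcal{E}}^2(v)\coloneqq\mathcal{E}(v)-\mathcal{E}(u),\quad\eta_{\mathcal{E}}^2(v)\coloneqq\mathcal{E}(v)-\tfrac12\|u_0\|_H^2 .$$
   Context: Spaces. $\Omega\subseteq\mathbb{R}^d$ is a bounded Lipschitz domain whose boundary is split into disjoint relatively open sets $\Gamma_D\neq\emptyset$, $\Gamma_N$ with $\overline\Gamma_D\cup\overline\Gamma_N=\partial\Omega$; $\ell\in\mathbb{N}$; $p\in(1,\infty)$ with $p\ge\frac{2d}{d+2}$, $\frac1p+\frac1{p'}=1$; $I=(0,T)$, $0<T<\infty$; $Q=I\times\Omega$. $V=W^{1,p}_D(\Omega;\mathbb{R}^\ell)$ (zero trace on $\Gamma_D$), $H=L^2(\Omega;\mathbb{R}^\ell)$, $Y=L^p(\Omega;\mathbb{R}^{\ell\times d})$, $Y^*=L^{p'}(\Omega;\mathbb{R}^{\ell\times d})$. $V\hookrightarrow H\cong H^*\hookrightarrow V^*$ is the usual evolution triple, $\mathcal{W}(I)=\{v\in L^p(I;V)\mid\partial_tv\in L^{p'}(I;V^* )\}\hookrightarrow C^0(\overline I;H)$. Integral functionals. A convex normal integrand $g$ on $Q\times\mathbb{R}^m$ is a (Lebesgue $\otimes$ Borel)-measurable function into $\mathbb{R}\cup\{+\infty\}$ such that $g(t,x,\cdot)$ is proper,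 convex and lower semicontinuous for a.e. $(t,x)$. For an integrand $g$, $I_g(x)=\int g(s,x(s))\,ds$ if the positive part of the integrand is integrable, $I_g(x)=+\infty$ otherwise. $I_g^\Omega(t,v)=\int_\Omega g(t,x,v(x))\,dx$ with the same convention. A superscript $*$ denotes the Fenchel conjugate in the last argument for fixed other arguments. Assumption (A). $\phi\colon Q\times\mathbb{R}^{\ell\times d}\to\mathbb{R}\cup\{+\infty\}$ and $\psi\colon Q\times\mathbb{R}^\ell\to\mathbb{R}\cup\{+\infty\}$ are convex normal integrands, and there exist $u^\star\in L^p(I;V)$, $z^\star\in L^{p'}(I;Y^* )$, $w^\star\in L^{p'}(Q;\mathbb{R}^\ell)$ such that the positive parts of $I_\phi^\Omega(\cdot,\nabla u^\star)$, $I_\psi^\Omega(\cdot,u^\star)$, $I_{\phi^*}^\Omega(\cdot,z^\star)$, $I_{\psi^*}^\Omega(\cdot,w^\star)$ are in $L^1(I)$. Data: $f\in L^{p'}(I;V^* )$, $u_0\in H$. For a.e. $t\in I$ and $v\in V$: $E(t,v)=I_\phi^\Omega(t,\nabla v)+I_\psi^\Omega(t,v)-\langle f(t),v\rangle_V$. $I_E(v)=\int_IE(t,v(t))\,dt$ on $L^p(I;V)$ and $I_{E^*}(v^* )=\int_IE^*(t,v^*(t))\,dt$ on $L^{p'}(I;V^* )$. Br\'ezis--Ekeland--Nayroles functional: $\mathcal{E}\colon\mathcal{W}(I)\to\mathbb{R}\cup\{+\infty\}$, $\mathcal{E}(v)=I_E(v)+I_{E^*}(-\partial_tv)+\frac12\|v(T)\|_H^2+\chi_{\{u_0\}}(v(0))$,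 where $\chi_{\{u_0\}}$ is $0$ at $u_0$ and $+\infty$ elsewhere. Standing assumption: there is a solution $u\in\mathcal{W}(I)$ of the subgradient flow $\partial_tu(t)+\partial_vE(t,u(t))\ni0$ in $V^*$ for a.e. $t\in I$, $u(0)=u_0$ in $H$; $u$ is fixed. *)

theory Defs
  imports "HOL-Analysis.Analysis"
begin

section \<open>Bounded Lipschitz domains\<close>

text \<open>Near each boundary point, and after choosing a unit direction \<open>e\<close>, the set is the strict
  epigraph of a Lipschitz function of the coordinates orthogonal to \<open>e\<close>.\<close>

definition lipschitz_boundary :: "'a::euclidean_space set \<Rightarrow> bool" where
  "lipschitz_boundary \<Omega> \<longleftrightarrow>
     (\<forall>x0\<in>frontier \<Omega>. \<exists>e r L. \<exists>\<gamma> :: 'a \<Rightarrow> real.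
        norm e = 1 \<and> r > 0 \<and> L-lipschitz_on {z. z \<bullet> e = 0} \<gamma> \<and>
        \<Omega> \<inter> ball x0 r = {y \<in> ball x0 r. y \<bullet> e > \<gamma> (y - (y \<bullet> e) *\<^sub>R e)})"

definition bounded_lipschitz_domain :: "'a::euclidean_space set \<Rightarrow> bool" where
  "bounded_lipschitz_domain \<Omega> \<longleftrightarrow>
     \<Omega> \<noteq> {} \<and> open \<Omega> \<and> connected \<Omega> \<and> bounded \<Omega> \<and> lipschitz_boundary \<Omega>"

definition boundary_partition :: "'a::euclidean_space set \<Rightarrow> 'a set \<Rightarrow> 'a set \<Rightarrow> bool" where
  "boundary_partition \<Omega> \<Gamma>\<^sub>D \<Gamma>\<^sub>N \<longleftrightarrow>
     openin (top_of_set (frontier \<Omega>)) \<Gamma>\<^sub>D \<and> openin (top_of_set (frontier \<Omega>)) \<Gamma>\<^sub>N \<and>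
     \<Gamma>\<^sub>D \<noteq> {} \<and> \<Gamma>\<^sub>D \<inter> \<Gamma>\<^sub>N = {} \<and> closure \<Gamma>\<^sub>D \<union> closure \<Gamma>\<^sub>N = frontier \<Omega>"


section \<open>Smooth functions and test functions\<close>

text \<open>\<open>D bs\<close> is the iterated partial derivative of \<open>f\<close> along the list \<open>bs\<close> of basis vectors.\<close>

definition smooth :: "('a::euclidean_space \<Rightarrow> real) \<Rightarrow> bool" where
  "smooth f \<longleftrightarrow> (\<exists>D :: 'a list \<Rightarrow> 'a \<Rightarrow> real. D [] = f \<and>
     (\<forall>bs x. (D bs has_derivative (\<lambda>h. \<Sum>b\<in>Basis. (h \<bullet> b) * D (b # bs) x)) (at x)))"

definition test_function :: "'a::euclidean_space set \<Rightarrow> ('a \<Rightarrow> real) \<Rightarrow> bool" where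
  "test_function S \<zeta> \<longleftrightarrow>
     smooth \<zeta> \<and> compact (closure {x. \<zeta> x \<noteq> 0}) \<and> closure {x. \<zeta> x \<noteq> 0} \<subseteq> S"


section \<open>Function spaces on the domain\<close>

text \<open>Elements of function spaces are represented by functions rather than by classes modulo
  equality almost everywhere; the norms are then seminorms, and equations between elements are
  read almost everywhere.  Values outside the domain are irrelevant.\<close>

definition Lp :: "real \<Rightarrow> 'a measure \<Rightarrow> ('a \<Rightarrow> 'b::euclidean_space) set" where
  "Lp r M = {f \<in> borel_measurable M. (\<integral>\<^sup>+x. ennreal (norm (f x) powr r) \<partial>M) < \<infinity>}"

definition Lp_norm :: "real \<Rightarrow> 'a measure \<Rightarrow> ('a \<Rightarrow> 'b::euclidean_space) \<Rightarrow> real" where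
  "Lp_norm r M f = (LINT x|M. norm (f x) powr r) powr (1 / r)"

definition is_weak_gradient ::
    "(real^'d) set \<Rightarrow> (real^'d \<Rightarrow> real^'l) \<Rightarrow> (real^'d \<Rightarrow> real^'d^'l) \<Rightarrow> bool" where
  "is_weak_gradient \<Omega> v g \<longleftrightarrow>
     (\<forall>\<zeta>. test_function \<Omega> \<zeta> \<longrightarrow> (\<forall>i j.
        (LINT x|lebesgue_on \<Omega>. v x $ i * frechet_derivative \<zeta> (at x) (axis j 1)) =
        - (LINT x|lebesgue_on \<Omega>. g x $ i $ j * \<zeta> x)))"

definition W1p :: "(real^'d) set \<Rightarrow> real \<Rightarrow> (real^'d \<Rightarrow> real^'l) set" where
  "W1p \<Omega> p = {v \<in> Lp p (lebesgue_on \<Omega>). \<exists>g \<in> Lp p (lebesgue_on \<Omega>). is_weak_gradient \<Omega> v g}"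

definition weak_grad ::
    "(real^'d) set \<Rightarrow> real \<Rightarrow> (real^'d \<Rightarrow> real^'l) \<Rightarrow> real^'d \<Rightarrow> real^'d^'l" where
  "weak_grad \<Omega> p v = (SOME g. g \<in> Lp p (lebesgue_on \<Omega>) \<and> is_weak_gradient \<Omega> v g)"

definition W1p_norm :: "(real^'d) set \<Rightarrow> real \<Rightarrow> (real^'d \<Rightarrow> real^'l) \<Rightarrow> real" where
  "W1p_norm \<Omega> p v =
     (Lp_norm p (lebesgue_on \<Omega>) v powr p
        + Lp_norm p (lebesgue_on \<Omega>) (weak_grad \<Omega> p v) powr p) powr (1 / p)"


subsection \<open>Traces\<close>

text \<open>Normalised \<open>(d - 1)\<close>-dimensional Hausdorff outer measure on \<open>\<real>\<^sup>d\<close>, and the surface measure as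
  its restriction to the Borel sets, where it is countably additive.  Empty covering sets are
  treated separately because \<open>0 ^ 0 = 1\<close> when \<open>d = 1\<close>.\<close>

definition surface_premeasure :: "real \<Rightarrow> (real^'d) set \<Rightarrow> ennreal" where
  "surface_premeasure \<delta> A =
     Inf {(\<Sum>n. if C n = {} then 0
               else ennreal (unit_ball_vol (real (CARD('d) - 1))
                               * (diameter (C n) / 2) ^ (CARD('d) - 1))) |
          C :: nat \<Rightarrow> (real^'d) set.
          A \<subseteq> (\<Union>n. C n) \<and> (\<forall>n. bounded (C n) \<and> diameter (C n) \<le> \<delta>)}"

definition surface_measure :: "(real^'d) measure" where
  "surface_measure = measure_of UNIV (sets borel) (\<lambda>A. SUP \<delta>\<in>{0<..}. surface_premeasure \<delta> A)"

abbreviation boundary_measure :: "(real^'d) set \<Rightarrow> (real^'d) measure" where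
  "boundary_measure \<Omega> \<equiv> restrict_space surface_measure (frontier \<Omega>)"

text \<open>The trace operator is the continuous extension to \<open>W\<^sup>1\<^sup>,\<^sup>p\<close> of restriction to the boundary,
  defined on functions that are smooth up to the boundary.\<close>

definition has_trace ::
    "(real^'d) set \<Rightarrow> real \<Rightarrow> (real^'d \<Rightarrow> real^'l) \<Rightarrow> (real^'d \<Rightarrow> real^'l) \<Rightarrow> bool" where
  "has_trace \<Omega> p v g \<longleftrightarrow>
     g \<in> Lp p (boundary_measure \<Omega>) \<and>
     (\<exists>w :: nat \<Rightarrow> real^'d \<Rightarrow> real^'l.
        (\<forall>n i. smooth (\<lambda>x. w n x $ i)) \<and>
        (\<lambda>n. W1p_norm \<Omega> p (w n - v)) \<longlonglongrightarrow> 0 \<and>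
        (\<lambda>n. Lp_norm p (boundary_measure \<Omega>) (w n - g)) \<longlonglongrightarrow> 0)"

definition W1p_D :: "(real^'d) set \<Rightarrow> (real^'d) set \<Rightarrow> real \<Rightarrow> (real^'d \<Rightarrow> real^'l) set" where
  "W1p_D \<Omega> \<Gamma>\<^sub>D p =
     {v \<in> W1p \<Omega> p. \<exists>g. has_trace \<Omega> p v g \<and> (AE x in boundary_measure \<Omega>. x \<in> \<Gamma>\<^sub>D \<longrightarrow> g x = 0)}"


section \<open>Dual spaces and Bochner spaces\<close>

text \<open>A seminormed space of functions is given by its carrier \<open>X\<close> and its seminorm \<open>N\<close>.\<close>

definition dual_space ::
    "('a \<Rightarrow> 'b::real_vector) set \<Rightarrow> (('a \<Rightarrow> 'b) \<Rightarrow> real) \<Rightarrow> (('a \<Rightarrow> 'b) \<Rightarrow> real) set" where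
  "dual_space X N =
     {\<xi>. (\<forall>v\<in>X. \<forall>w\<in>X. \<forall>a b. \<xi> (\<lambda>x. a *\<^sub>R v x + b *\<^sub>R w x) = a * \<xi> v + b * \<xi> w) \<and>
         (\<exists>C. \<forall>v\<in>X. \<bar>\<xi> v\<bar> \<le> C * N v)}"

definition dual_norm ::
    "('a \<Rightarrow> 'b) set \<Rightarrow> (('a \<Rightarrow> 'b) \<Rightarrow> real) \<Rightarrow> (('a \<Rightarrow> 'b) \<Rightarrow> real) \<Rightarrow> real" where
  "dual_norm X N \<xi> = (SUP v\<in>{v \<in> X. N v \<le> 1}. \<bar>\<xi> v\<bar>)"

definition strongly_measurable ::
    "real set \<Rightarrow> 'a::minus set \<Rightarrow> ('a \<Rightarrow> real) \<Rightarrow> (real \<Rightarrow> 'a) \<Rightarrow> bool" where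
  "strongly_measurable J X N f \<longleftrightarrow>
     (\<exists>s :: nat \<Rightarrow> real \<Rightarrow> 'a.
        (\<forall>n. finite (s n ` J) \<and> s n ` J \<subseteq> X \<and> (\<forall>y. {t \<in> J. s n t = y} \<in> sets lebesgue)) \<and>
        (AE t in lebesgue_on J. (\<lambda>n. N (s n t - f t)) \<longlonglongrightarrow> 0))"

definition bochner_Lp ::
    "real \<Rightarrow> real set \<Rightarrow> 'a::minus set \<Rightarrow> ('a \<Rightarrow> real) \<Rightarrow> (real \<Rightarrow> 'a) set" where
  "bochner_Lp r J X N =
     {f. (AE t in lebesgue_on J. f t \<in> X) \<and> strongly_measurable J X N f \<and>
         (\<integral>\<^sup>+t. ennreal (N (f t) powr r) \<partial>lebesgue_on J) < \<infinity>}"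

abbreviation bochner_Lp_V ::
    "(real^'d) set \<Rightarrow> (real^'d) set \<Rightarrow> real \<Rightarrow> real \<Rightarrow> real set
       \<Rightarrow> (real \<Rightarrow> real^'d \<Rightarrow> real^'l) set" where
  "bochner_Lp_V \<Omega> \<Gamma>\<^sub>D p r J \<equiv> bochner_Lp r J (W1p_D \<Omega> \<Gamma>\<^sub>D p) (W1p_norm \<Omega> p)"

abbreviation bochner_Lp_Vdual ::
    "(real^'d) set \<Rightarrow> (real^'d) set \<Rightarrow> real \<Rightarrow> real \<Rightarrow> real set
       \<Rightarrow> (real \<Rightarrow> (real^'d \<Rightarrow> real^'l) \<Rightarrow> real) set" where
  "bochner_Lp_Vdual \<Omega> \<Gamma>\<^sub>D p r J \<equiv>
     bochner_Lp r J (dual_space (W1p_D \<Omega> \<Gamma>\<^sub>D p) (W1p_norm \<Omega> p))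
                    (dual_norm (W1p_D \<Omega> \<Gamma>\<^sub>D p) (W1p_norm \<Omega> p))"


section \<open>The evolution triple and the space of the flow\<close>

text \<open>The embedding of \<open>H = L\<^sup>2(\<Omega>)\<close>, identified with its dual, into the dual of \<open>V\<close>.\<close>

definition H_to_Vdual ::
    "(real^'d) set \<Rightarrow> (real^'d \<Rightarrow> real^'l) \<Rightarrow> (real^'d \<Rightarrow> real^'l) \<Rightarrow> real" where
  "H_to_Vdual \<Omega> h = (\<lambda>w. LINT x|lebesgue_on \<Omega>. h x \<bullet> w x)"

text \<open>Distributional derivative on \<open>J\<close> of an integrable function with values in the dual of \<open>V\<close>;
  the identity between elements of the dual is written out on elements \<open>w\<close> of \<open>V\<close>.\<close>

definition has_weak_time_derivative ::
    "(real^'d) set \<Rightarrow> (real^'d) set \<Rightarrow> real \<Rightarrow> real set \<Rightarrow>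
     (real \<Rightarrow> (real^'d \<Rightarrow> real^'l) \<Rightarrow> real) \<Rightarrow> (real \<Rightarrow> (real^'d \<Rightarrow> real^'l) \<Rightarrow> real) \<Rightarrow> bool" where
  "has_weak_time_derivative \<Omega> \<Gamma>\<^sub>D p J G G' \<longleftrightarrow>
     G \<in> bochner_Lp_Vdual \<Omega> \<Gamma>\<^sub>D p 1 J \<and> G' \<in> bochner_Lp_Vdual \<Omega> \<Gamma>\<^sub>D p 1 J \<and>
     (\<forall>\<theta>. test_function J \<theta> \<longrightarrow> (\<forall>w \<in> W1p_D \<Omega> \<Gamma>\<^sub>D p.
        (LINT t|lebesgue_on J. deriv \<theta> t * G t w) = - (LINT t|lebesgue_on J. \<theta> t * G' t w)))"

text \<open>Here \<open>q\<close> is the conjugate exponent of \<open>p\<close>.  For \<open>p \<ge> 2 d / (d + 2)\<close> the space \<open>V\<close> embeds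
  into \<open>H\<close>, so membership of \<open>v t\<close> in \<open>H\<close> and the \<open>V\<^sup>*\<close>-integrability of the embedded function
  required above only make explicit that \<open>v\<close> is read through \<open>V \<hookrightarrow> H \<hookrightarrow> V\<^sup>*\<close>.\<close>

definition is_time_derivative ::
    "(real^'d) set \<Rightarrow> (real^'d) set \<Rightarrow> real \<Rightarrow> real \<Rightarrow> real \<Rightarrow>
     (real \<Rightarrow> real^'d \<Rightarrow> real^'l) \<Rightarrow> (real \<Rightarrow> (real^'d \<Rightarrow> real^'l) \<Rightarrow> real) \<Rightarrow> bool" where
  "is_time_derivative \<Omega> \<Gamma>\<^sub>D p q T v v' \<longleftrightarrow>
     v' \<in> bochner_Lp_Vdual \<Omega> \<Gamma>\<^sub>D p q {0<..<T} \<and>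
     (AE t in lebesgue_on {0<..<T}. v t \<in> Lp 2 (lebesgue_on \<Omega>)) \<and>
     has_weak_time_derivative \<Omega> \<Gamma>\<^sub>D p {0<..<T} (\<lambda>t. H_to_Vdual \<Omega> (v t)) v'"

definition W_space ::
    "(real^'d) set \<Rightarrow> (real^'d) set \<Rightarrow> real \<Rightarrow> real \<Rightarrow> real
       \<Rightarrow> (real \<Rightarrow> real^'d \<Rightarrow> real^'l) set" where
  "W_space \<Omega> \<Gamma>\<^sub>D p q T =
     {v \<in> bochner_Lp_V \<Omega> \<Gamma>\<^sub>D p p {0<..<T}. \<exists>v'. is_time_derivative \<Omega> \<Gamma>\<^sub>D p q T v v'}"

definition time_derivative ::
    "(real^'d) set \<Rightarrow> (real^'d) set \<Rightarrow> real \<Rightarrow> real \<Rightarrow> real \<Rightarrow>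
     (real \<Rightarrow> real^'d \<Rightarrow> real^'l) \<Rightarrow> real \<Rightarrow> (real^'d \<Rightarrow> real^'l) \<Rightarrow> real" where
  "time_derivative \<Omega> \<Gamma>\<^sub>D p q T v = (SOME v'. is_time_derivative \<Omega> \<Gamma>\<^sub>D p q T v v')"

text \<open>Point values in time are those of the representative in \<open>C\<^sup>0([0,T]; H)\<close>.\<close>

definition is_continuous_rep ::
    "(real^'d) set \<Rightarrow> real \<Rightarrow> (real \<Rightarrow> real^'d \<Rightarrow> real^'l) \<Rightarrow> (real \<Rightarrow> real^'d \<Rightarrow> real^'l) \<Rightarrow> bool"
  where
  "is_continuous_rep \<Omega> T v c \<longleftrightarrow>
     (\<forall>t\<in>{0..T}. c t \<in> Lp 2 (lebesgue_on \<Omega>)) \<and>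
     (\<forall>t\<in>{0..T}. ((\<lambda>s. Lp_norm 2 (lebesgue_on \<Omega>) (c s - c t)) \<longlongrightarrow> 0) (at t within {0..T})) \<and>
     (AE t in lebesgue_on {0<..<T}. AE x in lebesgue_on \<Omega>. v t x = c t x)"

definition value_at ::
    "(real^'d) set \<Rightarrow> real \<Rightarrow> (real \<Rightarrow> real^'d \<Rightarrow> real^'l) \<Rightarrow> real \<Rightarrow> real^'d \<Rightarrow> real^'l" where
  "value_at \<Omega> T v = (SOME c. is_continuous_rep \<Omega> T v c)"


section \<open>Integral functionals and convex analysis\<close>

text \<open>\<open>e2ennreal\<close> truncates negative values to \<open>0\<close>.\<close>

definition has_integrable_pos_part :: "'a measure \<Rightarrow> ('a \<Rightarrow> ereal) \<Rightarrow> bool" where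
  "has_integrable_pos_part M g \<longleftrightarrow>
     (\<lambda>s. max 0 (g s)) \<in> borel_measurable M \<and> (\<integral>\<^sup>+s. e2ennreal (g s) \<partial>M) < \<infinity>"

definition ext_integral :: "'a measure \<Rightarrow> ('a \<Rightarrow> ereal) \<Rightarrow> ereal" where
  "ext_integral M g =
     (if g \<in> borel_measurable M \<and> has_integrable_pos_part M g
      then enn2ereal (\<integral>\<^sup>+s. e2ennreal (g s) \<partial>M) - enn2ereal (\<integral>\<^sup>+s. e2ennreal (- g s) \<partial>M)
      else \<infinity>)"

definition convex_normal_integrand ::
    "(real \<times> (real^'d)) set \<Rightarrow> (real \<Rightarrow> real^'d \<Rightarrow> 'b::euclidean_space \<Rightarrow> ereal) \<Rightarrow> bool" where
  "convex_normal_integrand Q g \<longleftrightarrow>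
     (\<lambda>((t, x), z). g t x z) \<in> borel_measurable (lebesgue_on Q \<Otimes>\<^sub>M borel) \<and>
     (\<forall>(t, x)\<in>Q. \<forall>z. g t x z \<noteq> -\<infinity>) \<and>
     (AE (t, x) in lebesgue_on Q.
        (\<exists>z. g t x z \<noteq> \<infinity>) \<and>
        (\<forall>y z. \<forall>s\<in>{0<..<1}.
           g t x (s *\<^sub>R y + (1 - s) *\<^sub>R z) \<le> ereal s * g t x y + ereal (1 - s) * g t x z) \<and>
        (\<forall>z. g t x z \<le> Liminf (at z) (g t x)))"

definition integrand_conj ::
    "(real \<Rightarrow> real^'d \<Rightarrow> 'b::euclidean_space \<Rightarrow> ereal) \<Rightarrow> real \<Rightarrow> real^'d \<Rightarrow> 'b \<Rightarrow> ereal" where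
  "integrand_conj g t x \<zeta> = (SUP z. ereal (\<zeta> \<bullet> z) - g t x z)"

definition slice_integral ::
    "(real^'d) set \<Rightarrow> (real \<Rightarrow> real^'d \<Rightarrow> 'b \<Rightarrow> ereal) \<Rightarrow> real \<Rightarrow> (real^'d \<Rightarrow> 'b) \<Rightarrow> ereal" where
  "slice_integral \<Omega> g t v = ext_integral (lebesgue_on \<Omega>) (\<lambda>x. g t x (v x))"

definition assumption_A ::
    "(real^'d) set \<Rightarrow> (real^'d) set \<Rightarrow> real \<Rightarrow> real \<Rightarrow> real \<Rightarrow>
     (real \<Rightarrow> real^'d \<Rightarrow> real^'d^'l \<Rightarrow> ereal) \<Rightarrow> (real \<Rightarrow> real^'d \<Rightarrow> real^'l \<Rightarrow> ereal) \<Rightarrow> bool" where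
  "assumption_A \<Omega> \<Gamma>\<^sub>D p q T \<phi> \<psi> \<longleftrightarrow>
     convex_normal_integrand ({0<..<T} \<times> \<Omega>) \<phi> \<and>
     convex_normal_integrand ({0<..<T} \<times> \<Omega>) \<psi> \<and>
     (\<exists>us zs ws.
        us \<in> bochner_Lp_V \<Omega> \<Gamma>\<^sub>D p p {0<..<T} \<and>
        zs \<in> bochner_Lp q {0<..<T} (Lp q (lebesgue_on \<Omega>)) (Lp_norm q (lebesgue_on \<Omega>)) \<and>
        (\<lambda>(t, x). ws t x) \<in> Lp q (lebesgue_on ({0<..<T} \<times> \<Omega>)) \<and>
        has_integrable_pos_part (lebesgue_on {0<..<T})
          (\<lambda>t. slice_integral \<Omega> \<phi> t (weak_grad \<Omega> p (us t))) \<and>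
        has_integrable_pos_part (lebesgue_on {0<..<T}) (\<lambda>t. slice_integral \<Omega> \<psi> t (us t)) \<and>
        has_integrable_pos_part (lebesgue_on {0<..<T})
          (\<lambda>t. slice_integral \<Omega> (integrand_conj \<phi>) t (zs t)) \<and>
        has_integrable_pos_part (lebesgue_on {0<..<T})
          (\<lambda>t. slice_integral \<Omega> (integrand_conj \<psi>) t (ws t)))"

definition fenchel_conj :: "('a \<Rightarrow> 'b) set \<Rightarrow> (('a \<Rightarrow> 'b) \<Rightarrow> ereal)
    \<Rightarrow> (('a \<Rightarrow> 'b) \<Rightarrow> real) \<Rightarrow> ereal" where
  "fenchel_conj X F \<xi> = (SUP w\<in>X. ereal (\<xi> w) - F w)"

definition subdifferential :: "('a \<Rightarrow> 'b::real_normed_vector) set \<Rightarrow> (('a \<Rightarrow> 'b) \<Rightarrow> real)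
    \<Rightarrow> (('a \<Rightarrow> 'b) \<Rightarrow> ereal) \<Rightarrow> ('a \<Rightarrow> 'b) \<Rightarrow> (('a \<Rightarrow> 'b) \<Rightarrow> real) set" where
  "subdifferential X N F v =
     {\<xi> \<in> dual_space X N. \<bar>F v\<bar> \<noteq> \<infinity> \<and> (\<forall>w\<in>X. F v + ereal (\<xi> (w - v)) \<le> F w)}"


section \<open>The energy, the subgradient flow and the Brezis--Ekeland--Nayroles functional\<close>

definition energy ::
    "(real^'d) set \<Rightarrow> real \<Rightarrow>
     (real \<Rightarrow> real^'d \<Rightarrow> real^'d^'l \<Rightarrow> ereal) \<Rightarrow> (real \<Rightarrow> real^'d \<Rightarrow> real^'l \<Rightarrow> ereal) \<Rightarrow>
     (real \<Rightarrow> (real^'d \<Rightarrow> real^'l) \<Rightarrow> real) \<Rightarrow> real \<Rightarrow> (real^'d \<Rightarrow> real^'l) \<Rightarrow> ereal" where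
  "energy \<Omega> p \<phi> \<psi> f t v =
     slice_integral \<Omega> \<phi> t (weak_grad \<Omega> p v) + slice_integral \<Omega> \<psi> t v - ereal (f t v)"

definition is_flow_solution ::
    "(real^'d) set \<Rightarrow> (real^'d) set \<Rightarrow> real \<Rightarrow> real \<Rightarrow> real \<Rightarrow>
     (real \<Rightarrow> (real^'d \<Rightarrow> real^'l) \<Rightarrow> ereal) \<Rightarrow> (real^'d \<Rightarrow> real^'l) \<Rightarrow>
     (real \<Rightarrow> real^'d \<Rightarrow> real^'l) \<Rightarrow> bool" where
  "is_flow_solution \<Omega> \<Gamma>\<^sub>D p q T E u0 u \<longleftrightarrow>
     u \<in> W_space \<Omega> \<Gamma>\<^sub>D p q T \<and>
     (AE t in lebesgue_on {0<..<T}.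
        - time_derivative \<Omega> \<Gamma>\<^sub>D p q T u t
          \<in> subdifferential (W1p_D \<Omega> \<Gamma>\<^sub>D p) (W1p_norm \<Omega> p) (E t) (u t)) \<and>
     (AE x in lebesgue_on \<Omega>. value_at \<Omega> T u 0 x = u0 x)"

definition BEN_functional ::
    "(real^'d) set \<Rightarrow> (real^'d) set \<Rightarrow> real \<Rightarrow> real \<Rightarrow> real \<Rightarrow>
     (real \<Rightarrow> (real^'d \<Rightarrow> real^'l) \<Rightarrow> ereal) \<Rightarrow> (real^'d \<Rightarrow> real^'l) \<Rightarrow>
     (real \<Rightarrow> real^'d \<Rightarrow> real^'l) \<Rightarrow> ereal" where
  "BEN_functional \<Omega> \<Gamma>\<^sub>D p q T E u0 v =
     ext_integral (lebesgue_on {0<..<T}) (\<lambda>t. E t (v t))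
     + ext_integral (lebesgue_on {0<..<T})
         (\<lambda>t. fenchel_conj (W1p_D \<Omega> \<Gamma>\<^sub>D p) (E t) (- time_derivative \<Omega> \<Gamma>\<^sub>D p q T v t))
     + ereal ((1/2) * (Lp_norm 2 (lebesgue_on \<Omega>) (value_at \<Omega> T v T))\<^sup>2)
     + (if AE x in lebesgue_on \<Omega>. value_at \<Omega> T v 0 x = u0 x then 0 else \<infinity>)"

definition rho_squared ::
    "((real \<Rightarrow> real^'d \<Rightarrow> real^'l) \<Rightarrow> ereal) \<Rightarrow> (real \<Rightarrow> real^'d \<Rightarrow> real^'l)
       \<Rightarrow> (real \<Rightarrow> real^'d \<Rightarrow> real^'l) \<Rightarrow> ereal" where
  "rho_squared \<E> u v = \<E> v - \<E> u"

definition eta_squared ::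
    "(real^'d) set \<Rightarrow> ((real \<Rightarrow> real^'d \<Rightarrow> real^'l) \<Rightarrow> ereal) \<Rightarrow> (real^'d \<Rightarrow> real^'l)
       \<Rightarrow> (real \<Rightarrow> real^'d \<Rightarrow> real^'l) \<Rightarrow> ereal" where
  "eta_squared \<Omega> \<E> u0 v = \<E> v - ereal ((1/2) * (Lp_norm 2 (lebesgue_on \<Omega>) u0)\<^sup>2)"

end

theory Submission
  imports Defs
begin

text \<open>For the solution \<open>u\<close>, equality in Fenchel's inequality turns \<open>E(t, u) + E\<^sup>*(t, - u')\<close> into the
  pairing \<open>- u'(u)\<close>, and integration by parts in time gives the value \<open>1/2 * \<parallel>u\<^sub>0\<parallel>\<^sup>2\<close> for the functional.
  The two summands are integrable separately because \<open>u\<^sup>*\<close>, \<open>z\<^sup>*\<close>, \<open>w\<^sup>*\<close> bound \<open>E(t, u(t))\<close> from above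
  and below.

  Integration by parts needs no embedding of \<open>V\<close> into \<open>H\<close>.  The weak derivative and the essential
  separability of the range of \<open>u\<close> yield \<open>(u(t) - u(s), u(\<tau>))\<^sub>H = \<integral> u'(r)(u(\<tau>)) dr\<close> (integral over \<open>[s, t]\<close>) for almost all
  \<open>s\<close>, \<open>t\<close>, \<open>\<tau>\<close>.  Dividing by \<open>t - s\<close> identifies the weak derivative of \<open>\<parallel>u\<parallel>\<^sup>2\<close> as \<open>2 * u'(u)\<close>, and every short
  interval contains a time where the norm of \<open>u\<close> in \<open>V\<close> is at most average, which makes \<open>u\<close> uniformly
  continuous into \<open>H\<close>.\<close>

section \<open>Smooth functions and the fundamental lemma\<close>

text \<open>Both \<open>rho_squared\<close> and \<open>eta_squared\<close> subtract a constant from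
  \<open>\<E> v\<close>, so the theorem amounts to computing \<open>\<E> u\<close>. The spaces V,
  its dual and H are sets of functions with seminorms, and this shapes the proof in three ways.
  Vector-valued integrals are avoided: an identity in the dual of V is tested with a fixed
  \<open>w\<close>. The null set of times then depends on \<open>w\<close>; testing with the
  countably many values of simple functions that approximate \<open>u\<close> makes it uniform.
  Gradients, time derivatives and point values in time are choices. The triangle inequality in V
  therefore rests on uniqueness of weak gradients, and closing the trace condition under sums rests
  on p-integrability of smooth functions on the boundary. Hence the bump functions and the surface
  measure of a Lipschitz boundary. Finally, \<open>ext_integral\<close> is \<infinity> for a
  non-measurable integrand, so the energy along \<open>u\<close> must be shown measurable in time.
  The integrands are measurable only on a product space, so \<open>u\<close> and its gradient need
  versions jointly measurable in time and space.\<close>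

lemma smoothI:
  fixes f :: "'a::euclidean_space \<Rightarrow> real"
  assumes "f \<in> F"
    and step: "\<And>g. g \<in> F \<Longrightarrow> \<exists>d. (\<forall>b\<in>Basis. d b \<in> F) \<and>
          (\<forall>x. (g has_derivative (\<lambda>h. \<Sum>b\<in>Basis. (h \<bullet> b) * d b x)) (at x))"
  shows "smooth f"
proof -
  have *: "\<exists>d. (\<forall>b. d b \<in> F) \<and>
          (\<forall>x. (g has_derivative (\<lambda>h. \<Sum>b\<in>Basis. (h \<bullet> b) * d b x)) (at x))" if gF: "g \<in> F" for g
  proof -
    obtain d where d: "\<forall>b\<in>Basis. d b \<in> F"
        "\<forall>x. (g has_derivative (\<lambda>h. \<Sum>b\<in>Basis. (h \<bullet> b) * d b x)) (at x)"
      using step[OF gF] by blast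
    \<comment> \<open>The index lists of \<open>smooth\<close> may contain vectors outside
      \<open>Basis\<close>. Such entries never enter a derivative formula, and \<open>g\<close>
      itself serves as default there so that the choice stays in \<open>F\<close>.\<close>
    have "(\<Sum>b\<in>Basis. (h \<bullet> b) * (if b \<in> Basis then d b else g) x) = (\<Sum>b\<in>Basis. (h \<bullet> b) * d b x)"
      for h x by (rule sum.cong) auto
    then show ?thesis
      using d gF by (intro exI[of _ "\<lambda>b. if b \<in> Basis then d b else g"]) auto
  qed
  \<comment> \<open>Coinduction: a class closed under partial derivatives consists of smooth
    functions, because partials chosen once for every member can be iterated along a list. Later
    closure proofs only have to exhibit such a class.\<close>
  have "\<exists>pd. \<forall>g\<in>F. (\<forall>b. pd g b \<in> F) \<and>
          (\<forall>x. (g has_derivative (\<lambda>h. \<Sum>b\<in>Basis. (h \<bullet> b) * pd g b x)) (at x))"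
    using * by (intro bchoice) blast
  then obtain pd where pd: "\<And>g b. g \<in> F \<Longrightarrow> pd g b \<in> F"
      "\<And>g x. g \<in> F \<Longrightarrow> (g has_derivative (\<lambda>h. \<Sum>b\<in>Basis. (h \<bullet> b) * pd g b x)) (at x)"
    by blast
  define D where "D = rec_list f (\<lambda>b bs r. pd r b)"
  have D: "D [] = f" "\<And>b bs. D (b # bs) = pd (D bs) b"
    by (auto simp: D_def)
  have "D bs \<in> F" for bs
    by (induction bs) (auto simp: D pd assms(1))
  then show ?thesis
    unfolding smooth_def using D pd(2) by (intro exI[of _ D]) auto
qed

lemma smoothE:
  fixes f :: "'a::euclidean_space \<Rightarrow> real"
  assumes "smooth f"
  obtains d where "\<And>b. smooth (d b)"
    "\<And>x. (f has_derivative (\<lambda>h. \<Sum>b\<in>Basis. (h \<bullet> b) * d b x)) (at x)"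
proof -
  obtain D where D: "D [] = f"
     "\<And>bs x. (D bs has_derivative (\<lambda>h. \<Sum>b\<in>Basis. (h \<bullet> b) * D (b # bs) x)) (at x)"
    using assms unfolding smooth_def by blast
  \<comment> \<open>The derivative taken first is the last entry of the list, so the tree of
    \<open>D [b]\<close> arises by appending \<open>b\<close> at the end.\<close>
  have "smooth (D [b])" for b
    unfolding smooth_def
    by (intro exI[of _ "\<lambda>bs. D (bs @ [b])"]) (use D in auto)
  moreover have "(f has_derivative (\<lambda>h. \<Sum>b\<in>Basis. (h \<bullet> b) * D [b] x)) (at x)" for x
    using D(2)[of "[]"] D(1) by simp
  ultimately show ?thesis
    using that[of "\<lambda>b. D [b]"] by blast
qed

lemma smooth_ex:
  fixes f :: "'a::euclidean_space \<Rightarrow> real"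
  assumes "smooth f"
  shows "\<exists>d. (\<forall>b. smooth (d b)) \<and>
     (\<forall>x. (f has_derivative (\<lambda>h. \<Sum>b\<in>Basis. (h \<bullet> b) * d b x)) (at x))"
  by (rule smoothE[OF assms]) blast

text \<open>Identifies the anonymous partials in \<open>smooth\<close> with
  \<open>frechet_derivative\<close>, the form in which \<open>is_weak_gradient\<close> speaks of
  test functions.\<close>

lemma smooth_has_derivative_partials:
  fixes f :: "'a::euclidean_space \<Rightarrow> real"
  assumes "smooth f"
  shows "(f has_derivative (\<lambda>h. \<Sum>b\<in>Basis. (h \<bullet> b) * frechet_derivative f (at x) b)) (at x)"
    and "b \<in> Basis \<Longrightarrow> smooth (\<lambda>x. frechet_derivative f (at x) b)"
proof -
  obtain d where d: "\<And>b. smooth (d b)"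
     "\<And>x. (f has_derivative (\<lambda>h. \<Sum>b\<in>Basis. (h \<bullet> b) * d b x)) (at x)"
    by (rule smoothE[OF assms]) blast
  have eq: "frechet_derivative f (at x) b = d b x" if "b \<in> Basis" for b x
  proof -
    have "frechet_derivative f (at x) = (\<lambda>h. \<Sum>b\<in>Basis. (h \<bullet> b) * d b x)"
      using frechet_derivative_at[OF d(2)] by simp
    then show ?thesis
      using that by (simp add: inner_Basis if_distrib[where f="\<lambda>t. t * _"] cong: if_cong)
  qed
  show "(f has_derivative (\<lambda>h. \<Sum>b\<in>Basis. (h \<bullet> b) * frechet_derivative f (at x) b)) (at x)"
    using d(2)[of x] eq by simp
  show "smooth (\<lambda>x. frechet_derivative f (at x) b)" if "b \<in> Basis"
    unfolding eq[OF that] by (rule d(1))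
qed

lemma smooth_differentiable: "smooth f \<Longrightarrow> f differentiable (at x)"
  using smooth_has_derivative_partials(1) differentiable_def by blast

lemma smooth_continuous_on: "smooth f \<Longrightarrow> continuous_on S f"
  by (meson continuous_at_imp_continuous_on differentiable_imp_continuous_within smooth_differentiable)

lemma smooth_const [intro, simp]: "smooth (\<lambda>x. c)"
  by (rule smoothI[of _ "range (\<lambda>c x. c)"]) (auto intro!: exI[of _ "\<lambda>b x. 0"])

lemma smooth_add [intro]:
  assumes "smooth f" "smooth g" shows "smooth (\<lambda>x. f x + g x)"
proof (rule smoothI[of _ "{\<lambda>x. f x + g x |f g. smooth f \<and> smooth g}"])
  fix k :: "'a \<Rightarrow> real" assume "k \<in> {\<lambda>x. f x + g x |f g. smooth f \<and> smooth g}"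
  then obtain f g where k: "k = (\<lambda>x. f x + g x)" and "smooth f" "smooth g" by blast
  then obtain d where d: "\<And>b. smooth (d b)" "\<And>x. (f has_derivative (\<lambda>h. \<Sum>b\<in>Basis. (h \<bullet> b) * d b x)) (at x)"
    using smooth_ex[of f] by blast
    obtain e where e: "\<And>b. smooth (e b)" "\<And>x. (g has_derivative (\<lambda>h. \<Sum>b\<in>Basis. (h \<bullet> b) * e b x)) (at x)"
    using \<open>smooth g\<close> smooth_ex[of g] by blast
  have "(k has_derivative (\<lambda>h. \<Sum>b\<in>Basis. (h \<bullet> b) * (d b x + e b x))) (at x)" for x
    unfolding k by (rule derivative_eq_intros d(2) e(2) refl)+
      (simp add: algebra_simps sum.distrib)
  with d(1) e(1) show "\<exists>d. (\<forall>b\<in>Basis. d b \<in> {\<lambda>x. f x + g x |f g. smooth f \<and> smooth g}) \<and>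
            (\<forall>x. (k has_derivative (\<lambda>h. \<Sum>b\<in>Basis. (h \<bullet> b) * d b x)) (at x))"
    by (intro exI[of _ "\<lambda>b x. d b x + e b x"]) blast
qed (use assms in blast)

text \<open>The Leibniz rule leads out of the class of products of two smooth functions, but not out
  of its closure under sums; this closure is the class given to \<open>smoothI\<close>.\<close>

inductive_set smooth_products :: "('a::euclidean_space \<Rightarrow> real) set" where
  "smooth f \<Longrightarrow> smooth g \<Longrightarrow> (\<lambda>x. f x * g x) \<in> smooth_products"
| "f \<in> smooth_products \<Longrightarrow> g \<in> smooth_products \<Longrightarrow> (\<lambda>x. f x + g x) \<in> smooth_products"

lemma smooth_mult [intro]:
  assumes "smooth f" "smooth g" shows "smooth (\<lambda>x. f x * g x)"
proof (rule smoothI[of _ smooth_products])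
  show "(\<lambda>x. f x * g x) \<in> smooth_products" using assms by (rule smooth_products.intros)
  fix k :: "'a \<Rightarrow> real" assume "k \<in> smooth_products"
  then show "\<exists>d. (\<forall>b\<in>Basis. d b \<in> smooth_products) \<and>
            (\<forall>x. (k has_derivative (\<lambda>h. \<Sum>b\<in>Basis. (h \<bullet> b) * d b x)) (at x))"
  proof induction
    case (1 f g)
    then obtain d where d: "\<And>b. smooth (d b)" "\<And>x. (f has_derivative (\<lambda>h. \<Sum>b\<in>Basis. (h \<bullet> b) * d b x)) (at x)"
      using smooth_ex[of f] by blast
      obtain e where e: "\<And>b. smooth (e b)" "\<And>x. (g has_derivative (\<lambda>h. \<Sum>b\<in>Basis. (h \<bullet> b) * e b x)) (at x)"
      using 1 smooth_ex[of g] by blast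
    have "((\<lambda>x. f x * g x) has_derivative
        (\<lambda>h. \<Sum>b\<in>Basis. (h \<bullet> b) * (f x * e b x + d b x * g x))) (at x)" for x
      by (rule derivative_eq_intros d(2) e(2) refl)+
        (simp add: algebra_simps sum.distrib sum_distrib_left sum_distrib_right)
    moreover have "(\<lambda>x. f x * e b x + d b x * g x) \<in> smooth_products" for b
      using 1 d(1) e(1) by (intro smooth_products.intros) auto
    ultimately show ?case
      by (intro exI[of _ "\<lambda>b x. f x * e b x + d b x * g x"]) blast
  next
    case (2 f g)
    then obtain d e where d: "\<forall>b\<in>Basis. d b \<in> smooth_products" "\<And>x. (f has_derivative (\<lambda>h. \<Sum>b\<in>Basis. (h \<bullet> b) * d b x)) (at x)"
      and e: "\<forall>b\<in>Basis. e b \<in> smooth_products" "\<And>x. (g has_derivative (\<lambda>h. \<Sum>b\<in>Basis. (h \<bullet> b) * e b x)) (at x)"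
      by blast
    have "((\<lambda>x. f x + g x) has_derivative (\<lambda>h. \<Sum>b\<in>Basis. (h \<bullet> b) * (d b x + e b x))) (at x)" for x
      by (rule derivative_eq_intros d(2) e(2) refl)+ (simp add: algebra_simps sum.distrib)
    with d(1) e(1) show ?case
      by (intro exI[of _ "\<lambda>b x. d b x + e b x"]) (blast intro: smooth_products.intros)
  qed
qed

lemma smooth_prod:
  "(\<And>i. i \<in> I \<Longrightarrow> smooth (f i)) \<Longrightarrow> smooth (\<lambda>x. \<Prod>i\<in>I. f i x)"
  by (induction I rule: infinite_finite_induct) auto

lemma smooth_diff [intro]:
  assumes "smooth f" "smooth g" shows "smooth (\<lambda>x. f x - g x)"
  using smooth_add[OF assms(1) smooth_mult[OF smooth_const[of "-1"] assms(2)]] by simp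

lemma has_derivative_real_Basis:
  assumes "(f has_real_derivative D) (at x)"
  shows "(f has_derivative (\<lambda>h. \<Sum>b\<in>Basis. (h \<bullet> b) * D)) (at x)"
proof -
  have "(*) D = (\<lambda>h. \<Sum>b\<in>Basis. (h \<bullet> b) * D)"
    by (simp add: fun_eq_iff mult.commute)
  then show ?thesis using assms by (metis has_field_derivative_def)
qed

lemma smooth_if_smooth_deriv:
  fixes f :: "real \<Rightarrow> real"
  assumes "\<And>x. (f has_real_derivative f' x) (at x)" "smooth f'"
  shows "smooth f"
proof (rule smoothI[of _ "insert f {g. smooth g}"])
  fix g assume "g \<in> insert f {g. smooth g}"
  then show "\<exists>d. (\<forall>b\<in>Basis. d b \<in> insert f {g. smooth g}) \<and>
             (\<forall>x. (g has_derivative (\<lambda>h. \<Sum>b\<in>Basis. (h \<bullet> b) * d b x)) (at x))"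
  proof
    assume "g = f"
    then show ?thesis using assms
      by (intro exI[of _ "\<lambda>b. f'"]) (simp only: has_derivative_real_Basis, blast)
  next
    assume "g \<in> {g. smooth g}"
    then show ?thesis using smooth_ex[of g] by blast
  qed
qed simp

lemma smooth_compose_coordinate:
  fixes f :: "real \<Rightarrow> real" and u :: "'a::euclidean_space"
  assumes "smooth f"
  shows "smooth (\<lambda>x::'a. f (c * (x \<bullet> u) + e))"
\<comment> \<open>The chain rule produces the factor \<open>c * (u \<bullet> b)\<close>, hence the
  free scalar \<open>k\<close> in the class.\<close>
proof (rule smoothI[of _ "{\<lambda>x. k * f (c * (x \<bullet> u) + e) |k f. smooth f}"])
  show "(\<lambda>x::'a. f (c * (x \<bullet> u) + e)) \<in> {\<lambda>x. k * f (c * (x \<bullet> u) + e) |k f. smooth f}"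
    using assms by (intro CollectI exI[of _ 1] exI[of _ f]) simp
  fix g assume "g \<in> {\<lambda>x::'a. k * f (c * (x \<bullet> u) + e) |k f. smooth f}"
  then obtain k f where g: "g = (\<lambda>x. k * f (c * (x \<bullet> u) + e))" and "smooth f" by blast
  then obtain d where d: "\<And>b. smooth (d b)"
     "\<And>x::real. (f has_derivative (\<lambda>h. \<Sum>b\<in>Basis. (h \<bullet> b) * d b x)) (at x)"
    using smooth_ex[of f] by blast
  have f': "(f has_derivative (\<lambda>h. h * d 1 y)) (at y)" for y
    using d(2)[of y] by simp
  have "((\<lambda>x. f (c * (x \<bullet> u) + e)) has_derivative (\<lambda>h. (c * (h \<bullet> u)) * d 1 (c * (x \<bullet> u) + e))) (at x)" for x
    by (rule has_derivative_compose[where f="\<lambda>x. c * (x \<bullet> u) + e", OF _ f'])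
      (auto intro!: derivative_eq_intros)
  then have "(g has_derivative (\<lambda>h. k * ((c * (h \<bullet> u)) * d 1 (c * (x \<bullet> u) + e)))) (at x)" for x
    unfolding g by (intro has_derivative_mult_right)
  moreover have "k * ((c * (h \<bullet> u)) * d 1 (c * (x \<bullet> u) + e))
      = (\<Sum>b\<in>Basis. (h \<bullet> b) * ((k * c * (u \<bullet> b)) * d 1 (c * (x \<bullet> u) + e)))" for h x
    by (subst euclidean_inner) (simp add: sum_distrib_left sum_distrib_right algebra_simps)
  ultimately have "(g has_derivative (\<lambda>h. (\<Sum>b\<in>Basis. (h \<bullet> b) * ((k * c * (u \<bullet> b)) * d 1 (c * (x \<bullet> u) + e))))) (at x)" for x
    by simp
  then show "\<exists>d. (\<forall>b\<in>Basis. d b \<in> {\<lambda>x. k * f (c * (x \<bullet> u) + e) |k f. smooth f}) \<and>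
            (\<forall>x. (g has_derivative (\<lambda>h. \<Sum>b\<in>Basis. (h \<bullet> b) * d b x)) (at x))"
    using d(1) by (intro exI[of _ "\<lambda>b x. (k * c * (u \<bullet> b)) * d 1 (c * (x \<bullet> u) + e)"]) blast
qed

section \<open>A smooth step and smooth approximations of box indicators\<close>

definition exp_step :: "real \<Rightarrow> real" where
  "exp_step x = (if x > 0 then exp (- (1 / x)) else 0)"

lemma poly_exp_tendsto_0: "((\<lambda>y::real. poly p y * exp (- y)) \<longlongrightarrow> 0) at_top"
proof -
  have "((\<lambda>y::real. \<Sum>i\<le>degree p. coeff p i * (y ^ i / exp y)) \<longlongrightarrow> (\<Sum>i\<le>degree p. coeff p i * 0)) at_top"
    by (intro tendsto_intros tendsto_power_div_exp_0)
  moreover have "(\<Sum>i\<le>degree p. coeff p i * (y ^ i / exp y)) = poly p y * exp (- y)" for y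
    by (simp add: poly_altdef sum_distrib_right exp_minus divide_inverse mult.assoc)
  ultimately show ?thesis by simp
qed

text \<open>The class consists of polynomials in \<open>1 / x\<close> times the step.
  Differentiation stays in it, and at 0 the exponential beats every polynomial, so all derivatives
  match the value 0 on the left.\<close>

lemma smooth_exp_step: "smooth exp_step"
proof (rule smoothI[of _ "range (\<lambda>p x. poly p (1 / x) * exp_step x)"])
  show "exp_step \<in> range (\<lambda>p x. poly p (1 / x) * exp_step x)"
    by (rule image_eqI[of _ _ 1]) auto
  fix g assume "g \<in> range (\<lambda>p x. poly p (1 / x) * exp_step x)"
  then obtain p where g: "g = (\<lambda>x. poly p (1 / x) * exp_step x)" by blast
  \<comment> \<open>Both factors of \<open>poly p (1 / x) * exp (- (1 / x))\<close> contribute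
    \<open>1 / x ^ 2\<close> when differentiated, the polynomial with a minus sign and the
    exponential with a plus sign.\<close>
  define r where "r = (p - pderiv p) * [:0, 0, 1:]"
  have "(g has_real_derivative poly r (1 / x) * exp_step x) (at x)" for x
  proof -
    consider "x > 0" | "x < 0" | "x = 0" by linarith
    then show ?thesis
    proof cases
      case 1
      have "((\<lambda>x. poly p (1 / x) * exp (- (1 / x))) has_real_derivative poly r (1 / x) * exp_step x) (at x)"
        using 1 unfolding r_def
        by (auto intro!: derivative_eq_intros DERIV_chain'[OF _ poly_DERIV]
             simp: exp_step_def field_simps power2_eq_square)
      then show ?thesis
      proof (rule has_field_derivative_transform_within_open[of _ _ _ "{0<..}"])
        show "\<And>x. x \<in> {0<..} \<Longrightarrow> poly p (1 / x) * exp (- (1 / x)) = g x"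
          by (simp add: g exp_step_def)
      qed (use 1 in auto)
    next
      case 2
      have "((\<lambda>x. 0) has_real_derivative poly r (1 / x) * exp_step x) (at x)"
        using 2 by (simp add: exp_step_def)
      then show ?thesis
      proof (rule has_field_derivative_transform_within_open[of _ _ _ "{..<0}"])
        show "\<And>x. x \<in> {..<0} \<Longrightarrow> 0 = g x" by (simp add: g exp_step_def)
      qed (use 2 in auto)
    next
      case 3
      have inv: "LIM h at_right (0::real). 1 / h :> at_top"
        using filterlim_inverse_at_top_right by (simp add: inverse_eq_divide)
      \<comment> \<open>The difference quotient at 0 carries one more factor \<open>1 / h\<close>,
        hence the polynomial \<open>p * [:0, 1:]\<close>.\<close>
      have "((\<lambda>h. poly (p * [:0, 1:]) (1 / h) * exp (- (1 / h))) \<longlongrightarrow> 0) (at_right 0)"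
        by (rule filterlim_compose[OF poly_exp_tendsto_0 inv])
      then have "((\<lambda>h. (g (0 + h) - g 0) / h) \<longlongrightarrow> 0) (at_right 0)"
        by (rule Lim_transform_eventually)
          (auto simp: eventually_at_filter g exp_step_def field_simps)
      moreover have "((\<lambda>h. (g (0 + h) - g 0) / h) \<longlongrightarrow> 0) (at_left 0)"
        by (rule Lim_transform_eventually[of "\<lambda>_. 0"])
          (auto simp: eventually_at_filter g exp_step_def)
      ultimately have "((\<lambda>h. (g (0 + h) - g 0) / h) \<longlongrightarrow> 0) (at 0)"
        by (simp add: filterlim_split_at)
      then show ?thesis
        using 3 by (simp add: DERIV_def exp_step_def)
    qed
  qed
  then have "\<And>x. (g has_derivative (\<lambda>h. \<Sum>b\<in>Basis. (h \<bullet> b) * (poly r (1 / x) * exp_step x))) (at x)"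
    by (rule has_derivative_real_Basis)
  then show "\<exists>d. (\<forall>b\<in>Basis. d b \<in> range (\<lambda>p x. poly p (1 / x) * exp_step x)) \<and>
           (\<forall>x. (g has_derivative (\<lambda>h. \<Sum>b\<in>Basis. (h \<bullet> b) * d b x)) (at x))"
    by (intro exI[of _ "\<lambda>b x. poly r (1 / x) * exp_step x"]) blast
qed

lemma exp_step_bounds: "0 \<le> exp_step x" "exp_step x \<le> 1"
  by (auto simp: exp_step_def)

lemma exp_step_tendsto: "x > 0 \<Longrightarrow> (\<lambda>n. exp_step (real n * x)) \<longlonglongrightarrow> 1"
proof -
  assume x: "x > 0"
  have "(\<lambda>n. exp (- (1 / x) * (1 / real n))) \<longlonglongrightarrow> exp (- (1 / x) * 0)"
    by (intro tendsto_intros lim_1_over_n)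
  moreover have "\<forall>\<^sub>F n in sequentially. exp (- (1 / x) * (1 / real n)) = exp_step (real n * x)"
    using eventually_gt_at_top[of 0] by eventually_elim (use x in \<open>auto simp: exp_step_def mult.commute\<close>)
  ultimately show ?thesis
    using Lim_transform_eventually by fastforce
qed

text \<open>For growing \<open>n\<close> these tend boundedly to the indicator of the open box while
  vanishing outside it, so box indicators become limits of test functions. The arguments are spelled
  as \<open>c * (x \<bullet> i) + e\<close> to fit \<open>smooth_compose_coordinate\<close>.\<close>

definition box_bump :: "nat \<Rightarrow> 'a::euclidean_space \<Rightarrow> 'a \<Rightarrow> 'a \<Rightarrow> real" where
  "box_bump n a b x =
     (\<Prod>i\<in>Basis. exp_step (real n * (x \<bullet> i) + - real n * (a \<bullet> i)) *
                 exp_step (- real n * (x \<bullet> i) + real n * (b \<bullet> i)))"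

lemma smooth_box_bump: "smooth (box_bump n a b)"
  unfolding box_bump_def
  by (intro smooth_prod smooth_mult smooth_compose_coordinate smooth_exp_step)

lemma box_bump_bounds: "0 \<le> box_bump n a b x" "box_bump n a b x \<le> 1"
  unfolding box_bump_def by (auto intro!: prod_nonneg prod_le_1 mult_le_one simp: exp_step_bounds)

lemma box_bump_tendsto: "(\<lambda>n. box_bump n a b x) \<longlonglongrightarrow> indicator (box a b) x"
proof -
  have "(\<lambda>n. exp_step (real n * y)) \<longlonglongrightarrow> (if y > 0 then 1 else 0)" for y
  proof (cases "y > 0")
    case False
    then have "exp_step (real n * y) = 0" for n
      by (auto simp: exp_step_def zero_less_mult_iff)
    with False show ?thesis by simp
  qed (use exp_step_tendsto in auto)
  from this[of "x \<bullet> i - a \<bullet> i" for i] this[of "b \<bullet> i - x \<bullet> i" for i]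
  have "(\<lambda>n. box_bump n a b x) \<longlonglongrightarrow>
     (\<Prod>i\<in>Basis. (if x \<bullet> i - a \<bullet> i > 0 then 1 else 0) * (if b \<bullet> i - x \<bullet> i > 0 then 1 else 0))"
    unfolding box_bump_def by (intro tendsto_prod tendsto_mult) (auto simp: algebra_simps)
  moreover have "(\<Prod>i\<in>Basis. (if x \<bullet> i - a \<bullet> i > 0 then 1 else 0) * (if b \<bullet> i - x \<bullet> i > 0 then 1 else (0::real)))
      = indicator (box a b) x"
  proof (cases "x \<in> box a b")
    case False
    then obtain i where "i \<in> Basis" "\<not> (a \<bullet> i < x \<bullet> i \<and> x \<bullet> i < b \<bullet> i)"
      by (auto simp: mem_box)
    then show ?thesis using False by (subst prod_zero[of Basis]) auto
  qed (auto simp: mem_box)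
  ultimately show ?thesis by simp
qed

lemma box_bump_eq_0:
  assumes "x \<notin> box a b"
  shows "box_bump n a b x = 0"
proof -
  have z: "exp_step (real n * y) = 0" if "y \<le> 0" for y
    using that by (auto simp: exp_step_def zero_less_mult_iff)
  have "exp_step (real n * (x \<bullet> i) + - real n * (a \<bullet> i)) = 0 \<or>
      exp_step (- real n * (x \<bullet> i) + real n * (b \<bullet> i)) = 0"
    if "\<not> (a \<bullet> i < x \<bullet> i \<and> x \<bullet> i < b \<bullet> i)" for i
  proof (cases "a \<bullet> i < x \<bullet> i")
    case False
    then have "exp_step (real n * (x \<bullet> i - a \<bullet> i)) = 0" by (intro z) simp
    then show ?thesis by (simp add: algebra_simps)
  next
    case True
    then have "exp_step (real n * (b \<bullet> i - x \<bullet> i)) = 0" using that by (intro z) simp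
    then show ?thesis by (simp add: algebra_simps)
  qed
  moreover obtain i where "i \<in> Basis" "\<not> (a \<bullet> i < x \<bullet> i \<and> x \<bullet> i < b \<bullet> i)"
    using assms by (auto simp: mem_box)
  ultimately show ?thesis unfolding box_bump_def
    by (intro prod_zero[OF finite_Basis] bexI[of _ i]) auto
qed

section \<open>Test functions and the fundamental lemma of the calculus of variations\<close>

lemma test_functionI:
  assumes "smooth \<zeta>" "compact K" "K \<subseteq> S" "\<And>x. x \<notin> K \<Longrightarrow> \<zeta> x = 0"
  shows "test_function S \<zeta>"
proof -
  have "closure {x. \<zeta> x \<noteq> 0} \<subseteq> K"
    using assms by (intro closure_minimal) (auto simp: compact_imp_closed)
  then show ?thesis
    using assms unfolding test_function_def
    by (metis bounded_subset closed_closure compact_eq_bounded_closed subset_trans)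
qed

lemma test_functionE:
  assumes "test_function S \<zeta>"
  obtains K where "smooth \<zeta>" "compact K" "K \<subseteq> S" "\<And>x. x \<notin> K \<Longrightarrow> \<zeta> x = 0"
    "\<And>x h. x \<notin> K \<Longrightarrow> frechet_derivative \<zeta> (at x) h = 0"
proof -
  define K where "K = closure {x. \<zeta> x \<noteq> 0}"
  have z: "\<zeta> x = 0" if "x \<notin> K" for x
    using that closure_subset[of "{x. \<zeta> x \<noteq> 0}"] by (auto simp: K_def)
  have d: "frechet_derivative \<zeta> (at x) h = 0" if "x \<notin> K" for x h
  proof -
    have "open (- K)" by (simp add: K_def open_Compl)
    moreover have "x \<in> - K" using that by simp
    ultimately have "(\<zeta> has_derivative (\<lambda>h. 0)) (at x)"
      by (rule has_derivative_transform_within_open[OF has_derivative_const]) (simp add: z)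
    from fun_cong[OF frechet_derivative_at[OF this], of h] show ?thesis by simp
  qed
  have "smooth \<zeta>" "compact K" "K \<subseteq> S"
    using assms by (auto simp: test_function_def K_def)
  then show ?thesis using z d by (rule that)
qed

lemma test_box_bump:
  "cbox a b \<subseteq> S \<Longrightarrow> test_function S (box_bump n a b)"
  by (rule test_functionI[of _ "cbox a b"])
    (use box_bump_eq_0[of _ a b] box_subset_cbox[of a b] in \<open>auto simp: smooth_box_bump\<close>)

text \<open>Lebesgue differentiation: outside a null set \<open>g x\<close> is the limit of the
  means of \<open>g\<close> over small cubes with corner \<open>x\<close>, and these means are zero
  as soon as the cube lies in \<open>S\<close>.\<close>

lemma AE_zero_if_integrals_over_boxes_zero:
  fixes g :: "'a::euclidean_space \<Rightarrow> real"
  assumes "open S" and g: "integrable (lebesgue_on S) g"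
    and zero: "\<And>a b. cbox a b \<subseteq> S \<Longrightarrow> (LINT x|lebesgue_on S. indicator (box a b) x * g x) = 0"
  shows "AE x in lebesgue_on S. g x = 0"
proof -
  define G where "G x = (if x \<in> S then g x else 0)" for x
  have S: "S \<in> sets lebesgue" using assms(1) by simp
  have G: "integrable lebesgue G"
    unfolding G_def using Lebesgue_Measure.integrable_restrict_UNIV[OF S, of g] g by simp
  have Gi: "G absolutely_integrable_on cbox a b" for a b
    by (rule set_integrable_subset[of _ UNIV]) (use G in \<open>auto simp: set_integrable_def\<close>)
  then have "G integrable_on cbox a b" for a b
    using set_lebesgue_integral_eq_integral(1) by blast
  then obtain N where N: "negligible N"
    "\<And>x e. \<lbrakk>x \<notin> N; 0 < e\<rbrakk> \<Longrightarrow> \<exists>d>0. \<forall>h. 0 < h \<and> h < d \<longrightarrow>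
                         norm(integral (cbox x (x + h *\<^sub>R One)) G /\<^sub>R h ^ DIM('a) - G x) < e"
    using integrable_ccontinuous_explicit[of G] by blast
  have int0: "integral (cbox a b) G = 0" if "cbox a b \<subseteq> S" for a b
  proof -
    have "integral (cbox a b) G = (LINT x|lebesgue. indicator (cbox a b) x * G x)"
      using set_lebesgue_integral_eq_integral(2)[OF Gi[of a b]] by (simp add: set_lebesgue_integral_def)
    also have "\<dots> = (LINT x|lebesgue. (if x \<in> S then indicator (box a b) x * g x else 0))"
    proof (rule integral_cong_AE)
      have "AE x in lebesgue. x \<notin> cbox a b - box a b"
        using null_sets_cbox_Diff_box[of a b] by (intro AE_not_in AE_completion null_sets_completionI)
      then show "AE x in lebesgue. indicator (cbox a b) x * G x = (if x \<in> S then indicator (box a b) x * g x else 0)"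
        by eventually_elim (use that box_subset_cbox in \<open>auto simp: indicator_def G_def\<close>)
      show "(\<lambda>x. indicator (cbox a b) x * G x) \<in> borel_measurable lebesgue"
        using borel_measurable_integrable[OF G]
        by (intro borel_measurable_times borel_measurable_indicator) auto
      have "(\<lambda>x. if x \<in> S then indicator (box a b) x * g x else 0) = (\<lambda>x. indicator (box a b) x * G x)"
        by (auto simp: G_def)
      also have "\<dots> \<in> borel_measurable lebesgue"
        using borel_measurable_integrable[OF G]
        by (intro borel_measurable_times borel_measurable_indicator) auto
      finally show "(\<lambda>x. if x \<in> S then indicator (box a b) x * g x else 0) \<in> borel_measurable lebesgue" .
    qed
    also have "\<dots> = 0"
      using zero[OF that] Lebesgue_Measure.integral_restrict_UNIV[OF S, of "\<lambda>x. indicator (box a b) x * g x"] by simp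
    finally show ?thesis .
  qed
  have "g x = 0" if x: "x \<in> S" "x \<notin> N" for x
  proof -
    obtain r where r: "r > 0" "ball x r \<subseteq> S" using x assms(1) open_contains_ball by blast
    have "norm (G x) < e" if e: "e > 0" for e
    proof -
      obtain d where d: "d > 0" "\<forall>h. 0 < h \<and> h < d \<longrightarrow>
                         norm(integral (cbox x (x + h *\<^sub>R One)) G /\<^sub>R h ^ DIM('a) - G x) < e"
        using N(2)[OF x(2) e] by blast
      \<comment> \<open>A cube of side \<open>h\<close> has diameter \<open>h * norm One\<close>, so
        the second entry fits it into the ball; halving the minimum makes both bounds
        strict.\<close>
      define h where "h = min d (r / (norm (One::'a) + 1)) / 2"
      have no: "norm (One::'a) + 1 > 0" by (simp add: add_nonneg_pos)
      have h: "0 < h" "h < d" "h * (norm (One::'a) + 1) < r"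
      proof -
        have half_gt: "y / 2 < y" if "0 < y" for y :: real using that by simp
      show "0 < h" using d(1) r(1) no by (simp add: h_def)
        show "h < d" using d(1) r(1) no by (auto simp: h_def min_def)
        have "h \<le> r / (norm (One::'a) + 1) / 2"
          unfolding h_def by (intro divide_right_mono min.cobounded2) simp
        also have "\<dots> < r / (norm (One::'a) + 1)"
          by (rule half_gt[OF divide_pos_pos[OF r(1) no]])
        finally show "h * (norm (One::'a) + 1) < r" using no by (simp add: pos_less_divide_eq)
      qed
      have "cbox x (x + h *\<^sub>R One) \<subseteq> ball x r"
      proof
        fix y assume y: "y \<in> cbox x (x + h *\<^sub>R One)"
        then have "norm (y - x) \<le> norm (h *\<^sub>R One :: 'a)"
          by (intro norm_le_componentwise) (auto simp: mem_box inner_diff_left inner_add_left)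
        also have "\<dots> = h * norm (One::'a)" using h by simp
        also have "\<dots> \<le> h * (norm (One::'a) + 1)" using h by (intro mult_left_mono) auto
        also have "\<dots> < r" by (rule h)
        finally show "y \<in> ball x r" by (simp add: dist_norm norm_minus_commute)
      qed
      then show ?thesis using d(2) h int0[of x "x + h *\<^sub>R One"] r by auto
    qed
    then show ?thesis using x by (metis G_def less_irrefl zero_less_norm_iff)
  qed
  then have "AE x in lebesgue. x \<in> S \<longrightarrow> g x = 0"
    using N(1) by (intro AE_I'[of N]) (auto simp: negligible_iff_null_sets)
  then show ?thesis using S by (simp add: AE_restrict_space_iff)
qed

text \<open>Dominated convergence with majorant \<open>\<bar>g x\<bar>\<close> carries the vanishing
  of the integrals from \<open>box_bump\<close> to box indicators.\<close>

lemma fundamental_lemma: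
  fixes g :: "'a::euclidean_space \<Rightarrow> real"
  assumes "open S" and g: "integrable (lebesgue_on S) g"
    and zero: "\<And>\<zeta>. test_function S \<zeta> \<Longrightarrow> (LINT x|lebesgue_on S. g x * \<zeta> x) = 0"
  shows "AE x in lebesgue_on S. g x = 0"
proof (rule AE_zero_if_integrals_over_boxes_zero[OF assms(1,2)])
  fix a b :: 'a assume ab: "cbox a b \<subseteq> S"
  have "(\<lambda>n. LINT x|lebesgue_on S. g x * box_bump n a b x) \<longlonglongrightarrow>
     (LINT x|lebesgue_on S. indicator (box a b) x * g x)"
  proof (rule integral_dominated_convergence[where w="\<lambda>x. \<bar>g x\<bar>"])
    show "(\<lambda>x. indicator (box a b) x * g x) \<in> borel_measurable (lebesgue_on S)"
      using borel_measurable_integrable[OF g]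
      by (intro borel_measurable_times[OF measurable_restrict_space1[OF borel_measurable_indicator]]) auto
    show "(\<lambda>x. g x * box_bump n a b x) \<in> borel_measurable (lebesgue_on S)" for n
      using assms(1) borel_measurable_integrable[OF g]
        continuous_imp_measurable_on_sets_lebesgue[OF smooth_continuous_on[OF smooth_box_bump], of S n a b]
      by (intro borel_measurable_times) auto
    show "AE x in lebesgue_on S. (\<lambda>n. g x * box_bump n a b x) \<longlonglongrightarrow> indicator (box a b) x * g x"
      using tendsto_mult[OF tendsto_const box_bump_tendsto] by (intro AE_I2) (simp add: mult.commute)
    show "AE x in lebesgue_on S. norm (g x * box_bump n a b x) \<le> \<bar>g x\<bar>" for n
      using box_bump_bounds[of n a b] by (auto simp: abs_mult mult_left_le)
  qed (use g in auto)
  moreover have "(\<lambda>n. LINT x|lebesgue_on S. g x * box_bump n a b x) = (\<lambda>n. 0)"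
    using zero[OF test_box_bump[OF ab]] by auto
  ultimately show "(LINT x|lebesgue_on S. indicator (box a b) x * g x) = 0"
    using LIMSEQ_const_iff by metis
qed

section \<open>Lebesgue spaces\<close>

lemma Lp_iff:
  "f \<in> Lp r M \<longleftrightarrow> f \<in> borel_measurable M \<and> integrable M (\<lambda>x. norm (f x) powr r)"
  unfolding Lp_def integrable_iff_bounded by auto

lemma Lp_measurable: "f \<in> Lp r M \<Longrightarrow> f \<in> borel_measurable M"
  and Lp_integrable: "f \<in> Lp r M \<Longrightarrow> integrable M (\<lambda>x. norm (f x) powr r)"
  by (auto simp: Lp_iff)

lemma Lp_norm_nonneg: "0 \<le> Lp_norm r M f"
  by (simp add: Lp_norm_def)

lemma Lp_norm_powr: "0 < r \<Longrightarrow> Lp_norm r M f powr r = (LINT x|M. norm (f x) powr r)"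
  by (simp add: Lp_norm_def powr_powr)

lemma Lp_norm_square: "(Lp_norm 2 M f)\<^sup>2 = (LINT x|M. (norm (f x))\<^sup>2)"
  using Lp_norm_powr[of 2 M f] by (simp add: Lp_norm_nonneg)

lemma Lp_norm_cong_AE:
  assumes "f \<in> borel_measurable M" "g \<in> borel_measurable M" "AE x in M. f x = g x"
  shows "Lp_norm r M f = Lp_norm r M g"
  unfolding Lp_norm_def
  by (intro arg_cong[of _ _ "\<lambda>t. t powr _"] integral_cong_AE) (use assms in auto)

lemma Lp_scale:
  assumes "f \<in> Lp r M"
  shows "(\<lambda>x. c *\<^sub>R f x) \<in> Lp r M"
  using assms by (auto simp: Lp_iff powr_mult)

lemma powr_convex_nonneg:
  fixes x y :: real
  assumes "1 \<le> p" "0 \<le> x" "0 \<le> y" "0 < s" "s < 1"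
  shows "(s * x + (1 - s) * y) powr p \<le> s * x powr p + (1 - s) * y powr p"
proof -
  have le: "c powr p \<le> c" if "0 < c" "c < 1" for c :: real
    using powr_mono_both'[of 1 p c c] that assms by (simp add: powr_mono')
  consider "x = 0" | "y = 0" | "0 < x" "0 < y" using assms by linarith
  then show ?thesis
  proof cases
    case 1
    then show ?thesis using assms le[of "1 - s"] by (simp add: powr_mult mult_right_mono)
  next
    case 2
    then show ?thesis using assms le[of s] by (simp add: powr_mult mult_right_mono)
  next
    case 3
    then show ?thesis
      using convex_onD[OF powr_convex[OF assms(1)], of "1 - s" x y] assms by simp
  qed
qed

text \<open>Convexity of the power with weight \<open>s = a / (a + b)\<close>, applied to
  \<open>norm x / s\<close> and \<open>norm y / (1 - s)\<close>. The weights stay free so that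
  Minkowski's inequality can be read off after integration, with the two norms inserted for
  \<open>a\<close> and \<open>b\<close>.\<close>

lemma powr_convex_combination:
  fixes x y :: "'a::real_normed_vector"
  assumes "1 \<le> p" "0 < a" "0 < b"
  shows "norm (x + y) powr p
     \<le> (a + b) powr (p - 1) * (a powr (1 - p) * norm x powr p + b powr (1 - p) * norm y powr p)"
proof -
  define s where "s = a / (a + b)"
  have s: "0 < s" "s < 1" "1 - s = b / (a + b)"
    using assms by (auto simp: s_def field_simps)
  have cv: "(s * (norm x / s) + (1 - s) * (norm y / (1 - s))) powr p
     \<le> s * (norm x / s) powr p + (1 - s) * (norm y / (1 - s)) powr p"
    using s assms by (intro powr_convex_nonneg) auto
  have pw: "c * (z / c) powr p = c powr (1 - p) * z powr p" if "0 < c" "0 \<le> z" for c z :: real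
    using that by (simp add: powr_divide powr_diff field_simps)
  have "norm (x + y) powr p \<le> (norm x + norm y) powr p"
    using assms by (intro powr_mono2) (auto simp: norm_triangle_ineq)
  also have "\<dots> \<le> s powr (1 - p) * norm x powr p + (1 - s) powr (1 - p) * norm y powr p"
  proof -
    have "s * (norm x / s) = norm x" "(1 - s) * (norm y / (1 - s)) = norm y" using s(1,2) by auto
    then show ?thesis using cv pw[of s "norm x"] pw[of "1 - s" "norm y"] s(1,2) by simp
  qed
  also have "\<dots> = (a + b) powr (p - 1) * (a powr (1 - p) * norm x powr p + b powr (1 - p) * norm y powr p)"
  proof -
    have "(c / (a + b)) powr (1 - p) = (a + b) powr (p - 1) * c powr (1 - p)" if "0 < c" for c
      using assms that by (simp add: powr_divide powr_diff field_simps)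
    then show ?thesis using assms s unfolding s(3) by (simp add: s_def algebra_simps)
  qed
  finally show ?thesis .
qed

lemma Lp_add:
  fixes f g :: "'a \<Rightarrow> 'b::euclidean_space"
  assumes "1 \<le> p" and f: "f \<in> Lp p M" and g: "g \<in> Lp p M"
  shows "(\<lambda>x. f x + g x) \<in> Lp p M"
    and "0 < a \<Longrightarrow> 0 < b \<Longrightarrow> (LINT x|M. norm (f x + g x) powr p)
     \<le> (a + b) powr (p - 1) * (a powr (1 - p) * (LINT x|M. norm (f x) powr p)
          + b powr (1 - p) * (LINT x|M. norm (g x) powr p))"
proof -
  note fm [measurable] = Lp_measurable[OF f] and gm [measurable] = Lp_measurable[OF g]
  have i: "integrable M (\<lambda>x. (a + b) powr (p - 1) * (a powr (1 - p) * norm (f x) powr p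
       + b powr (1 - p) * norm (g x) powr p))" for a b :: real
    using Lp_integrable[OF f] Lp_integrable[OF g] by simp
  have j: "integrable M (\<lambda>x. norm (f x + g x) powr p)"
    by (rule Bochner_Integration.integrable_bound[OF i[of 1 1]])
      (use powr_convex_combination[OF assms(1), of 1 1] in \<open>auto intro!: order_trans[OF _ abs_ge_self]\<close>)
  then show "(\<lambda>x. f x + g x) \<in> Lp p M" by (simp add: Lp_iff)
  assume ab: "0 < a" "0 < b"
  have "(LINT x|M. norm (f x + g x) powr p) \<le> (LINT x|M. (a + b) powr (p - 1) *
      (a powr (1 - p) * norm (f x) powr p + b powr (1 - p) * norm (g x) powr p))"
    using powr_convex_combination[OF assms(1) ab] by (intro integral_mono i j)
  also have "\<dots> = (a + b) powr (p - 1) * (a powr (1 - p) * (LINT x|M. norm (f x) powr p)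
          + b powr (1 - p) * (LINT x|M. norm (g x) powr p))"
    using Lp_integrable[OF f] Lp_integrable[OF g] by simp
  finally show "(LINT x|M. norm (f x + g x) powr p)
     \<le> (a + b) powr (p - 1) * (a powr (1 - p) * (LINT x|M. norm (f x) powr p)
          + b powr (1 - p) * (LINT x|M. norm (g x) powr p))" .
qed

text \<open>The premise is what integrating the convexity of the \<open>p\<close>-th power yields; this form also fits the
  sum of two powers in the norm of \<open>W\<^sup>1\<^sup>,\<^sup>p\<close>.\<close>

lemma root_subadditive:
  fixes p A B C :: real
  assumes "1 \<le> p" "0 \<le> A" "0 \<le> B" "0 \<le> C"
    and le: "\<And>a b. 0 < a \<Longrightarrow> 0 < b \<Longrightarrow>
        C \<le> (a + b) powr (p - 1) * (a powr (1 - p) * A + b powr (1 - p) * B)"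
  shows "C powr (1 / p) \<le> A powr (1 / p) + B powr (1 / p)"
proof (rule field_le_epsilon)
  fix e :: real assume e: "e > 0"
  \<comment> \<open>The optimal weights are the two roots; the extra \<open>e / 2\<close> keeps them
    positive when \<open>A\<close> or \<open>B\<close> vanishes.\<close>
  define a where "a = A powr (1 / p) + e / 2"
  define b where "b = B powr (1 / p) + e / 2"
  have ab: "0 < a" "0 < b" using e by (auto simp: a_def b_def add_nonneg_pos)
  have A: "A \<le> a powr p"
  proof -
    have "A = (A powr (1 / p)) powr p" using assms by (simp add: powr_powr)
    also have "\<dots> \<le> a powr p" using assms e by (intro powr_mono2) (auto simp: a_def)
    finally show ?thesis .
  qed
  have B: "B \<le> b powr p"
  proof -
    have "B = (B powr (1 / p)) powr p" using assms by (simp add: powr_powr)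
    also have "\<dots> \<le> b powr p" using assms e by (intro powr_mono2) (auto simp: b_def)
    finally show ?thesis .
  qed
  have "C \<le> (a + b) powr (p - 1) * (a powr (1 - p) * A + b powr (1 - p) * B)"
    using le ab by blast
  also have "\<dots> \<le> (a + b) powr (p - 1) * (a powr (1 - p) * a powr p + b powr (1 - p) * b powr p)"
    using A B by (intro mult_left_mono add_mono) auto
  also have "\<dots> = (a + b) powr p"
    using ab by (simp flip: powr_add) (simp add: powr_diff)
  finally have "C powr (1 / p) \<le> ((a + b) powr p) powr (1 / p)"
    using assms by (intro powr_mono2) auto
  also have "\<dots> = A powr (1 / p) + B powr (1 / p) + e"
    using assms ab by (simp add: powr_powr) (simp add: a_def b_def)
  finally show "C powr (1 / p) \<le> A powr (1 / p) + B powr (1 / p) + e" .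
qed

section \<open>Seminormed spaces of functions\<close>

text \<open>Common frame for V, its dual and the Lebesgue spaces, all given as carrier sets with
  seminorms. The zero function is obtained from any member by \<open>lin\<close> with zero
  coefficients, which is the purpose of \<open>nonempty\<close>.\<close>

locale seminormed =
  fixes X :: "('a \<Rightarrow> 'b::real_vector) set" and N :: "('a \<Rightarrow> 'b) \<Rightarrow> real"
  assumes nonempty: "X \<noteq> {}"
    and lin: "v \<in> X \<Longrightarrow> w \<in> X \<Longrightarrow> (\<lambda>x. a *\<^sub>R v x + b *\<^sub>R w x) \<in> X"
    and nonneg: "v \<in> X \<Longrightarrow> 0 \<le> N v"
    and scale: "v \<in> X \<Longrightarrow> N (\<lambda>x. a *\<^sub>R v x) = \<bar>a\<bar> * N v"
    and tri: "v \<in> X \<Longrightarrow> w \<in> X \<Longrightarrow> N (\<lambda>x. v x + w x) \<le> N v + N w"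
begin

lemma zero_mem: "(\<lambda>x. 0) \<in> X"
  using nonempty lin[of _ _ 0 0] by auto

lemma N_zero: "N (\<lambda>x. 0) = 0"
  using scale[OF zero_mem, of 0] by simp

lemma scale_mem: "v \<in> X \<Longrightarrow> (\<lambda>x. a *\<^sub>R v x) \<in> X"
  using lin[of v v a 0] by simp

lemma add_mem: "v \<in> X \<Longrightarrow> w \<in> X \<Longrightarrow> (\<lambda>x. v x + w x) \<in> X"
  using lin[of v w 1 1] by simp

lemma diff_mem: "v \<in> X \<Longrightarrow> w \<in> X \<Longrightarrow> v - w \<in> X"
  using lin[of v w 1 "-1"] by (simp add: fun_diff_def)

lemma N_minus_commute: "v \<in> X \<Longrightarrow> w \<in> X \<Longrightarrow> N (v - w) = N (w - v)"
  using scale[OF diff_mem[of w v], of "-1"] by (simp add: fun_diff_def)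

lemma N_diff_le: "v \<in> X \<Longrightarrow> w \<in> X \<Longrightarrow> N (v - w) \<le> N v + N w"
  using tri[of v "\<lambda>x. (-1) *\<^sub>R w x"] scale[of w "-1"] scale_mem[of w "-1"] by (simp add: fun_diff_def)

lemma N_le_add_diff: "v \<in> X \<Longrightarrow> w \<in> X \<Longrightarrow> N v \<le> N w + N (v - w)"
  using tri[of w "v - w"] diff_mem[of v w] by (simp add: fun_diff_def)

lemma N_reverse_tri: "v \<in> X \<Longrightarrow> w \<in> X \<Longrightarrow> \<bar>N v - N w\<bar> \<le> N (v - w)"
  using N_le_add_diff[of v w] N_le_add_diff[of w v] N_minus_commute[of v w] by linarith

lemma N_tendsto:
  assumes "\<And>n. s n \<in> X" "v \<in> X" "(\<lambda>n. N (s n - v)) \<longlonglongrightarrow> 0"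
  shows "(\<lambda>n. N (s n)) \<longlonglongrightarrow> N v"
proof -
  have "(\<lambda>n. N (s n) - N v) \<longlonglongrightarrow> 0"
    by (rule Lim_null_comparison[OF _ assms(3)]) (use assms N_reverse_tri in auto)
  then show ?thesis by (simp add: LIM_zero_iff)
qed

lemma dual_lin:
  assumes "\<xi> \<in> dual_space X N" "v \<in> X" "w \<in> X"
  shows "\<xi> (\<lambda>x. a *\<^sub>R v x + b *\<^sub>R w x) = a * \<xi> v + b * \<xi> w"
  using assms by (auto simp: dual_space_def)

lemma dual_diff: "\<xi> \<in> dual_space X N \<Longrightarrow> v \<in> X \<Longrightarrow> w \<in> X \<Longrightarrow> \<xi> (v - w) = \<xi> v - \<xi> w"
  using dual_lin[of \<xi> v w 1 "-1"] by (simp add: fun_diff_def)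

lemma dual_bound: "\<xi> \<in> dual_space X N \<Longrightarrow> \<exists>C\<ge>0. \<forall>v\<in>X. \<bar>\<xi> v\<bar> \<le> C * N v"
proof -
  assume "\<xi> \<in> dual_space X N"
  then obtain C where C: "\<forall>v\<in>X. \<bar>\<xi> v\<bar> \<le> C * N v" by (auto simp: dual_space_def)
  have "\<bar>\<xi> v\<bar> \<le> max C 0 * N v" if "v \<in> X" for v
    using C nonneg that mult_right_mono[of C "max C 0" "N v"] by force
  then show ?thesis by (intro exI[of _ "max C 0"]) auto
qed

lemma unit_ball_nonempty: "{v \<in> X. N v \<le> 1} \<noteq> {}"
  using zero_mem N_zero by force

lemma dual_bdd_above:
  assumes "\<xi> \<in> dual_space X N" shows "bdd_above ((\<lambda>v. \<bar>\<xi> v\<bar>) ` {v \<in> X. N v \<le> 1})"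
proof -
  obtain C where C: "C \<ge> 0" "\<forall>v\<in>X. \<bar>\<xi> v\<bar> \<le> C * N v" using dual_bound[OF assms] by blast
  have "\<bar>\<xi> v\<bar> \<le> C" if "v \<in> X" "N v \<le> 1" for v
    using C that mult_left_mono[of "N v" 1 C] by force
  then show ?thesis by (auto intro!: bdd_aboveI)
qed

lemma dual_norm_nonneg: "\<xi> \<in> dual_space X N \<Longrightarrow> 0 \<le> dual_norm X N \<xi>"
  unfolding dual_norm_def
  by (rule cSUP_upper2[OF dual_bdd_above, of _ "\<lambda>x. 0"]) (auto simp: zero_mem N_zero)

lemma dual_norm_bound:
  assumes "\<xi> \<in> dual_space X N" "v \<in> X"
  shows "\<bar>\<xi> v\<bar> \<le> dual_norm X N \<xi> * N v"
proof (cases "N v = 0")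
  case True
  \<comment> \<open>An element of seminorm 0 cannot be normalised, and need not be zero; boundedness
    of \<xi> still forces \<open>\<xi> v = 0\<close>.\<close>
  then show ?thesis using dual_bound[OF assms(1)] assms(2) by force
next
  case False
  then have pos: "N v > 0" using nonneg[OF assms(2)] by simp
  define w where "w = (\<lambda>x. (1 / N v) *\<^sub>R v x)"
  have w: "w \<in> X" "N w = 1" unfolding w_def
    using scale_mem[OF assms(2), of "1 / N v"] scale[OF assms(2), of "1 / N v"] pos by auto
  have "\<xi> w = (1 / N v) * \<xi> v"
    using dual_lin[OF assms(1,2,2), of "1 / N v" 0] by (simp add: w_def)
  moreover have "\<bar>\<xi> w\<bar> \<le> dual_norm X N \<xi>"
    unfolding dual_norm_def by (rule cSUP_upper[OF _ dual_bdd_above[OF assms(1)]]) (use w in auto)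
  ultimately have "\<bar>\<xi> v\<bar> / N v \<le> dual_norm X N \<xi>" using pos by (simp add: abs_mult)
  then show ?thesis using pos by (simp add: pos_divide_le_eq)
qed

lemma dual_norm_le:
  assumes "\<And>v. v \<in> X \<Longrightarrow> N v \<le> 1 \<Longrightarrow> \<bar>\<xi> v\<bar> \<le> C"
  shows "dual_norm X N \<xi> \<le> C"
  unfolding dual_norm_def by (rule cSUP_least) (use unit_ball_nonempty assms in auto)

text \<open>Allows the theory of Bochner functions developed for \<open>seminormed\<close> to be
  used for V and for its dual alike.\<close>

lemma seminormed_dual: "seminormed (dual_space X N) (dual_norm X N)"
proof
  show "dual_space X N \<noteq> {}"
  proof -
    have "(\<lambda>v. 0) \<in> dual_space X N" by (auto simp: dual_space_def intro: exI[of _ 0])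
    then show ?thesis by blast
  qed
  have lin': "(\<lambda>v. a *\<^sub>R \<xi> v + b *\<^sub>R \<zeta> v) \<in> dual_space X N"
    if \<xi>: "\<xi> \<in> dual_space X N" and \<zeta>: "\<zeta> \<in> dual_space X N" for \<xi> \<zeta> and a b :: real
  proof -
    obtain C D where C: "\<forall>v\<in>X. \<bar>\<xi> v\<bar> \<le> C * N v" and D: "\<forall>v\<in>X. \<bar>\<zeta> v\<bar> \<le> D * N v"
      using dual_bound[OF \<xi>] dual_bound[OF \<zeta>] by blast
    have "\<bar>a * \<xi> v + b * \<zeta> v\<bar> \<le> (\<bar>a\<bar> * C + \<bar>b\<bar> * D) * N v" if "v \<in> X" for v
    proof -
      have "\<bar>a * \<xi> v + b * \<zeta> v\<bar> \<le> \<bar>a\<bar> * \<bar>\<xi> v\<bar> + \<bar>b\<bar> * \<bar>\<zeta> v\<bar>"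
        by (metis abs_mult abs_triangle_ineq)
      also have "\<dots> \<le> \<bar>a\<bar> * (C * N v) + \<bar>b\<bar> * (D * N v)"
        using C D that by (intro add_mono mult_left_mono) auto
      finally show ?thesis by (simp add: algebra_simps)
    qed
    moreover have "a * \<xi> (\<lambda>x. c *\<^sub>R v x + d *\<^sub>R w x) + b * \<zeta> (\<lambda>x. c *\<^sub>R v x + d *\<^sub>R w x)
        = c * (a * \<xi> v + b * \<zeta> v) + d * (a * \<xi> w + b * \<zeta> w)" if "v \<in> X" "w \<in> X" for v w c d
      using dual_lin[OF \<xi> that] dual_lin[OF \<zeta> that] by (simp add: algebra_simps)
    ultimately show ?thesis by (auto simp: dual_space_def)
  qed
  then show "(\<lambda>v. a *\<^sub>R \<xi> v + b *\<^sub>R \<zeta> v) \<in> dual_space X N"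
    if "\<xi> \<in> dual_space X N" "\<zeta> \<in> dual_space X N" for \<xi> \<zeta> and a b :: real
    using that by blast
  show "0 \<le> dual_norm X N \<xi>" if "\<xi> \<in> dual_space X N" for \<xi>
    using that by (rule dual_norm_nonneg)
  have le: "dual_norm X N (\<lambda>x. a *\<^sub>R \<xi> x) \<le> \<bar>a\<bar> * dual_norm X N \<xi>"
    if \<xi>: "\<xi> \<in> dual_space X N" for \<xi> and a :: real
  proof (rule dual_norm_le)
    fix v assume v: "v \<in> X" "N v \<le> 1"
    have "\<bar>\<xi> v\<bar> \<le> dual_norm X N \<xi> * 1"
      using dual_norm_bound[OF \<xi> v(1)] mult_left_mono[OF v(2) dual_norm_nonneg[OF \<xi>]] by simp
    then show "\<bar>a *\<^sub>R \<xi> v\<bar> \<le> \<bar>a\<bar> * dual_norm X N \<xi>"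
      by (simp add: abs_mult mult_left_mono)
  qed
  show "dual_norm X N (\<lambda>x. a *\<^sub>R \<xi> x) = \<bar>a\<bar> * dual_norm X N \<xi>"
    if \<xi>: "\<xi> \<in> dual_space X N" for \<xi> and a :: real
  proof (cases "a = 0")
    case True
    have "(\<lambda>x. a *\<^sub>R \<xi> x) \<in> dual_space X N" using lin'[OF \<xi> \<xi>, of a 0] by simp
    then show ?thesis using le[OF \<xi>, of a] dual_norm_nonneg True by force
  next
    case False
    have "(\<lambda>x. a *\<^sub>R \<xi> x) \<in> dual_space X N" using lin'[OF \<xi> \<xi>, of a 0] by simp
    \<comment> \<open>The reverse inequality is the upper bound for the scalar \<open>1 / a\<close>,
      applied to the scaled functional.\<close>
    from le[OF this, of "1 / a"] False have "dual_norm X N \<xi> \<le> \<bar>1 / a\<bar> * dual_norm X N (\<lambda>x. a *\<^sub>R \<xi> x)"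
      by simp
    then have "\<bar>a\<bar> * dual_norm X N \<xi> \<le> dual_norm X N (\<lambda>x. a *\<^sub>R \<xi> x)"
      using False by (simp add: field_simps abs_divide)
    with le[OF \<xi>, of a] show ?thesis by linarith
  qed
  show "dual_norm X N (\<lambda>x. \<xi> x + \<zeta> x) \<le> dual_norm X N \<xi> + dual_norm X N \<zeta>"
    if \<xi>: "\<xi> \<in> dual_space X N" and \<zeta>: "\<zeta> \<in> dual_space X N" for \<xi> \<zeta>
  proof (rule dual_norm_le)
    fix v assume v: "v \<in> X" "N v \<le> 1"
    have "\<bar>\<xi> v\<bar> \<le> dual_norm X N \<xi>" "\<bar>\<zeta> v\<bar> \<le> dual_norm X N \<zeta>"
      using dual_norm_bound[OF \<xi> v(1)] mult_left_mono[OF v(2) dual_norm_nonneg[OF \<xi>]]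
        dual_norm_bound[OF \<zeta> v(1)] mult_left_mono[OF v(2) dual_norm_nonneg[OF \<zeta>]] by auto
    then show "\<bar>\<xi> v + \<zeta> v\<bar> \<le> dual_norm X N \<xi> + dual_norm X N \<zeta>" by linarith
  qed
qed

end

lemma seminormed_Lp:
  assumes "1 \<le> p"
  shows "seminormed (Lp p M :: ('a \<Rightarrow> 'b::euclidean_space) set) (Lp_norm p M)"
proof
  have "(\<lambda>x. 0 :: 'b) \<in> Lp p M" by (simp add: Lp_iff)
  then show "(Lp p M :: ('a \<Rightarrow> 'b) set) \<noteq> {}" by blast
  fix v w :: "'a \<Rightarrow> 'b" and a b :: real
  assume v: "v \<in> Lp p M"
  show "0 \<le> Lp_norm p M v" by (rule Lp_norm_nonneg)
  show "Lp_norm p M (\<lambda>x. a *\<^sub>R v x) = \<bar>a\<bar> * Lp_norm p M v"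
    using assms by (simp add: Lp_norm_def powr_mult powr_powr)
  assume w: "w \<in> Lp p M"
  show "(\<lambda>x. a *\<^sub>R v x + b *\<^sub>R w x) \<in> Lp p M"
    by (intro Lp_add(1) Lp_scale v w assms)
  show "Lp_norm p M (\<lambda>x. v x + w x) \<le> Lp_norm p M v + Lp_norm p M w"
    unfolding Lp_norm_def by (rule root_subadditive[OF assms _ _ _ Lp_add(2)[OF assms v w]]) auto
qed

section \<open>Sobolev spaces\<close>

lemma Lp_imp_integrable:
  fixes f :: "'a \<Rightarrow> 'b::euclidean_space"
  assumes "finite_measure M" "1 \<le> p" "f \<in> Lp p M"
  shows "integrable M f"
proof (rule Bochner_Integration.integrable_bound)
  interpret finite_measure M by fact
  show "integrable M (\<lambda>x. 1 + norm (f x) powr p)"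
    using Lp_integrable[OF assms(3)] by simp
  have "norm y \<le> 1 + norm y powr p" for y :: 'b
  proof (cases "norm y \<le> 1")
    case False
    then have "norm y powr 1 \<le> norm y powr p" using assms by (intro powr_mono) auto
    then show ?thesis using False by simp
  qed (simp add: add_increasing2)
  then show "AE x in M. norm (f x) \<le> norm (1 + norm (f x) powr p)"
    by (auto intro!: AE_I2 order_trans[OF _ abs_ge_self])
  show "f \<in> borel_measurable M" using assms(3) by (rule Lp_measurable)
qed

lemma bounded_measurable_in_Lp:
  fixes f :: "'a \<Rightarrow> 'b::euclidean_space"
  assumes "finite_measure M" "0 \<le> p" "f \<in> borel_measurable M" "\<And>x. x \<in> space M \<Longrightarrow> norm (f x) \<le> C"
  shows "f \<in> Lp p M"
proof -
  interpret finite_measure M by fact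
  have "integrable M (\<lambda>x. norm (f x) powr p)"
    by (rule integrable_const_bound[of _ "C powr p"]) (use assms in \<open>auto intro!: powr_mono2 AE_I2\<close>)
  then show ?thesis using assms by (simp add: Lp_iff)
qed

section \<open>Integrals of derivatives of compactly supported smooth functions\<close>

lemma continuous_zero_outside_compact_bounded:
  fixes f :: "'a::euclidean_space \<Rightarrow> real"
  assumes "continuous_on UNIV f" "compact K" "\<And>x. x \<notin> K \<Longrightarrow> f x = 0"
  obtains C where "0 \<le> C" "\<And>x. \<bar>f x\<bar> \<le> C"
proof -
  have "compact (f ` K)"
    using assms by (intro compact_continuous_image) (auto intro: continuous_on_subset)
  then obtain C where C: "\<forall>y\<in>f ` K. norm y \<le> C" using compact_imp_bounded bounded_iff by blast
  have "\<bar>f x\<bar> \<le> max C 0" for x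
    using C assms(3)[of x] by (cases "x \<in> K") force+
  then show ?thesis by (intro that[of "max C 0"]) auto
qed

text \<open>By translation invariance every difference quotient in direction \<open>b\<close>
  integrates to zero; dominated convergence passes to the derivative, the quotients being bounded by
  the mean value theorem.\<close>

lemma integral_partial_derivative_eq_0:
  fixes F :: "'a::euclidean_space \<Rightarrow> real"
  assumes F: "smooth F" and K: "compact K" "\<And>x. x \<notin> K \<Longrightarrow> F x = 0"
    and b: "b \<in> Basis" and G0: "\<And>x. x \<notin> K \<Longrightarrow> frechet_derivative F (at x) b = 0"
  shows "(LINT x|lborel. frechet_derivative F (at x) b) = 0"
proof -
  define G where "G x = frechet_derivative F (at x) b" for x
  have G: "smooth G" unfolding G_def by (rule smooth_has_derivative_partials(2)[OF F b])
  note Gc = smooth_continuous_on[OF G, of UNIV] and Fc = smooth_continuous_on[OF F, of UNIV]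
  have [measurable]: "G \<in> borel_measurable borel" "F \<in> borel_measurable borel"
    using Gc Fc by (auto intro: borel_measurable_continuous_onI)
  obtain C where C: "0 \<le> C" "\<And>x. \<bar>G x\<bar> \<le> C"
    using continuous_zero_outside_compact_bounded[OF Gc K(1)] G0 unfolding G_def by metis
  obtain R where R: "\<And>x. x \<in> K \<Longrightarrow> norm x \<le> R"
    using compact_imp_bounded[OF K(1)] bounded_iff by blast
  have der: "((\<lambda>t. F (x + t *\<^sub>R b)) has_real_derivative G (x + t *\<^sub>R b)) (at t)" for x t
  proof -
    have "((\<lambda>t. F (x + t *\<^sub>R b)) has_derivative (\<lambda>h. \<Sum>c\<in>Basis. ((h *\<^sub>R b) \<bullet> c) * frechet_derivative F (at (x + t *\<^sub>R b)) c)) (at t)"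
      by (rule has_derivative_compose[where f="\<lambda>t. x + t *\<^sub>R b", OF _ smooth_has_derivative_partials(1)[OF F]])
        (auto intro!: derivative_eq_intros)
    moreover have "(\<Sum>c\<in>Basis. ((h *\<^sub>R b) \<bullet> c) * frechet_derivative F (at y) c) = G y * h" for h y
    proof -
      have "(\<Sum>c\<in>Basis. ((h *\<^sub>R b) \<bullet> c) * frechet_derivative F (at y) c)
          = (\<Sum>c\<in>Basis. if c = b then h * frechet_derivative F (at y) c else 0)"
        by (rule sum.cong) (use b in \<open>auto simp: inner_Basis\<close>)
      then show ?thesis using b by (simp add: G_def mult.commute)
    qed
    ultimately show ?thesis by (simp add: has_field_derivative_def)
  qed
  define D where "D n x = (F (x + (1 / real (Suc n)) *\<^sub>R b) - F x) * real (Suc n)" for n x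
  have int: "integrable lborel F"
  proof -
    have "integrable lborel (\<lambda>x. indicator K x *\<^sub>R F x)"
      using borel_integrable_compact[OF K(1), of F] Fc Fc[THEN continuous_on_subset, of K] by simp
    moreover have "(\<lambda>x. indicator K x *\<^sub>R F x) = F" using K(2) by (auto simp: indicator_def fun_eq_iff)
    ultimately show ?thesis by simp
  qed
  have shift: "integrable lborel (\<lambda>x. F (x + c))" "(LINT x|lborel. F (x + c)) = (LINT x|lborel. F x)" for c
  proof -
    have "integrable (distr lborel borel ((+) c)) F" using int by (simp add: lborel_distr_plus)
    then show "integrable lborel (\<lambda>x. F (x + c))" by (simp add: integrable_distr_eq add.commute)
    have "(LINT x|distr lborel borel ((+) c). F x) = (LINT x|lborel. F (c + x))"
      by (rule integral_distr) auto
    then show "(LINT x|lborel. F (x + c)) = (LINT x|lborel. F x)"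
      by (simp add: lborel_distr_plus add.commute)
  qed
  have D0: "(LINT x|lborel. D n x) = 0" for n
    unfolding D_def using shift int by simp
  have "(\<lambda>n. LINT x|lborel. D n x) \<longlonglongrightarrow> (LINT x|lborel. G x)"
  proof (rule integral_dominated_convergence[where w="\<lambda>x. indicator (cball 0 (R + 1)) x * C"])
    \<comment> \<open>All shifts have length at most 1 and \<open>F\<close> vanishes beyond radius
      \<open>R\<close>, so the quotients vanish outside the ball of radius
      \<open>R + 1\<close>.\<close>
    show "integrable lborel (\<lambda>x::'a. indicator (cball 0 (R + 1)) x * C)"
      using emeasure_lborel_cball_finite[of "0::'a" "R + 1"] by (intro integrable_mult_left integrable_real_indicator) auto
    show "AE x in lborel. (\<lambda>n. D n x) \<longlonglongrightarrow> G x"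
    proof (rule AE_I2)
      fix x
      have "((\<lambda>h. (F (x + (0 + h) *\<^sub>R b) - F (x + 0 *\<^sub>R b)) / h) \<longlongrightarrow> G (x + 0 *\<^sub>R b)) (at 0)"
        using der[of x 0] by (simp only: DERIV_def)
      then have "((\<lambda>h. (F (x + h *\<^sub>R b) - F x) / h) \<longlongrightarrow> G x) (at 0)" by simp
      moreover have "filterlim (\<lambda>n. 1 / real (Suc n)) (at 0) sequentially"
        unfolding filterlim_at using LIMSEQ_Suc[OF lim_1_over_n] by (auto intro!: always_eventually)
      ultimately have "(\<lambda>n. (F (x + (1 / real (Suc n)) *\<^sub>R b) - F x) / (1 / real (Suc n))) \<longlonglongrightarrow> G x"
        by (rule filterlim_compose)
      then show "(\<lambda>n. D n x) \<longlonglongrightarrow> G x" by (simp add: D_def)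
    qed
    show "AE x in lborel. norm (D n x) \<le> indicator (cball 0 (R + 1)) x * C" for n
    proof (rule AE_I2)
      fix x
      define h where "h = 1 / real (Suc n)"
      have h: "0 < h" "h \<le> 1" by (auto simp: h_def)
      obtain z where z: "F (x + h *\<^sub>R b) - F (x + 0 *\<^sub>R b) = (h - 0) * G (x + z *\<^sub>R b)"
        using MVT2[OF h(1), of "\<lambda>t. F (x + t *\<^sub>R b)" "\<lambda>t. G (x + t *\<^sub>R b)"] der by blast
      have "D n x = G (x + z *\<^sub>R b)"
        using z h(1) by (simp add: D_def h_def[symmetric]) (simp add: h_def field_simps)
      then have "norm (D n x) \<le> C" using C by simp
      moreover have "D n x = 0" if "x \<notin> cball 0 (R + 1)"
      proof -
        have nx: "norm x > R + 1" using that by simp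
        have "norm (h *\<^sub>R b) \<le> 1" using h b by simp
        then have "norm (x + h *\<^sub>R b) > R" using nx norm_triangle_ineq2[of x "- (h *\<^sub>R b)"] by simp
        then have "F (x + h *\<^sub>R b) = 0" "F x = 0" using R K(2) nx by force+
        then show ?thesis unfolding D_def h_def by (metis diff_0_right mult_zero_left)
      qed
      ultimately show "norm (D n x) \<le> indicator (cball 0 (R + 1)) x * C"
        by (cases "x \<in> cball 0 (R + 1)") (auto simp: indicator_def)
    qed
  qed (simp_all add: D_def)
  then have "(\<lambda>n::nat. 0) \<longlonglongrightarrow> (LINT x|lborel. G x)" by (simp only: D0)
  from LIMSEQ_unique[OF this tendsto_const] show ?thesis by (simp add: G_def)
qed

section \<open>Weak gradients and the spaces W1p and V\<close>

context
  fixes \<Omega> :: "(real^'d) set" and p :: real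
  assumes op: "open \<Omega>" and bd: "bounded \<Omega>" and p: "1 \<le> p"
begin

lemma finite_measure_Omega: "finite_measure (lebesgue_on \<Omega>)"
  by (rule finite_measure_lebesgue_on[OF lmeasurable_open[OF bd op]])

lemma test_function_bounds:
  assumes "test_function \<Omega> \<zeta>"
  shows "\<zeta> \<in> borel_measurable (lebesgue_on \<Omega>)" "\<exists>C. \<forall>x. \<bar>\<zeta> x\<bar> \<le> C"
    "(\<lambda>x. frechet_derivative \<zeta> (at x) (axis j 1)) \<in> borel_measurable (lebesgue_on \<Omega>)"
    "\<exists>C. \<forall>x. \<bar>frechet_derivative \<zeta> (at x) (axis j 1)\<bar> \<le> C"
proof -
  obtain K where K: "smooth \<zeta>" "compact K" "K \<subseteq> \<Omega>" "\<And>x. x \<notin> K \<Longrightarrow> \<zeta> x = 0"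
    "\<And>x h. x \<notin> K \<Longrightarrow> frechet_derivative \<zeta> (at x) h = 0"
    using test_functionE[OF assms] by blast
  have b: "axis j 1 \<in> (Basis :: (real^'d) set)" by (simp add: axis_in_Basis_iff)
  note c1 = smooth_continuous_on[OF K(1)]
    and c2 = smooth_continuous_on[OF smooth_has_derivative_partials(2)[OF K(1) b]]
  show "\<zeta> \<in> borel_measurable (lebesgue_on \<Omega>)"
    "(\<lambda>x. frechet_derivative \<zeta> (at x) (axis j 1)) \<in> borel_measurable (lebesgue_on \<Omega>)"
    using op by (auto intro!: continuous_imp_measurable_on_sets_lebesgue c1 c2)
  show "\<exists>C. \<forall>x. \<bar>\<zeta> x\<bar> \<le> C"
    by (rule continuous_zero_outside_compact_bounded[OF c1 K(2,4)]) auto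
  show "\<exists>C. \<forall>x. \<bar>frechet_derivative \<zeta> (at x) (axis j 1)\<bar> \<le> C"
    by (rule continuous_zero_outside_compact_bounded[OF c2 K(2)], erule K(5)) auto
qed

lemma integrable_mult_bounded:
  fixes g z :: "'a \<Rightarrow> real"
  assumes "integrable M g" "z \<in> borel_measurable M" "\<exists>C. \<forall>x. \<bar>z x\<bar> \<le> C"
  shows "integrable M (\<lambda>x. g x * z x)"
proof -
  obtain C where C: "\<forall>x. \<bar>z x\<bar> \<le> C" using assms by blast
  have "\<bar>g x * z x\<bar> \<le> C * \<bar>g x\<bar>" for x
    using C mult_right_mono[of "\<bar>z x\<bar>" C "\<bar>g x\<bar>"] by (simp add: abs_mult mult.commute)
  then have le: "norm (g x * z x) \<le> norm (C * \<bar>g x\<bar>)" for x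
    using abs_ge_self[of "C * \<bar>g x\<bar>"] unfolding real_norm_def by (rule order_trans)
  show ?thesis
  proof (rule Bochner_Integration.integrable_bound)
    show "integrable M (\<lambda>x. C * \<bar>g x\<bar>)" using assms(1) by simp
    show "(\<lambda>x. g x * z x) \<in> borel_measurable M"
      by (intro borel_measurable_times borel_measurable_integrable assms)
  qed (use le in blast)
qed

lemma integrable_component:
  fixes v :: "real^'d \<Rightarrow> real^'l"
  assumes "v \<in> Lp p (lebesgue_on \<Omega>)"
  shows "integrable (lebesgue_on \<Omega>) (\<lambda>x. v x $ i)"
proof -
  have "integrable (lebesgue_on \<Omega>) (\<lambda>x. v x \<bullet> axis i 1)"
    by (intro integrable_inner_left Lp_imp_integrable[OF finite_measure_Omega p assms])
  then show ?thesis by (simp add: inner_axis)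
qed

lemma integrable_component2:
  fixes g :: "real^'d \<Rightarrow> real^'d^'l"
  assumes "g \<in> Lp p (lebesgue_on \<Omega>)"
  shows "integrable (lebesgue_on \<Omega>) (\<lambda>x. g x $ i $ j)"
proof -
  have "integrable (lebesgue_on \<Omega>) (\<lambda>x. g x \<bullet> axis i (axis j 1))"
    by (intro integrable_inner_left Lp_imp_integrable[OF finite_measure_Omega p assms])
  then show ?thesis by (simp add: inner_axis)
qed

lemma integrable_weak:
  fixes v :: "real^'d \<Rightarrow> real^'l" and g :: "real^'d \<Rightarrow> real^'d^'l"
  assumes "test_function \<Omega> \<zeta>"
  shows "v \<in> Lp p (lebesgue_on \<Omega>) \<Longrightarrow>
      integrable (lebesgue_on \<Omega>) (\<lambda>x. v x $ i * frechet_derivative \<zeta> (at x) (axis j 1))"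
    and "g \<in> Lp p (lebesgue_on \<Omega>) \<Longrightarrow> integrable (lebesgue_on \<Omega>) (\<lambda>x. g x $ i $ j * \<zeta> x)"
  using test_function_bounds[OF assms] integrable_component integrable_component2
  by (auto intro!: integrable_mult_bounded)

lemma is_weak_gradient_lin:
  fixes v w :: "real^'d \<Rightarrow> real^'l"
  assumes "v \<in> Lp p (lebesgue_on \<Omega>)" "w \<in> Lp p (lebesgue_on \<Omega>)"
     "g \<in> Lp p (lebesgue_on \<Omega>)" "h \<in> Lp p (lebesgue_on \<Omega>)"
     "is_weak_gradient \<Omega> v g" "is_weak_gradient \<Omega> w h"
  shows "is_weak_gradient \<Omega> (\<lambda>x. a *\<^sub>R v x + b *\<^sub>R w x) (\<lambda>x. a *\<^sub>R g x + b *\<^sub>R h x)"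
  unfolding is_weak_gradient_def
proof (intro allI impI)
  fix \<zeta> :: "real^'d \<Rightarrow> real" and i j assume t: "test_function \<Omega> \<zeta>"
  let ?M = "lebesgue_on \<Omega>" and ?d = "\<lambda>x. frechet_derivative \<zeta> (at x) (axis j 1)"
  have "(LINT x|?M. (a *\<^sub>R v x + b *\<^sub>R w x) $ i * ?d x) =
     (LINT x|?M. a * (v x $ i * ?d x) + b * (w x $ i * ?d x))"
    by (simp add: algebra_simps)
  also have "\<dots> = a * (LINT x|?M. v x $ i * ?d x) + b * (LINT x|?M. w x $ i * ?d x)"
    using integrable_weak(1)[OF t assms(1), of i j] integrable_weak(1)[OF t assms(2), of i j] by simp
  also have "\<dots> = - (a * (LINT x|?M. g x $ i $ j * \<zeta> x) + b * (LINT x|?M. h x $ i $ j * \<zeta> x))"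
    using assms t by (simp add: is_weak_gradient_def)
  also have "\<dots> = - (LINT x|?M. a * (g x $ i $ j * \<zeta> x) + b * (h x $ i $ j * \<zeta> x))"
    using integrable_weak(2)[OF t assms(3), of i j] integrable_weak(2)[OF t assms(4), of i j] by simp
  also have "\<dots> = - (LINT x|?M. (a *\<^sub>R g x + b *\<^sub>R h x) $ i $ j * \<zeta> x)"
    by (simp add: algebra_simps)
  finally show "(LINT x|?M. (a *\<^sub>R v x + b *\<^sub>R w x) $ i * ?d x) = - (LINT x|?M. (a *\<^sub>R g x + b *\<^sub>R h x) $ i $ j * \<zeta> x)" .
qed

text \<open>Since \<open>weak_grad\<close> is a choice, linearity of the gradient up to null sets,
  and with it the triangle inequality for \<open>W1p_norm\<close>, rests on this.\<close>

lemma weak_gradient_unique: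
  fixes v :: "real^'d \<Rightarrow> real^'l"
  assumes "g \<in> Lp p (lebesgue_on \<Omega>)" "h \<in> Lp p (lebesgue_on \<Omega>)"
     "is_weak_gradient \<Omega> v g" "is_weak_gradient \<Omega> v h"
  shows "AE x in lebesgue_on \<Omega>. g x = h x"
proof -
  have "AE x in lebesgue_on \<Omega>. g x $ i $ j - h x $ i $ j = 0" for i j
  proof (rule fundamental_lemma[OF op])
    show "integrable (lebesgue_on \<Omega>) (\<lambda>x. g x $ i $ j - h x $ i $ j)"
      by (intro Bochner_Integration.integrable_diff integrable_component2 assms)
    fix \<zeta> :: "real^'d \<Rightarrow> real" assume t: "test_function \<Omega> \<zeta>"
    have "(LINT x|lebesgue_on \<Omega>. (g x $ i $ j - h x $ i $ j) * \<zeta> x) =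
       (LINT x|lebesgue_on \<Omega>. g x $ i $ j * \<zeta> x) - (LINT x|lebesgue_on \<Omega>. h x $ i $ j * \<zeta> x)"
      using integrable_weak(2)[OF t assms(1), of i j] integrable_weak(2)[OF t assms(2), of i j]
      by (simp add: left_diff_distrib)
    also have "\<dots> = 0"
    proof -
      have "- (LINT x|lebesgue_on \<Omega>. g x $ i $ j * \<zeta> x) = - (LINT x|lebesgue_on \<Omega>. h x $ i $ j * \<zeta> x)"
        using assms(3)[unfolded is_weak_gradient_def, rule_format, OF t, of i j, symmetric]
          assms(4)[unfolded is_weak_gradient_def, rule_format, OF t, of i j] by (rule trans)
      then show ?thesis by simp
    qed
    finally show "(LINT x|lebesgue_on \<Omega>. (g x $ i $ j - h x $ i $ j) * \<zeta> x) = 0" .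
  qed
  then have "AE x in lebesgue_on \<Omega>. \<forall>i j. g x $ i $ j - h x $ i $ j = 0"
    unfolding AE_all_countable by blast
  then show ?thesis by eventually_elim (simp add: vec_eq_iff)
qed

lemma weak_grad_spec:
  assumes "v \<in> W1p \<Omega> p"
  shows "weak_grad \<Omega> p v \<in> Lp p (lebesgue_on \<Omega>)" "is_weak_gradient \<Omega> v (weak_grad \<Omega> p v)"
proof -
  have "\<exists>g. g \<in> Lp p (lebesgue_on \<Omega>) \<and> is_weak_gradient \<Omega> v g" using assms by (auto simp: W1p_def)
  from someI_ex[OF this] show "weak_grad \<Omega> p v \<in> Lp p (lebesgue_on \<Omega>)" "is_weak_gradient \<Omega> v (weak_grad \<Omega> p v)"
    by (auto simp: weak_grad_def)
qed

lemma W1p_imp_Lp: "v \<in> W1p \<Omega> p \<Longrightarrow> v \<in> Lp p (lebesgue_on \<Omega>)"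
  by (simp add: W1p_def)

lemma W1p_lin:
  assumes v: "v \<in> W1p \<Omega> p" and w: "w \<in> W1p \<Omega> p"
  shows "(\<lambda>x. a *\<^sub>R v x + b *\<^sub>R w x) \<in> W1p \<Omega> p"
    and "AE x in lebesgue_on \<Omega>. weak_grad \<Omega> p (\<lambda>x. a *\<^sub>R v x + b *\<^sub>R w x) x
        = a *\<^sub>R weak_grad \<Omega> p v x + b *\<^sub>R weak_grad \<Omega> p w x"
proof -
  let ?g = "\<lambda>x. a *\<^sub>R weak_grad \<Omega> p v x + b *\<^sub>R weak_grad \<Omega> p w x"
  have g: "?g \<in> Lp p (lebesgue_on \<Omega>)"
    by (intro Lp_add(1) Lp_scale p weak_grad_spec v w)
  have wg: "is_weak_gradient \<Omega> (\<lambda>x. a *\<^sub>R v x + b *\<^sub>R w x) ?g"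
    by (intro is_weak_gradient_lin weak_grad_spec W1p_imp_Lp v w)
  have "(\<lambda>x. a *\<^sub>R v x + b *\<^sub>R w x) \<in> Lp p (lebesgue_on \<Omega>)"
    by (intro Lp_add(1) Lp_scale p W1p_imp_Lp v w)
  with g wg show m: "(\<lambda>x. a *\<^sub>R v x + b *\<^sub>R w x) \<in> W1p \<Omega> p" by (auto simp: W1p_def)
  show "AE x in lebesgue_on \<Omega>. weak_grad \<Omega> p (\<lambda>x. a *\<^sub>R v x + b *\<^sub>R w x) x = ?g x"
    by (rule weak_gradient_unique[OF weak_grad_spec(1)[OF m] g weak_grad_spec(2)[OF m] wg])
qed

lemma W1p_norm_eq:
  "W1p_norm \<Omega> p v = ((LINT x|lebesgue_on \<Omega>. norm (v x) powr p)
      + (LINT x|lebesgue_on \<Omega>. norm (weak_grad \<Omega> p v x) powr p)) powr (1 / p)"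
  unfolding W1p_norm_def using p by (subst (1 2) Lp_norm_powr) auto

lemma W1p_norm_powr:
  "W1p_norm \<Omega> p v powr p = (LINT x|lebesgue_on \<Omega>. norm (v x) powr p)
      + (LINT x|lebesgue_on \<Omega>. norm (weak_grad \<Omega> p v x) powr p)"
  unfolding W1p_norm_eq using p by (simp add: powr_powr integral_nonneg_AE add_nonneg_nonneg)

lemma seminormed_W1p: "seminormed (W1p \<Omega> p :: (real^'d \<Rightarrow> real^'l) set) (W1p_norm \<Omega> p)"
proof
  have "(\<lambda>x. 0 :: real^'l) \<in> W1p \<Omega> p"
    unfolding W1p_def is_weak_gradient_def
    by (auto simp: Lp_iff intro!: bexI[of _ "\<lambda>x. 0"])
  then show "(W1p \<Omega> p :: (real^'d \<Rightarrow> real^'l) set) \<noteq> {}" by blast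
  fix v w :: "real^'d \<Rightarrow> real^'l" and a b :: real
  let ?M = "lebesgue_on \<Omega>" and ?G = "weak_grad \<Omega> p"
  assume v: "v \<in> W1p \<Omega> p"
  show "0 \<le> W1p_norm \<Omega> p v" by (simp add: W1p_norm_def)
  have wgm: "?G u \<in> borel_measurable ?M" if "u \<in> W1p \<Omega> p" for u :: "real^'d \<Rightarrow> real^'l"
    by (rule Lp_measurable[OF weak_grad_spec(1)[OF that]])
  note gv [measurable] = wgm[OF v]
  have av: "(\<lambda>x. a *\<^sub>R v x) \<in> W1p \<Omega> p" using W1p_lin(1)[OF v v, of a 0] by simp
  note gav [measurable] = wgm[OF av]
  have "(LINT x|?M. norm (?G (\<lambda>x. a *\<^sub>R v x) x) powr p) = (LINT x|?M. \<bar>a\<bar> powr p * norm (?G v x) powr p)"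
    using W1p_lin(2)[OF v v, of a 0] p by (intro integral_cong_AE) (auto simp: powr_mult)
  moreover have "(LINT x|?M. norm (a *\<^sub>R v x) powr p) = (LINT x|?M. \<bar>a\<bar> powr p * norm (v x) powr p)"
    by (simp add: powr_mult)
  ultimately have "W1p_norm \<Omega> p (\<lambda>x. a *\<^sub>R v x) = (\<bar>a\<bar> powr p * ((LINT x|?M. norm (v x) powr p)
      + (LINT x|?M. norm (?G v x) powr p))) powr (1 / p)"
    by (simp add: W1p_norm_eq algebra_simps)
  also have "\<dots> = \<bar>a\<bar> * W1p_norm \<Omega> p v"
    using p by (simp add: W1p_norm_eq powr_mult powr_powr add_nonneg_nonneg)
  finally show "W1p_norm \<Omega> p (\<lambda>x. a *\<^sub>R v x) = \<bar>a\<bar> * W1p_norm \<Omega> p v" .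
  assume w: "w \<in> W1p \<Omega> p"
  show "(\<lambda>x. a *\<^sub>R v x + b *\<^sub>R w x) \<in> W1p \<Omega> p" by (rule W1p_lin(1)[OF v w])
  have vw: "(\<lambda>x. v x + w x) \<in> W1p \<Omega> p" using W1p_lin(1)[OF v w, of 1 1] by simp
  note [measurable] = wgm[OF w] wgm[OF vw]
  have eq: "(LINT x|?M. norm (?G (\<lambda>x. v x + w x) x) powr p) = (LINT x|?M. norm (?G v x + ?G w x) powr p)"
    using W1p_lin(2)[OF v w, of 1 1] by (intro integral_cong_AE) auto
  note l1 = Lp_add(2)[OF p W1p_imp_Lp[OF v] W1p_imp_Lp[OF w]]
    and l2 = Lp_add(2)[OF p weak_grad_spec(1)[OF v] weak_grad_spec(1)[OF w]]
  show "W1p_norm \<Omega> p (\<lambda>x. v x + w x) \<le> W1p_norm \<Omega> p v + W1p_norm \<Omega> p w"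
    unfolding W1p_norm_eq eq
  proof (rule root_subadditive[OF p])
    fix a b :: real assume "0 < a" "0 < b"
    from add_mono[OF l1[OF this] l2[OF this]]
    show "(LINT x|?M. norm (v x + w x) powr p) + (LINT x|?M. norm (?G v x + ?G w x) powr p)
        \<le> (a + b) powr (p - 1) *
          (a powr (1 - p) * ((LINT x|?M. norm (v x) powr p) + (LINT x|?M. norm (?G v x) powr p)) +
           b powr (1 - p) * ((LINT x|?M. norm (w x) powr p) + (LINT x|?M. norm (?G w x) powr p)))"
      by (simp add: algebra_simps)
  qed (auto simp: add_nonneg_nonneg)
qed

text \<open>The classical gradient is a weak one, because a component of \<open>w\<close> times a
  test function has compact support in the domain and its partial derivatives integrate to zero.
  Functions smooth on the whole space are the approximants in \<open>has_trace\<close>; membership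
  in \<open>W1p\<close> makes the triangle inequality applicable to them.\<close>

lemma smooth_in_W1p:
  fixes w :: "real^'d \<Rightarrow> real^'l"
  assumes w: "\<And>i. smooth (\<lambda>x. w x $ i)"
  shows "w \<in> W1p \<Omega> p"
proof -
  define g where "g x = (\<chi> i j. frechet_derivative (\<lambda>x. w x $ i) (at x) (axis j 1))" for x
  have b: "axis j 1 \<in> (Basis :: (real^'d) set)" for j by (simp add: axis_in_Basis_iff)
  note part = smooth_has_derivative_partials(2)[OF w b]
  have wc: "continuous_on UNIV w"
    by (subst continuous_on_componentwise) (simp add: Basis_vec_def inner_axis, use w in \<open>auto intro: smooth_continuous_on\<close>)
  have gc: "continuous_on UNIV g"
    unfolding g_def by (intro continuous_on_vec_lambda smooth_continuous_on part)
  have bnd: "\<exists>C. \<forall>x\<in>\<Omega>. norm (f x) \<le> C" if "continuous_on UNIV f" for f :: "real^'d \<Rightarrow> 'c::euclidean_space"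
  proof -
    have "compact (f ` closure \<Omega>)"
      using that bd by (intro compact_continuous_image) (auto intro: continuous_on_subset simp: compact_closure)
    then show ?thesis using compact_imp_bounded bounded_iff closure_subset by (metis image_eqI subsetD)
  qed
  have inLp: "f \<in> Lp p (lebesgue_on \<Omega>)" if f: "continuous_on UNIV f" for f :: "real^'d \<Rightarrow> 'c::euclidean_space"
  proof -
    obtain C where "\<forall>x\<in>\<Omega>. norm (f x) \<le> C" using bnd[OF f] by blast
    moreover have "f \<in> borel_measurable (lebesgue_on \<Omega>)"
      using f op by (intro continuous_imp_measurable_on_sets_lebesgue) (auto intro: continuous_on_subset)
    ultimately show ?thesis using p by (intro bounded_measurable_in_Lp[OF finite_measure_Omega]) auto
  qed
  have "is_weak_gradient \<Omega> w g"
    unfolding is_weak_gradient_def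
  proof (intro allI impI)
    fix \<zeta> :: "real^'d \<Rightarrow> real" and i j assume t: "test_function \<Omega> \<zeta>"
    let ?M = "lebesgue_on \<Omega>" and ?d = "\<lambda>x. frechet_derivative \<zeta> (at x) (axis j 1)"
    obtain K where K: "smooth \<zeta>" "compact K" "K \<subseteq> \<Omega>" "\<And>x. x \<notin> K \<Longrightarrow> \<zeta> x = 0"
      "\<And>x h. x \<notin> K \<Longrightarrow> frechet_derivative \<zeta> (at x) h = 0"
      using test_functionE[OF t] by blast
    let ?F = "\<lambda>x. w x $ i * \<zeta> x"
    have fd: "frechet_derivative ?F (at x) h = w x $ i * frechet_derivative \<zeta> (at x) h
        + frechet_derivative (\<lambda>x. w x $ i) (at x) h * \<zeta> x" for x h
    proof -
      have "(?F has_derivative (\<lambda>h. w x $ i * frechet_derivative \<zeta> (at x) h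
          + frechet_derivative (\<lambda>x. w x $ i) (at x) h * \<zeta> x)) (at x)"
        by (intro has_derivative_mult smooth_differentiable[OF w, unfolded frechet_derivative_works]
            smooth_differentiable[OF K(1), unfolded frechet_derivative_works])
      from fun_cong[OF frechet_derivative_at[OF this], of h] show ?thesis by simp
    qed
    have "(LINT x|lborel. frechet_derivative ?F (at x) (axis j 1)) = 0"
      by (rule integral_partial_derivative_eq_0[OF smooth_mult[OF w K(1)] K(2) _ b]) (auto simp: fd K(4,5))
    moreover have "(LINT x|lborel. frechet_derivative ?F (at x) (axis j 1)) =
        (LINT x|lebesgue. (if x \<in> \<Omega> then frechet_derivative ?F (at x) (axis j 1) else 0))"
    proof -
      have "(\<lambda>x. if x \<in> \<Omega> then frechet_derivative ?F (at x) (axis j 1) else 0) =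
        (\<lambda>x. frechet_derivative ?F (at x) (axis j 1))"
      proof
        fix x
        show "(if x \<in> \<Omega> then frechet_derivative ?F (at x) (axis j 1) else 0) = frechet_derivative ?F (at x) (axis j 1)"
        proof (cases "x \<in> \<Omega>")
          case False
          then have "x \<notin> K" using K(3) by blast
          then show ?thesis using False by (simp add: fd K(4,5))
        qed simp
      qed
      moreover have "(\<lambda>x. frechet_derivative ?F (at x) (axis j 1)) \<in> borel_measurable lborel"
        using smooth_continuous_on[OF smooth_has_derivative_partials(2)[OF smooth_mult[OF w K(1)] b], of UNIV]
        by (simp add: borel_measurable_continuous_onI)
      ultimately show ?thesis by (simp add: integral_completion)
    qed
    ultimately have "(LINT x|?M. frechet_derivative ?F (at x) (axis j 1)) = 0"
      using Lebesgue_Measure.integral_restrict_UNIV[of \<Omega> "\<lambda>x. frechet_derivative ?F (at x) (axis j 1)"] op by simp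
    moreover have "(LINT x|?M. frechet_derivative ?F (at x) (axis j 1))
        = (LINT x|?M. w x $ i * ?d x) + (LINT x|?M. g x $ i $ j * \<zeta> x)"
      using integrable_weak(1)[OF t inLp[OF wc], of i j] integrable_weak(2)[OF t inLp[OF gc], of i j]
      by (simp add: fd) (simp add: g_def)
    ultimately show "(LINT x|?M. w x $ i * ?d x) = - (LINT x|?M. g x $ i $ j * \<zeta> x)" by simp
  qed
  then show ?thesis using inLp[OF wc] inLp[OF gc] by (auto simp: W1p_def)
qed

text \<open>A trace of a linear combination is obtained by combining two approximating sequences and
  using the triangle inequality in the domain and on the boundary. On the boundary this asks smooth
  functions to lie in L^p, which follows from \<open>fin\<close> as they are bounded on the compact
  frontier.\<close>

lemma seminormed_W1p_D:
  assumes fin: "finite_measure (boundary_measure \<Omega>)"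
  shows "seminormed (W1p_D \<Omega> \<Gamma> p :: (real^'d \<Rightarrow> real^'l) set) (W1p_norm \<Omega> p)"
proof -
  let ?B = "boundary_measure \<Omega>"
  interpret V: seminormed "W1p \<Omega> p :: (real^'d \<Rightarrow> real^'l) set" "W1p_norm \<Omega> p" by (rule seminormed_W1p)
  interpret B: seminormed "Lp p ?B :: (real^'d \<Rightarrow> real^'l) set" "Lp_norm p ?B" by (rule seminormed_Lp[OF p])
  have smB: "w \<in> Lp p ?B" if w: "\<And>i. smooth (\<lambda>x. w x $ i)" for w :: "real^'d \<Rightarrow> real^'l"
  proof -
    have wc: "continuous_on UNIV w"
      by (subst continuous_on_componentwise) (simp add: Basis_vec_def inner_axis, use w in \<open>auto intro: smooth_continuous_on\<close>)
    have "compact (w ` frontier \<Omega>)"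
      using wc bd by (intro compact_continuous_image) (auto intro: continuous_on_subset simp: compact_frontier_bounded)
    then obtain C where C: "\<forall>x\<in>frontier \<Omega>. norm (w x) \<le> C"
      using compact_imp_bounded bounded_iff by (metis image_eqI)
    have "w \<in> borel_measurable surface_measure"
      using borel_measurable_continuous_onI[OF wc] measurable_cong_sets[of surface_measure borel]
      by (auto simp: surface_measure_def measurable_def sets.sigma_sets_eq)
    then have "w \<in> borel_measurable ?B" by (rule measurable_restrict_space1)
    then show ?thesis
      using C p by (intro bounded_measurable_in_Lp[OF fin]) (auto simp: space_restrict_space)
  qed
  have lin: "(\<lambda>x. a *\<^sub>R v x + b *\<^sub>R w x) \<in> W1p_D \<Omega> \<Gamma> p"
    if "v \<in> W1p_D \<Omega> \<Gamma> p" "w \<in> W1p_D \<Omega> \<Gamma> p" for v w :: "real^'d \<Rightarrow> real^'l" and a b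
  proof -
    from that(1) obtain g s where v: "v \<in> W1p \<Omega> p"
      and g: "g \<in> Lp p ?B" "AE x in ?B. x \<in> \<Gamma> \<longrightarrow> g x = 0"
      and s: "\<forall>n i. smooth (\<lambda>x. s n x $ i)" "(\<lambda>n. W1p_norm \<Omega> p (s n - v)) \<longlonglongrightarrow> 0"
        "(\<lambda>n. Lp_norm p ?B (s n - g)) \<longlonglongrightarrow> 0"
      unfolding W1p_D_def has_trace_def by blast
    from that(2) obtain h r where w: "w \<in> W1p \<Omega> p"
      and h: "h \<in> Lp p ?B" "AE x in ?B. x \<in> \<Gamma> \<longrightarrow> h x = 0"
      and r: "\<forall>n i. smooth (\<lambda>x. r n x $ i)" "(\<lambda>n. W1p_norm \<Omega> p (r n - w)) \<longlonglongrightarrow> 0"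
        "(\<lambda>n. Lp_norm p ?B (r n - h)) \<longlonglongrightarrow> 0"
      unfolding W1p_D_def has_trace_def by blast
    define u where "u n x = a *\<^sub>R s n x + b *\<^sub>R r n x" for n x
    define k where "k x = a *\<^sub>R g x + b *\<^sub>R h x" for x
    have k: "k \<in> Lp p ?B" unfolding k_def by (rule B.lin[OF g(1) h(1)])
    have "smooth (\<lambda>x. u n x $ i)" for n i
      unfolding u_def using s(1) r(1) by (auto intro!: smooth_add smooth_mult)
    moreover have "(\<lambda>n. W1p_norm \<Omega> p (u n - (\<lambda>x. a *\<^sub>R v x + b *\<^sub>R w x))) \<longlonglongrightarrow> 0"
    proof (rule Lim_null_comparison)
      show "(\<lambda>n. \<bar>a\<bar> * W1p_norm \<Omega> p (s n - v) + \<bar>b\<bar> * W1p_norm \<Omega> p (r n - w)) \<longlonglongrightarrow> 0"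
        using tendsto_add[OF tendsto_mult_right_zero[OF s(2)] tendsto_mult_right_zero[OF r(2)]] by simp
      have "W1p_norm \<Omega> p (u n - (\<lambda>x. a *\<^sub>R v x + b *\<^sub>R w x))
          \<le> \<bar>a\<bar> * W1p_norm \<Omega> p (s n - v) + \<bar>b\<bar> * W1p_norm \<Omega> p (r n - w)" for n
      proof -
        have m: "s n - v \<in> W1p \<Omega> p" "r n - w \<in> W1p \<Omega> p"
          using V.diff_mem smooth_in_W1p s(1) r(1) v w by blast+
        have "u n - (\<lambda>x. a *\<^sub>R v x + b *\<^sub>R w x) = (\<lambda>x. a *\<^sub>R (s n - v) x + b *\<^sub>R (r n - w) x)"
          by (auto simp: u_def algebra_simps)
        then show ?thesis
          using V.tri[OF V.scale_mem[OF m(1), of a] V.scale_mem[OF m(2), of b]]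
            V.scale[OF m(1), of a] V.scale[OF m(2), of b] by simp
      qed
      then show "\<forall>\<^sub>F n in sequentially. norm (W1p_norm \<Omega> p (u n - (\<lambda>x. a *\<^sub>R v x + b *\<^sub>R w x)))
          \<le> \<bar>a\<bar> * W1p_norm \<Omega> p (s n - v) + \<bar>b\<bar> * W1p_norm \<Omega> p (r n - w)"
        by (simp add: W1p_norm_def)
    qed
    moreover have "(\<lambda>n. Lp_norm p ?B (u n - k)) \<longlonglongrightarrow> 0"
    proof (rule Lim_null_comparison)
      show "(\<lambda>n. \<bar>a\<bar> * Lp_norm p ?B (s n - g) + \<bar>b\<bar> * Lp_norm p ?B (r n - h)) \<longlonglongrightarrow> 0"
        using tendsto_add[OF tendsto_mult_right_zero[OF s(3)] tendsto_mult_right_zero[OF r(3)]] by simp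
      have "Lp_norm p ?B (u n - k)
          \<le> \<bar>a\<bar> * Lp_norm p ?B (s n - g) + \<bar>b\<bar> * Lp_norm p ?B (r n - h)" for n
      proof -
        have m: "s n - g \<in> Lp p ?B" "r n - h \<in> Lp p ?B"
          using B.diff_mem smB s(1) r(1) g(1) h(1) by blast+
        have "u n - k = (\<lambda>x. a *\<^sub>R (s n - g) x + b *\<^sub>R (r n - h) x)"
          by (auto simp: u_def k_def algebra_simps)
        then show ?thesis
          using B.tri[OF B.scale_mem[OF m(1), of a] B.scale_mem[OF m(2), of b]]
            B.scale[OF m(1), of a] B.scale[OF m(2), of b] by simp
      qed
      then show "\<forall>\<^sub>F n in sequentially. norm (Lp_norm p ?B (u n - k))
          \<le> \<bar>a\<bar> * Lp_norm p ?B (s n - g) + \<bar>b\<bar> * Lp_norm p ?B (r n - h)"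
        by (simp add: Lp_norm_nonneg)
    qed
    ultimately have "has_trace \<Omega> p (\<lambda>x. a *\<^sub>R v x + b *\<^sub>R w x) k"
      unfolding has_trace_def using k by blast
    moreover have "AE x in ?B. x \<in> \<Gamma> \<longrightarrow> k x = 0"
      using g(2) h(2) by eventually_elim (auto simp: k_def)
    ultimately show ?thesis
      using V.lin[OF v w] unfolding W1p_D_def by blast
  qed
  have "has_trace \<Omega> p (\<lambda>x. 0 :: real^'l) (\<lambda>x. 0)"
    unfolding has_trace_def using B.zero_mem V.N_zero B.N_zero
    by (intro conjI exI[of _ "\<lambda>n x. 0"]) (auto simp: fun_diff_def)
  then have zero: "(\<lambda>x. 0 :: real^'l) \<in> W1p_D \<Omega> \<Gamma> p"
    using V.zero_mem unfolding W1p_D_def by auto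
  have sub: "v \<in> W1p \<Omega> p" if "v \<in> W1p_D \<Omega> \<Gamma> p" for v :: "real^'d \<Rightarrow> real^'l"
    using that by (simp add: W1p_D_def)
  show ?thesis
    by unfold_locales (use zero lin sub V.nonneg V.scale V.tri in auto)
qed

end

section \<open>Surface measure of a Lipschitz boundary\<close>

text \<open>A criterion for finite (d-1)-dimensional Hausdorff measure that is stable under finite
  unions: one bound \<open>K\<close> serves covers of every mesh. The normalising constants of the
  measure are left out here and restored in \<open>surface_premeasure_le\<close>.\<close>

definition finite_surface_covers :: "(real^'d) set \<Rightarrow> bool" where
  "finite_surface_covers A \<longleftrightarrow> (\<exists>K. \<forall>\<delta>>0. \<exists>\<C>. finite \<C> \<and> A \<subseteq> \<Union>\<C> \<and>
     (\<forall>C\<in>\<C>. bounded C \<and> diameter C \<le> \<delta>) \<and> (\<Sum>C\<in>\<C>. diameter C ^ (CARD('d) - 1)) \<le> K)"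

lemma finite_surface_covers_Un:
  fixes A B :: "(real^'d) set"
  assumes "finite_surface_covers A" "finite_surface_covers B"
  shows "finite_surface_covers (A \<union> B)"
proof -
  obtain K where K: "\<forall>\<delta>>0. \<exists>\<C>. finite \<C> \<and> A \<subseteq> \<Union>\<C> \<and>
     (\<forall>C\<in>\<C>. bounded C \<and> diameter C \<le> \<delta>) \<and> (\<Sum>C\<in>\<C>. diameter C ^ (CARD('d) - 1)) \<le> K"
    using assms(1) unfolding finite_surface_covers_def by (rule exE)
  obtain L where L: "\<forall>\<delta>>0. \<exists>\<C>. finite \<C> \<and> B \<subseteq> \<Union>\<C> \<and>
     (\<forall>C\<in>\<C>. bounded C \<and> diameter C \<le> \<delta>) \<and> (\<Sum>C\<in>\<C>. diameter C ^ (CARD('d) - 1)) \<le> L"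
    using assms(2) unfolding finite_surface_covers_def by (rule exE)
  show ?thesis
    unfolding finite_surface_covers_def
  proof (intro exI[of _ "K + L"] allI impI)
    fix \<delta> :: real assume d: "\<delta> > 0"
    obtain \<C> where C: "finite \<C>" "A \<subseteq> \<Union>\<C>" "\<forall>C\<in>\<C>. bounded C \<and> diameter C \<le> \<delta>"
       "(\<Sum>C\<in>\<C>. diameter C ^ (CARD('d) - 1)) \<le> K" using K[rule_format, OF d] by blast
    obtain \<D> where D: "finite \<D>" "B \<subseteq> \<Union>\<D>" "\<forall>C\<in>\<D>. bounded C \<and> diameter C \<le> \<delta>"
       "(\<Sum>C\<in>\<D>. diameter C ^ (CARD('d) - 1)) \<le> L" using L[rule_format, OF d] by blast
    have "(\<Sum>C\<in>\<C> \<union> \<D>. diameter C ^ (CARD('d) - 1)) \<le> (\<Sum>C\<in>\<C>. diameter C ^ (CARD('d) - 1)) + (\<Sum>C\<in>\<D>. diameter C ^ (CARD('d) - 1))"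
    proof -
      have "0 \<le> (\<Sum>C\<in>\<C> \<inter> \<D>. diameter C ^ (CARD('d) - 1))"
        using C(3) by (intro sum_nonneg zero_le_power diameter_ge_0) blast
      then show ?thesis
        using sum.union_inter[OF C(1) D(1), of "\<lambda>C. diameter C ^ (CARD('d) - 1)"] by linarith
    qed
    then have "(\<Sum>C\<in>\<C> \<union> \<D>. diameter C ^ (CARD('d) - 1)) \<le> K + L" using C(4) D(4) by linarith
    then show "\<exists>\<C>. finite \<C> \<and> A \<union> B \<subseteq> \<Union>\<C> \<and>
     (\<forall>C\<in>\<C>. bounded C \<and> diameter C \<le> \<delta>) \<and> (\<Sum>C\<in>\<C>. diameter C ^ (CARD('d) - 1)) \<le> K + L"
      using C D by (intro exI[of _ "\<C> \<union> \<D>"]) blast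
  qed
qed

lemma finite_surface_covers_UN:
  assumes "finite I" "\<And>i. i \<in> I \<Longrightarrow> finite_surface_covers (A i)"
  shows "finite_surface_covers (\<Union>i\<in>I. A i)"
  using assms
proof (induction I)
  case empty
  show ?case unfolding finite_surface_covers_def
    by (intro exI[of _ 0] allI impI exI[of _ "{}"]) simp
qed (simp add: finite_surface_covers_Un)

lemma finite_surface_covers_subset:
  "finite_surface_covers B \<Longrightarrow> A \<subseteq> B \<Longrightarrow> finite_surface_covers A"
  unfolding finite_surface_covers_def by (meson order_trans)

lemma surface_premeasure_le:
  fixes A :: "(real^'d) set"
  assumes "finite \<C>" "A \<subseteq> \<Union>\<C>" "\<forall>C\<in>\<C>. bounded C \<and> diameter C \<le> \<delta>" "0 < \<delta>"
  shows "surface_premeasure \<delta> A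
    \<le> ennreal (unit_ball_vol (real (CARD('d) - 1)) * (\<Sum>C\<in>\<C>. diameter C ^ (CARD('d) - 1)))"
proof -
  let ?k = "CARD('d) - 1" and ?v = "unit_ball_vol (real (CARD('d) - 1))"
  let ?f = "\<lambda>C :: (real^'d) set. if C = {} then 0 else ennreal (?v * (diameter C / 2) ^ ?k)"
  obtain h where h: "bij_betw h {..<card \<C>} \<C>"
    using ex_bij_betw_nat_finite[OF assms(1)] by (auto simp: atLeast0LessThan)
  \<comment> \<open>The finite cover is padded with empty sets, which the premeasure counts as 0
    even when the exponent is 0.\<close>
  define C where "C n = (if n < card \<C> then h n else {})" for n
  have "A \<subseteq> (\<Union>n. C n)"
  proof
    fix x assume "x \<in> A"
    then obtain S where "S \<in> \<C>" "x \<in> S" using assms by blast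
    moreover obtain n where "n < card \<C>" "h n = S"
      using h \<open>S \<in> \<C>\<close> by (metis bij_betw_iff_bijections lessThan_iff)
    ultimately show "x \<in> (\<Union>n. C n)" by (auto simp: C_def intro!: exI[of _ n])
  qed
  moreover have "\<forall>n. bounded (C n) \<and> diameter (C n) \<le> \<delta>"
    using assms h by (auto simp: C_def dest: bij_betwE)
  ultimately have "surface_premeasure \<delta> A \<le> (\<Sum>n. ?f (C n))"
    unfolding surface_premeasure_def by (intro Inf_lower) blast
  also have "\<dots> = (\<Sum>n<card \<C>. ?f (C n))"
    by (rule suminf_finite) (auto simp: C_def)
  also have "\<dots> = (\<Sum>n<card \<C>. ?f (h n))"
    by (rule sum.cong) (auto simp: C_def)
  also have "\<dots> = (\<Sum>C\<in>\<C>. ?f C)" by (rule sum.reindex_bij_betw[OF h])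
  also have "\<dots> \<le> (\<Sum>C\<in>\<C>. ennreal (?v * diameter C ^ ?k))"
  proof (rule sum_mono)
    fix S assume S: "S \<in> \<C>"
    then have d: "0 \<le> diameter S" using assms by (auto intro: diameter_ge_0)
    then have "?v * (diameter S / 2) ^ ?k \<le> ?v * diameter S ^ ?k"
      by (intro mult_left_mono power_mono) auto
    then show "?f S \<le> ennreal (?v * diameter S ^ ?k)" by (simp add: ennreal_leI)
  qed
  also have "\<dots> = ennreal (\<Sum>C\<in>\<C>. ?v * diameter C ^ ?k)"
    using assms by (intro sum_ennreal) (auto intro!: mult_nonneg_nonneg zero_le_power diameter_ge_0)
  finally show ?thesis by (simp add: sum_distrib_left)
qed

text \<open>The graph is cut along a grid of mesh \<open>h\<close> in the hyperplane orthogonal to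
  \<open>e\<close>. There are of the order of \<open>(R / h) ^ (d - 1)\<close> cells, and the
  Lipschitz bound keeps their diameters below a multiple of \<open>h\<close>, so the sum of the
  powers is bounded independently of the mesh.\<close>

lemma finite_surface_covers_graph:
  fixes e x0 :: "real^'d" and \<gamma> :: "real^'d \<Rightarrow> real"
  assumes e: "norm e = 1" and lip: "L-lipschitz_on {z. z \<bullet> e = 0} \<gamma>" and r: "0 < r"
  shows "finite_surface_covers {y \<in> ball x0 r. y \<bullet> e = \<gamma> (y - (y \<bullet> e) *\<^sub>R e)}"
proof -
  let ?G = "{y \<in> ball x0 r. y \<bullet> e = \<gamma> (y - (y \<bullet> e) *\<^sub>R e)}" and ?k = "CARD('d) - 1"
  define P where "P y = y - (y \<bullet> e) *\<^sub>R e" for y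
  have ee: "e \<bullet> e = 1" using e by (simp add: norm_eq_1)
  have sub: "subspace {z. z \<bullet> e = 0}" by (simp add: subspace_def inner_add_left)
  obtain B where B: "B \<subseteq> {z. z \<bullet> e = 0}" "pairwise orthogonal B" "\<And>b. b \<in> B \<Longrightarrow> norm b = 1"
     "independent B" "card B = dim {z. z \<bullet> e = 0}" "span B = {z. z \<bullet> e = 0}"
    using orthonormal_basis_subspace[OF sub] by metis
  have cardB: "card B = ?k"
  proof -
    have "dim {z. e \<bullet> z = 0} = DIM(real^'d) - 1"
      by (rule dim_hyperplane) (use e in auto)
    then show ?thesis using B(5) by (simp add: inner_commute)
  qed
  have finB: "finite B" using B(4) independent_imp_finite by blast
  have P: "P y \<bullet> e = 0" for y by (simp add: P_def inner_diff_left ee)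
  have L0: "0 \<le> L" by (rule lipschitz_on_nonneg[OF lip])
  \<comment> \<open>If each of the d-1 orthonormal coordinates differs by at most \<open>h\<close>,
    the projections have distance at most \<open>(d - 1) * h\<close>; the factor
    \<open>1 + L\<close> adds the difference in height.\<close>
  define c where "c = (1 + L) * real ?k"
  have c0: "0 \<le> c" using L0 by (simp add: c_def)
  have key: "dist y y' \<le> c * h"
    if y: "y \<in> ?G" "y' \<in> ?G" and b: "\<And>b. b \<in> B \<Longrightarrow> \<bar>(y - y') \<bullet> b\<bar> \<le> h" for y y' h
  proof -
    have "P y - P y' \<in> span B" using B(6) P by (simp add: inner_diff_left)
    then have "(\<Sum>b\<in>B. ((P y - P y') \<bullet> b) *\<^sub>R b) = P y - P y'"
      using orthonormal_basis_expand[OF B(2) B(3) _ finB] by blast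
    then have "norm (P y - P y') \<le> (\<Sum>b\<in>B. norm (((P y - P y') \<bullet> b) *\<^sub>R b))"
      by (metis norm_sum)
    also have "\<dots> \<le> (\<Sum>b\<in>B. h)"
    proof (rule sum_mono)
      fix b assume bB: "b \<in> B"
      then have "b \<bullet> e = 0" using B(1) by blast
      then have "(P y - P y') \<bullet> b = (y - y') \<bullet> b"
        by (simp add: P_def inner_diff_left inner_commute[of e b])
      then show "norm (((P y - P y') \<bullet> b) *\<^sub>R b) \<le> h"
        using b[OF bB] B(3)[OF bB] by simp
    qed
    finally have n1: "norm (P y - P y') \<le> real ?k * h" by (simp add: cardB)
    have "\<bar>y \<bullet> e - y' \<bullet> e\<bar> \<le> L * norm (P y - P y')"
    proof -
      have "\<bar>\<gamma> (P y) - \<gamma> (P y')\<bar> \<le> L * norm (P y - P y')"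
        using lipschitz_onD[OF lip, of "P y" "P y'"] P by (simp add: dist_norm)
      moreover have "y \<bullet> e = \<gamma> (P y)" "y' \<bullet> e = \<gamma> (P y')" using y by (auto simp: P_def)
      ultimately show ?thesis by simp
    qed
    moreover have "y - y' = (P y - P y') + (y \<bullet> e - y' \<bullet> e) *\<^sub>R e"
      by (simp add: P_def algebra_simps)
    then have "norm (y - y') \<le> norm (P y - P y') + \<bar>y \<bullet> e - y' \<bullet> e\<bar>"
      using norm_triangle_ineq[of "P y - P y'" "(y \<bullet> e - y' \<bullet> e) *\<^sub>R e"] e by simp
    ultimately have "norm (y - y') \<le> (1 + L) * norm (P y - P y')" by (simp add: algebra_simps)
    also have "\<dots> \<le> (1 + L) * (real ?k * h)" using n1 L0 by (intro mult_left_mono) auto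
    finally show ?thesis by (simp add: dist_norm c_def mult.assoc)
  qed
  define R where "R = norm x0 + r"
  have R: "R > 0" using r by (simp add: R_def add_nonneg_pos)
  have bR: "\<bar>y \<bullet> b\<bar> \<le> R" if "y \<in> ?G" "b \<in> B" for y b
  proof -
    have "norm y \<le> R" using that(1) norm_triangle_ineq2[of y x0] by (auto simp: R_def dist_norm norm_minus_commute)
    moreover have "\<bar>y \<bullet> b\<bar> \<le> norm y * norm b" by (rule Cauchy_Schwarz_ineq2)
    ultimately show ?thesis using B(3)[OF that(2)] by simp
  qed
  show ?thesis
    unfolding finite_surface_covers_def
  \<comment> \<open>Each coordinate has \<open>2 * n + 1 \<le> 3 * n\<close> grid positions, and
    each cell has diameter at most \<open>c * R / n\<close>; in the product \<open>n\<close>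
    cancels.\<close>
  proof (intro exI[of _ "(3 * c * R) ^ ?k"] allI impI)
    fix \<delta> :: real assume d: "\<delta> > 0"
    \<comment> \<open>The summand 1 keeps \<open>n\<close> positive when \<open>c = 0\<close>, that
      is in dimension one.\<close>
    obtain n :: nat where n: "c * R / \<delta> + 1 < real n" using reals_Archimedean2 by blast
    have n0: "0 < n" using n c0 R d by (metis add_nonneg_pos divide_nonneg_pos less_trans mult_nonneg_nonneg of_nat_0_less_iff zero_less_one less_imp_le)
    define h where "h = R / real n"
    have h: "0 < h" "c * h \<le> \<delta>"
    proof -
      show "0 < h" using R n0 by (simp add: h_def)
      have "c * R < real n * \<delta>" using n d by (simp add: field_simps)
      then show "c * h \<le> \<delta>" using n0 by (simp add: h_def field_simps)
    qed
    define J where "J = (B \<rightarrow>\<^sub>E {- int n..int n})"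
    define cell where "cell j = {y \<in> ?G. \<forall>b\<in>B. \<lfloor>(y \<bullet> b) / h\<rfloor> = j b}" for j
    have fJ: "finite J" unfolding J_def by (rule finite_PiE) (use finB in auto)
    have cJ: "card J = (2 * n + 1) ^ ?k"
      unfolding J_def by (subst card_PiE[OF finB]) (simp add: cardB nat_add_distrib nat_mult_distrib)
    have bd: "bounded (cell j)" for j
      by (rule bounded_subset[of "ball x0 r"]) (auto simp: cell_def)
    have di: "diameter (cell j) \<le> c * h" for j
    proof (rule diameter_le)
      show "cell j \<noteq> {} \<or> 0 \<le> c * h" using c0 h by simp
      fix y y' assume y: "y \<in> cell j" "y' \<in> cell j"
      have "\<bar>(y - y') \<bullet> b\<bar> \<le> h" if "b \<in> B" for b
      proof -
        have "\<lfloor>(y \<bullet> b) / h\<rfloor> = \<lfloor>(y' \<bullet> b) / h\<rfloor>" using y that by (simp add: cell_def)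
        then have "\<bar>(y \<bullet> b) / h - (y' \<bullet> b) / h\<bar> \<le> 1" by linarith
        then have "\<bar>(y \<bullet> b) - (y' \<bullet> b)\<bar> / h \<le> 1" using h by (simp add: diff_divide_distrib[symmetric])
        then show ?thesis using h by (simp add: inner_diff_left field_simps)
      qed
      then show "norm (y - y') \<le> c * h" using key[of y y' h] y by (simp add: cell_def dist_norm)
    qed
    have "?G \<subseteq> \<Union>(cell ` J)"
    proof
      fix y assume y: "y \<in> ?G"
      define j where "j = restrict (\<lambda>b. \<lfloor>(y \<bullet> b) / h\<rfloor>) B"
      have "\<lfloor>(y \<bullet> b) / h\<rfloor> \<in> {- int n..int n}" if "b \<in> B" for b
      proof -
        have "\<bar>(y \<bullet> b) / h\<bar> \<le> R / h" using bR[OF y that] h by (simp add: divide_right_mono)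
        also have "R / h = real n" using R n0 by (simp add: h_def)
        finally have "- real n \<le> (y \<bullet> b) / h" "(y \<bullet> b) / h \<le> real n" by linarith+
        then show ?thesis by (auto simp: le_floor_iff floor_le_iff)
      qed
      then have "j \<in> J" by (auto simp: J_def j_def)
      moreover have "y \<in> cell j" using y by (simp add: cell_def j_def)
      ultimately show "y \<in> \<Union>(cell ` J)" by blast
    qed
    moreover have "(\<Sum>C\<in>cell ` J. diameter C ^ ?k) \<le> (3 * c * R) ^ ?k"
    proof -
      have "(\<Sum>C\<in>cell ` J. diameter C ^ ?k) \<le> (\<Sum>j\<in>J. diameter (cell j) ^ ?k)"
        using sum_image_le[OF fJ, of "\<lambda>C. diameter C ^ ?k" cell] bd
        by (simp add: diameter_ge_0)
      also have "\<dots> \<le> (\<Sum>j\<in>J. (c * h) ^ ?k)"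
        by (intro sum_mono power_mono di diameter_ge_0 bd)
      also have "\<dots> = ((2 * real n + 1) * (c * h)) ^ ?k"
        by (simp add: cJ power_mult_distrib add.commute[of 1])
      also have "\<dots> \<le> ((3 * real n) * (c * h)) ^ ?k"
        using n0 c0 h by (intro power_mono mult_right_mono mult_nonneg_nonneg) auto
      also have "(3 * real n) * (c * h) = 3 * c * R" using n0 by (simp add: h_def)
      finally show ?thesis .
    qed
    ultimately show "\<exists>\<C>. finite \<C> \<and> ?G \<subseteq> \<Union>\<C> \<and>
     (\<forall>C\<in>\<C>. bounded C \<and> diameter C \<le> \<delta>) \<and> (\<Sum>C\<in>\<C>. diameter C ^ ?k) \<le> (3 * c * R) ^ ?k"
      using fJ bd order_trans[OF di h(2)] by (intro exI[of _ "cell ` J"]) blast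
  qed
qed

text \<open>A frontier point is not in the open set, hence not above the graph. Strictly below the
  graph, continuity of \<open>F\<close> gives a neighbourhood free of the set, so the point could
  not lie in the closure.\<close>

lemma frontier_subset_graph:
  fixes \<Omega> :: "'a::euclidean_space set"
  assumes "open \<Omega>" and e: "norm e = 1" and lip: "L-lipschitz_on {z. z \<bullet> e = 0} \<gamma>"
    and eq: "\<Omega> \<inter> ball x0 r = {y \<in> ball x0 r. y \<bullet> e > \<gamma> (y - (y \<bullet> e) *\<^sub>R e)}"
  shows "frontier \<Omega> \<inter> ball x0 r \<subseteq> {y \<in> ball x0 r. y \<bullet> e = \<gamma> (y - (y \<bullet> e) *\<^sub>R e)}"
proof
  fix y assume y: "y \<in> frontier \<Omega> \<inter> ball x0 r"
  define F where "F y = y \<bullet> e - \<gamma> (y - (y \<bullet> e) *\<^sub>R e)" for y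
  have ee: "e \<bullet> e = 1" using e by (simp add: norm_eq_1)
  have "continuous_on {z. z \<bullet> e = 0} \<gamma>" by (rule lipschitz_on_continuous_on[OF lip])
  then have "continuous_on UNIV (\<lambda>y. \<gamma> (y - (y \<bullet> e) *\<^sub>R e))"
    by (rule continuous_on_compose2) (auto intro!: continuous_intros simp: inner_diff_left ee)
  then have F: "continuous_on UNIV F" unfolding F_def by (intro continuous_intros)
  have "y \<notin> \<Omega>" using y assms(1) by (simp add: frontier_def interior_open)
  then have "\<not> y \<bullet> e > \<gamma> (y - (y \<bullet> e) *\<^sub>R e)" using y eq by blast
  then have "F y \<le> 0" by (simp add: F_def)
  moreover have "F y \<ge> 0"
  proof (rule ccontr)
    assume "\<not> F y \<ge> 0"
    then have "y \<in> {y. F y < 0} \<inter> ball x0 r" using y by auto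
    moreover have "open ({y. F y < 0} \<inter> ball x0 r)"
      using F by (intro open_Int open_Collect_less) auto
    moreover have "y \<in> closure \<Omega>" using y by (simp add: frontier_def)
    ultimately obtain z where "z \<in> \<Omega>" "z \<in> {y. F y < 0} \<inter> ball x0 r"
      using closure_iff_nhds_not_empty by (metis disjoint_iff open_Int_closure_eq_empty)
    moreover have "z \<in> ball x0 r \<Longrightarrow> z \<in> \<Omega> \<Longrightarrow> z \<bullet> e > \<gamma> (z - (z \<bullet> e) *\<^sub>R e)" using eq by blast
    ultimately show False by (auto simp: F_def)
  qed
  ultimately show "y \<in> {y \<in> ball x0 r. y \<bullet> e = \<gamma> (y - (y \<bullet> e) *\<^sub>R e)}"
    using y by (auto simp: F_def)
qed

text \<open>Finiteness is what makes the trace seminorms meaningful: a smooth function that is not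
  \<open>p\<close>-integrable on the boundary would have the junk norm \<open>0\<close> there.\<close>

lemma finite_boundary_measure:
  fixes \<Omega> :: "(real^'d) set"
  assumes "bounded_lipschitz_domain \<Omega>"
  shows "finite_measure (boundary_measure \<Omega>)"
proof -
  have op: "open \<Omega>" and bd: "bounded \<Omega>" and lip: "lipschitz_boundary \<Omega>"
    using assms by (auto simp: bounded_lipschitz_domain_def)
  have ex: "\<exists>r>0. finite_surface_covers (frontier \<Omega> \<inter> ball x r)" if "x \<in> frontier \<Omega>" for x
  proof -
    from bspec[OF lip[unfolded lipschitz_boundary_def] that]
    obtain e r L \<gamma> where "norm e = 1" "r > 0" "L-lipschitz_on {z. z \<bullet> e = 0} \<gamma>"
       "\<Omega> \<inter> ball x r = {y \<in> ball x r. y \<bullet> e > \<gamma> (y - (y \<bullet> e) *\<^sub>R e)}" by blast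
    with frontier_subset_graph[OF op, of e L \<gamma> x r] finite_surface_covers_graph[of e L \<gamma> r x]
    show ?thesis using finite_surface_covers_subset by blast
  qed
  then obtain r where r: "\<And>x. x \<in> frontier \<Omega> \<Longrightarrow> r x > 0 \<and> finite_surface_covers (frontier \<Omega> \<inter> ball x (r x))"
    by metis
  have "compact (frontier \<Omega>)" using bd by (simp add: compact_frontier_bounded)
  then obtain I where I: "I \<subseteq> frontier \<Omega>" "finite I" "frontier \<Omega> \<subseteq> (\<Union>x\<in>I. ball x (r x))"
    by (rule compactE_image[of _ "frontier \<Omega>" "\<lambda>x. ball x (r x)"]) (use r in force)+
  have "finite_surface_covers (\<Union>x\<in>I. frontier \<Omega> \<inter> ball x (r x))"
    using I r by (intro finite_surface_covers_UN) auto
  then have "finite_surface_covers (frontier \<Omega>)"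
    by (rule finite_surface_covers_subset) (use I in blast)
  then obtain K where K: "\<forall>\<delta>>0. \<exists>\<C>. finite \<C> \<and> frontier \<Omega> \<subseteq> \<Union>\<C> \<and>
     (\<forall>C\<in>\<C>. bounded C \<and> diameter C \<le> \<delta>) \<and> (\<Sum>C\<in>\<C>. diameter C ^ (CARD('d) - 1)) \<le> K"
    unfolding finite_surface_covers_def by blast
  let ?v = "unit_ball_vol (real (CARD('d) - 1))"
  have "surface_premeasure \<delta> (frontier \<Omega>) \<le> ennreal (?v * K)" if d: "\<delta> > 0" for \<delta>
  proof -
    obtain \<C> where C: "finite \<C>" "frontier \<Omega> \<subseteq> \<Union>\<C>" "\<forall>C\<in>\<C>. bounded C \<and> diameter C \<le> \<delta>"
       "(\<Sum>C\<in>\<C>. diameter C ^ (CARD('d) - 1)) \<le> K" using K[rule_format, OF d] by blast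
    have "surface_premeasure \<delta> (frontier \<Omega>) \<le> ennreal (?v * (\<Sum>C\<in>\<C>. diameter C ^ (CARD('d) - 1)))"
      by (rule surface_premeasure_le[OF C(1-3) d])
    also have "\<dots> \<le> ennreal (?v * K)" using C(4) by (intro ennreal_leI mult_left_mono) auto
    finally show ?thesis .
  qed
  then have le: "(SUP \<delta>\<in>{0<..}. surface_premeasure \<delta> (frontier \<Omega>)) \<le> ennreal (?v * K)"
    by (intro SUP_least) auto
  \<comment> \<open>\<open>emeasure_measure_of_conv\<close> returns either the outer measure or 0,
    and both obey the bound.\<close>
  have "emeasure surface_measure (frontier \<Omega>) \<le> ennreal (?v * K)"
    unfolding surface_measure_def emeasure_measure_of_conv using le by simp
  then have "emeasure surface_measure (frontier \<Omega>) < \<infinity>"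
    using ennreal_less_top le_less_trans by (metis infinity_ennreal_def)
  moreover have "frontier \<Omega> \<in> sets surface_measure"
    by (simp add: surface_measure_def sets.sigma_sets_eq[where M=borel, simplified])
  moreover have "space surface_measure = UNIV" by (simp add: surface_measure_def)
  ultimately show ?thesis
    by (intro finite_measureI) (simp add: space_restrict_space emeasure_restrict_space)
qed

section \<open>Strongly measurable functions\<close>

abbreviation cut :: "real set \<Rightarrow> (real \<Rightarrow> 'a \<Rightarrow> 'b::zero) \<Rightarrow> real \<Rightarrow> 'a \<Rightarrow> 'b" where
  "cut S f t \<equiv> (if t \<in> S then f t else (\<lambda>_. 0))"

definition borel_simple :: "'a set \<Rightarrow> (real \<Rightarrow> 'a) \<Rightarrow> bool" where
  "borel_simple X s \<longleftrightarrow> finite (range s) \<and> range s \<subseteq> X \<and> s \<in> borel \<rightarrow>\<^sub>M count_space UNIV"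

text \<open>Convergence is required at every time; a strongly measurable function becomes such a limit
  after being set to \<open>0\<close> outside a suitable Borel set of full measure.\<close>

definition borel_limit :: "('a \<Rightarrow> 'b::minus) set \<Rightarrow> (('a \<Rightarrow> 'b) \<Rightarrow> real) \<Rightarrow> (real \<Rightarrow> 'a \<Rightarrow> 'b) \<Rightarrow> bool" where
  "borel_limit X N F \<longleftrightarrow> (\<forall>t. F t \<in> X) \<and>
     (\<exists>s. (\<forall>n. borel_simple X (s n)) \<and> (\<forall>t. (\<lambda>n. N (s n t - F t)) \<longlonglongrightarrow> 0))"

lemma borel_simpleI:
  assumes "finite (range s)" "range s \<subseteq> X" "\<And>y. s -` {y} \<in> sets borel"
  shows "borel_simple X s"
proof -
  have "s -` A \<in> sets borel" for A
  proof -
    have "s -` A = (\<Union>y\<in>A \<inter> range s. s -` {y})" by auto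
    also have "\<dots> \<in> sets borel" using assms by (intro sets.finite_UN) auto
    finally show ?thesis .
  qed
  then show ?thesis using assms by (auto simp: borel_simple_def measurable_def)
qed

lemma borel_simple_vimage: "borel_simple X s \<Longrightarrow> s -` A \<in> sets borel"
  using measurable_sets[of s borel "count_space UNIV" A] by (auto simp: borel_simple_def)

text \<open>The condition may depend on time and on the current value, and only its measurability in
  time for each of the finitely many values matters. This covers both truncation by the norm and
  cutting to a Borel set of times.\<close>

lemma borel_simple_if:
  assumes s: "borel_simple X s" and r: "borel_simple X r" and P: "\<And>y. y \<in> range s \<Longrightarrow> {t. P y t} \<in> sets borel"
  shows "borel_simple X (\<lambda>t. if P (s t) t then s t else r t)"
proof (rule borel_simpleI)
  let ?s = "\<lambda>t. if P (s t) t then s t else r t"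
  have sub: "range ?s \<subseteq> range s \<union> range r" by auto
  show "finite (range ?s)" by (rule finite_subset[OF sub]) (use s r in \<open>simp add: borel_simple_def\<close>)
  show "range ?s \<subseteq> X" using sub s r by (auto simp: borel_simple_def)
  fix y
  define A where "A = (\<Union>z\<in>range s. s -` {z} \<inter> {t. P z t})"
  have "A \<in> sets borel"
    unfolding A_def using s borel_simple_vimage[OF s] P
    by (intro sets.finite_UN sets.Int) (auto simp: borel_simple_def)
  moreover have "?s -` {y} = (s -` {y} \<inter> A) \<union> (r -` {y} - A)" by (auto simp: A_def)
  ultimately show "?s -` {y} \<in> sets borel"
    using borel_simple_vimage[OF s] borel_simple_vimage[OF r] by auto
qed

lemma borel_simple_const: "c \<in> X \<Longrightarrow> borel_simple X (\<lambda>_. c)"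
  by (auto simp: borel_simple_def)

text \<open>Trades an almost everywhere statement for a pointwise one on a Borel set of full
  measure; exceptional times are handled in this form throughout.\<close>

lemma AE_lebesgue_on_borel_set:
  assumes J: "J \<in> sets borel" and "AE t in lebesgue_on J. P t"
  obtains S :: "'a::euclidean_space set" where "S \<in> sets borel" "S \<subseteq> J" "AE t in lborel. t \<in> J \<longrightarrow> t \<in> S" "\<And>t. t \<in> S \<Longrightarrow> P t"
proof -
  have "AE t in lebesgue. t \<in> J \<longrightarrow> P t"
    using assms by (simp add: AE_restrict_space_iff)
  then have "AE t in lborel. t \<in> J \<longrightarrow> P t" by (simp add: AE_completion_iff)
  then obtain M where M: "{t \<in> space lborel. \<not> (t \<in> J \<longrightarrow> P t)} \<subseteq> M" "M \<in> null_sets lborel"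
    by (auto simp: eventually_ae_filter)
  have "AE t in lborel. t \<notin> M" by (rule AE_not_in[OF M(2)])
  then have "AE t in lborel. t \<in> J \<longrightarrow> t \<in> J - M" by eventually_elim auto
  moreover have "J - M \<in> sets borel" using J M(2) null_setsD2[OF M(2)] by auto
  moreover have "P t" if "t \<in> J - M" for t using that M(1) by auto
  ultimately show ?thesis using that[of "J - M"] by blast
qed

section \<open>Measurability and approximation of Bochner functions\<close>

context seminormed
begin

lemma borel_limit_memD: "borel_limit X N F \<Longrightarrow> F t \<in> X"
  by (simp add: borel_limit_def)

text \<open>No measurable structure is placed on \<open>X\<close>. The approximants take finitely
  many values, so any function of them is measurable, and the norm of the limit is a pointwise limit
  of such functions.\<close>

lemma borel_limit_norm_diff:
  assumes F: "borel_limit X N F" and w: "borel_simple X w"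
  shows "(\<lambda>t. N (F t - w t)) \<in> borel_measurable borel"
proof -
  obtain s where s: "\<And>n. borel_simple X (s n)" "\<And>t. (\<lambda>n. N (s n t - F t)) \<longlonglongrightarrow> 0"
    using F by (auto simp: borel_limit_def)
  have sX: "s n t \<in> X" "w t \<in> X" "F t \<in> X" for n t
    using s(1)[of n] w F by (auto simp: borel_simple_def borel_limit_def)
  show ?thesis
  proof (rule borel_measurable_LIMSEQ_real)
    fix t
    have "(s n t - w t) - (F t - w t) = s n t - F t" for n by auto
    then show "(\<lambda>n. N (s n t - w t)) \<longlonglongrightarrow> N (F t - w t)"
      using s(2)[of t] by (intro N_tendsto diff_mem sX) simp
  next
    fix n
    have "(\<lambda>t. (s n t, w t)) \<in> borel \<rightarrow>\<^sub>M count_space (range (s n) \<times> range w)"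
    proof (rule measurableI)
      fix A assume "A \<in> sets (count_space (range (s n) \<times> range w))"
      then have A: "A \<subseteq> range (s n) \<times> range w" by simp
      then have fin: "finite A"
        using s(1)[of n] w by (auto intro: finite_subset simp: borel_simple_def)
      have "(\<lambda>t. (s n t, w t)) -` A \<inter> space borel = (\<Union>(y, z)\<in>A. s n -` {y} \<inter> w -` {z})" by auto
      also have "\<dots> \<in> sets borel"
        using fin borel_simple_vimage[OF s(1)] borel_simple_vimage[OF w] by (intro sets.finite_UN) auto
      finally show "(\<lambda>t. (s n t, w t)) -` A \<inter> space borel \<in> sets borel" .
    qed simp
    from measurable_compose[OF this, of "\<lambda>(y, z). N (y - z)" borel]
    show "(\<lambda>t. N (s n t - w t)) \<in> borel_measurable borel" by simp
  qed
qed

lemma borel_limit_norm: "borel_limit X N F \<Longrightarrow> (\<lambda>t. N (F t)) \<in> borel_measurable borel"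
  using borel_limit_norm_diff[OF _ borel_simple_const[OF zero_mem], of F] by (simp add: fun_diff_def)

lemma pairing_tendsto:
  assumes "\<And>n. s' n \<in> dual_space X N" "\<xi> \<in> dual_space X N" "(\<lambda>n. dual_norm X N (s' n - \<xi>)) \<longlonglongrightarrow> 0"
    and "\<And>n. s n \<in> X" "v \<in> X" "(\<lambda>n. N (s n - v)) \<longlonglongrightarrow> 0"
  shows "(\<lambda>n. s' n (s n)) \<longlonglongrightarrow> \<xi> v"
proof -
  interpret D: seminormed "dual_space X N" "dual_norm X N" by (rule seminormed_dual)
  have "(\<lambda>n. dual_norm X N (s' n - \<xi>) * N (s n) + dual_norm X N \<xi> * N (s n - v)) \<longlonglongrightarrow> 0 * N v + dual_norm X N \<xi> * 0"
    by (intro tendsto_intros N_tendsto assms)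
  moreover have "norm (s' n (s n) - \<xi> v) \<le> dual_norm X N (s' n - \<xi>) * N (s n) + dual_norm X N \<xi> * N (s n - v)" for n
  proof -
    have "s' n (s n) - \<xi> v = (s' n - \<xi>) (s n) + \<xi> (s n - v)"
      using dual_diff[OF assms(2) assms(4)[of n] assms(5)] by simp
    also have "\<bar>\<dots>\<bar> \<le> \<bar>(s' n - \<xi>) (s n)\<bar> + \<bar>\<xi> (s n - v)\<bar>" by (rule abs_triangle_ineq)
    also have "\<dots> \<le> dual_norm X N (s' n - \<xi>) * N (s n) + dual_norm X N \<xi> * N (s n - v)"
      by (intro add_mono dual_norm_bound D.diff_mem diff_mem assms)
    finally show ?thesis by simp
  qed
  ultimately have "(\<lambda>n. s' n (s n) - \<xi> v) \<longlonglongrightarrow> 0"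
    by (intro Lim_null_comparison[of "\<lambda>n. s' n (s n) - \<xi> v"]) auto
  then show ?thesis by (simp add: LIM_zero_iff)
qed

lemma borel_limit_pairing:
  assumes F: "borel_limit X N F" and F': "borel_limit (dual_space X N) (dual_norm X N) F'"
  shows "(\<lambda>(r, t). F' r (F t)) \<in> borel_measurable (borel \<Otimes>\<^sub>M borel)"
proof -
  interpret D: seminormed "dual_space X N" "dual_norm X N" by (rule seminormed_dual)
  obtain s where s: "\<And>n. borel_simple X (s n)" "\<And>t. (\<lambda>n. N (s n t - F t)) \<longlonglongrightarrow> 0"
    using F by (auto simp: borel_limit_def)
  obtain s' where s': "\<And>n. borel_simple (dual_space X N) (s' n)"
      "\<And>t. (\<lambda>n. dual_norm X N (s' n t - F' t)) \<longlonglongrightarrow> 0"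
    using F' by (auto simp: borel_limit_def)
  show ?thesis
  proof (rule borel_measurable_LIMSEQ_real)
    fix x :: "real \<times> real"
    obtain r t where x: "x = (r, t)" by fastforce
    have "(\<lambda>n. s' n r (s n t)) \<longlonglongrightarrow> F' r (F t)"
    proof (rule pairing_tendsto)
      show "s' n r \<in> dual_space X N" "s n t \<in> X" for n
        using s(1)[of n] s'(1)[of n] by (auto simp: borel_simple_def)
    qed (use s(2) s'(2) borel_limit_memD[OF F] D.borel_limit_memD[OF F'] in auto)
    then show "(\<lambda>n. (case x of (r, t) \<Rightarrow> s' n r (s n t))) \<longlonglongrightarrow> (case x of (r, t) \<Rightarrow> F' r (F t))"
      by (simp add: x)
  next
    fix n
    have "(\<lambda>x. (s' n (fst x), s n (snd x))) \<in> borel \<Otimes>\<^sub>M borel \<rightarrow>\<^sub>M count_space (range (s' n) \<times> range (s n))"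
    proof (rule measurableI)
      fix A assume "A \<in> sets (count_space (range (s' n) \<times> range (s n)))"
      then have A: "A \<subseteq> range (s' n) \<times> range (s n)" by simp
      then have fin: "finite A"
        using s(1)[of n] s'(1)[of n] by (auto intro: finite_subset simp: borel_simple_def)
      have "(\<lambda>x. (s' n (fst x), s n (snd x))) -` A \<inter> space (borel \<Otimes>\<^sub>M borel) =
          (\<Union>(y, z)\<in>A. s' n -` {y} \<times> s n -` {z})" by (auto simp: space_pair_measure)
      also have "\<dots> \<in> sets (borel \<Otimes>\<^sub>M borel)"
        using fin borel_simple_vimage[OF s(1)] borel_simple_vimage[OF s'(1)] by (intro sets.finite_UN) auto
      finally show "(\<lambda>x. (s' n (fst x), s n (snd x))) -` A \<inter> space (borel \<Otimes>\<^sub>M borel) \<in> sets (borel \<Otimes>\<^sub>M borel)" .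
    qed auto
    from measurable_compose[OF this, of "\<lambda>(y, z). y z" borel]
    show "(\<lambda>(r, t). s' n r (s n t)) \<in> borel_measurable (borel \<Otimes>\<^sub>M borel)"
      by (simp add: split_beta)
  qed
qed

lemma borel_limit_const: "v \<in> X \<Longrightarrow> borel_limit X N (\<lambda>_. v)"
  using N_zero by (auto simp: borel_limit_def fun_diff_def intro!: exI[of _ "\<lambda>_ _. v"] borel_simple_const)

lemma borel_limit_pairing_diag:
  assumes F: "borel_limit X N F" and F': "borel_limit (dual_space X N) (dual_norm X N) F'"
  shows "(\<lambda>t. F' t (F t)) \<in> borel_measurable borel"
  using measurable_compose[OF _ borel_limit_pairing[OF assms], of "\<lambda>t. (t, t)" borel] by simp

lemma borel_limit_cut:
  assumes F: "borel_limit X N F" and S: "S \<in> sets borel"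
  shows "borel_limit X N (cut S F)"
proof -
  obtain s where s: "\<And>n. borel_simple X (s n)" "\<And>t. (\<lambda>n. N (s n t - F t)) \<longlonglongrightarrow> 0"
    using F by (auto simp: borel_limit_def)
  have "borel_simple X (cut S (s n))" for n
    using borel_simple_if[OF s(1) borel_simple_const[OF zero_mem], of n "\<lambda>y t. t \<in> S"] S by simp
  moreover have "(\<lambda>n. N (cut S (s n) t - cut S F t)) \<longlonglongrightarrow> 0" for t
    using s(2)[of t] N_zero by (auto simp: fun_diff_def)
  ultimately show ?thesis
    unfolding borel_limit_def using borel_limit_memD[OF F] zero_mem
    by (intro conjI exI[of _ "\<lambda>n. cut S (s n)"]) auto
qed

lemma borel_limit_simple_approx:
  assumes F: "borel_limit X N F" and p: "0 < p" and int: "integrable lborel (\<lambda>t. N (F t) powr p)" and e: "0 < e"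
  obtains s where "borel_simple X s" "integrable lborel (\<lambda>t. N (F t - s t) powr p)"
    "(LINT t|lborel. N (F t - s t) powr p) < e"
proof -
  obtain s where s: "\<And>n. borel_simple X (s n)" "\<And>t. (\<lambda>n. N (s n t - F t)) \<longlonglongrightarrow> 0"
    using F by (auto simp: borel_limit_def)
  note FX = borel_limit_memD[OF F]
  have sX: "s n t \<in> X" for n t using s(1)[of n] by (auto simp: borel_simple_def)
  \<comment> \<open>Truncation at twice the norm supplies the majorant \<open>3 * N (F t)\<close>,
    and where \<open>N (F t) > 0\<close> it eventually changes nothing.\<close>
  define r where "r n t = (if N (s n t) \<le> 2 * N (F t) then s n t else (\<lambda>_. 0))" for n t
  have r: "borel_simple X (r n)" for n
    unfolding r_def using borel_limit_norm[OF F]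
    by (intro borel_simple_if[where P = "\<lambda>y t. N y \<le> 2 * N (F t)"] s(1) borel_simple_const zero_mem) auto
  have rX: "r n t \<in> X" for n t using sX zero_mem by (simp add: r_def)
  have bound: "N (F t - r n t) \<le> 3 * N (F t)" for n t
    using N_diff_le[OF FX rX, of t n t] N_zero nonneg[OF FX[of t]] by (auto simp: r_def split: if_splits)
  have lim: "(\<lambda>n. N (F t - r n t)) \<longlonglongrightarrow> 0" for t
  proof (cases "N (F t) = 0")
    case True
    then have "N (F t - r n t) = 0" for n using bound[of t n] nonneg[OF diff_mem[OF FX rX], of t n t] by simp
    then show ?thesis by simp
  next
    case False
    then have pos: "N (F t) > 0" using nonneg[OF FX[of t]] by simp
    have "(\<lambda>n. N (s n t)) \<longlonglongrightarrow> N (F t)" by (intro N_tendsto sX FX s(2))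
    then have "\<forall>\<^sub>F n in sequentially. N (s n t) < 2 * N (F t)"
      using pos by (intro order_tendstoD) auto
    then have "\<forall>\<^sub>F n in sequentially. N (s n t - F t) = N (F t - r n t)"
      by eventually_elim (use N_minus_commute[OF sX FX] in \<open>simp add: r_def\<close>)
    then show ?thesis using s(2)[of t] by (rule Lim_transform_eventually[rotated])
  qed
  have meas: "(\<lambda>t. N (F t - r n t) powr p) \<in> borel_measurable borel" for n
    using borel_limit_norm_diff[OF F r] by measurable
  have nn: "0 \<le> N (F t - r n t)" for t n by (rule nonneg[OF diff_mem[OF FX rX]])
  have bound': "N (F t - r n t) powr p \<le> 3 powr p * N (F t) powr p" for n t
    using powr_mono2[OF less_imp_le[OF p] nn bound[of t n]] nonneg[OF FX[of t]] by (simp add: powr_mult)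
  have int': "integrable lborel (\<lambda>t. N (F t - r n t) powr p)" for n
    by (rule Bochner_Integration.integrable_bound[of _ "\<lambda>t. 3 powr p * N (F t) powr p"])
      (use int meas bound' in auto)
  have "(\<lambda>n. LINT t|lborel. N (F t - r n t) powr p) \<longlonglongrightarrow> (LINT t|(lborel :: real measure). (0::real))"
  proof (rule integral_dominated_convergence[where w = "\<lambda>t. 3 powr p * N (F t) powr p"])
    show "AE t in lborel. (\<lambda>n. N (F t - r n t) powr p) \<longlonglongrightarrow> 0"
      using tendsto_powr'[OF lim tendsto_const, of p] p nn by (intro AE_I2) simp
  qed (use int meas bound' in auto)
  then have "\<forall>\<^sub>F n in sequentially. (LINT t|lborel. N (F t - r n t) powr p) < e"
    using e by (intro order_tendstoD) auto
  then obtain n where "(LINT t|lborel. N (F t - r n t) powr p) < e"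
    using eventually_happens sequentially_bot by blast
  then show ?thesis using that[OF r int'] by blast
qed

text \<open>The level sets of the approximants are only Lebesgue sets. There are finitely many of
  them for each \<open>n\<close>, so removing one Borel null set makes all of them Borel; the set
  where convergence fails is removed as well.\<close>

lemma strongly_measurable_borel_limit:
  assumes J: "J \<in> sets borel" and fX: "AE t in lebesgue_on J. f t \<in> X" and sm: "strongly_measurable J X N f"
  obtains S where "S \<in> sets borel" "S \<subseteq> J" "AE t in lborel. t \<in> J \<longrightarrow> t \<in> S" "\<And>t. t \<in> S \<Longrightarrow> f t \<in> X"
    "borel_limit X N (cut S f)"
proof -
  obtain s where s: "\<And>n. finite (s n ` J)" "\<And>n. s n ` J \<subseteq> X" "\<And>n y. {t \<in> J. s n t = y} \<in> sets lebesgue"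
     "AE t in lebesgue_on J. (\<lambda>n. N (s n t - f t)) \<longlonglongrightarrow> 0"
    using sm unfolding strongly_measurable_def by blast
  obtain S0 where S0: "S0 \<in> sets borel" "S0 \<subseteq> J" "AE t in lborel. t \<in> J \<longrightarrow> t \<in> S0"
     "\<And>t. t \<in> S0 \<Longrightarrow> f t \<in> X \<and> (\<lambda>n. N (s n t - f t)) \<longlonglongrightarrow> 0"
    by (rule AE_lebesgue_on_borel_set[OF J AE_conjI[OF fX s(4)]]) blast
  have "\<exists>B M. B \<in> sets borel \<and> M \<in> null_sets lborel \<and> (\<forall>t. t \<notin> M \<longrightarrow> (t \<in> J \<and> s n t = y \<longleftrightarrow> t \<in> B))" for n y
  proof -
    obtain B Z Z' where "{t \<in> J. s n t = y} = B \<union> Z" "Z \<subseteq> Z'" "Z' \<in> null_sets lborel" "B \<in> sets lborel"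
      by (rule sets_completionE[OF s(3)[of n y]]) blast
    then show ?thesis by (intro exI[of _ B] exI[of _ Z']) auto
  qed
  then obtain B M where BM: "\<And>n y. B n y \<in> sets borel" "\<And>n y. M n y \<in> null_sets lborel"
     "\<And>n y t. t \<notin> M n y \<Longrightarrow> t \<in> J \<and> s n t = y \<longleftrightarrow> t \<in> B n y" by metis
  define Z where "Z = (\<Union>n. \<Union>y\<in>s n ` J. M n y)"
  have Z: "Z \<in> null_sets lborel"
    unfolding Z_def using BM(2) s(1) by (intro null_sets_UN null_sets_UN') (auto simp: countable_finite)
  define S where "S = S0 - Z"
  have S: "S \<in> sets borel" "S \<subseteq> J" using S0 null_setsD2[OF Z] by (auto simp: S_def)
  have AES: "AE t in lborel. t \<in> J \<longrightarrow> t \<in> S"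
    using S0(3) AE_not_in[OF Z] by eventually_elim (auto simp: S_def)
  have "borel_simple X (cut S (s n))" for n
  proof (rule borel_simpleI)
    have sub: "range (cut S (s n)) \<subseteq> insert (\<lambda>_. 0) (s n ` J)" using S by auto
    show "finite (range (cut S (s n)))" by (rule finite_subset[OF sub]) (use s in auto)
    show "range (cut S (s n)) \<subseteq> X" using s(2)[of n] zero_mem by (intro order_trans[OF sub]) auto
    fix y
    show "cut S (s n) -` {y} \<in> sets borel"
    proof (cases "y \<in> s n ` J")
      case True
      have eq: "s n t = y \<longleftrightarrow> t \<in> B n y" if "t \<in> S" for t
        using BM(3)[of t n y] True that S(2) by (auto simp: S_def Z_def)
      have "cut S (s n) -` {y} = (S \<inter> B n y) \<union> (if y = (\<lambda>_. 0) then - S else {})"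
      proof (rule set_eqI)
        fix x
        show "x \<in> cut S (s n) -` {y} \<longleftrightarrow> x \<in> (S \<inter> B n y) \<union> (if y = (\<lambda>_. 0) then - S else {})"
          using eq[of x] by (cases "x \<in> S") simp_all
      qed
      then show ?thesis using S BM(1) by auto
    next
      case False
      then have ne: "s n x \<noteq> y" if "x \<in> S" for x using S(2) that by auto
      have "cut S (s n) -` {y} = (if y = (\<lambda>_. 0) then - S else {})"
      proof (rule set_eqI)
        fix x
        show "x \<in> cut S (s n) -` {y} \<longleftrightarrow> x \<in> (if y = (\<lambda>_. 0) then - S else {})"
          using ne[of x] by (cases "x \<in> S") simp_all
      qed
      then show ?thesis using S by auto
    qed
  qed
  moreover have "(\<lambda>n. N (cut S (s n) t - cut S f t)) \<longlonglongrightarrow> 0" for t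
    using S0(4)[of t] N_zero by (auto simp: S_def fun_diff_def)
  moreover have "cut S f t \<in> X" for t using S0(4)[of t] zero_mem by (auto simp: S_def)
  ultimately have "borel_limit X N (cut S f)"
    unfolding borel_limit_def by (intro conjI exI[of _ "\<lambda>n. cut S (s n)"]) auto
  moreover have "\<And>t. t \<in> S \<Longrightarrow> f t \<in> X" using S0(4) by (auto simp: S_def)
  ultimately show ?thesis using that[OF S AES] by blast
qed

text \<open>Stated for every Borel subset of \<open>S0\<close>, so that the good sets of several
  functions can be intersected afterwards without losing these properties.\<close>

lemma bochner_Lp_borel_limit:
  assumes J: "J \<in> sets borel" and f: "f \<in> bochner_Lp r J X N"
  obtains S0 where "S0 \<in> sets borel" "S0 \<subseteq> J" "AE t in lborel. t \<in> J \<longrightarrow> t \<in> S0" "\<And>t. t \<in> S0 \<Longrightarrow> f t \<in> X"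
    "\<And>S. S \<in> sets borel \<Longrightarrow> S \<subseteq> S0 \<Longrightarrow> borel_limit X N (cut S f)"
    "\<And>S. S \<in> sets borel \<Longrightarrow> S \<subseteq> S0 \<Longrightarrow> integrable lborel (\<lambda>t. N (cut S f t) powr r)"
proof -
  have fX: "AE t in lebesgue_on J. f t \<in> X" and sm: "strongly_measurable J X N f"
    and fin: "(\<integral>\<^sup>+t. ennreal (N (f t) powr r) \<partial>lebesgue_on J) < \<infinity>"
    using f by (auto simp: bochner_Lp_def)
  obtain S0 where S0: "S0 \<in> sets borel" "S0 \<subseteq> J" "AE t in lborel. t \<in> J \<longrightarrow> t \<in> S0" "\<And>t. t \<in> S0 \<Longrightarrow> f t \<in> X"
    "borel_limit X N (cut S0 f)"
    by (rule strongly_measurable_borel_limit[OF J fX sm]) blast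
  have lim: "borel_limit X N (cut S f)" if S: "S \<in> sets borel" "S \<subseteq> S0" for S
  proof -
    have "cut S (cut S0 f) = cut S f" using S by (auto simp: fun_eq_iff)
    then show ?thesis using borel_limit_cut[OF S0(5) S(1)] by simp
  qed
  moreover have "integrable lborel (\<lambda>t. N (cut S f t) powr r)" if S: "S \<in> sets borel" "S \<subseteq> S0" for S
  proof -
    have m: "(\<lambda>t. N (cut S f t) powr r) \<in> borel_measurable borel"
      using borel_limit_norm[OF lim[OF S]] by measurable
    have "(\<integral>\<^sup>+t. ennreal (N (cut S f t) powr r) \<partial>lborel) = (\<integral>\<^sup>+t. ennreal (N (cut S f t) powr r) \<partial>lebesgue)"
      by (simp add: nn_integral_completion)
    also have "\<dots> \<le> (\<integral>\<^sup>+t. ennreal (N (f t) powr r) * indicator J t \<partial>lebesgue)"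
      using S S0(2) by (intro nn_integral_mono) (auto simp: N_zero indicator_def)
    also have "\<dots> = (\<integral>\<^sup>+t. ennreal (N (f t) powr r) \<partial>lebesgue_on J)"
      using J by (subst nn_integral_restrict_space) auto
    also note fin
    finally show ?thesis using m by (simp add: integrable_iff_bounded)
  qed
  ultimately show ?thesis using that[OF S0(1-4)] by blast
qed

end

section \<open>Continuity of translations and the du Bois-Reymond lemma\<close>

lemma integrable_shift:
  fixes f :: "real \<Rightarrow> real"
  assumes "integrable lborel f"
  shows "integrable lborel (\<lambda>t. f (t + \<sigma>))" "(LINT t|lborel. f (t + \<sigma>)) = (LINT t|lborel. f t)"
  using lborel_integrable_real_affine[OF assms, of 1 \<sigma>] lborel_integral_real_affine[of 1 f \<sigma>]
  by (auto simp: add.commute)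

text \<open>\<open>A\<close> is enclosed in an open set \<open>U\<close> of nearly the same measure.
  Each point of \<open>U\<close> stays in \<open>U\<close> under small shifts, so the loss
  \<open>h\<close> of \<open>U\<close> tends to zero by dominated convergence, and translation
  invariance makes the gain as small as the loss.\<close>

lemma translation_continuous_indicator:
  fixes A :: "real set"
  assumes A: "A \<in> sets lborel" "emeasure lborel A < \<infinity>" and e: "0 < (e::real)"
  shows "\<exists>d>0. \<forall>\<sigma>. \<bar>\<sigma>\<bar> < d \<longrightarrow> (LINT t|lborel. \<bar>indicator A (t + \<sigma>) - indicator A t\<bar>) < e"
proof -
  obtain U where U: "open U" "A \<subseteq> U" "emeasure lborel (U - A) < ennreal (e / 4)"
    using outer_regular_lborel[of A "e / 4"] A e by auto
  have Am [measurable]: "A \<in> sets borel" and Um [measurable]: "U \<in> sets borel" using A U by auto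
  have fU: "emeasure lborel U < \<infinity>"
  proof -
    have "emeasure lborel U \<le> emeasure lborel A + emeasure lborel (U - A)"
      using U(2) by (subst plus_emeasure) (auto simp: Un_absorb1)
    also have "\<dots> < \<infinity>" using A(2) U(3) by (simp add: ennreal_add_less_top order_less_trans[OF U(3)])
    finally show ?thesis .
  qed
  have iA: "integrable lborel (indicator A :: real \<Rightarrow> real)" and iU: "integrable lborel (indicator U :: real \<Rightarrow> real)"
    using A(2) fU by (auto intro: integrable_real_indicator)
  have UA: "(LINT t|lborel. indicator U t - indicator A t) < e / 4"
  proof -
    have "(LINT t|lborel. indicator U t - indicator A t) = (LINT t|lborel. (indicator (U - A) t :: real))"
      using U(2) by (intro Bochner_Integration.integral_cong) (auto simp: indicator_def)
    also have "\<dots> < e / 4"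
    proof -
      have "emeasure lborel (U - A) \<noteq> top" using U(3) by auto
      then have "ennreal (measure lborel (U - A)) < ennreal (e / 4)"
        using U(3) by (simp add: emeasure_eq_ennreal_measure)
      then show ?thesis by (simp add: ennreal_less_iff)
    qed
    finally show ?thesis .
  qed
  define h where "h \<sigma> t = max 0 (indicator U t - indicator U (t + \<sigma>) :: real)" for \<sigma> t
  have hm [measurable]: "h \<sigma> \<in> borel_measurable borel" for \<sigma> unfolding h_def by measurable
  have "((\<lambda>\<sigma>. LINT t|lborel. h \<sigma> t) \<longlongrightarrow> (LINT t|(lborel :: real measure). (0::real))) (at 0)"
    unfolding tendsto_at_iff_sequentially comp_def
  proof (intro allI impI)
    fix X :: "nat \<Rightarrow> real" assume X: "\<forall>i. X i \<in> UNIV - {0}" "X \<longlonglongrightarrow> 0"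
    show "(\<lambda>n. LINT t|lborel. h (X n) t) \<longlonglongrightarrow> (LINT t|(lborel :: real measure). (0::real))"
    proof (rule integral_dominated_convergence[where w="indicator U"])
      show "AE t in lborel. (\<lambda>n. h (X n) t) \<longlonglongrightarrow> 0"
      proof (rule AE_I2)
        fix t
        show "(\<lambda>n. h (X n) t) \<longlonglongrightarrow> 0"
        proof (cases "t \<in> U")
          case True
          have "(\<lambda>n. t + X n) \<longlonglongrightarrow> t + 0" using X by (intro tendsto_intros) auto
          then have "\<forall>\<^sub>F n in sequentially. t + X n \<in> U"
            using U(1) True by (intro topological_tendstoD) auto
          then have "\<forall>\<^sub>F n in sequentially. 0 = h (X n) t"
            by eventually_elim (use True in \<open>simp add: h_def\<close>)
          then show ?thesis by (rule Lim_transform_eventually[OF tendsto_const])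
        qed (simp add: h_def)
      qed
    qed (use iU in \<open>auto simp: h_def indicator_def\<close>)
  qed
  then have "\<forall>\<^sub>F \<sigma> in at 0. (LINT t|lborel. h \<sigma> t) < e / 4"
    using e by (intro order_tendstoD) auto
  then obtain d where d: "d > 0" "\<And>\<sigma>. \<sigma> \<noteq> 0 \<Longrightarrow> \<bar>\<sigma>\<bar> < d \<Longrightarrow> (LINT t|lborel. h \<sigma> t) < e / 4"
    by (auto simp: eventually_at dist_real_def)
  have "(LINT t|lborel. \<bar>indicator A (t + \<sigma>) - indicator A t\<bar>) < e" if "\<bar>\<sigma>\<bar> < d" for \<sigma>
  proof (cases "\<sigma> = 0")
    case False
    have ih: "integrable lborel (h \<sigma>)"
      by (rule Bochner_Integration.integrable_bound[OF iU]) (auto simp: h_def indicator_def)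
    note ints = iA iU integrable_shift(1)[OF iA, of \<sigma>] integrable_shift(1)[OF iU, of \<sigma>] ih
    \<comment> \<open>The last bracket is the absolute value of
      \<open>x = indicator U (t + \<sigma>) - indicator U t\<close>, written as
      \<open>2 * max 0 (- x) + x\<close>; its summand \<open>x\<close> integrates to zero.\<close>
    have "(LINT t|lborel. \<bar>indicator A (t + \<sigma>) - indicator A t\<bar>) \<le>
       (LINT t|lborel. (indicator U (t + \<sigma>) - indicator A (t + \<sigma>)) + (indicator U t - indicator A t)
          + (2 * h \<sigma> t + (indicator U (t + \<sigma>) - indicator U t)))"
    proof (rule integral_mono)
      show "integrable lborel (\<lambda>t. \<bar>indicator A (t + \<sigma>) - indicator A t\<bar> :: real)"
        using ints by (intro integrable_abs Bochner_Integration.integrable_diff)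
      show "integrable lborel (\<lambda>t. (indicator U (t + \<sigma>) - indicator A (t + \<sigma>)) + (indicator U t - indicator A t)
          + (2 * h \<sigma> t + (indicator U (t + \<sigma>) - indicator U t)))"
        using ints by (intro Bochner_Integration.integrable_add Bochner_Integration.integrable_diff integrable_mult_right)
    qed (use U(2) in \<open>auto simp: h_def indicator_def\<close>)
    also have "\<dots> = (LINT t|lborel. indicator U (t + \<sigma>) - indicator A (t + \<sigma>))
        + (LINT t|lborel. indicator U t - indicator A t)
        + (2 * (LINT t|lborel. h \<sigma> t) + ((LINT t|lborel. indicator U (t + \<sigma>)) - (LINT t|lborel. indicator U t)))"
      using ints by simp
    also have "(LINT t|lborel. indicator U (t + \<sigma>)) = (LINT t|lborel. (indicator U t :: real))"
      by (rule integrable_shift(2)[OF iU])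
    also have "(LINT t|lborel. indicator U (t + \<sigma>) - indicator A (t + \<sigma>)) = (LINT t|lborel. indicator U t - (indicator A t :: real))"
      using integrable_shift(2)[of "\<lambda>t. indicator U t - indicator A t" \<sigma>] iA iU by simp
    finally show ?thesis using UA d(2)[OF False that] by linarith
  qed (use e in simp)
  then show ?thesis using d(1) by blast
qed

text \<open>Induction over integrable functions starting from indicators. In the limit step the
  approximation error is the same before and after the shift, by translation invariance.\<close>

lemma translation_continuous_L1:
  fixes f :: "real \<Rightarrow> real"
  assumes "integrable lborel f" "0 < e"
  shows "\<exists>d>0. \<forall>\<sigma>. \<bar>\<sigma>\<bar> < d \<longrightarrow> (LINT t|lborel. \<bar>f (t + \<sigma>) - f t\<bar>) < e"
proof -
  have "\<forall>e>0. \<exists>d>0. \<forall>\<sigma>. \<bar>\<sigma>\<bar> < d \<longrightarrow> (LINT t|lborel. \<bar>f (t + \<sigma>) - f t\<bar>) < e"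
    using assms(1)
  proof (induction rule: integrable_induct)
    case (base A c)
    show ?case
    proof (intro allI impI)
      fix e :: real assume e: "e > 0"
      obtain d where d: "d > 0" "\<And>\<sigma>. \<bar>\<sigma>\<bar> < d \<Longrightarrow> (LINT t|lborel. \<bar>indicator A (t + \<sigma>) - indicator A t\<bar>) < e / (\<bar>c\<bar> + 1)"
        using translation_continuous_indicator[OF base, of "e / (\<bar>c\<bar> + 1)"] e by auto
      have "(LINT t|lborel. \<bar>indicator A (t + \<sigma>) *\<^sub>R c - indicator A t *\<^sub>R c\<bar>) < e" if "\<bar>\<sigma>\<bar> < d" for \<sigma>
      proof -
        have "(LINT t|lborel. \<bar>indicator A (t + \<sigma>) *\<^sub>R c - indicator A t *\<^sub>R c\<bar>)
           = (LINT t|lborel. \<bar>indicator A (t + \<sigma>) - indicator A t\<bar>) * \<bar>c\<bar>"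
          by (simp flip: left_diff_distrib add: abs_mult)
        also have "\<dots> \<le> (LINT t|lborel. \<bar>indicator A (t + \<sigma>) - indicator A t\<bar>) * (\<bar>c\<bar> + 1)"
          by (intro mult_left_mono) auto
        also have "\<dots> < e" using d(2)[OF that] by (simp add: pos_less_divide_eq)
        finally show ?thesis .
      qed
      then show "\<exists>d>0. \<forall>\<sigma>. \<bar>\<sigma>\<bar> < d \<longrightarrow> (LINT t|lborel. \<bar>indicator A (t + \<sigma>) *\<^sub>R c - indicator A t *\<^sub>R c\<bar>) < e"
        using d(1) by blast
    qed
  next
    case (add f g)
    show ?case
    proof (intro allI impI)
      fix e :: real assume e: "e > 0"
      obtain d1 where d1: "d1 > 0" "\<And>\<sigma>. \<bar>\<sigma>\<bar> < d1 \<Longrightarrow> (LINT t|lborel. \<bar>f (t + \<sigma>) - f t\<bar>) < e / 2"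
        using add(3) e half_gt_zero by blast
      obtain d2 where d2: "d2 > 0" "\<And>\<sigma>. \<bar>\<sigma>\<bar> < d2 \<Longrightarrow> (LINT t|lborel. \<bar>g (t + \<sigma>) - g t\<bar>) < e / 2"
        using add(4) e half_gt_zero by blast
      have "(LINT t|lborel. \<bar>(f (t + \<sigma>) + g (t + \<sigma>)) - (f t + g t)\<bar>) < e" if "\<bar>\<sigma>\<bar> < min d1 d2" for \<sigma>
      proof -
        have "(LINT t|lborel. \<bar>(f (t + \<sigma>) + g (t + \<sigma>)) - (f t + g t)\<bar>)
           \<le> (LINT t|lborel. \<bar>f (t + \<sigma>) - f t\<bar> + \<bar>g (t + \<sigma>) - g t\<bar>)"
          using add(1,2) integrable_shift(1)[OF add(1)] integrable_shift(1)[OF add(2)] by (intro integral_mono) auto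
        also have "\<dots> = (LINT t|lborel. \<bar>f (t + \<sigma>) - f t\<bar>) + (LINT t|lborel. \<bar>g (t + \<sigma>) - g t\<bar>)"
          using add(1,2) integrable_shift(1)[OF add(1)] integrable_shift(1)[OF add(2)] by simp
        also have "\<dots> < e" using d1(2)[of \<sigma>] d2(2)[of \<sigma>] that by simp
        finally show ?thesis .
      qed
      then show "\<exists>d>0. \<forall>\<sigma>. \<bar>\<sigma>\<bar> < d \<longrightarrow> (LINT t|lborel. \<bar>(f (t + \<sigma>) + g (t + \<sigma>)) - (f t + g t)\<bar>) < e"
        using d1(1) d2(1) by (intro exI[of _ "min d1 d2"]) auto
    qed
  next
    case (lim f s)
    have si: "integrable lborel (s i)" and l: "(\<lambda>i. s i t) \<longlonglongrightarrow> f t" and b: "\<bar>s i t\<bar> \<le> 2 * \<bar>f t\<bar>"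
      and IH: "\<forall>e>0. \<exists>d>0. \<forall>\<sigma>. \<bar>\<sigma>\<bar> < d \<longrightarrow> (LINT t|lborel. \<bar>s i (t + \<sigma>) - s i t\<bar>) < e"
      and if': "integrable lborel f" for i t
      using lim by auto
    have "(\<lambda>i. LINT t|lborel. \<bar>s i t - f t\<bar>) \<longlonglongrightarrow> (LINT t|(lborel :: real measure). (0::real))"
    proof (rule integral_dominated_convergence[where w="\<lambda>t. 3 * norm (f t)"])
      show "AE t in lborel. (\<lambda>i. \<bar>s i t - f t\<bar>) \<longlonglongrightarrow> 0"
      proof (rule AE_I2)
        fix t
        have "(\<lambda>i. \<bar>s i t - f t\<bar>) \<longlonglongrightarrow> \<bar>f t - f t\<bar>" by (intro tendsto_intros l)
        then show "(\<lambda>i. \<bar>s i t - f t\<bar>) \<longlonglongrightarrow> 0" by simp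
      qed
      show "AE t in lborel. norm \<bar>s i t - f t\<bar> \<le> 3 * norm (f t)" for i
      proof (rule AE_I2)
        fix t
        have "\<bar>s i t\<bar> \<le> 2 * \<bar>f t\<bar>" by (rule b)
        then show "norm \<bar>s i t - f t\<bar> \<le> 3 * norm (f t)" by simp
      qed
    qed (use si if' in auto)
    then have lim0: "(\<lambda>i. LINT t|lborel. \<bar>s i t - f t\<bar>) \<longlonglongrightarrow> 0" by simp
    show ?case
    proof (intro allI impI)
      fix e :: real assume e: "e > 0"
      obtain i where i: "(LINT t|lborel. \<bar>s i t - f t\<bar>) < e / 4"
        using order_tendstoD(2)[OF lim0, of "e / 4"] e eventually_happens sequentially_bot by force
      obtain d where d: "d > 0" "\<And>\<sigma>. \<bar>\<sigma>\<bar> < d \<Longrightarrow> (LINT t|lborel. \<bar>s i (t + \<sigma>) - s i t\<bar>) < e / 4"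
        using IH[of i, rule_format, of "e / 4"] e by auto
      have "(LINT t|lborel. \<bar>f (t + \<sigma>) - f t\<bar>) < e" if "\<bar>\<sigma>\<bar> < d" for \<sigma>
      proof -
        have isf: "integrable lborel (\<lambda>t. \<bar>s i t - f t\<bar>)" using si if' by auto
        note ints = si[of i] if' integrable_shift(1)[OF si[of i], of \<sigma>] integrable_shift(1)[OF if', of \<sigma>]
        have "(LINT t|lborel. \<bar>f (t + \<sigma>) - f t\<bar>)
           \<le> (LINT t|lborel. \<bar>s i (t + \<sigma>) - f (t + \<sigma>)\<bar> + (\<bar>s i (t + \<sigma>) - s i t\<bar> + \<bar>s i t - f t\<bar>))"
          using ints by (intro integral_mono) auto
        also have "\<dots> = (LINT t|lborel. \<bar>s i (t + \<sigma>) - f (t + \<sigma>)\<bar>) + ((LINT t|lborel. \<bar>s i (t + \<sigma>) - s i t\<bar>)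
            + (LINT t|lborel. \<bar>s i t - f t\<bar>))"
          using ints by simp
        also have "(LINT t|lborel. \<bar>s i (t + \<sigma>) - f (t + \<sigma>)\<bar>) = (LINT t|lborel. \<bar>s i t - f t\<bar>)"
          by (rule integrable_shift(2)[OF isf])
        finally show ?thesis using i d(2)[OF that] e by linarith
      qed
      then show "\<exists>d>0. \<forall>\<sigma>. \<bar>\<sigma>\<bar> < d \<longrightarrow> (LINT t|lborel. \<bar>f (t + \<sigma>) - f t\<bar>) < e"
        using d(1) by blast
    qed
  qed
  then show ?thesis using assms(2) by blast
qed

section \<open>Primitives of test functions and the du Bois-Reymond lemma\<close>

lemma test_function_eq_0:
  assumes "test_function S \<zeta>" "x \<notin> S" shows "\<zeta> x = 0"
  by (rule test_functionE[OF assms(1)]) (use assms(2) in blast)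

lemma test_function_deriv:
  fixes \<theta> :: "real \<Rightarrow> real"
  assumes "test_function S \<theta>"
  shows "(\<theta> has_real_derivative deriv \<theta> t) (at t)" "smooth (deriv \<theta>)"
    "\<exists>C\<ge>0. \<forall>t. \<bar>\<theta> t\<bar> \<le> C" "\<exists>C\<ge>0. \<forall>t. \<bar>deriv \<theta> t\<bar> \<le> C"
proof -
  obtain K where K: "smooth \<theta>" "compact K" "K \<subseteq> S" "\<And>x. x \<notin> K \<Longrightarrow> \<theta> x = 0"
    "\<And>x h. x \<notin> K \<Longrightarrow> frechet_derivative \<theta> (at x) h = 0"
    using test_functionE[OF assms] by blast
  have d: "(\<theta> has_real_derivative frechet_derivative \<theta> (at t) 1) (at t)" for t
  proof -
    have "(*) (frechet_derivative \<theta> (at t) 1) = (\<lambda>h. h * frechet_derivative \<theta> (at t) 1)"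
      by (auto simp: mult.commute)
    then show ?thesis
      using smooth_has_derivative_partials(1)[OF K(1), of t] by (simp add: has_field_derivative_def)
  qed
  then have deq: "deriv \<theta> = (\<lambda>t. frechet_derivative \<theta> (at t) 1)"
    by (intro ext DERIV_imp_deriv) auto
  show "(\<theta> has_real_derivative deriv \<theta> t) (at t)" using d deq by simp
  show sm: "smooth (deriv \<theta>)" unfolding deq by (rule smooth_has_derivative_partials(2)[OF K(1)]) simp
  have bnd: "\<exists>C\<ge>0. \<forall>t. \<bar>f t\<bar> \<le> C" if "smooth f" "\<And>x. x \<notin> K \<Longrightarrow> f x = 0" for f :: "real \<Rightarrow> real"
  proof -
    have "compact (f ` K)" using smooth_continuous_on[OF that(1)] K(2) by (intro compact_continuous_image)
    then obtain C where C: "\<forall>y\<in>f ` K. norm y \<le> C" using compact_imp_bounded bounded_iff by blast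
    have "\<bar>f x\<bar> \<le> max C 0" for x
      using C that(2)[of x] by (cases "x \<in> K") force+
    then show ?thesis by (intro exI[of _ "max C 0"]) auto
  qed
  show "\<exists>C\<ge>0. \<forall>t. \<bar>\<theta> t\<bar> \<le> C" by (rule bnd[OF K(1,4)])
  show "\<exists>C\<ge>0. \<forall>t. \<bar>deriv \<theta> t\<bar> \<le> C" by (rule bnd[OF sm]) (simp add: deq K(5))
qed

lemma test_function_support_interval:
  fixes \<theta> :: "real \<Rightarrow> real"
  assumes "test_function {0<..<T} \<theta>" "0 < T"
  obtains a b where "0 < a" "a \<le> b" "b < T" "\<And>t. t \<notin> {a..b} \<Longrightarrow> \<theta> t = 0"
proof -
  obtain K where K: "compact K" "K \<subseteq> {0<..<T}" "\<And>x. x \<notin> K \<Longrightarrow> \<theta> x = 0"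
    using test_functionE[OF assms(1)] by metis
  show ?thesis
  proof (cases "K = {}")
    case True
    then show ?thesis using assms(2) K(3) by (intro that[of "T / 2" "T / 2"]) auto
  next
    case False
    obtain a where a: "a \<in> K" "\<And>t. t \<in> K \<Longrightarrow> a \<le> t" using compact_attains_inf[OF K(1) False] by blast
    obtain b where b: "b \<in> K" "\<And>t. t \<in> K \<Longrightarrow> t \<le> b" using compact_attains_sup[OF K(1) False] by blast
    show ?thesis
    proof (rule that[of a b])
      show "0 < a" "b < T" using a(1) b(1) K(2) by auto
      show "a \<le> b" using a(2)[OF b(1)] .
      show "\<theta> t = 0" if "t \<notin> {a..b}" for t using that a(2)[of t] b(2)[of t] K(3)[of t] by auto
    qed
  qed
qed

text \<open>A primitive that vanishes to the left of the support is constant to the right of it,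
  with the integral of \<eta> as value; mean zero is what makes its support compact.\<close>

lemma test_function_antiderivative:
  fixes \<eta> :: "real \<Rightarrow> real"
  assumes t: "test_function {0<..<T} \<eta>" "0 < T" and zero: "(LINT t|lborel. \<eta> t) = 0"
  obtains \<theta> where "test_function {0<..<T} \<theta>" "deriv \<theta> = \<eta>"
proof -
  obtain a b where ab: "0 < a" "a \<le> b" "b < T" "\<And>t. t \<notin> {a..b} \<Longrightarrow> \<eta> t = 0"
    using test_function_support_interval[OF t] by blast
  have sm: "smooth \<eta>" using t by (simp add: test_function_def)
  then have c: "continuous_on UNIV \<eta>" by (rule smooth_continuous_on)
  obtain \<Theta> where \<Theta>: "\<And>x. (\<Theta> has_real_derivative \<eta> x) (at x)"
    using einterval_antiderivative[of "-\<infinity>" "\<infinity>" \<eta>] c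
    by (auto simp: continuous_on_eq_continuous_at has_real_derivative_iff_has_vector_derivative)
  define \<theta> where "\<theta> x = \<Theta> x - \<Theta> a" for x
  have \<theta>: "(\<theta> has_real_derivative \<eta> x) (at x)" for x
    unfolding \<theta>_def by (auto intro!: derivative_eq_intros \<Theta>)
  have int: "(\<eta> has_integral \<Theta> y - \<Theta> x) {x..y}" if "x \<le> y" for x y
    using \<Theta> that by (intro fundamental_theorem_of_calculus)
      (auto simp: has_real_derivative_iff_has_vector_derivative[symmetric] intro: has_field_derivative_at_within)
  have "\<theta> x = 0" if "x \<notin> {a..b}" for x
  proof -
    consider "x < a" | "b < x" using \<open>x \<notin> {a..b}\<close> by auto
    then show ?thesis
    proof cases
      case 1
      have "(\<eta> has_integral 0) {x..a}"
        by (rule has_integral_spike_finite[of "{a}" _ _ "\<lambda>_. 0"]) (use ab(4) in auto)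
      from has_integral_unique[OF int[of x a] this] 1 show ?thesis by (simp add: \<theta>_def)
    next
      case 2
      have "integrable lborel (\<lambda>t. indicator {a..b} t *\<^sub>R \<eta> t)"
        using c by (intro borel_integrable_compact) (auto intro: continuous_on_subset)
      moreover have "(\<lambda>t. indicator {a..b} t *\<^sub>R \<eta> t) = \<eta>"
        using ab(4) by (auto simp: indicator_def fun_eq_iff)
      ultimately have "(\<eta> has_integral 0) UNIV"
        using has_integral_integral_lborel[of \<eta>] zero by simp
      moreover have "(\<lambda>t. if t \<in> {a..x} then \<eta> t else 0) = \<eta>"
        using ab(4) 2 by (auto simp: fun_eq_iff)
      ultimately have "(\<eta> has_integral 0) {a..x}"
        by (metis has_integral_restrict_UNIV)
      from has_integral_unique[OF int[of a x] this] 2 ab(2) show ?thesis by (simp add: \<theta>_def)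
    qed
  qed
  then have "test_function {0<..<T} \<theta>"
    using ab smooth_if_smooth_deriv[OF \<theta> sm] by (intro test_functionI[of _ "{a..b}"]) auto
  moreover have "deriv \<theta> = \<eta>" using \<theta> by (intro ext DERIV_imp_deriv)
  ultimately show ?thesis by (rule that)
qed

text \<open>By Fubini the indefinite integral \<open>W\<close> satisfies the same weak equation, so
  \<open>v - W\<close> annihilates the derivatives of test functions, which are the test functions
  of mean zero. Correcting an arbitrary \<eta> by a multiple of one fixed \<open>\<eta>1\<close>
  with nonzero mean then shows that \<open>v - W\<close> acts as a constant.\<close>

lemma du_Bois_Reymond:
  fixes v w :: "real \<Rightarrow> real"
  assumes T: "0 < T" and v: "integrable lborel v" and w: "integrable lborel w"
    and eq: "\<And>\<theta>. test_function {0<..<T} \<theta> \<Longrightarrow>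
        (LINT t|lborel. deriv \<theta> t * v t) = - (LINT t|lborel. \<theta> t * w t)"
  shows "\<exists>c. AE t in lborel. t \<in> {0<..<T} \<longrightarrow> v t = c + (LINT r|lborel. indicator {0..t} r * w r)"
proof -
  define W where "W t = (LINT r|lborel. indicator {0..t} r * w r)" for t
  have [measurable]: "v \<in> borel_measurable borel" "w \<in> borel_measurable borel" using v w by auto
  have iw: "integrable lborel (\<lambda>r. indicator {0..t} r * w r)" for t
    using integrable_mult_indicator[of "{0..t}" lborel w] w by simp
  \<comment> \<open>Writing \<open>W\<close> with the indicator of a closed subset of the plane
    makes it measurable and prepares the exchange of integrals in \<open>parts\<close>.\<close>
  define \<Delta> where "\<Delta> = {(t, r). 0 \<le> r \<and> r \<le> (t::real)}"
  have [measurable]: "\<Delta> \<in> sets (borel \<Otimes>\<^sub>M borel)"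
  proof -
    have "closed \<Delta>" unfolding \<Delta>_def split_beta by (intro closed_Collect_conj closed_Collect_le continuous_intros)
    then show ?thesis unfolding borel_prod by (rule borel_closed)
  qed
  have W_eq: "W = (\<lambda>t. LINT r|lborel. indicator \<Delta> (t, r) * w r)"
    by (auto simp: W_def \<Delta>_def indicator_def intro!: Bochner_Integration.integral_cong)
  have Wm [measurable]: "W \<in> borel_measurable borel" unfolding W_eq by measurable
  have Wb: "\<bar>W t\<bar> \<le> (LINT r|lborel. \<bar>w r\<bar>)" for t
    unfolding W_def using w iw[of t]
    by (intro order_trans[OF integral_abs_bound] integral_mono) (auto simp: indicator_def)
  have parts: "(LINT t|lborel. \<theta> t * w t) = - (LINT t|lborel. deriv \<theta> t * W t)"
    if \<theta>: "test_function {0<..<T} \<theta>" for \<theta>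
  proof -
    obtain a b where ab: "0 < a" "a \<le> b" "b < T" "\<And>t. t \<notin> {a..b} \<Longrightarrow> \<theta> t = 0"
      using test_function_support_interval[OF \<theta> T] by blast
    note d = test_function_deriv[OF \<theta>]
    have dz: "deriv \<theta> t = 0" if "t \<notin> {a..b}" for t
    proof -
      have "(\<theta> has_real_derivative 0) (at t)"
        by (rule has_field_derivative_transform_within_open[OF DERIV_const, of "- {a..b}"])
          (use ab(4) that in \<open>auto simp: open_Compl\<close>)
      then show ?thesis by (rule DERIV_imp_deriv)
    qed
    have dm [measurable]: "deriv \<theta> \<in> borel_measurable borel"
      using smooth_continuous_on[OF d(2)] by (rule borel_measurable_continuous_onI)
    have id: "integrable lborel (deriv \<theta>)"
    proof -
      have "integrable lborel (\<lambda>t. indicator {a..b} t *\<^sub>R deriv \<theta> t)"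
        using smooth_continuous_on[OF d(2)] by (intro borel_integrable_compact) auto
      moreover have "(\<lambda>t. indicator {a..b} t *\<^sub>R deriv \<theta> t) = deriv \<theta>"
        using dz by (auto simp: indicator_def fun_eq_iff)
      ultimately show ?thesis by simp
    qed
    have tail: "(LINT t|lborel. indicator {r..} t * deriv \<theta> t) = - \<theta> r" for r
    proof -
      \<comment> \<open>Beyond \<open>T\<close> the test function vanishes; the maximum is taken
        because \<open>r\<close> may itself exceed \<open>T\<close>.\<close>
      define c where "c = max r T"
      have "(deriv \<theta> has_integral \<theta> c - \<theta> r) {r..c}"
        using d(1) by (intro fundamental_theorem_of_calculus)
          (auto simp: c_def has_real_derivative_iff_has_vector_derivative[symmetric] intro: has_field_derivative_at_within)
      then have "((\<lambda>t. if t \<in> {r..c} then deriv \<theta> t else 0) has_integral - \<theta> r) UNIV"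
        using ab by (subst has_integral_restrict_UNIV) (auto simp: c_def)
      moreover have "(\<lambda>t. if t \<in> {r..c} then deriv \<theta> t else 0) = (\<lambda>t. indicator {r..} t * deriv \<theta> t)"
      proof
        fix t
        have "deriv \<theta> t = 0" if "c < t" using that ab by (intro dz) (auto simp: c_def)
        then show "(if t \<in> {r..c} then deriv \<theta> t else 0) = indicator {r..} t * deriv \<theta> t"
          by (cases "c < t") (auto simp: indicator_def)
      qed
      moreover have "integrable lborel (\<lambda>t. indicator {r..} t * deriv \<theta> t)"
        using integrable_mult_indicator[of "{r..}" lborel "deriv \<theta>"] id by simp
      ultimately show ?thesis
        using has_integral_integral_lborel has_integral_unique by metis
    qed
    let ?f = "\<lambda>(t, r). deriv \<theta> t * (indicator \<Delta> (t, r) * w r)"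
    have fm [measurable]: "?f \<in> borel_measurable (lborel \<Otimes>\<^sub>M lborel)" by measurable
    have iD: "integrable lborel (\<lambda>r. indicator \<Delta> (t, r) * w r)" for t
      using iw[of t] by (rule back_subst) (auto simp: \<Delta>_def indicator_def fun_eq_iff)
    have int: "integrable (lborel \<Otimes>\<^sub>M lborel) ?f"
    proof (rule lborel_pair.Fubini_integrable[OF fm])
      show "AE t in lborel. integrable lborel (\<lambda>r. ?f (t, r))" using iD by simp
      have "(LINT r|lborel. norm (?f (t, r))) \<le> \<bar>deriv \<theta> t\<bar> * (LINT r|lborel. \<bar>w r\<bar>)" for t
      proof -
        have "(LINT r|lborel. norm (?f (t, r))) \<le> (LINT r|lborel. \<bar>deriv \<theta> t\<bar> * \<bar>w r\<bar>)"
        proof (rule integral_mono)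
          show "integrable lborel (\<lambda>r. norm (?f (t, r)))"
            using integrable_norm[OF integrable_mult_right[OF iD[of t], of "deriv \<theta> t"]] by simp
        qed (use w in \<open>auto simp: abs_mult indicator_def\<close>)
        then show ?thesis by simp
      qed
      moreover have "0 \<le> (LINT r|lborel. norm (?f (t, r)))" for t by (rule integral_nonneg_AE) simp
      ultimately show "integrable lborel (\<lambda>t. LINT r|lborel. norm (?f (t, r)))"
        by (intro Bochner_Integration.integrable_bound[OF integrable_mult_left[OF integrable_abs[OF id], of "LINT r|lborel. \<bar>w r\<bar>"]])
          (auto intro!: AE_I2 order_trans[OF _ abs_ge_self])
    qed
    have "(LINT t|lborel. deriv \<theta> t * W t) = (LINT t|lborel. (LINT r|lborel. ?f (t, r)))"
      by (simp add: W_eq)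
    also have "\<dots> = (LINT r|lborel. (LINT t|lborel. ?f (t, r)))"
      using lborel_pair.Fubini_integral[of "\<lambda>t r. ?f (t, r)"] int by simp
    also have "\<dots> = (LINT r|lborel. - (\<theta> r * w r))"
    proof (rule Bochner_Integration.integral_cong)
      fix r
      have "(LINT t|lborel. ?f (t, r)) = (LINT t|lborel. (indicator {r..} t * deriv \<theta> t) * (indicator {0..} r * w r))"
        by (rule Bochner_Integration.integral_cong) (auto simp: \<Delta>_def indicator_def)
      also have "\<dots> = - \<theta> r * (indicator {0..} r * w r)" by (simp add: tail)
      also have "\<dots> = - (\<theta> r * w r)" using ab by (auto simp: indicator_def)
      finally show "(LINT t|lborel. ?f (t, r)) = - (\<theta> r * w r)" .
    qed simp
    finally show ?thesis by simp
  qed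
  let ?J = "{0<..<T}"
  have test_int: "integrable lborel (\<lambda>t. \<eta> t * z t)"
    if \<eta>: "test_function ?J \<eta>" and z: "integrable lborel (\<lambda>t. indicator ?J t * z t)" for \<eta> z :: "real \<Rightarrow> real"
  proof -
    obtain C where C: "\<And>t. \<bar>\<eta> t\<bar> \<le> C" using test_function_deriv(3)[OF \<eta>] by blast
    obtain K where K: "smooth \<eta>" "K \<subseteq> ?J" "\<And>x. x \<notin> K \<Longrightarrow> \<eta> x = 0" using test_functionE[OF \<eta>] by metis
    have [measurable]: "\<eta> \<in> borel_measurable borel"
      using smooth_continuous_on[OF K(1)] by (rule borel_measurable_continuous_onI)
    have "integrable lborel (\<lambda>t. \<eta> t * (indicator ?J t * z t))"
    proof (rule Bochner_Integration.integrable_bound)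
      show "integrable lborel (\<lambda>t. C * (indicator ?J t * z t))" using z by simp
      show "(\<lambda>t. \<eta> t * (indicator ?J t * z t)) \<in> borel_measurable lborel"
        using borel_measurable_integrable[OF z] by measurable
      have "0 \<le> C" using C[of 0] by simp
      then show "AE t in lborel. norm (\<eta> t * (indicator ?J t * z t)) \<le> norm (C * (indicator ?J t * z t))"
        using C by (intro AE_I2) (auto simp: abs_mult intro!: mult_right_mono)
    qed
    moreover have "(\<lambda>t. \<eta> t * (indicator ?J t * z t)) = (\<lambda>t. \<eta> t * z t)"
    proof
      fix t
      show "\<eta> t * (indicator ?J t * z t) = \<eta> t * z t"
        using test_function_eq_0[OF \<eta>, of t] by (cases "t \<in> ?J") auto
    qed
    ultimately show ?thesis by simp
  qed
  have "integrable lborel (indicator ?J :: real \<Rightarrow> real)"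
    using T by (intro integrable_real_indicator) auto
  then have one: "integrable lborel (\<lambda>t. indicator ?J t * 1 :: real)" by simp
  \<comment> \<open>If all test functions had mean zero, the fundamental lemma applied to the
    constant 1 would make the interval a null set.\<close>
  have "\<exists>\<eta>1. test_function ?J \<eta>1 \<and> (LINT t|lborel. \<eta>1 t) \<noteq> 0"
  proof (rule ccontr)
    assume no: "\<not> ?thesis"
    have "AE t in lebesgue_on ?J. (1::real) = 0"
    proof (rule fundamental_lemma)
      show "integrable (lebesgue_on ?J) (\<lambda>t. 1 :: real)"
        by (intro finite_measure.integrable_const finite_measure_lebesgue_on lmeasurable_open) auto
      fix \<zeta> :: "real \<Rightarrow> real" assume z: "test_function ?J \<zeta>"
      have "(LINT t|lebesgue_on ?J. 1 * \<zeta> t) = (LINT t|lebesgue. indicator ?J t * \<zeta> t)"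
        by (subst Bochner_Integration.integral_restrict_space) auto
      also have "(\<lambda>t. indicator ?J t * \<zeta> t) = \<zeta>"
        using test_function_eq_0[OF z] by (auto simp: fun_eq_iff indicator_def)
      also have "(LINT t|lebesgue. \<zeta> t) = (LINT t|lborel. \<zeta> t)"
        using z smooth_continuous_on[of \<zeta> UNIV]
        by (intro integral_completion) (auto simp: test_function_def intro: borel_measurable_continuous_onI)
      also have "\<dots> = 0" using no z by blast
      finally show "(LINT t|lebesgue_on ?J. 1 * \<zeta> t) = 0" .
    qed auto
    then have "AE t in lebesgue. t \<notin> ?J" by (simp add: AE_restrict_space_iff)
    then have "emeasure lebesgue ?J = 0" by (subst (asm) AE_iff_measurable[of ?J]) auto
    then show False using T by simp
  qed
  then obtain \<eta>1 where \<eta>1: "test_function ?J \<eta>1" "(LINT t|lborel. \<eta>1 t) \<noteq> 0" by blast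
  define c where "c = (LINT t|lborel. \<eta>1 t * (v t - W t)) / (LINT t|lborel. \<eta>1 t)"
  have iv: "integrable lborel (\<lambda>t. indicator ?J t * v t)"
    using integrable_mult_indicator[of ?J lborel v] v by simp
  have iW: "integrable lborel (\<lambda>t. indicator ?J t * W t)"
  proof (rule Bochner_Integration.integrable_bound)
    show "integrable lborel (\<lambda>t. (indicator ?J t * 1) * (LINT r|lborel. \<bar>w r\<bar>))"
      using one by (rule integrable_mult_left)
    show "AE t in lborel. norm (indicator ?J t * W t) \<le> norm ((indicator ?J t * 1) * (LINT r|lborel. \<bar>w r\<bar>))"
      using Wb by (auto simp: indicator_def intro!: AE_I2 order_trans[OF _ abs_ge_self])
  qed measurable
  have key: "(LINT t|lborel. \<eta> t * (v t - W t)) = c * (LINT t|lborel. \<eta> t)"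
    if \<eta>: "test_function ?J \<eta>" for \<eta>
  proof -
    define k where "k = (LINT t|lborel. \<eta> t) / (LINT t|lborel. \<eta>1 t)"
    \<comment> \<open>The multiple \<open>k\<close> is the quotient of the two means, so \<psi> has
      mean zero and is the derivative of a test function.\<close>
    define \<psi> where "\<psi> t = \<eta> t - k * \<eta>1 t" for t
    have i: "integrable lborel \<eta>" "integrable lborel \<eta>1"
      using test_int[OF \<eta> one] test_int[OF \<eta>1(1) one] by auto
    obtain K where K: "compact K" "K \<subseteq> ?J" "\<And>x. x \<notin> K \<Longrightarrow> \<eta> x = 0" using test_functionE[OF \<eta>] by metis
    obtain K1 where K1: "compact K1" "K1 \<subseteq> ?J" "\<And>x. x \<notin> K1 \<Longrightarrow> \<eta>1 x = 0" using test_functionE[OF \<eta>1(1)] by metis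
    have \<psi>: "test_function ?J \<psi>"
    proof (rule test_functionI[of _ "K \<union> K1"])
      show "smooth \<psi>" unfolding \<psi>_def using \<eta> \<eta>1(1) by (intro smooth_diff smooth_mult) (auto simp: test_function_def)
    qed (use K K1 in \<open>auto simp: \<psi>_def\<close>)
    have "(LINT t|lborel. \<psi> t) = 0" unfolding \<psi>_def using i \<eta>1(2) by (simp add: k_def)
    then obtain \<theta> where \<theta>: "test_function ?J \<theta>" "deriv \<theta> = \<psi>"
      using test_function_antiderivative[OF \<psi> T] by blast
    have "(LINT t|lborel. \<psi> t * v t) = (LINT t|lborel. \<psi> t * W t)"
      using eq[OF \<theta>(1)] parts[OF \<theta>(1)] by (simp add: \<theta>(2))
    then have "(LINT t|lborel. \<psi> t * (v t - W t)) = 0"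
      using test_int[OF \<psi> iv] test_int[OF \<psi> iW] by (simp add: right_diff_distrib)
    moreover have iz: "integrable lborel (\<lambda>t. indicator ?J t * (v t - W t))"
      using iv iW by (simp add: right_diff_distrib)
    have "(LINT t|lborel. \<psi> t * (v t - W t)) = (LINT t|lborel. \<eta> t * (v t - W t)) - k * (LINT t|lborel. \<eta>1 t * (v t - W t))"
    proof -
      have "(LINT t|lborel. \<psi> t * (v t - W t)) = (LINT t|lborel. \<eta> t * (v t - W t) - k * (\<eta>1 t * (v t - W t)))"
        by (simp add: \<psi>_def left_diff_distrib mult.assoc)
      then show ?thesis using test_int[OF \<eta> iz] test_int[OF \<eta>1(1) iz] by simp
    qed
    ultimately show ?thesis by (simp add: c_def k_def)
  qed
  have "AE t in lebesgue_on ?J. v t - W t - c = 0"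
  proof (rule fundamental_lemma)
    have "integrable lborel (\<lambda>t. indicator ?J t *\<^sub>R (v t - W t - c))"
      using iv iW one[THEN integrable_mult_left, of c] by (simp add: right_diff_distrib)
    then have "integrable lebesgue (\<lambda>t. indicator ?J t *\<^sub>R (v t - W t - c))"
      by (subst integrable_completion) auto
    then show "integrable (lebesgue_on ?J) (\<lambda>t. v t - W t - c)"
      by (subst integrable_restrict_space) auto
    fix \<eta> :: "real \<Rightarrow> real" assume \<eta>: "test_function ?J \<eta>"
    have cm [measurable]: "\<eta> \<in> borel_measurable borel"
      using \<eta> smooth_continuous_on[of \<eta> UNIV] by (auto simp: test_function_def intro: borel_measurable_continuous_onI)
    have iz: "integrable lborel (\<lambda>t. indicator ?J t * (v t - W t))"
      using iv iW by (simp add: right_diff_distrib)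
    have "(LINT t|lebesgue_on ?J. (v t - W t - c) * \<eta> t) = (LINT t|lebesgue. indicator ?J t * ((v t - W t - c) * \<eta> t))"
      by (subst Bochner_Integration.integral_restrict_space) auto
    also have "(\<lambda>t. indicator ?J t * ((v t - W t - c) * \<eta> t)) = (\<lambda>t. (v t - W t - c) * \<eta> t)"
      using test_function_eq_0[OF \<eta>] by (auto simp: fun_eq_iff indicator_def)
    also have "(LINT t|lebesgue. (v t - W t - c) * \<eta> t) = (LINT t|lborel. (v t - W t - c) * \<eta> t)"
      by (intro integral_completion) auto
    also have "\<dots> = (LINT t|lborel. \<eta> t * (v t - W t) - c * (\<eta> t * 1))"
      by (rule Bochner_Integration.integral_cong) (auto simp: algebra_simps)
    also have "\<dots> = 0"
      using test_int[OF \<eta> iz] test_int[OF \<eta> one] key[OF \<eta>] by simp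
    finally show "(LINT t|lebesgue_on ?J. (v t - W t - c) * \<eta> t) = 0" .
  qed auto
  then have "AE t in lborel. t \<in> ?J \<longrightarrow> v t - W t - c = 0"
    by (simp add: AE_restrict_space_iff AE_completion_iff)
  then have "AE t in lborel. t \<in> ?J \<longrightarrow> v t = c + W t" by eventually_elim auto
  then show ?thesis unfolding W_def by blast
qed

section \<open>The integration by parts formula in abstract form\<close>

text \<open>Young's inequality with the factors \<open>1 / p\<close> and \<open>1 / q\<close>, both
  below 1, dropped. Where small constants matter, the arguments are rescaled beforehand.\<close>

lemma young_le:
  fixes a b p q :: real
  assumes "1 < p" "1 < q" "1 / p + 1 / q = 1" "0 \<le> a" "0 \<le> b"
  shows "a * b \<le> a powr q + b powr p"
proof -
  have "a * b \<le> a powr q / q + b powr p / p"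
    using Youngs_inequality[of q p a b] assms by (simp add: add.commute)
  also have "\<dots> \<le> a powr q + b powr p"
    using assms by (intro add_mono divide_left_mono[of 1 _ "_ powr _", simplified]) (auto simp: divide_le_eq mult_le_cancel_left1)
  finally show ?thesis .
qed

text \<open>Both functions live on the whole line, in the application extended by zero from a subset
  of \<open>{0<..<T}\<close>, so that translations can be used freely. \<open>ik\<close> is listed
  besides \<open>ikq\<close> because on a set of infinite measure one does not imply the
  other.\<close>

locale bochner_pair = seminormed X N
  for X :: "('a \<Rightarrow> 'b::real_vector) set" and N +
  fixes F :: "real \<Rightarrow> 'a \<Rightarrow> 'b" and F' :: "real \<Rightarrow> ('a \<Rightarrow> 'b) \<Rightarrow> real" and p q :: real
  assumes F: "borel_limit X N F"
    and F': "borel_limit (dual_space X N) (dual_norm X N) F'"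
    and pq: "1 < p" "1 < q" "1 / p + 1 / q = 1"
    and ig: "integrable lborel (\<lambda>t. N (F t) powr p)"
    and ikq: "integrable lborel (\<lambda>t. dual_norm X N (F' t) powr q)"
    and ik: "integrable lborel (\<lambda>t. dual_norm X N (F' t))"
begin

sublocale D: seminormed "dual_space X N" "dual_norm X N" by (rule seminormed_dual)

abbreviation "k t \<equiv> dual_norm X N (F' t)"
abbreviation "g t \<equiv> N (F t)"

lemmas FX = borel_limit_memD[OF F]
lemmas F'X = D.borel_limit_memD[OF F']

lemma k_nonneg: "0 \<le> k t" by (rule D.nonneg[OF F'X])
lemma g_nonneg: "0 \<le> g t" by (rule nonneg[OF FX])

lemma meas [measurable]:
  "(\<lambda>t. k t) \<in> borel_measurable borel" "(\<lambda>t. g t) \<in> borel_measurable borel"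
  "(\<lambda>(r, t). F' r (F t)) \<in> borel_measurable (borel \<Otimes>\<^sub>M borel)"
  "(\<lambda>t. F' t (F t)) \<in> borel_measurable borel"
  by (rule D.borel_limit_norm[OF F'] borel_limit_norm[OF F] borel_limit_pairing[OF F F'] borel_limit_pairing_diag[OF F F'])+

lemma meas_pair [measurable (raw)]:
  assumes [measurable]: "a \<in> borel_measurable M" "b \<in> borel_measurable M"
  shows "(\<lambda>x. F' (a x) (F (b x))) \<in> borel_measurable M"
  using measurable_compose[OF measurable_Pair[OF assms] meas(3)] by simp

lemma meas_const [measurable]: "v \<in> X \<Longrightarrow> (\<lambda>t. F' t v) \<in> borel_measurable borel"
  using borel_limit_pairing_diag[OF borel_limit_const F'] by simp

lemma pairing_bound: "\<bar>F' r (F t)\<bar> \<le> k r * g t"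
  by (rule dual_norm_bound[OF F'X FX])

lemma pairing_young: "\<bar>F' r (F t)\<bar> \<le> k r powr q + g t powr p"
  using pairing_bound[of r t] young_le[OF pq k_nonneg g_nonneg, of r t] by linarith

lemma pairing_integrable: "integrable lborel (\<lambda>t. F' (t + \<sigma>) (F t))"
  by (rule Bochner_Integration.integrable_bound[of _ "\<lambda>t. k (t + \<sigma>) powr q + g t powr p"])
    (use integrable_shift(1)[OF ikq] ig pairing_young in \<open>auto intro!: AE_I2 order_trans[OF _ abs_ge_self]\<close>)

lemma pairing_integrable_fst: "integrable lborel (\<lambda>r. F' r (F t))"
  by (rule Bochner_Integration.integrable_bound[of _ "\<lambda>r. k r * g t"])
    (use ik pairing_bound in \<open>auto intro!: AE_I2 order_trans[OF _ abs_ge_self]\<close>)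

text \<open>Only the functional is shifted. On the finitely many values of a simple approximant of
  \<open>F\<close> this is \<open>translation_continuous_L1\<close>. The remainder is split by
  Young's inequality scaled with \<open>a\<close>: first \<open>a\<close> makes the dual part small,
  then the approximant makes the rest small.\<close>

lemma pairing_translation_continuous:
  assumes e: "0 < e"
  shows "\<exists>d>0. \<forall>\<sigma>. \<bar>\<sigma>\<bar> < d \<longrightarrow> (LINT t|lborel. \<bar>F' (t + \<sigma>) (F t) - F' t (F t)\<bar>) < e"
proof -
  define K where "K = (LINT t|lborel. k t powr q)"
  have K0: "0 \<le> K" unfolding K_def by (rule integral_nonneg_AE) simp
  \<comment> \<open>The budget is \<open>e / 2\<close> for the simple approximant,
    \<open>e / 4\<close> for the two terms with \<open>k\<close> and \<open>e / 4\<close> for the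
    approximation error. The last two occur twice each, whence the divisors 8 here and in the choice
    of \<open>s\<close>.\<close>
  define a where "a = (e / (8 * (K + 1))) powr (1 / q)"
  have a: "0 < a" using e K0 by (simp add: a_def)
  have aq: "2 * (a powr q * K) \<le> e / 4"
  proof -
    have "a powr q = e / (8 * (K + 1))" using e K0 pq by (simp add: a_def powr_powr)
    then have "a powr q * (8 * (K + 1)) = e" using K0 by simp
    then have "8 * (a powr q * K) + 8 * a powr q = e" by (simp add: algebra_simps)
    then show ?thesis using powr_ge_zero[of a q] by linarith
  qed
  obtain s where s: "borel_simple X s" "integrable lborel (\<lambda>t. N (F t - s t) powr p)"
      "(LINT t|lborel. N (F t - s t) powr p) < e * a powr p / 8"
    using borel_limit_simple_approx[OF F _ ig, of "e * a powr p / 8"] pq e a by auto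
  define Y where "Y = range s"
  have Y: "finite Y" "Y \<subseteq> X" using s(1) by (auto simp: Y_def borel_simple_def)
  define r where "r t = N (F t - s t)" for t
  have sX: "s t \<in> X" for t using Y by (auto simp: Y_def)
  have r0: "0 \<le> r t" for t unfolding r_def by (rule nonneg[OF diff_mem[OF FX sX]])
  have iY: "integrable lborel (\<lambda>t. F' t y)" if "y \<in> Y" for y
    by (rule Bochner_Integration.integrable_bound[of _ "\<lambda>t. k t * N y"])
      (use ik dual_norm_bound[OF F'X] that Y in \<open>auto intro!: AE_I2 order_trans[OF _ abs_ge_self] meas_const\<close>)
  have "\<forall>y\<in>Y. \<exists>d>0. \<forall>\<sigma>. \<bar>\<sigma>\<bar> < d \<longrightarrow> (LINT t|lborel. \<bar>F' (t + \<sigma>) y - F' t y\<bar>) < e / (2 * (real (card Y) + 1))"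
    using translation_continuous_L1[OF iY] e by simp
  from bchoice[OF this] obtain dd where dd: "\<And>y. y \<in> Y \<Longrightarrow> 0 < dd y"
    "\<And>y \<sigma>. y \<in> Y \<Longrightarrow> \<bar>\<sigma>\<bar> < dd y \<Longrightarrow> (LINT t|lborel. \<bar>F' (t + \<sigma>) y - F' t y\<bar>) < e / (2 * (real (card Y) + 1))"
    by blast
  define d where "d = Min (insert 1 (dd ` Y))"
  have d: "0 < d" "\<And>y. y \<in> Y \<Longrightarrow> d \<le> dd y"
    using Y(1) dd(1) by (auto simp: d_def)
  have "(LINT t|lborel. \<bar>F' (t + \<sigma>) (F t) - F' t (F t)\<bar>) < e" if \<sigma>: "\<bar>\<sigma>\<bar> < d" for \<sigma>
  proof -
    have yg: "c * r t \<le> a powr q * c powr q + r t powr p / a powr p" if "0 \<le> c" for c t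
    proof -
      have "c * r t = (a * c) * (r t / a)" using a by simp
      also have "\<dots> \<le> (a * c) powr q + (r t / a) powr p"
        using a that r0 by (intro young_le pq) auto
      finally show ?thesis using a that r0 by (simp add: powr_mult powr_divide)
    qed
    have pt: "\<bar>F' (t + \<sigma>) (F t) - F' t (F t)\<bar> \<le> (\<Sum>y\<in>Y. \<bar>F' (t + \<sigma>) y - F' t y\<bar>)
        + (a powr q * k (t + \<sigma>) powr q + a powr q * k t powr q + 2 * (r t powr p / a powr p))" for t
    proof -
      have "F' (t + \<sigma>) (F t) - F' t (F t) =
        (F' (t + \<sigma>) (s t) - F' t (s t)) + (F' (t + \<sigma>) (F t - s t) - F' t (F t - s t))"
        using dual_diff[OF F'X FX sX] by simp
      \<comment> \<open>The value \<open>s t\<close> varies with \<open>t\<close>; the sum over all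
        of \<open>Y\<close> replaces it by fixed arguments of the functional.\<close>
      moreover have "\<bar>F' (t + \<sigma>) (s t) - F' t (s t)\<bar> \<le> (\<Sum>y\<in>Y. \<bar>F' (t + \<sigma>) y - F' t y\<bar>)"
        by (rule member_le_sum[of "s t" Y "\<lambda>y. \<bar>F' (t + \<sigma>) y - F' t y\<bar>"]) (use Y in \<open>auto simp: Y_def\<close>)
      moreover have "\<bar>F' u (F t - s t)\<bar> \<le> a powr q * k u powr q + r t powr p / a powr p" for u
        using dual_norm_bound[OF F'X[of u] diff_mem[OF FX sX], of t t] yg[OF k_nonneg, of u t] by (simp add: r_def)
      from this[of "t + \<sigma>"] this[of t]
      have "\<bar>F' (t + \<sigma>) (F t - s t) - F' t (F t - s t)\<bar>
          \<le> a powr q * k (t + \<sigma>) powr q + a powr q * k t powr q + 2 * (r t powr p / a powr p)" by linarith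
      ultimately show ?thesis by linarith
    qed
    have iYd: "integrable lborel (\<lambda>t. \<bar>F' (t + \<sigma>) y - F' t y\<bar>)" if "y \<in> Y" for y
      using iY[OF that] integrable_shift(1)[OF iY[OF that]] by auto
    have ik\<sigma>: "integrable lborel (\<lambda>t. k (t + \<sigma>) powr q)" by (rule integrable_shift(1)[OF ikq])
    have ir: "integrable lborel (\<lambda>t. r t powr p)" using s(2) by (simp add: r_def)
    have "(LINT t|lborel. \<bar>F' (t + \<sigma>) (F t) - F' t (F t)\<bar>) \<le>
       (LINT t|lborel. (\<Sum>y\<in>Y. \<bar>F' (t + \<sigma>) y - F' t y\<bar>)
        + (a powr q * k (t + \<sigma>) powr q + a powr q * k t powr q + 2 * (r t powr p / a powr p)))"
      using pt pairing_integrable[of \<sigma>] pairing_integrable[of 0] iY integrable_shift(1)[OF iY] ik\<sigma> ikq ir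
      by (intro integral_mono integrable_abs Bochner_Integration.integrable_diff Bochner_Integration.integrable_add
          Bochner_Integration.integrable_sum integrable_mult_right integrable_divide) auto
    also have "\<dots> = (\<Sum>y\<in>Y. LINT t|lborel. \<bar>F' (t + \<sigma>) y - F' t y\<bar>)
        + (a powr q * (LINT t|lborel. k (t + \<sigma>) powr q) + a powr q * K + 2 * ((LINT t|lborel. r t powr p) / a powr p))"
      using iYd ik\<sigma> ikq ir by (simp add: K_def)
    also have "(LINT t|lborel. k (t + \<sigma>) powr q) = K" unfolding K_def by (rule integrable_shift(2)[OF ikq])
    also have "(\<Sum>y\<in>Y. LINT t|lborel. \<bar>F' (t + \<sigma>) y - F' t y\<bar>) \<le> (\<Sum>y\<in>Y. e / (2 * (real (card Y) + 1)))"
      by (intro sum_mono less_imp_le[OF dd(2)] less_le_trans[OF \<sigma> d(2)])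
    also have "\<dots> \<le> e / 2"
    proof -
      have "(\<Sum>y\<in>Y. e / (2 * (real (card Y) + 1))) = (e / 2) * (real (card Y) / (real (card Y) + 1))" by simp
      also have "\<dots> \<le> (e / 2) * 1" using e by (intro mult_left_mono) auto
      finally show ?thesis by simp
    qed
    also have "2 * ((LINT t|lborel. r t powr p) / a powr p) < e / 4"
      using s(3) a by (simp add: r_def[symmetric] pos_divide_less_eq mult.commute)
    finally show ?thesis using aq by (simp add: algebra_simps)
  qed
  then show ?thesis using d(1) by blast
qed

text \<open>The difference quotient of \<open>B t t\<close> is an average of \<open>F' (t + \<sigma>) (F t)\<close> and
  \<open>F' (t + \<sigma>) (F (t + \<Delta>))\<close>; continuity of translations then gives the weak derivative
  \<open>2 * F' t (F t)\<close>.\<close>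

lemma energy_identity:
  fixes B :: "real \<Rightarrow> real \<Rightarrow> real"
  assumes T: "0 < T" and S: "S \<in> sets borel" "S \<subseteq> {0<..<T}"
    and full: "AE t in lborel. t \<in> {0<..<T} \<longrightarrow> t \<in> S"
    and out: "\<And>t. t \<notin> S \<Longrightarrow> F t = (\<lambda>_. 0)"
    and ft: "\<And>s t \<tau>. s \<in> S \<Longrightarrow> t \<in> S \<Longrightarrow> \<tau> \<in> S \<Longrightarrow> s \<le> t \<Longrightarrow>
        B t \<tau> - B s \<tau> = (LINT r|lborel. indicator {s..t} r * F' r (F \<tau>))"
    and sym: "\<And>s t. s \<in> S \<Longrightarrow> t \<in> S \<Longrightarrow> B s t = B t s"
    and s0: "s0 \<in> S" "\<xi> \<in> dual_space X N" "\<And>\<tau>. \<tau> \<in> S \<Longrightarrow> B s0 \<tau> = \<xi> (F \<tau>)"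
  shows "\<exists>c. AE t in lborel. t \<in> S \<longrightarrow> B t t = c + 2 * (LINT r|lborel. indicator {0..t} r * F' r (F r))"
proof -
  note [measurable] = S(1)
  define h where "h t = (if t \<in> S then B t t else 0)" for t
  define \<kappa> where "\<kappa> t = F' t (F t)" for t
  have i\<kappa>: "integrable lborel \<kappa>" unfolding \<kappa>_def using pairing_integrable[of 0] by simp
  note [measurable] = borel_measurable_integrable[OF i\<kappa>]
  have iK: "integrable lborel (\<lambda>r. indicator {s..t} r * F' r (F \<tau>))" for s t \<tau>
    using integrable_mult_indicator[of "{s..t}" lborel "\<lambda>r. F' r (F \<tau>)"] pairing_integrable_fst by simp
  \<comment> \<open>The signed indicator covers both orders of \<open>s0\<close> and
    \<open>t\<close>. It expresses \<open>B t t\<close> through \<open>F\<close> and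
    \<open>F'\<close> alone, which yields the measurability and integrability of \<open>h\<close>;
    nothing of the kind is assumed about \<open>B\<close>.\<close>
  define R where "R t = (LINT r|lborel. (indicator {s0..t} r - indicator {t..s0} r) * F' r (F t))" for t
  have Rm [measurable]: "R \<in> borel_measurable borel"
  proof -
    have "(\<lambda>t. LINT r|lborel. ((if s0 \<le> r \<and> r \<le> t then 1 else 0) - (if t \<le> r \<and> r \<le> s0 then 1 else 0)) * F' r (F t))
        \<in> borel_measurable borel" by measurable
    moreover have "R = (\<lambda>t. LINT r|lborel. ((if s0 \<le> r \<and> r \<le> t then 1 else 0) - (if t \<le> r \<and> r \<le> s0 then 1 else 0)) * F' r (F t))"
      unfolding R_def by (intro ext Bochner_Integration.integral_cong) (auto simp: indicator_def)
    ultimately show ?thesis by simp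
  qed
  have hR: "h t = indicator S t * (\<xi> (F t) + R t)" for t
  proof (cases "t \<in> S")
    case True
    have "R t = (LINT r|lborel. indicator {s0..t} r * F' r (F t)) - (LINT r|lborel. indicator {t..s0} r * F' r (F t))"
      unfolding R_def using iK by (simp add: left_diff_distrib)
    moreover have "B t t - B s0 t = \<dots>"
    proof (cases "s0 \<le> t")
      case le: True
      have "(LINT r|lborel. indicator {t..s0} r * F' r (F t)) = 0"
      proof (cases "t = s0")
        case True
        show ?thesis
          by (rule integral_eq_zero_AE, rule AE_mp[OF AE_lborel_singleton[of t]])
            (use True in \<open>auto simp: indicator_def\<close>)
      qed (use le in auto)
      then show ?thesis using ft[OF s0(1) True True le] by simp
    next
      case False
      then show ?thesis using ft[OF True s0(1) True] by simp
    qed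
    ultimately show ?thesis using s0(3)[OF True] True by (simp add: h_def)
  qed (simp add: h_def)
  have \<xi>m [measurable]: "(\<lambda>t. \<xi> (F t)) \<in> borel_measurable borel"
    using borel_limit_pairing_diag[OF F D.borel_limit_const[OF s0(2)]] by simp
  have hm [measurable]: "h \<in> borel_measurable borel" unfolding hR[abs_def] by measurable
  have igS: "integrable lborel (\<lambda>t. g t)"
  proof (rule Bochner_Integration.integrable_bound)
    have "emeasure lborel S \<le> emeasure lborel {0<..<T}" using S by (intro emeasure_mono) auto
    also have "\<dots> < \<infinity>" using T by simp
    finally show "integrable lborel (\<lambda>t. indicator S t + g t powr p)"
      using S ig by (intro Bochner_Integration.integrable_add integrable_real_indicator) auto
    have "g t \<le> indicator S t + g t powr p" for t
    proof (cases "t \<in> S")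
      case True
      show ?thesis
      proof (cases "g t \<le> 1")
        case False
        then have "g t powr 1 \<le> g t powr p" using pq by (intro powr_mono) auto
        then show ?thesis using False True by simp
      qed (use True in \<open>simp add: add_increasing2\<close>)
    qed (simp add: out N_zero)
    then show "AE t in lborel. norm (g t) \<le> norm (indicator S t + g t powr p)"
      using g_nonneg by (auto intro!: AE_I2 order_trans[OF _ abs_ge_self])
  qed simp
  have ih: "integrable lborel h"
  proof (rule Bochner_Integration.integrable_bound)
    show "integrable lborel (\<lambda>t. (dual_norm X N \<xi> + 2 * (LINT r|lborel. k r)) * g t)"
      using igS by simp
    have "\<bar>R t\<bar> \<le> 2 * (LINT r|lborel. k r) * g t" for t
    proof -
      have iR: "integrable lborel (\<lambda>r. (indicator {s0..t} r - indicator {t..s0} r) * F' r (F t))"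
        using iK by (simp add: left_diff_distrib)
      have "\<bar>R t\<bar> \<le> (LINT r|lborel. \<bar>(indicator {s0..t} r - indicator {t..s0} r) * F' r (F t)\<bar>)"
        unfolding R_def by (rule integral_abs_bound)
      also have "\<dots> \<le> (LINT r|lborel. 2 * (k r * g t))"
      proof (rule integral_mono)
        show "integrable lborel (\<lambda>r. 2 * (k r * g t))" using ik by simp
        fix r
        have "\<bar>indicator {s0..t} r - indicator {t..s0} r :: real\<bar> \<le> 2" by (auto simp: indicator_def)
        then show "\<bar>(indicator {s0..t} r - indicator {t..s0} r) * F' r (F t)\<bar> \<le> 2 * (k r * g t)"
          unfolding abs_mult using pairing_bound[of r t] by (intro mult_mono) auto
      qed (use iR in simp)
      finally show ?thesis using ik by simp
    qed
    moreover have "\<bar>\<xi> (F t)\<bar> \<le> dual_norm X N \<xi> * g t" for t by (rule dual_norm_bound[OF s0(2) FX])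
    ultimately have "\<bar>h t\<bar> \<le> (dual_norm X N \<xi> + 2 * (LINT r|lborel. k r)) * g t" for t
    proof -
      have "\<bar>h t\<bar> \<le> \<bar>\<xi> (F t) + R t\<bar>" by (simp add: hR indicator_def)
      also have "\<dots> \<le> dual_norm X N \<xi> * g t + 2 * (LINT r|lborel. k r) * g t"
        using \<open>\<And>t. \<bar>R t\<bar> \<le> 2 * (LINT r|lborel. k r) * g t\<close>[of t]
          \<open>\<And>t. \<bar>\<xi> (F t)\<bar> \<le> dual_norm X N \<xi> * g t\<close>[of t] by linarith
      finally show ?thesis by (simp add: algebra_simps)
    qed
    then show "AE t in lborel. norm (h t) \<le> norm ((dual_norm X N \<xi> + 2 * (LINT r|lborel. k r)) * g t)"
      by (auto intro!: AE_I2 order_trans[OF _ abs_ge_self])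
  qed simp
  have weak: "(LINT t|lborel. deriv \<theta> t * h t) = - (LINT t|lborel. \<theta> t * (2 * \<kappa> t))"
    if \<theta>: "test_function {0<..<T} \<theta>" for \<theta>
  proof -
    obtain a b where ab: "0 < a" "a \<le> b" "b < T" "\<And>t. t \<notin> {a..b} \<Longrightarrow> \<theta> t = 0"
      using test_function_support_interval[OF \<theta> T] by blast
    note d\<theta> = test_function_deriv[OF \<theta>]
    obtain C where C: "0 \<le> C" "\<And>t. \<bar>\<theta> t\<bar> \<le> C" using d\<theta>(3) by blast
    obtain C' where C': "0 \<le> C'" "\<And>t. \<bar>deriv \<theta> t\<bar> \<le> C'" using d\<theta>(4) by blast
    have [measurable]: "\<theta> \<in> borel_measurable borel" "deriv \<theta> \<in> borel_measurable borel"
      using \<theta> smooth_continuous_on d\<theta>(2) by (auto simp: test_function_def intro!: borel_measurable_continuous_onI)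
    have mb: "integrable lborel (\<lambda>t. \<theta> (t + c) * f t)" if "integrable lborel f" for f :: "real \<Rightarrow> real" and c
    proof (rule Bochner_Integration.integrable_bound)
      show "integrable lborel (\<lambda>t. C * \<bar>f t\<bar>)" using that by simp
      show "(\<lambda>t. \<theta> (t + c) * f t) \<in> borel_measurable lborel"
        using borel_measurable_integrable[OF that] by measurable
      show "AE t in lborel. norm (\<theta> (t + c) * f t) \<le> norm (C * \<bar>f t\<bar>)"
        using C by (intro AE_I2) (auto simp: abs_mult intro!: mult_right_mono)
    qed
    define \<delta> where "\<delta> n = 1 / real (Suc n)" for n
    have \<delta>0: "0 < \<delta> n" for n by (simp add: \<delta>_def)
    have \<delta>lim: "\<delta> \<longlonglongrightarrow> 0" unfolding \<delta>_def by (rule LIMSEQ_Suc[OF lim_1_over_n])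
    \<comment> \<open>This number is evaluated twice. With the difference moved to \<theta> it tends
      to the weak derivative of \<open>h\<close>; with the difference left on \<open>h\<close> it is
      compared with \<open>A'\<close>, whose limit is the integral against the pairing.\<close>
    define A where "A n = (LINT t|lborel. \<theta> t * (h (t + \<delta> n) - h t)) / \<delta> n" for n
    have lim1: "A \<longlonglongrightarrow> (LINT t|lborel. - (deriv \<theta> t * h t))"
    proof -
      have Aeq: "A n = (LINT t|lborel. (\<theta> (t + - \<delta> n) - \<theta> t) / \<delta> n * h t)" for n
      proof -
        have i1: "integrable lborel (\<lambda>t. \<theta> t * h (t + \<delta> n))"
          using mb[OF integrable_shift(1)[OF ih], of 0 "\<delta> n"] by simp
        have i2: "integrable lborel (\<lambda>t. \<theta> t * h t)" using mb[OF ih, of 0] by simp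
        have i3: "integrable lborel (\<lambda>t. \<theta> (t + - \<delta> n) * h t)" by (rule mb[OF ih])
        have "(LINT t|lborel. \<theta> t * h (t + \<delta> n)) = (LINT t|lborel. \<theta> (t + - \<delta> n) * h t)"
          using integrable_shift(2)[OF i3, of "\<delta> n"] by simp
        then have "(LINT t|lborel. \<theta> t * (h (t + \<delta> n) - h t)) = (LINT t|lborel. (\<theta> (t + - \<delta> n) - \<theta> t) * h t)"
          using i1 i2 i3 by (simp add: right_diff_distrib left_diff_distrib)
        then show ?thesis by (simp add: A_def)
      qed
      show ?thesis unfolding Aeq
      proof (rule integral_dominated_convergence[where w="\<lambda>t. C' * \<bar>h t\<bar>"])
        show "AE t in lborel. (\<lambda>n. (\<theta> (t + - \<delta> n) - \<theta> t) / \<delta> n * h t) \<longlonglongrightarrow> - (deriv \<theta> t * h t)"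
        proof (rule AE_I2)
          fix t
          have "((\<lambda>x. (\<theta> (t + x) - \<theta> t) / x) \<longlongrightarrow> deriv \<theta> t) (at 0)"
            using d\<theta>(1)[of t] by (simp add: DERIV_def)
          moreover have "filterlim (\<lambda>n. - \<delta> n) (at 0) sequentially"
            unfolding filterlim_at using tendsto_minus[OF \<delta>lim] \<delta>0
            by (auto intro!: always_eventually simp: less_imp_neq[THEN not_sym])
          ultimately have "(\<lambda>n. (\<theta> (t + - \<delta> n) - \<theta> t) / (- \<delta> n)) \<longlonglongrightarrow> deriv \<theta> t"
            by (rule filterlim_compose)
          from tendsto_mult[OF tendsto_minus[OF this] tendsto_const[of "h t"]]
          show "(\<lambda>n. (\<theta> (t + - \<delta> n) - \<theta> t) / \<delta> n * h t) \<longlonglongrightarrow> - (deriv \<theta> t * h t)" by simp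
        qed
        show "AE t in lborel. norm ((\<theta> (t + - \<delta> n) - \<theta> t) / \<delta> n * h t) \<le> C' * \<bar>h t\<bar>" for n
        proof (rule AE_I2)
          fix t
          obtain z where "\<theta> t - \<theta> (t + - \<delta> n) = (t - (t + - \<delta> n)) * deriv \<theta> z"
            using MVT2[of "t + - \<delta> n" t \<theta> "deriv \<theta>"] d\<theta>(1) \<delta>0[of n] by auto
          then have "\<bar>\<theta> (t + - \<delta> n) - \<theta> t\<bar> = \<delta> n * \<bar>deriv \<theta> z\<bar>"
            using \<delta>0[of n] by (metis abs_minus_commute abs_mult abs_of_pos add_diff_cancel_left' diff_add_cancel uminus_add_conv_diff add.commute diff_minus_eq_add)
          then have "\<bar>(\<theta> (t + - \<delta> n) - \<theta> t) / \<delta> n\<bar> \<le> C'"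
            using C'(2)[of z] \<delta>0[of n] by (simp add: abs_divide)
          then show "norm ((\<theta> (t + - \<delta> n) - \<theta> t) / \<delta> n * h t) \<le> C' * \<bar>h t\<bar>"
            by (simp only: real_norm_def abs_mult) (rule mult_right_mono, auto)
        qed
      qed (use ih in auto)
    qed
    define A' where "A' n = (LINT t|lborel. \<theta> t * (\<kappa> (t + \<delta> n) + \<kappa> t))" for n
    have lim2: "A' \<longlonglongrightarrow> (LINT t|lborel. \<theta> t * (2 * \<kappa> t))"
    proof (rule LIMSEQ_I)
      fix e :: real assume e: "0 < e"
      obtain d where d: "d > 0" "\<And>\<sigma>. \<bar>\<sigma>\<bar> < d \<Longrightarrow> (LINT t|lborel. \<bar>\<kappa> (t + \<sigma>) - \<kappa> t\<bar>) < e / (C + 1)"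
        using translation_continuous_L1[OF i\<kappa>, of "e / (C + 1)"] e C(1) by auto
      obtain n0 where n0: "\<And>n. n \<ge> n0 \<Longrightarrow> \<bar>\<delta> n\<bar> < d"
        using LIMSEQ_D[OF \<delta>lim d(1)] by auto
      have "norm (A' n - (LINT t|lborel. \<theta> t * (2 * \<kappa> t))) < e" if n: "n \<ge> n0" for n
      proof -
        have i1: "integrable lborel (\<lambda>t. \<theta> t * \<kappa> (t + \<delta> n))"
          using mb[OF integrable_shift(1)[OF i\<kappa>], of 0 "\<delta> n"] by simp
        have i2: "integrable lborel (\<lambda>t. \<theta> t * \<kappa> t)" using mb[OF i\<kappa>, of 0] by simp
        have id: "integrable lborel (\<lambda>t. \<bar>\<kappa> (t + \<delta> n) - \<kappa> t\<bar>)"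
          using i\<kappa> integrable_shift(1)[OF i\<kappa>] by auto
        have "A' n - (LINT t|lborel. \<theta> t * (2 * \<kappa> t)) = (LINT t|lborel. \<theta> t * (\<kappa> (t + \<delta> n) - \<kappa> t))"
          unfolding A'_def using i1 i2 by (simp add: distrib_left right_diff_distrib mult.left_commute[of _ 2])
        also have "\<bar>\<dots>\<bar> \<le> (LINT t|lborel. \<bar>\<theta> t * (\<kappa> (t + \<delta> n) - \<kappa> t)\<bar>)" by (rule integral_abs_bound)
        also have "\<dots> \<le> (LINT t|lborel. (C + 1) * \<bar>\<kappa> (t + \<delta> n) - \<kappa> t\<bar>)"
        proof (rule integral_mono)
          show "integrable lborel (\<lambda>t. \<bar>\<theta> t * (\<kappa> (t + \<delta> n) - \<kappa> t)\<bar>)"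
            using i1 i2 by (simp add: right_diff_distrib)
          fix t
          have "\<bar>\<theta> t\<bar> \<le> C + 1" using C(2)[of t] by simp
          then show "\<bar>\<theta> t * (\<kappa> (t + \<delta> n) - \<kappa> t)\<bar> \<le> (C + 1) * \<bar>\<kappa> (t + \<delta> n) - \<kappa> t\<bar>"
            unfolding abs_mult by (intro mult_right_mono) auto
        qed (use id in simp)
        also have "\<dots> = (C + 1) * (LINT t|lborel. \<bar>\<kappa> (t + \<delta> n) - \<kappa> t\<bar>)" by simp
        also have "\<dots> < e" using d(2)[OF n0[OF n]] C(1) by (simp add: pos_less_divide_eq mult.commute)
        finally show ?thesis by simp
      qed
      then show "\<exists>n0. \<forall>n\<ge>n0. norm (A' n - (LINT t|lborel. \<theta> t * (2 * \<kappa> t))) < e" by blast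
    qed
    have lim3: "(\<lambda>n. A n - A' n) \<longlonglongrightarrow> 0"
    proof (rule LIMSEQ_I)
      fix e :: real assume e: "0 < e"
      define \<epsilon> where "\<epsilon> = e / (2 * C + 1)"
      have \<epsilon>: "0 < \<epsilon>" using e C(1) by (simp add: \<epsilon>_def)
      obtain d where d: "d > 0" "\<And>\<sigma>. \<bar>\<sigma>\<bar> < d \<Longrightarrow> (LINT t|lborel. \<bar>F' (t + \<sigma>) (F t) - \<kappa> t\<bar>) < \<epsilon>"
        using pairing_translation_continuous[OF \<epsilon>] by (auto simp: \<kappa>_def)
      \<comment> \<open>The bound \<open>T - b\<close> keeps \<open>t + \<Delta>\<close> inside the
        interval for \<open>t\<close> in the support of \<theta>.\<close>
      obtain n0 where n0: "\<And>n. n \<ge> n0 \<Longrightarrow> \<bar>\<delta> n\<bar> < min d (T - b)"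
        using LIMSEQ_D[OF \<delta>lim, of "min d (T - b)"] d(1) ab(3) by auto
      have "norm (A n - A' n - 0) < e" if n: "n \<ge> n0" for n
      proof -
        define \<Delta> where "\<Delta> = \<delta> n"
        have \<Delta>: "0 < \<Delta>" "\<Delta> < d" "\<Delta> < T - b" using n0[OF n] \<delta>0[of n] by (auto simp: \<Delta>_def)
        define E where "E t = \<theta> t * (h (t + \<Delta>) - h t) - \<Delta> * (\<theta> t * (\<kappa> (t + \<Delta>) + \<kappa> t))" for t
        \<comment> \<open>The error at shift \<sigma> when the two integrands are replaced by
          \<open>\<kappa> (t + \<Delta>)\<close> and \<open>\<kappa> t\<close>.\<close>
        define P where "P t \<sigma> = \<bar>F' (t + \<sigma>) (F (t + \<Delta>)) - \<kappa> (t + \<Delta>)\<bar> + \<bar>F' (t + \<sigma>) (F t) - \<kappa> t\<bar>" for t \<sigma>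
        have i1: "integrable lborel (\<lambda>t. \<theta> t * (h (t + \<Delta>) - h t))"
          using mb[OF integrable_shift(1)[OF ih], of 0 \<Delta>] mb[OF ih, of 0] by (simp add: right_diff_distrib)
        have i2: "integrable lborel (\<lambda>t. \<theta> t * (\<kappa> (t + \<Delta>) + \<kappa> t))"
          using mb[OF integrable_shift(1)[OF i\<kappa>], of 0 \<Delta>] mb[OF i\<kappa>, of 0] by (simp add: distrib_left)
        have iE: "integrable lborel E" unfolding E_def using i1 i2 by simp
        have "AE t in lborel. t + \<Delta> \<in> {0<..<T} \<longrightarrow> t + \<Delta> \<in> S"
          using AE_borel_affine[of 1 "\<lambda>t. t \<in> {0<..<T} \<longrightarrow> t \<in> S" \<Delta>] full by (simp add: add.commute)
        then have AEE: "AE t in lborel. ennreal \<bar>E t\<bar> \<le> ennreal C * (\<integral>\<^sup>+\<sigma>. indicator {0..\<Delta>} \<sigma> * ennreal (P t \<sigma>) \<partial>lborel)"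
          using full
        proof eventually_elim
          case (elim t)
          show ?case
          proof (cases "\<theta> t = 0")
            case False
            then have "t \<in> {a..b}" using ab(4) by blast
            then have tS: "t \<in> S" "t + \<Delta> \<in> S" using elim ab \<Delta> by auto
            let ?I = "\<lambda>\<tau>. (LINT \<sigma>|lborel. indicator {0..\<Delta>} \<sigma> * F' (t + \<sigma>) (F \<tau>))"
            have iI: "integrable lborel (\<lambda>\<sigma>. indicator {0..\<Delta>} \<sigma> * F' (t + \<sigma>) (F \<tau>))" for \<tau>
              using integrable_shift(1)[OF iK[of t "t + \<Delta>" \<tau>], of t]
              by (rule back_subst) (auto simp: fun_eq_iff indicator_def add.commute)
            have I: "B (t + \<Delta>) \<tau> - B t \<tau> = ?I \<tau>" if "\<tau> \<in> S" for \<tau>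
            proof -
              have "B (t + \<Delta>) \<tau> - B t \<tau> = (LINT r|lborel. indicator {t..t + \<Delta>} r * F' r (F \<tau>))"
                using ft[OF tS that] \<Delta> by simp
              also have "\<dots> = (LINT \<sigma>|lborel. indicator {t..t + \<Delta>} (\<sigma> + t) * F' (\<sigma> + t) (F \<tau>))"
                using integrable_shift(2)[OF iK[of t "t + \<Delta>" \<tau>], of t] by simp
              also have "\<dots> = ?I \<tau>"
                by (rule Bochner_Integration.integral_cong) (auto simp: indicator_def add.commute)
              finally show ?thesis .
            qed
            have ind: "integrable lborel (\<lambda>\<sigma>. indicator {0..\<Delta>} \<sigma> * c)" "(LINT \<sigma>|lborel. indicator {0..\<Delta>} \<sigma> * c) = \<Delta> * c" for c :: real
              using \<Delta>(1) by (auto intro!: integrable_mult_left integrable_real_indicator)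
            \<comment> \<open>Symmetry of \<open>B\<close> splits the increment on the diagonal into
              two increments of the first argument alone, to which \<open>ft\<close>
              applies.\<close>
            have "h (t + \<Delta>) - h t = (B (t + \<Delta>) (t + \<Delta>) - B t (t + \<Delta>)) + (B (t + \<Delta>) t - B t t)"
              using tS sym[OF tS] by (simp add: h_def)
            also have "\<dots> = ?I (t + \<Delta>) + ?I t" using I tS by simp
            finally have "E t = \<theta> t * (?I (t + \<Delta>) + ?I t - \<Delta> * \<kappa> (t + \<Delta>) - \<Delta> * \<kappa> t)"
              by (simp add: E_def algebra_simps)
            also have "?I (t + \<Delta>) + ?I t - \<Delta> * \<kappa> (t + \<Delta>) - \<Delta> * \<kappa> t =
               (LINT \<sigma>|lborel. indicator {0..\<Delta>} \<sigma> * F' (t + \<sigma>) (F (t + \<Delta>)) + indicator {0..\<Delta>} \<sigma> * F' (t + \<sigma>) (F t)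
                  - indicator {0..\<Delta>} \<sigma> * \<kappa> (t + \<Delta>) - indicator {0..\<Delta>} \<sigma> * \<kappa> t)"
              using iI ind \<Delta>(1) by simp
            finally have Et: "\<bar>E t\<bar> = \<bar>\<theta> t\<bar> * norm (LINT \<sigma>|lborel. indicator {0..\<Delta>} \<sigma> * F' (t + \<sigma>) (F (t + \<Delta>)) + indicator {0..\<Delta>} \<sigma> * F' (t + \<sigma>) (F t)
                  - indicator {0..\<Delta>} \<sigma> * \<kappa> (t + \<Delta>) - indicator {0..\<Delta>} \<sigma> * \<kappa> t)" (is "_ = _ * norm (LINT \<sigma>|lborel. ?J \<sigma>)")
              by (simp add: abs_mult)
            have "ennreal (norm (LINT \<sigma>|lborel. ?J \<sigma>)) \<le> (\<integral>\<^sup>+\<sigma>. ennreal (norm (?J \<sigma>)) \<partial>lborel)"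
              using iI ind(1) by (intro integral_norm_bound_ennreal) simp
            also have "\<dots> \<le> (\<integral>\<^sup>+\<sigma>. indicator {0..\<Delta>} \<sigma> * ennreal (P t \<sigma>) \<partial>lborel)"
              by (intro nn_integral_mono) (auto simp: indicator_def P_def simp del: ennreal_plus intro!: ennreal_leI)
            finally have le: "ennreal (norm (LINT \<sigma>|lborel. ?J \<sigma>)) \<le> (\<integral>\<^sup>+\<sigma>. indicator {0..\<Delta>} \<sigma> * ennreal (P t \<sigma>) \<partial>lborel)" .
            show ?thesis unfolding Et
              using C(2)[of t] le by (subst ennreal_mult) (auto intro!: mult_mono ennreal_leI)
          qed (simp add: E_def)
        qed
        have Pm [measurable]: "(\<lambda>(t, \<sigma>). P t \<sigma>) \<in> borel_measurable (lborel \<Otimes>\<^sub>M lborel)"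
          unfolding P_def by measurable
        have P\<sigma>: "(\<integral>\<^sup>+t. ennreal (P t \<sigma>) \<partial>lborel) \<le> ennreal (2 * \<epsilon>)" if \<sigma>: "\<sigma> \<in> {0..\<Delta>}" for \<sigma>
        proof -
          have b: "integrable lborel (\<lambda>t. \<bar>F' (t + u) (F t) - \<kappa> t\<bar>)" for u
            using pairing_integrable[of u] i\<kappa> by auto
          \<comment> \<open>Seen from time \<open>t + \<Delta>\<close> the functional is shifted by
            \<open>\<sigma> - \<Delta>\<close>, again of size below \<open>d\<close>, so one
            continuity estimate serves both summands of \<open>P\<close>.\<close>
          have eq: "(\<lambda>t. \<bar>F' (t + \<sigma>) (F (t + \<Delta>)) - \<kappa> (t + \<Delta>)\<bar>) = (\<lambda>t. (\<lambda>t. \<bar>F' (t + (\<sigma> - \<Delta>)) (F t) - \<kappa> t\<bar>) (t + \<Delta>))"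
            by (simp add: algebra_simps)
          have b1: "integrable lborel (\<lambda>t. \<bar>F' (t + \<sigma>) (F (t + \<Delta>)) - \<kappa> (t + \<Delta>)\<bar>)"
            unfolding eq by (rule integrable_shift(1)[OF b])
          have b2: "(LINT t|lborel. \<bar>F' (t + \<sigma>) (F (t + \<Delta>)) - \<kappa> (t + \<Delta>)\<bar>) < \<epsilon>"
            unfolding eq using d(2)[of "\<sigma> - \<Delta>"] \<sigma> \<Delta> by (subst integrable_shift(2)[OF b]) auto
          have "(\<integral>\<^sup>+t. ennreal (P t \<sigma>) \<partial>lborel) = ennreal (LINT t|lborel. P t \<sigma>)"
            by (rule nn_integral_eq_integral) (use b1 b in \<open>auto simp: P_def\<close>)
          also have "(LINT t|lborel. P t \<sigma>) \<le> 2 * \<epsilon>"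
            unfolding P_def using b1 b b2 d(2)[of \<sigma>] \<sigma> \<Delta> by simp
          finally show ?thesis by (simp add: ennreal_leI)
        qed
        \<comment> \<open>With nonnegative integrals the order of integration can be exchanged from
          measurability alone; integrating in \<open>t\<close> first makes the continuity estimate
          available for each fixed \<sigma>.\<close>
        have "ennreal (norm (LINT t|lborel. E t)) \<le> (\<integral>\<^sup>+t. ennreal \<bar>E t\<bar> \<partial>lborel)"
          using integral_norm_bound_ennreal[OF iE] by simp
        also have "\<dots> \<le> (\<integral>\<^sup>+t. ennreal C * (\<integral>\<^sup>+\<sigma>. indicator {0..\<Delta>} \<sigma> * ennreal (P t \<sigma>) \<partial>lborel) \<partial>lborel)"
          by (rule nn_integral_mono_AE[OF AEE])
        also have "\<dots> = ennreal C * (\<integral>\<^sup>+t. (\<integral>\<^sup>+\<sigma>. indicator {0..\<Delta>} \<sigma> * ennreal (P t \<sigma>) \<partial>lborel) \<partial>lborel)"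
          by (rule nn_integral_cmult) measurable
        also have "(\<integral>\<^sup>+t. (\<integral>\<^sup>+\<sigma>. indicator {0..\<Delta>} \<sigma> * ennreal (P t \<sigma>) \<partial>lborel) \<partial>lborel)
            = (\<integral>\<^sup>+\<sigma>. (\<integral>\<^sup>+t. indicator {0..\<Delta>} \<sigma> * ennreal (P t \<sigma>) \<partial>lborel) \<partial>lborel)"
          by (rule lborel_pair.Fubini') measurable
        also have "\<dots> \<le> (\<integral>\<^sup>+\<sigma>. ennreal (2 * \<epsilon>) * indicator {0..\<Delta>} \<sigma> \<partial>lborel)"
          using P\<sigma> by (intro nn_integral_mono) (auto simp: indicator_def)
        also have "\<dots> = ennreal (2 * \<epsilon>) * ennreal \<Delta>"
          using \<Delta>(1) by (subst nn_integral_cmult_indicator) auto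
        finally have "ennreal (norm (LINT t|lborel. E t)) \<le> ennreal (C * (2 * \<epsilon> * \<Delta>))"
          using C(1) \<epsilon> \<Delta>(1) by (simp add: ennreal_mult mult_left_mono)
        then have En: "\<bar>LINT t|lborel. E t\<bar> \<le> C * (2 * \<epsilon> * \<Delta>)"
          using C(1) \<epsilon> \<Delta>(1) by (subst (asm) ennreal_le_iff) auto
        have "(LINT t|lborel. E t) = \<Delta> * (A n - A' n)"
          unfolding E_def A_def A'_def using i1 i2 \<Delta>(1) by (simp add: \<Delta>_def[symmetric] right_diff_distrib)
        then have "\<Delta> * \<bar>A n - A' n\<bar> \<le> \<Delta> * (C * (2 * \<epsilon>))"
          using En \<Delta>(1) by (simp add: abs_mult mult_ac)
        then have "\<bar>A n - A' n\<bar> \<le> 2 * C * \<epsilon>" using \<Delta>(1) by (simp add: mult_ac)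
        also have "\<dots> < (2 * C + 1) * \<epsilon>" using \<epsilon> by (intro mult_strict_right_mono) auto
        also have "\<dots> = e" using C(1) by (simp add: \<epsilon>_def)
        finally show ?thesis by simp
      qed
      then show "\<exists>n0. \<forall>n\<ge>n0. norm (A n - A' n - 0) < e" by blast
    qed
    have "A \<longlonglongrightarrow> (LINT t|lborel. \<theta> t * (2 * \<kappa> t))"
      using tendsto_add[OF lim3 lim2] by simp
    from LIMSEQ_unique[OF lim1 this] show ?thesis by simp
  qed
  have "integrable lborel (\<lambda>t. 2 * \<kappa> t)" using i\<kappa> by simp
  from du_Bois_Reymond[OF T ih this weak]
  obtain c where c: "AE t in lborel. t \<in> {0<..<T} \<longrightarrow> h t = c + (LINT r|lborel. indicator {0..t} r * (2 * \<kappa> r))"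
    by blast
  have "AE t in lborel. t \<in> S \<longrightarrow> B t t = c + 2 * (LINT r|lborel. indicator {0..t} r * F' r (F r))"
    using c
  proof eventually_elim
    case (elim t)
    have "(LINT r|lborel. indicator {0..t} r * (2 * \<kappa> r)) = 2 * (LINT r|lborel. indicator {0..t} r * F' r (F r))"
      by (simp add: \<kappa>_def mult.left_commute[of _ 2])
    then show ?case using elim S(2) by (auto simp: h_def)
  qed
  then show ?thesis by blast
qed

text \<open>Both times are compared with a time \<open>s\<close> between them at which \<open>N (F s) powr p\<close> does not exceed
  its average (plus one), which makes the mixed term \<open>F' r (F s)\<close> integrable with a uniform bound.\<close>

lemma distance_bound:
  fixes B :: "real \<Rightarrow> real \<Rightarrow> real"
  assumes S: "S \<in> sets borel" "S \<subseteq> {0<..<T}"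
    and full: "AE t in lborel. t \<in> {0<..<T} \<longrightarrow> t \<in> S"
    and ft: "\<And>s t \<tau>. s \<in> S \<Longrightarrow> t \<in> S \<Longrightarrow> \<tau> \<in> S \<Longrightarrow> s \<le> t \<Longrightarrow>
        B t \<tau> - B s \<tau> = (LINT r|lborel. indicator {s..t} r * F' r (F \<tau>))"
    and h: "\<And>s t. s \<in> S \<Longrightarrow> t \<in> S \<Longrightarrow> s \<le> t \<Longrightarrow>
        B t t - B s s = 2 * (LINT r|lborel. indicator {s..t} r * F' r (F r))"
    and tri: "\<And>s t \<tau>. s \<in> S \<Longrightarrow> t \<in> S \<Longrightarrow> \<tau> \<in> S \<Longrightarrow>
        B t t - 2 * B t \<tau> + B \<tau> \<tau> \<le> 2 * (B t t - 2 * B t s + B s s) + 2 * (B \<tau> \<tau> - 2 * B \<tau> s + B s s)"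
    and st: "t1 \<in> S" "t2 \<in> S" "t1 \<le> t2"
  shows "B t2 t2 - 2 * B t2 t1 + B t1 t1
     \<le> 16 * (LINT r|lborel. indicator {t1..t2} r * (k r powr q + g r powr p + 1))"
proof (cases "t1 = t2")
  case True
  have "0 \<le> (LINT r|lborel. indicator {t1..t2} r * (k r powr q + g r powr p + 1))"
    by (rule integral_nonneg_AE) simp
  then show ?thesis using True by simp
next
  case False
  define \<Delta> where "\<Delta> = t2 - t1"
  have \<Delta>: "0 < \<Delta>" using False st by (simp add: \<Delta>_def)
  let ?J = "{t1..t2}"
  have ind: "integrable lborel (indicator ?J :: real \<Rightarrow> real)" "(LINT r|lborel. (indicator ?J r :: real)) = \<Delta>"
    using \<Delta> by (auto intro!: integrable_real_indicator simp: \<Delta>_def)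
  have cutint: "integrable lborel (\<lambda>r. indicator A r * f r)" if "integrable lborel f" "A \<in> sets borel" for f :: "real \<Rightarrow> real" and A
    using integrable_mult_indicator[of A lborel f] that by simp
  define GG where "GG = (LINT r|lborel. indicator ?J r * g r powr p)"
  define KK where "KK = (LINT r|lborel. indicator ?J r * k r powr q)"
  note iG = cutint[OF ig, of ?J] and iKq = cutint[OF ikq, of ?J]
  have m: "(LINT r|lborel. indicator ?J r * (k r powr q + g r powr p + 1)) = KK + GG + \<Delta>"
    using iG iKq ind by (simp add: distrib_left GG_def KK_def)
  \<comment> \<open>The added \<open>\<Delta>\<close> (one, after division by the length) makes the
    contradiction strict: integrating the opposite inequality would give
    \<open>\<Delta> * (GG + \<Delta>) \<le> GG * \<Delta>\<close>.\<close>
  have "\<exists>s\<in>S \<inter> ?J. g s powr p * \<Delta> \<le> GG + \<Delta>"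
  proof (rule ccontr)
    assume no: "\<not> ?thesis"
    have "AE r in lborel. indicator ?J r * (GG + \<Delta>) \<le> (indicator ?J r * g r powr p) * \<Delta>"
      using full
    proof eventually_elim
      case (elim r)
      have "t1 \<in> {0<..<T}" "t2 \<in> {0<..<T}" using st S(2) by auto
      then have "r \<in> ?J \<Longrightarrow> r \<in> S" using elim by auto
      then show ?case using no by (cases "r \<in> ?J") (auto simp: indicator_def not_le intro: less_imp_le)
    qed
    then have "(LINT r|lborel. indicator ?J r * (GG + \<Delta>)) \<le> (LINT r|lborel. (indicator ?J r * g r powr p) * \<Delta>)"
      using ind iG by (intro integral_mono_AE integrable_mult_left) auto
    then have "\<Delta> * (GG + \<Delta>) \<le> GG * \<Delta>" using ind iG by (simp add: GG_def)
    then show False using \<Delta> by (simp add: algebra_simps mult_le_0_iff)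
  qed
  then obtain s where s: "s \<in> S" "s \<in> ?J" "g s powr p * \<Delta> \<le> GG + \<Delta>" by blast
  have sub_bound: "\<bar>LINT r|lborel. indicator {x..y} r * f r\<bar> \<le> (LINT r|lborel. indicator ?J r * w r)"
    if f: "integrable lborel f" and w: "integrable lborel (\<lambda>r. indicator ?J r * w r)" and fw: "\<And>r. \<bar>f r\<bar> \<le> w r"
      and xy: "x \<in> ?J" "y \<in> ?J" for x y and f w :: "real \<Rightarrow> real"
  proof -
    have "\<bar>LINT r|lborel. indicator {x..y} r * f r\<bar> \<le> (LINT r|lborel. \<bar>indicator {x..y} r * f r\<bar>)"
      by (rule integral_abs_bound)
    also have "\<dots> \<le> (LINT r|lborel. indicator ?J r * w r)"
    proof (rule integral_mono)
      show "integrable lborel (\<lambda>r. \<bar>indicator {x..y} r * f r\<bar>)" using cutint[OF f, of "{x..y}"] by auto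
      fix r
      have "0 \<le> w r" using fw[of r] by linarith
      then show "\<bar>indicator {x..y} r * f r\<bar> \<le> indicator ?J r * w r"
        using fw[of r] xy by (auto simp: indicator_def)
    qed (rule w)
    finally show ?thesis .
  qed
  have ik: "integrable lborel (\<lambda>r. F' r (F r))" using pairing_integrable[of 0] by simp
  have b1: "\<bar>LINT r|lborel. indicator {x..y} r * F' r (F r)\<bar> \<le> KK + GG" if "x \<in> ?J" "y \<in> ?J" for x y
  proof -
    have "\<bar>LINT r|lborel. indicator {x..y} r * F' r (F r)\<bar> \<le> (LINT r|lborel. indicator ?J r * (k r powr q + g r powr p))"
      using iG iKq by (intro sub_bound ik pairing_young that) (simp add: distrib_left)
    also have "\<dots> = KK + GG" using iG iKq by (simp add: distrib_left GG_def KK_def)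
    finally show ?thesis .
  qed
  have b2: "\<bar>LINT r|lborel. indicator {x..y} r * F' r (F s)\<bar> \<le> KK + (GG + \<Delta>)" if "x \<in> ?J" "y \<in> ?J" for x y
  proof -
    have "\<bar>LINT r|lborel. indicator {x..y} r * F' r (F s)\<bar> \<le> (LINT r|lborel. indicator ?J r * (k r powr q + g s powr p))"
      using iKq ind by (intro sub_bound pairing_integrable_fst pairing_young that) (simp add: distrib_left)
    also have "\<dots> = KK + g s powr p * \<Delta>" using iKq ind by (simp add: distrib_left KK_def mult.commute)
    finally show ?thesis using s(3) by linarith
  qed
  \<comment> \<open>The squared distance equals
    \<open>(B x x - B s s) + 2 * (B s s - B x s)\<close>, and each increment is a time integral
    controlled by \<open>b1\<close> or \<open>b2\<close>. Passing from \<open>t1\<close> to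
    \<open>t2\<close> through \<open>s\<close> with \<open>tri\<close> then turns 4 into 16.\<close>
  have ds: "B x x - 2 * B x s + B s s \<le> 4 * (KK + GG + \<Delta>)" if x: "x \<in> S" "x \<in> ?J" for x
  proof -
    have "\<bar>B x x - B s s\<bar> \<le> 2 * (KK + GG) \<and> \<bar>B x s - B s s\<bar> \<le> KK + (GG + \<Delta>)"
    proof (cases "s \<le> x")
      case True
      then show ?thesis
        using h[OF s(1) x(1)] ft[OF s(1) x(1) s(1)] b1[OF s(2) x(2)] b2[OF s(2) x(2)] by (simp add: abs_mult)
    next
      case False
      then have "B s s - B x x = 2 * (LINT r|lborel. indicator {x..s} r * F' r (F r))"
        "B s s - B x s = (LINT r|lborel. indicator {x..s} r * F' r (F s))"
        using h[OF x(1) s(1)] ft[OF x(1) s(1) s(1)] by auto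
      then show ?thesis using b1[OF x(2) s(2)] b2[OF x(2) s(2)]
        by (simp add: abs_minus_commute[of "B x x"] abs_minus_commute[of "B x s"] abs_mult)
    qed
    then have "B x x - B s s \<le> 2 * (KK + GG)" "B s s - B x s \<le> KK + (GG + \<Delta>)"
      by (auto simp: abs_le_iff)
    then show ?thesis using \<Delta> by argo
  qed
  have "B t2 t2 - 2 * B t2 t1 + B t1 t1 \<le> 2 * (B t2 t2 - 2 * B t2 s + B s s) + 2 * (B t1 t1 - 2 * B t1 s + B s s)"
    by (rule tri[OF s(1) st(2,1)])
  also have "\<dots> \<le> 16 * (KK + GG + \<Delta>)" using ds[of t2] ds[of t1] st by simp
  finally show ?thesis unfolding m .
qed

end

section \<open>Square integrable functions\<close>

lemma L2_iff:
  "f \<in> Lp 2 M \<longleftrightarrow> f \<in> borel_measurable M \<and> integrable M (\<lambda>x. (norm (f x))\<^sup>2)"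
  by (simp add: Lp_iff)

lemma L2_inner_integrable:
  fixes f g :: "'a \<Rightarrow> 'b::euclidean_space"
  assumes "f \<in> Lp 2 M" "g \<in> Lp 2 M"
  shows "integrable M (\<lambda>x. f x \<bullet> g x)"
proof (rule Bochner_Integration.integrable_bound)
  show "integrable M (\<lambda>x. (norm (f x))\<^sup>2 + (norm (g x))\<^sup>2)" using assms by (simp add: L2_iff)
  show "(\<lambda>x. f x \<bullet> g x) \<in> borel_measurable M" using assms by (auto simp: L2_iff)
  have "\<bar>a \<bullet> b\<bar> \<le> (norm a)\<^sup>2 + (norm b)\<^sup>2" for a b :: 'b
  proof -
    have "\<bar>a \<bullet> b\<bar> \<le> norm a * norm b" by (rule Cauchy_Schwarz_ineq2)
    also have "\<dots> \<le> (norm a)\<^sup>2 + (norm b)\<^sup>2"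
    proof -
      have "0 \<le> norm a * norm b" by simp
      moreover have "2 * (norm a * norm b) \<le> (norm a)\<^sup>2 + (norm b)\<^sup>2"
        using sum_squares_bound[of "norm a" "norm b"] by (simp add: mult.assoc)
      ultimately show ?thesis by linarith
    qed
    finally show ?thesis .
  qed
  then show "AE x in M. norm (f x \<bullet> g x) \<le> norm ((norm (f x))\<^sup>2 + (norm (g x))\<^sup>2)"
    by (auto intro!: AE_I2)
qed

lemma L2_dist_eq:
  fixes f g :: "'a \<Rightarrow> 'b::euclidean_space"
  assumes f: "f \<in> Lp 2 M" and g: "g \<in> Lp 2 M"
  shows "(LINT x|M. (norm (f x - g x))\<^sup>2)
     = (LINT x|M. f x \<bullet> f x) - 2 * (LINT x|M. f x \<bullet> g x) + (LINT x|M. g x \<bullet> g x)"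
proof -
  have "(LINT x|M. (norm (f x - g x))\<^sup>2) = (LINT x|M. f x \<bullet> f x - 2 * (f x \<bullet> g x) + g x \<bullet> g x)"
    by (intro Bochner_Integration.integral_cong)
      (auto simp: power2_norm_eq_inner inner_diff_left inner_diff_right inner_commute)
  then show ?thesis using L2_inner_integrable[OF f f] L2_inner_integrable[OF f g] L2_inner_integrable[OF g g] by simp
qed

lemma L2_diff: "f \<in> Lp 2 M \<Longrightarrow> g \<in> Lp 2 M \<Longrightarrow> (\<lambda>x. f x - g x) \<in> Lp 2 M"
  using seminormed.diff_mem[OF seminormed_Lp[of 2 M], of f g] by (simp add: fun_diff_def)

lemma L2_dist_tri:
  fixes f g h :: "'a \<Rightarrow> 'b::euclidean_space"
  assumes f: "f \<in> Lp 2 M" and g: "g \<in> Lp 2 M" and h: "h \<in> Lp 2 M"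
  shows "(LINT x|M. (norm (f x - h x))\<^sup>2)
     \<le> 2 * (LINT x|M. (norm (f x - g x))\<^sup>2) + 2 * (LINT x|M. (norm (g x - h x))\<^sup>2)"
proof -
  have i: "integrable M (\<lambda>x. (norm (f x - h x))\<^sup>2)" "integrable M (\<lambda>x. (norm (f x - g x))\<^sup>2)"
    "integrable M (\<lambda>x. (norm (g x - h x))\<^sup>2)"
    using L2_diff[OF f h] L2_diff[OF f g] L2_diff[OF g h] by (auto simp: L2_iff)
  have "(norm (a - c))\<^sup>2 \<le> 2 * (norm (a - b))\<^sup>2 + 2 * (norm (b - c))\<^sup>2" for a b c :: 'b
  proof -
    have "norm (a - c) \<le> norm (a - b) + norm (b - c)"
      using norm_triangle_ineq[of "a - b" "b - c"] by simp
    then have "(norm (a - c))\<^sup>2 \<le> (norm (a - b) + norm (b - c))\<^sup>2" by (intro power_mono) auto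
    also have "\<dots> \<le> 2 * (norm (a - b))\<^sup>2 + 2 * (norm (b - c))\<^sup>2"
      using sum_squares_bound[of "norm (a - b)" "norm (b - c)"] by (simp add: power2_sum)
    finally show ?thesis .
  qed
  then have "(LINT x|M. (norm (f x - h x))\<^sup>2) \<le> (LINT x|M. 2 * (norm (f x - g x))\<^sup>2 + 2 * (norm (g x - h x))\<^sup>2)"
    using i by (intro integral_mono) auto
  then show ?thesis using i by simp
qed

text \<open>The weight \<open>2 ^ n\<close> against the rate \<open>(1 / 8) ^ n\<close> leaves a
  convergent series of integrals. Hence almost everywhere the weighted squares stay bounded, the
  increments decay geometrically and \<open>f n x\<close> converges. Fatou's lemma carries the
  bounds over to the limit.\<close>

lemma L2_complete:
  fixes f :: "nat \<Rightarrow> 'a \<Rightarrow> 'b::euclidean_space"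
  assumes f: "\<And>n. f n \<in> Lp 2 M"
    and cauchy: "\<And>m n. n \<le> m \<Longrightarrow> (LINT x|M. (norm (f m x - f n x))\<^sup>2) \<le> (1 / 8) ^ n"
  obtains c where "c \<in> Lp 2 M" "\<And>n. (LINT x|M. (norm (c x - f n x))\<^sup>2) \<le> (1 / 8) ^ n"
proof -
  have fm [measurable]: "f n \<in> borel_measurable M" for n by (rule Lp_measurable[OF f])
  have id: "integrable M (\<lambda>x. (norm (f m x - f n x))\<^sup>2)" for m n
    using L2_diff[OF f f] by (simp add: L2_iff)
  have nnd: "(\<integral>\<^sup>+x. ennreal ((norm (f m x - f n x))\<^sup>2) \<partial>M) \<le> ennreal ((1 / 8) ^ n)" if "n \<le> m" for m n
    using nn_integral_eq_integral[OF id, of m n] cauchy[OF that] by (simp add: ennreal_leI)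
  have "(\<integral>\<^sup>+x. (\<Sum>n. ennreal (2 ^ n * (norm (f (Suc n) x - f n x))\<^sup>2)) \<partial>M)
      = (\<Sum>n. \<integral>\<^sup>+x. ennreal (2 ^ n * (norm (f (Suc n) x - f n x))\<^sup>2) \<partial>M)"
    by (rule nn_integral_suminf) measurable
  also have "\<dots> \<le> (\<Sum>n. ennreal ((1 / 4) ^ n))"
  proof (rule suminf_le)
    fix n
    have "(\<integral>\<^sup>+x. ennreal (2 ^ n * (norm (f (Suc n) x - f n x))\<^sup>2) \<partial>M)
       = ennreal (2 ^ n) * (\<integral>\<^sup>+x. ennreal ((norm (f (Suc n) x - f n x))\<^sup>2) \<partial>M)"
      by (subst ennreal_mult) (auto intro!: nn_integral_cmult)
    also have "\<dots> \<le> ennreal (2 ^ n) * ennreal ((1 / 8) ^ n)" by (intro mult_left_mono nnd) auto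
    also have "\<dots> = ennreal ((1 / 4) ^ n)" by (simp add: ennreal_mult[symmetric] power_mult_distrib[symmetric])
    finally show "(\<integral>\<^sup>+x. ennreal (2 ^ n * (norm (f (Suc n) x - f n x))\<^sup>2) \<partial>M) \<le> ennreal ((1 / 4) ^ n)" .
  qed auto
  also have "\<dots> = ennreal (\<Sum>n. (1 / 4) ^ n)"
    by (rule suminf_ennreal2) (auto intro: summable_geometric)
  also have "\<dots> < \<infinity>" by simp
  finally have "AE x in M. (\<Sum>n. ennreal (2 ^ n * (norm (f (Suc n) x - f n x))\<^sup>2)) \<noteq> \<infinity>"
    by (intro nn_integral_PInf_AE) auto
  then have conv: "AE x in M. convergent (\<lambda>n. f n x)"
  proof eventually_elim
    case (elim x)
    have "summable (\<lambda>n. 2 ^ n * (norm (f (Suc n) x - f n x))\<^sup>2)"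
      using elim by (intro summable_suminf_not_top) (auto simp: infinity_ennreal_def)
    then have "(\<lambda>n. 2 ^ n * (norm (f (Suc n) x - f n x))\<^sup>2) \<longlonglongrightarrow> 0" by (rule summable_LIMSEQ_zero)
    then have "Bseq (\<lambda>n. 2 ^ n * (norm (f (Suc n) x - f n x))\<^sup>2)" using convergentI convergent_imp_Bseq by blast
    then obtain K where K: "K > 0" "\<And>n. norm (2 ^ n * (norm (f (Suc n) x - f n x))\<^sup>2) \<le> K" by (auto simp: Bseq_def)
    have "norm (f (Suc n) x - f n x) \<le> sqrt K * (1 / sqrt 2) ^ n" for n
    proof -
      have "(norm (f (Suc n) x - f n x))\<^sup>2 \<le> K * (1 / 2) ^ n"
        using K(2)[of n] by (simp add: abs_mult field_simps power_divide)
      also have "\<dots> = (sqrt K * (1 / sqrt 2) ^ n)\<^sup>2"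
      proof -
        have "(sqrt 2 ^ n)\<^sup>2 = (2 :: real) ^ n" by (simp add: power2_eq_square power_mult_distrib[symmetric])
        then show ?thesis using K(1) by (simp add: power_mult_distrib power_divide)
      qed
      finally show ?thesis using K(1) by (intro power2_le_imp_le[of "norm _"]) auto
    qed
    then have le: "norm (norm (f (Suc n) x - f n x)) \<le> sqrt K * (1 / sqrt 2) ^ n" for n by simp
    have "summable (\<lambda>n. sqrt K * (1 / sqrt 2) ^ n)" by (intro summable_mult summable_geometric) simp
    then have "summable (\<lambda>n. norm (f (Suc n) x - f n x))"
      by (rule summable_comparison_test'[of _ 0]) (rule le)
    then have "summable (\<lambda>n. f (Suc n) x - f n x)" by (rule summable_norm_cancel)
    then have "convergent (\<lambda>n. \<Sum>i<n. f (Suc i) x - f i x)" by (simp add: summable_iff_convergent)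
    then have "convergent (\<lambda>n. f n x - f 0 x)" by (simp add: sum_lessThan_telescope[of "\<lambda>n. f n x"])
    then show ?case unfolding convergent_diff_const_right_iff .
  qed
  define c where "c x = lim (\<lambda>n. f n x)" for x
  have cm [measurable]: "c \<in> borel_measurable M" unfolding c_def by measurable
  have fatou: "(\<integral>\<^sup>+x. ennreal ((norm (c x - f n x))\<^sup>2) \<partial>M) \<le> ennreal ((1 / 8) ^ n)" for n
  proof -
    have "(\<integral>\<^sup>+x. ennreal ((norm (c x - f n x))\<^sup>2) \<partial>M) = (\<integral>\<^sup>+x. liminf (\<lambda>m. ennreal ((norm (f m x - f n x))\<^sup>2)) \<partial>M)"
    proof (rule nn_integral_cong_AE, use conv in eventually_elim)
      case (elim x)
      then have "(\<lambda>m. f m x) \<longlonglongrightarrow> c x" unfolding c_def by (simp add: convergent_LIMSEQ_iff)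
      then have "(\<lambda>m. ennreal ((norm (f m x - f n x))\<^sup>2)) \<longlonglongrightarrow> ennreal ((norm (c x - f n x))\<^sup>2)"
        by (intro tendsto_intros)
      then show ?case by (metis lim_imp_Liminf sequentially_bot)
    qed
    also have "\<dots> \<le> liminf (\<lambda>m. \<integral>\<^sup>+x. ennreal ((norm (f m x - f n x))\<^sup>2) \<partial>M)"
      by (rule nn_integral_liminf) measurable
    also have "\<dots> \<le> ennreal ((1 / 8) ^ n)"
    proof (rule Liminf_le)
      show "\<forall>\<^sub>F m in sequentially. (\<integral>\<^sup>+x. ennreal ((norm (f m x - f n x))\<^sup>2) \<partial>M) \<le> ennreal ((1 / 8) ^ n)"
        using eventually_ge_at_top[of n] by eventually_elim (rule nnd)
    qed simp
    finally show ?thesis .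
  qed
  have ic: "integrable M (\<lambda>x. (norm (c x - f n x))\<^sup>2)" for n
    using fatou[of n] by (auto simp: integrable_iff_bounded intro: le_less_trans)
  have "(\<lambda>x. c x - f 0 x) \<in> Lp 2 M" using ic by (simp add: L2_iff)
  from seminormed.add_mem[OF seminormed_Lp this f[of 0]] have "c \<in> Lp 2 M" by simp
  moreover have "(LINT x|M. (norm (c x - f n x))\<^sup>2) \<le> (1 / 8) ^ n" for n
    using fatou[of n] nn_integral_eq_integral[OF ic, of n] by (simp add: ennreal_le_iff)
  ultimately show ?thesis by (rule that)
qed

section \<open>The continuous representative\<close>

lemma indefinite_integral_continuous:
  fixes f :: "real \<Rightarrow> real"
  assumes f: "integrable lborel f"
  shows "continuous_on UNIV (\<lambda>t. LINT r|lborel. indicator {0..t} r * f r)"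
  unfolding continuous_on_sequentially comp_def
proof (intro ballI allI impI)
  fix X :: "nat \<Rightarrow> real" and t assume X: "(\<forall>n. X n \<in> UNIV) \<and> X \<longlonglongrightarrow> t"
  have [measurable]: "f \<in> borel_measurable borel" using f by auto
  show "(\<lambda>n. LINT r|lborel. indicator {0..X n} r * f r) \<longlonglongrightarrow> (LINT r|lborel. indicator {0..t} r * f r)"
  proof (rule integral_dominated_convergence[where w="\<lambda>r. \<bar>f r\<bar>"])
    show "AE r in lborel. (\<lambda>n. indicator {0..X n} r * f r) \<longlonglongrightarrow> indicator {0..t} r * f r"
    proof (rule AE_mp[OF AE_lborel_singleton[of t]], intro AE_I2 impI)
      fix r assume "r \<noteq> t"
      have "\<forall>\<^sub>F n in sequentially. indicator {0..t} r * f r = indicator {0..X n} r * f r"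
      proof (cases "r < t")
        case True
        then have "\<forall>\<^sub>F n in sequentially. r < X n" using X by (intro order_tendstoD) auto
        then show ?thesis by eventually_elim (use True in \<open>auto simp: indicator_def\<close>)
      next
        case False
        then have "r > t" using \<open>r \<noteq> t\<close> by simp
        then have "\<forall>\<^sub>F n in sequentially. X n < r" using X by (intro order_tendstoD) auto
        then show ?thesis by eventually_elim (use \<open>r > t\<close> in \<open>auto simp: indicator_def\<close>)
      qed
      then show "(\<lambda>n. indicator {0..X n} r * f r) \<longlonglongrightarrow> indicator {0..t} r * f r"
        by (rule Lim_transform_eventually[OF tendsto_const])
    qed
  qed (use f in \<open>auto simp: indicator_def\<close>)
qed

lemma indefinite_integral_diff:
  fixes f :: "real \<Rightarrow> real"
  assumes f: "integrable lborel f" and st: "0 \<le> s" "s \<le> t"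
  shows "(LINT r|lborel. indicator {0..t} r * f r) - (LINT r|lborel. indicator {0..s} r * f r)
     = (LINT r|lborel. indicator {s..t} r * f r)"
proof -
  have i: "integrable lborel (\<lambda>r. indicator {a..b} r * f r)" for a b :: real
    using integrable_mult_indicator[of "{a..b}" lborel f] f by simp
  have "(LINT r|lborel. indicator {0..t} r * f r) = (LINT r|lborel. indicator {0..s} r * f r + indicator {s..t} r * f r)"
  proof (rule integral_cong_AE)
    show "AE r in lborel. indicator {0..t} r * f r = indicator {0..s} r * f r + indicator {s..t} r * f r"
      by (rule AE_mp[OF AE_lborel_singleton[of s]], intro AE_I2) (use st in \<open>auto simp: indicator_def\<close>)
  qed (use i in auto)
  then show ?thesis using i by simp
qed

lemma full_set_dense:
  fixes S :: "real set"
  assumes full: "AE t in lborel. t \<in> {0<..<T} \<longrightarrow> t \<in> S" and T: "0 < T" and t: "t \<in> {0..T}" and e: "0 < e"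
  shows "\<exists>s\<in>S \<inter> {0<..<T}. \<bar>s - t\<bar> < e"
proof (rule ccontr)
  assume no: "\<not> ?thesis"
  define a where "a = max 0 (t - e)"
  define b where "b = min T (t + e)"
  have ab: "a < b" using T t e by (auto simp: a_def b_def)
  have "AE r in lborel. r \<notin> {a<..<b}"
    using full by eventually_elim (use no in \<open>force simp: a_def b_def abs_less_iff\<close>)
  then have "emeasure lborel {a<..<b} = 0" by (subst (asm) AE_iff_measurable[of "{a<..<b}"]) auto
  then show False using ab by simp
qed

lemma continuous_eq_if_AE_eq:
  fixes f g :: "real \<Rightarrow> real"
  assumes T: "0 < T" and f: "continuous_on {0..T} f" and g: "continuous_on {0..T} g"
    and eq: "AE t in lborel. t \<in> {0<..<T} \<longrightarrow> f t = g t" and t: "t \<in> {0..T}"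
  shows "f t = g t"
proof (rule ccontr)
  assume ne: "f t \<noteq> g t"
  have "continuous_on {0..T} (\<lambda>t. \<bar>f t - g t\<bar>)" using f g by (intro continuous_intros)
  from this[unfolded continuous_on_iff, rule_format, OF t, of "\<bar>f t - g t\<bar>"]
  obtain d where d: "d > 0" "\<And>s. s \<in> {0..T} \<Longrightarrow> \<bar>s - t\<bar> < d \<Longrightarrow> \<bar>\<bar>f s - g s\<bar> - \<bar>f t - g t\<bar>\<bar> < \<bar>f t - g t\<bar>"
    using ne by (auto simp: dist_real_def)
  have "AE t in lborel. t \<in> {0<..<T} \<longrightarrow> t \<in> {s. f s = g s}" using eq by simp
  from full_set_dense[OF this T t d(1)] obtain s where "s \<in> {0<..<T}" "f s = g s" "\<bar>s - t\<bar> < d" by blast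
  then show False using d(2)[of s] by auto
qed

text \<open>\<open>m\<close> acts as a modulus of continuity: times of \<open>S\<close> with close
  values of \<open>m\<close> have close values of \<open>u\<close>, so \<open>u\<close> extends from
  the dense set \<open>S\<close> by completeness. At times of \<open>S\<close> the value is kept
  unchanged, which gives agreement almost everywhere.\<close>

lemma continuous_rep_exists:
  fixes \<Omega> :: "(real^'d) set" and u :: "real \<Rightarrow> real^'d \<Rightarrow> real^'l"
  defines "M \<equiv> lebesgue_on \<Omega>"
  assumes T: "0 < T" and S: "S \<subseteq> {0<..<T}" and full: "AE t in lborel. t \<in> {0<..<T} \<longrightarrow> t \<in> S"
    and u: "\<And>t. t \<in> S \<Longrightarrow> u t \<in> Lp 2 M"
    and m: "continuous_on {0..T} m"
    and le: "\<And>s t. s \<in> S \<Longrightarrow> t \<in> S \<Longrightarrow> (LINT x|M. (norm (u t x - u s x))\<^sup>2) \<le> \<bar>m t - m s\<bar>"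
  shows "\<exists>c. is_continuous_rep \<Omega> T u c"
proof -
  have ex: "\<exists>c. c \<in> Lp 2 M \<and> (t \<in> S \<longrightarrow> c = u t) \<and>
      (\<forall>n. \<exists>s\<in>S. \<bar>m s - m t\<bar> \<le> (1 / 8) ^ n \<and> (LINT x|M. (norm (c x - u s x))\<^sup>2) \<le> (1 / 8) ^ n)"
    if t: "t \<in> {0..T}" for t
  proof (cases "t \<in> S")
    case True
    then show ?thesis using u by (intro exI[of _ "u t"] conjI allI bexI[of _ t]) auto
  next
    case False
    \<comment> \<open>Half the rate is required because two such errors add up in the Cauchy
      estimate.\<close>
    have "\<exists>s\<in>S. \<bar>m s - m t\<bar> \<le> (1 / 8) ^ n / 2" for n
    proof -
      have "0 < (1 / 8 :: real) ^ n / 2" by simp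
      from m[unfolded continuous_on_iff, rule_format, OF t this]
      obtain d where d: "d > 0" "\<And>s. s \<in> {0..T} \<Longrightarrow> dist s t < d \<Longrightarrow> dist (m s) (m t) < (1 / 8) ^ n / 2"
        by blast
      obtain s where "s \<in> S" "s \<in> {0<..<T}" "\<bar>s - t\<bar> < d" using full_set_dense[OF full T t d(1)] by blast
      then show ?thesis using d(2)[of s] by (intro bexI[of _ s]) (auto simp: dist_real_def)
    qed
    then obtain \<tau> where \<tau>: "\<And>n. \<tau> n \<in> S" "\<And>n. \<bar>m (\<tau> n) - m t\<bar> \<le> (1 / 8) ^ n / 2" by metis
    have "(LINT x|M. (norm (u (\<tau> j) x - u (\<tau> i) x))\<^sup>2) \<le> (1 / 8) ^ i" if "i \<le> j" for i j
    proof -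
      have "(1 / 8 :: real) ^ j \<le> (1 / 8) ^ i" using that by (intro power_decreasing) auto
      then show ?thesis using le[OF \<tau>(1)[of i] \<tau>(1)[of j]] \<tau>(2)[of i] \<tau>(2)[of j] by linarith
    qed
    then obtain c where c: "c \<in> Lp 2 M" "\<And>n. (LINT x|M. (norm (c x - u (\<tau> n) x))\<^sup>2) \<le> (1 / 8) ^ n"
      by (rule L2_complete[of "\<lambda>n. u (\<tau> n)" M, OF u[OF \<tau>(1)]]) (assumption, rule that)
    have "\<bar>m (\<tau> n) - m t\<bar> \<le> (1 / 8) ^ n" for n using \<tau>(2)[of n] zero_less_power[of "1 / 8 :: real" n] by linarith
    then show ?thesis using False c \<tau>(1) by (intro exI[of _ c]) blast
  qed
  obtain c where cL: "\<And>t. t \<in> {0..T} \<Longrightarrow> c t \<in> Lp 2 M" and cu: "\<And>t. t \<in> {0..T} \<Longrightarrow> t \<in> S \<Longrightarrow> c t = u t"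
    and cs: "\<And>t n. t \<in> {0..T} \<Longrightarrow> \<exists>s\<in>S. \<bar>m s - m t\<bar> \<le> (1 / 8) ^ n \<and> (LINT x|M. (norm (c t x - u s x))\<^sup>2) \<le> (1 / 8) ^ n"
    using bchoice[of "{0..T}" "\<lambda>t c. c \<in> Lp 2 M \<and> (t \<in> S \<longrightarrow> c = u t) \<and>
      (\<forall>n. \<exists>s\<in>S. \<bar>m s - m t\<bar> \<le> (1 / 8) ^ n \<and> (LINT x|M. (norm (c x - u s x))\<^sup>2) \<le> (1 / 8) ^ n)"] ex
    by blast
  have bound: "(LINT x|M. (norm (c s x - c t x))\<^sup>2) \<le> 4 * \<bar>m s - m t\<bar>" if st: "s \<in> {0..T}" "t \<in> {0..T}" for s t
  proof (rule LIMSEQ_le_const)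
    have "(\<lambda>n. 4 * \<bar>m s - m t\<bar> + 16 * (1 / 8) ^ n) \<longlonglongrightarrow> 4 * \<bar>m s - m t\<bar> + 16 * 0"
      by (intro tendsto_intros LIMSEQ_power_zero) auto
    then show "(\<lambda>n. 4 * \<bar>m s - m t\<bar> + 16 * (1 / 8) ^ n) \<longlonglongrightarrow> 4 * \<bar>m s - m t\<bar>" by simp
    \<comment> \<open>Two triangle inequalities for squares cost the factor 4 in front of the
      modulus; the other errors amount to 14 times the rate, rounded up to 16, and vanish as
      \<open>n\<close> grows.\<close>
    have "(LINT x|M. (norm (c s x - c t x))\<^sup>2) \<le> 4 * \<bar>m s - m t\<bar> + 16 * (1 / 8) ^ n" for n
    proof -
      obtain s' where s': "s' \<in> S" "\<bar>m s' - m s\<bar> \<le> (1 / 8) ^ n" "(LINT x|M. (norm (c s x - u s' x))\<^sup>2) \<le> (1 / 8) ^ n"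
        using cs[OF st(1)] by blast
      obtain t' where t': "t' \<in> S" "\<bar>m t' - m t\<bar> \<le> (1 / 8) ^ n" "(LINT x|M. (norm (c t x - u t' x))\<^sup>2) \<le> (1 / 8) ^ n"
        using cs[OF st(2)] by blast
      have "(LINT x|M. (norm (c s x - c t x))\<^sup>2) \<le> 2 * (LINT x|M. (norm (c s x - u s' x))\<^sup>2) + 2 * (LINT x|M. (norm (u s' x - c t x))\<^sup>2)"
        by (intro L2_dist_tri cL st u s')
      moreover have "(LINT x|M. (norm (u s' x - c t x))\<^sup>2) \<le> 2 * (LINT x|M. (norm (u s' x - u t' x))\<^sup>2) + 2 * (LINT x|M. (norm (u t' x - c t x))\<^sup>2)"
        by (intro L2_dist_tri cL st u s' t')
      moreover have "(LINT x|M. (norm (u t' x - c t x))\<^sup>2) = (LINT x|M. (norm (c t x - u t' x))\<^sup>2)"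
        by (simp add: norm_minus_commute)
      moreover have "(LINT x|M. (norm (u s' x - u t' x))\<^sup>2) \<le> \<bar>m s' - m t'\<bar>" by (rule le[OF t'(1) s'(1)])
      moreover have "\<bar>m s' - m t'\<bar> \<le> \<bar>m s - m t\<bar> + 2 * (1 / 8) ^ n" using s'(2) t'(2) by linarith
      moreover have "0 \<le> (1 / 8 :: real) ^ n" by simp
      ultimately show ?thesis using s'(3) t'(3) by argo
    qed
    then show "\<exists>N. \<forall>n\<ge>N. (LINT x|M. (norm (c s x - c t x))\<^sup>2) \<le> 4 * \<bar>m s - m t\<bar> + 16 * (1 / 8) ^ n" by blast
  qed
  have "((\<lambda>s. Lp_norm 2 M (c s - c t)) \<longlongrightarrow> 0) (at t within {0..T})" if t: "t \<in> {0..T}" for t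
  proof (rule Lim_null_comparison)
    have "(m \<longlongrightarrow> m t) (at t within {0..T})" using m t by (simp add: continuous_on_def)
    then have "((\<lambda>s. sqrt (4 * \<bar>m s - m t\<bar>)) \<longlongrightarrow> sqrt (4 * \<bar>m t - m t\<bar>)) (at t within {0..T})"
      by (intro tendsto_intros)
    then show "((\<lambda>s. sqrt (4 * \<bar>m s - m t\<bar>)) \<longlongrightarrow> 0) (at t within {0..T})" by simp
    have "Lp_norm 2 M (c s - c t) \<le> sqrt (4 * \<bar>m s - m t\<bar>)" if "s \<in> {0..T}" for s
      using bound[OF that t] by (intro real_le_rsqrt) (simp add: Lp_norm_square)
    then show "\<forall>\<^sub>F s in at t within {0..T}. norm (Lp_norm 2 M (c s - c t)) \<le> sqrt (4 * \<bar>m s - m t\<bar>)"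
      by (auto simp: eventually_at_filter Lp_norm_nonneg)
  qed
  moreover have "AE t in lebesgue_on {0<..<T}. AE x in lebesgue_on \<Omega>. u t x = c t x"
  proof -
    have "AE t in lebesgue. t \<in> {0<..<T} \<longrightarrow> t \<in> S" using full by (rule AE_completion)
    then show ?thesis using cu by (auto simp: AE_restrict_space_iff elim!: eventually_mono)
  qed
  ultimately show ?thesis using cL unfolding is_continuous_rep_def M_def by blast
qed

section \<open>Integration by parts in time\<close>

text \<open>Bridge between the definitions, which integrate Lebesgue measurable functions over the
  interval, and the proofs, which use Borel functions on the whole line, where translations and
  product measures are at hand.\<close>

lemma integral_lebesgue_on_eq_lborel:
  fixes f g :: "real \<Rightarrow> real"
  assumes J: "J \<in> sets borel" and f [measurable]: "f \<in> borel_measurable borel"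
    and ae: "AE t in lborel. t \<in> J \<longrightarrow> g t = f t" and out: "\<And>t. t \<notin> J \<Longrightarrow> f t = 0"
  shows "(LINT t|lebesgue_on J. g t) = (LINT t|lborel. f t)"
    and "integrable (lebesgue_on J) g \<longleftrightarrow> integrable lborel f"
proof -
  let ?g = "\<lambda>t. if t \<in> J then g t else 0"
  have JL: "J \<in> sets lebesgue" using J by simp
  have fm: "f \<in> borel_measurable lebesgue" by (rule measurable_completion) simp
  have ae': "AE t in lebesgue. f t = ?g t"
    using AE_completion[OF ae] by eventually_elim (auto simp: out)
  have gm: "?g \<in> borel_measurable lebesgue" by (rule borel_measurable_AE[OF fm ae'])
  have "(LINT t|lebesgue_on J. g t) = (LINT t|lebesgue. ?g t)"
    by (rule Lebesgue_Measure.integral_restrict_UNIV[OF JL, symmetric])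
  also have "\<dots> = (LINT t|lebesgue. f t)" by (rule integral_cong_AE[OF gm fm]) (use ae' in eventually_elim, simp)
  also have "\<dots> = (LINT t|lborel. f t)" by (rule integral_completion) simp
  finally show "(LINT t|lebesgue_on J. g t) = (LINT t|lborel. f t)" .
  have "integrable (lebesgue_on J) g \<longleftrightarrow> integrable lebesgue ?g"
    by (rule Lebesgue_Measure.integrable_restrict_UNIV[OF JL, symmetric])
  also have "\<dots> \<longleftrightarrow> integrable lebesgue f"
    by (rule integrable_cong_AE[OF gm fm]) (use ae' in eventually_elim, simp)
  also have "\<dots> \<longleftrightarrow> integrable lborel f" by (rule integrable_completion) simp
  finally show "integrable (lebesgue_on J) g \<longleftrightarrow> integrable lborel f" .
qed

lemma AE_lborel_borel_set:
  fixes J :: "'a::euclidean_space set"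
  assumes J: "J \<in> sets borel" and ae: "AE t in lborel. t \<in> J \<longrightarrow> P t"
  obtains S where "S \<in> sets borel" "S \<subseteq> J" "AE t in lborel. t \<in> J \<longrightarrow> t \<in> S" "\<And>t. t \<in> S \<Longrightarrow> P t"
proof -
  have "AE t in lebesgue_on J. P t"
    using AE_completion[OF ae] J by (simp add: AE_restrict_space_iff)
  from AE_lebesgue_on_borel_set[OF J this] show ?thesis using that by blast
qed

lemma (in seminormed) dual_integrable_const:
  assumes F': "borel_limit (dual_space X N) (dual_norm X N) F'"
    and int: "integrable lborel (\<lambda>t. dual_norm X N (F' t))" and w: "w \<in> X"
  shows "integrable lborel (\<lambda>t. F' t w)"
proof (rule Bochner_Integration.integrable_bound)
  show "integrable lborel (\<lambda>t. dual_norm X N (F' t) * N w)" using int by simp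
  show "(\<lambda>t. F' t w) \<in> borel_measurable lborel"
    using borel_limit_pairing_diag[OF borel_limit_const[OF w] F'] by simp
  have "F' t \<in> dual_space X N" for t using F' by (simp add: borel_limit_def)
  then show "AE t in lborel. norm (F' t w) \<le> norm (dual_norm X N (F' t) * N w)"
    using dual_norm_bound[OF _ w] by (auto intro!: AE_I2 order_trans[OF _ abs_ge_self])
qed

text \<open>The abstract results are applied with \<open>B\<close> the inner product in H of two
  values of \<open>u\<close>. Exceptional times are removed in stages: \<open>S0\<close> secures
  membership and measurability, \<open>S1\<close> the tested time derivative, \<open>S2\<close> the
  energy identity. The formula is stated for every continuous representative because
  \<open>value_at\<close> merely chooses one.\<close>

lemma integration_by_parts:
  fixes \<Omega> \<Gamma>\<^sub>D :: "(real^'d) set" and u :: "real \<Rightarrow> real^'d \<Rightarrow> real^'l"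
  assumes V: "seminormed (W1p_D \<Omega> \<Gamma>\<^sub>D p :: (real^'d \<Rightarrow> real^'l) set) (W1p_norm \<Omega> p)"
    and pq: "1 < p" "1 < q" "1 / p + 1 / q = 1" and T: "0 < T"
    and u: "u \<in> bochner_Lp_V \<Omega> \<Gamma>\<^sub>D p p {0<..<T}"
    and d: "is_time_derivative \<Omega> \<Gamma>\<^sub>D p q T u u'"
  shows "\<exists>c. is_continuous_rep \<Omega> T u c"
    and "integrable (lebesgue_on {0<..<T}) (\<lambda>t. u' t (u t))"
    and "is_continuous_rep \<Omega> T u c \<Longrightarrow> (LINT t|lebesgue_on {0<..<T}. u' t (u t))
       = (1/2) * (Lp_norm 2 (lebesgue_on \<Omega>) (c T))\<^sup>2 - (1/2) * (Lp_norm 2 (lebesgue_on \<Omega>) (c 0))\<^sup>2"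
proof -
  define X where "X = (W1p_D \<Omega> \<Gamma>\<^sub>D p :: (real^'d \<Rightarrow> real^'l) set)"
  define N where "N = (W1p_norm \<Omega> p :: (real^'d \<Rightarrow> real^'l) \<Rightarrow> real)"
  let ?M = "lebesgue_on \<Omega>" and ?J = "{0<..<T}"
  let ?D = "dual_space X N" and ?dn = "dual_norm X N"
  interpret V: seminormed X N using V by (simp add: X_def N_def)
  interpret D: seminormed ?D ?dn by (rule V.seminormed_dual)
  define G where "G t = H_to_Vdual \<Omega> (u t)" for t
  have J: "?J \<in> sets borel" by simp
  have uB: "u \<in> bochner_Lp p ?J X N" using u by (simp add: X_def N_def)
  have u'q: "u' \<in> bochner_Lp q ?J ?D ?dn" and uH: "AE t in lebesgue_on ?J. u t \<in> Lp 2 ?M"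
    and u'1: "u' \<in> bochner_Lp 1 ?J ?D ?dn" and G1: "G \<in> bochner_Lp 1 ?J ?D ?dn"
    and weak: "\<And>\<theta> w. test_function ?J \<theta> \<Longrightarrow> w \<in> X \<Longrightarrow>
        (LINT t|lebesgue_on ?J. deriv \<theta> t * G t w) = - (LINT t|lebesgue_on ?J. \<theta> t * u' t w)"
    using d unfolding is_time_derivative_def has_weak_time_derivative_def X_def N_def G_def by auto
  obtain Su where Su: "Su \<in> sets borel" "Su \<subseteq> ?J" "AE t in lborel. t \<in> ?J \<longrightarrow> t \<in> Su" "\<And>t. t \<in> Su \<Longrightarrow> u t \<in> X"
    "\<And>S. S \<in> sets borel \<Longrightarrow> S \<subseteq> Su \<Longrightarrow> borel_limit X N (cut S u)"
    "\<And>S. S \<in> sets borel \<Longrightarrow> S \<subseteq> Su \<Longrightarrow> integrable lborel (\<lambda>t. N (cut S u t) powr p)"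
    by (rule V.bochner_Lp_borel_limit[OF J uB]) blast
  obtain Sd where Sd: "Sd \<in> sets borel" "Sd \<subseteq> ?J" "AE t in lborel. t \<in> ?J \<longrightarrow> t \<in> Sd" "\<And>t. t \<in> Sd \<Longrightarrow> u' t \<in> ?D"
    "\<And>S. S \<in> sets borel \<Longrightarrow> S \<subseteq> Sd \<Longrightarrow> borel_limit ?D ?dn (cut S u')"
    "\<And>S. S \<in> sets borel \<Longrightarrow> S \<subseteq> Sd \<Longrightarrow> integrable lborel (\<lambda>t. ?dn (cut S u' t) powr q)"
    by (rule D.bochner_Lp_borel_limit[OF J u'q]) blast
  obtain Se where Se: "Se \<in> sets borel" "Se \<subseteq> ?J" "AE t in lborel. t \<in> ?J \<longrightarrow> t \<in> Se" "\<And>t. t \<in> Se \<Longrightarrow> u' t \<in> ?D"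
    "\<And>S. S \<in> sets borel \<Longrightarrow> S \<subseteq> Se \<Longrightarrow> borel_limit ?D ?dn (cut S u')"
    "\<And>S. S \<in> sets borel \<Longrightarrow> S \<subseteq> Se \<Longrightarrow> integrable lborel (\<lambda>t. ?dn (cut S u' t) powr 1)"
    by (rule D.bochner_Lp_borel_limit[OF J u'1]) blast
  obtain SG where SG: "SG \<in> sets borel" "SG \<subseteq> ?J" "AE t in lborel. t \<in> ?J \<longrightarrow> t \<in> SG" "\<And>t. t \<in> SG \<Longrightarrow> G t \<in> ?D"
    "\<And>S. S \<in> sets borel \<Longrightarrow> S \<subseteq> SG \<Longrightarrow> borel_limit ?D ?dn (cut S G)"
    "\<And>S. S \<in> sets borel \<Longrightarrow> S \<subseteq> SG \<Longrightarrow> integrable lborel (\<lambda>t. ?dn (cut S G t) powr 1)"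
    by (rule D.bochner_Lp_borel_limit[OF J G1]) blast
  obtain SH where SH: "SH \<in> sets borel" "SH \<subseteq> ?J" "AE t in lborel. t \<in> ?J \<longrightarrow> t \<in> SH" "\<And>t. t \<in> SH \<Longrightarrow> u t \<in> Lp 2 ?M"
    by (rule AE_lebesgue_on_borel_set[OF J uH]) blast
  define S0 where "S0 = Su \<inter> Sd \<inter> Se \<inter> SG \<inter> SH"
  have S0: "S0 \<in> sets borel" "S0 \<subseteq> ?J" "S0 \<subseteq> Su" "S0 \<subseteq> Sd" "S0 \<subseteq> Se" "S0 \<subseteq> SG" "S0 \<subseteq> SH"
    using Su(1,2) Sd(1) Se(1) SG(1) SH(1) by (auto simp: S0_def)
  have full0: "AE t in lborel. t \<in> ?J \<longrightarrow> t \<in> S0"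
    using Su(3) Sd(3) Se(3) SG(3) SH(3) by eventually_elim (auto simp: S0_def)
  define F' where "F' = cut S0 u'"
  define G0 where "G0 = cut S0 G"
  have F'lim: "borel_limit ?D ?dn F'" unfolding F'_def by (rule Sd(5)[OF S0(1,4)])
  have G0lim: "borel_limit ?D ?dn G0" unfolding G0_def by (rule SG(5)[OF S0(1,6)])
  have ik: "integrable lborel (\<lambda>t. ?dn (F' t))"
    using Se(6)[OF S0(1,5)] D.nonneg[OF D.borel_limit_memD[OF F'lim]] by (simp add: F'_def)
  have iG: "integrable lborel (\<lambda>t. ?dn (G0 t))"
    using SG(6)[OF S0(1,6)] D.nonneg[OF D.borel_limit_memD[OF G0lim]] by (simp add: G0_def)
  note iF'w = V.dual_integrable_const[OF F'lim ik] and iGw = V.dual_integrable_const[OF G0lim iG]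
  \<comment> \<open>For a fixed \<open>w\<close> the weak time derivative is a scalar equation; both
    the constant and the null set of times still depend on \<open>w\<close>.\<close>
  have ex: "\<exists>C. AE t in lborel. t \<in> ?J \<longrightarrow> G0 t w = C + (LINT r|lborel. indicator {0..t} r * F' r w)" if w: "w \<in> X" for w
  proof (rule du_Bois_Reymond[OF T iGw[OF w] iF'w[OF w]])
    fix \<theta> assume \<theta>: "test_function ?J \<theta>"
    have [measurable]: "\<theta> \<in> borel_measurable borel" "deriv \<theta> \<in> borel_measurable borel"
      using \<theta> smooth_continuous_on test_function_deriv(2)[OF \<theta>]
      by (auto simp: test_function_def intro!: borel_measurable_continuous_onI)
    have [measurable]: "(\<lambda>t. G0 t w) \<in> borel_measurable borel" "(\<lambda>t. F' t w) \<in> borel_measurable borel"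
      using iGw[OF w] iF'w[OF w] by auto
    have "(LINT t|lebesgue_on ?J. deriv \<theta> t * G t w) = (LINT t|lborel. deriv \<theta> t * G0 t w)"
    proof (rule integral_lebesgue_on_eq_lborel(1)[OF J])
      show "AE t in lborel. t \<in> ?J \<longrightarrow> deriv \<theta> t * G t w = deriv \<theta> t * G0 t w"
        using full0 by eventually_elim (auto simp: G0_def)
      show "deriv \<theta> t * G0 t w = 0" if "t \<notin> ?J" for t using that S0(2) by (auto simp: G0_def)
    qed measurable
    moreover have "(LINT t|lebesgue_on ?J. \<theta> t * u' t w) = (LINT t|lborel. \<theta> t * F' t w)"
    proof (rule integral_lebesgue_on_eq_lborel(1)[OF J])
      show "AE t in lborel. t \<in> ?J \<longrightarrow> \<theta> t * u' t w = \<theta> t * F' t w"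
        using full0 by eventually_elim (auto simp: F'_def)
      show "\<theta> t * F' t w = 0" if "t \<notin> ?J" for t using that S0(2) by (auto simp: F'_def)
    qed measurable
    ultimately show "(LINT t|lborel. deriv \<theta> t * G0 t w) = - (LINT t|lborel. \<theta> t * F' t w)"
      using weak[OF \<theta> w] by simp
  qed
  have "\<exists>C. \<forall>w\<in>X. AE t in lborel. t \<in> ?J \<longrightarrow> G0 t w = C w + (LINT r|lborel. indicator {0..t} r * F' r w)"
    by (rule bchoice) (use ex in blast)
  then obtain C where C: "\<And>w. w \<in> X \<Longrightarrow> AE t in lborel. t \<in> ?J \<longrightarrow> G0 t w = C w + (LINT r|lborel. indicator {0..t} r * F' r w)"
    by blast
  obtain s where s: "\<And>n. borel_simple X (s n)" "\<And>t. (\<lambda>n. N (s n t - cut S0 u t)) \<longlonglongrightarrow> 0"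
    using Su(5)[OF S0(1,3)] by (auto simp: borel_limit_def)
  \<comment> \<open>All values of the simple approximants: countably many, so that one null set
    serves them all, and enough to approach each \<open>u \<tau>\<close> with \<tau> in
    \<open>S0\<close>.\<close>
  define DD where "DD = (\<Union>n. range (s n))"
  have DD: "countable DD" "DD \<subseteq> X"
    using s(1) by (auto simp: DD_def borel_simple_def countable_finite)
  have "AE t in lborel. \<forall>w\<in>DD. t \<in> ?J \<longrightarrow> G0 t w = C w + (LINT r|lborel. indicator {0..t} r * F' r w)"
    using C DD by (subst AE_ball_countable) auto
  with full0 have "AE t in lborel. t \<in> ?J \<longrightarrow> (t \<in> S0 \<and> (\<forall>w\<in>DD. G0 t w = C w + (LINT r|lborel. indicator {0..t} r * F' r w)))"
    by eventually_elim auto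
  then obtain S1 where S1: "S1 \<in> sets borel" "S1 \<subseteq> ?J" "AE t in lborel. t \<in> ?J \<longrightarrow> t \<in> S1"
    "\<And>t. t \<in> S1 \<Longrightarrow> t \<in> S0 \<and> (\<forall>w\<in>DD. G0 t w = C w + (LINT r|lborel. indicator {0..t} r * F' r w))"
    by (rule AE_lborel_borel_set[OF J]) blast
  have S10: "S1 \<subseteq> S0" using S1(4) by blast
  define F where "F = cut S1 u"
  have S1u: "S1 \<subseteq> Su" using S10 S0(3) by blast
  interpret P: bochner_pair X N F F' p q
  proof
    show "borel_limit X N F" unfolding F_def by (rule Su(5)[OF S1(1) S1u])
    show "integrable lborel (\<lambda>t. N (F t) powr p)" unfolding F_def by (rule Su(6)[OF S1(1) S1u])
    show "integrable lborel (\<lambda>t. ?dn (F' t) powr q)" unfolding F'_def by (rule Sd(6)[OF S0(1,4)])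
  qed (use F'lim ik pq in auto)
  define B where "B s t = (LINT x|?M. u s x \<bullet> u t x)" for s t
  have uL: "u t \<in> Lp 2 ?M" if "t \<in> S1" for t using that S10 S0(7) SH(4) by blast
  have GD: "G t \<in> ?D" if "t \<in> S1" for t using that S10 S0(6) SG(4) by blast
  have uX: "u t \<in> X" if "t \<in> S1" for t using that S1u Su(4) by blast
  \<comment> \<open>Tested with a value of \<open>u\<close>, the embedded function becomes the inner
    product in H; here identities in the dual of V turn into statements about the norm of H.\<close>
  have GB: "G t (u \<tau>) = B t \<tau>" for t \<tau> by (simp add: G_def H_to_Vdual_def B_def)
  have ft: "B t \<tau> - B s' \<tau> = (LINT r|lborel. indicator {s'..t} r * F' r (F \<tau>))"
    if st: "s' \<in> S1" "t \<in> S1" "\<tau> \<in> S1" "s' \<le> t" for s' t \<tau>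
  proof -
    define w where "w n = s n \<tau>" for n
    have wD: "w n \<in> DD" and wX: "w n \<in> X" for n using DD(2) by (auto simp: w_def DD_def)
    have \<tau>0: "\<tau> \<in> S0" using st(3) S10 by blast
    have wl: "(\<lambda>n. N (w n - u \<tau>)) \<longlonglongrightarrow> 0" using s(2)[of \<tau>] \<tau>0 by (simp add: w_def)
    have Gl: "(\<lambda>n. G r (w n)) \<longlonglongrightarrow> B r \<tau>" if "r \<in> S1" for r
      unfolding GB[symmetric]
      by (rule V.pairing_tendsto[where s' = "\<lambda>_. G r"])
        (use GD[OF that] wX uX[OF st(3)] wl D.N_zero in \<open>auto simp: fun_diff_def\<close>)
    have iFr: "integrable lborel (\<lambda>r. indicator {s'..t} r * F' r v)" if "v \<in> X" for v
      using integrable_mult_indicator[of "{s'..t}" lborel "\<lambda>r. F' r v"] iF'w[OF that] by simp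
    have eq: "G t (w n) - G s' (w n) = (LINT r|lborel. indicator {s'..t} r * F' r (w n))" for n
    proof -
      have "G0 t (w n) - G0 s' (w n) = (LINT r|lborel. indicator {0..t} r * F' r (w n)) - (LINT r|lborel. indicator {0..s'} r * F' r (w n))"
        using S1(4)[OF st(1)] S1(4)[OF st(2)] wD[of n] by simp
      also have "\<dots> = (LINT r|lborel. indicator {s'..t} r * F' r (w n))"
        using st S1(2) by (intro indefinite_integral_diff iF'w wX) auto
      finally have "G0 t (w n) - G0 s' (w n) = (LINT r|lborel. indicator {s'..t} r * F' r (w n))" .
      moreover have "s' \<in> S0" "t \<in> S0" using st S10 by blast+
      ultimately show ?thesis by (simp add: G0_def)
    qed
    have "(\<lambda>n. LINT r|lborel. indicator {s'..t} r * F' r (w n)) \<longlonglongrightarrow> (LINT r|lborel. indicator {s'..t} r * F' r (u \<tau>))"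
    proof (rule LIM_zero_cancel, rule Lim_null_comparison)
      show "(\<lambda>n. (LINT r|lborel. ?dn (F' r)) * N (w n - u \<tau>)) \<longlonglongrightarrow> 0"
        by (rule tendsto_mult_right_zero[OF wl])
      have "norm ((LINT r|lborel. indicator {s'..t} r * F' r (w n)) - (LINT r|lborel. indicator {s'..t} r * F' r (u \<tau>)))
          \<le> (LINT r|lborel. ?dn (F' r)) * N (w n - u \<tau>)" for n
      proof -
        have "(LINT r|lborel. indicator {s'..t} r * F' r (w n)) - (LINT r|lborel. indicator {s'..t} r * F' r (u \<tau>))
            = (LINT r|lborel. indicator {s'..t} r * F' r (w n) - indicator {s'..t} r * F' r (u \<tau>))"
          using iFr[OF wX] iFr[OF uX[OF st(3)]] by simp
        also have "norm \<dots> \<le> (LINT r|lborel. norm (indicator {s'..t} r * F' r (w n) - indicator {s'..t} r * F' r (u \<tau>)))"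
          by (rule integral_norm_bound)
        also have "\<dots> \<le> (LINT r|lborel. ?dn (F' r) * N (w n - u \<tau>))"
        proof (rule integral_mono)
          show "integrable lborel (\<lambda>r. norm (indicator {s'..t} r * F' r (w n) - indicator {s'..t} r * F' r (u \<tau>)))"
            using iFr[OF wX] iFr[OF uX[OF st(3)]] by (intro integrable_norm Bochner_Integration.integrable_diff)
          show "integrable lborel (\<lambda>r. ?dn (F' r) * N (w n - u \<tau>))" using ik by simp
          fix r
          have "\<bar>F' r (w n) - F' r (u \<tau>)\<bar> \<le> ?dn (F' r) * N (w n - u \<tau>)"
            using V.dual_norm_bound[OF P.F'X V.diff_mem[OF wX uX[OF st(3)]], of r n] V.dual_diff[OF P.F'X wX uX[OF st(3)], of r n] by simp
          moreover have "0 \<le> ?dn (F' r) * N (w n - u \<tau>)"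
            using P.k_nonneg V.nonneg[OF V.diff_mem[OF wX uX[OF st(3)]]] by simp
          ultimately show "norm (indicator {s'..t} r * F' r (w n) - indicator {s'..t} r * F' r (u \<tau>)) \<le> ?dn (F' r) * N (w n - u \<tau>)"
            by (auto simp: indicator_def)
        qed
        finally show ?thesis by simp
      qed
      then show "\<forall>\<^sub>F n in sequentially. norm ((LINT r|lborel. indicator {s'..t} r * F' r (w n)) - (LINT r|lborel. indicator {s'..t} r * F' r (u \<tau>)))
          \<le> (LINT r|lborel. ?dn (F' r)) * N (w n - u \<tau>)" by simp
    qed
    moreover have "(\<lambda>n. LINT r|lborel. indicator {s'..t} r * F' r (w n)) \<longlonglongrightarrow> B t \<tau> - B s' \<tau>"
      using tendsto_diff[OF Gl[OF st(2)] Gl[OF st(1)]] by (simp add: eq)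
    ultimately have "B t \<tau> - B s' \<tau> = (LINT r|lborel. indicator {s'..t} r * F' r (u \<tau>))"
      by (rule LIMSEQ_unique[rotated])
    then show ?thesis using st(3) by (simp add: F_def)
  qed
  have sym: "B s t = B t s" for s t by (simp add: B_def inner_commute)
  have F0: "F t = (\<lambda>_. 0)" if "t \<notin> S1" for t using that by (simp add: F_def)
  obtain s0 where s0: "s0 \<in> S1" using full_set_dense[OF S1(3) T, of 0 1] T by auto
  have Bs0: "B s0 \<tau> = G s0 (F \<tau>)" if "\<tau> \<in> S1" for \<tau> using that by (simp add: GB F_def)
  obtain c0 where c0: "AE t in lborel. t \<in> S1 \<longrightarrow> B t t = c0 + 2 * (LINT r|lborel. indicator {0..t} r * F' r (F r))"
    using P.energy_identity[OF T S1(1-3) F0 ft sym s0 GD[OF s0] Bs0] by blast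
  have "AE t in lborel. t \<in> ?J \<longrightarrow> (t \<in> S1 \<and> B t t = c0 + 2 * (LINT r|lborel. indicator {0..t} r * F' r (F r)))"
    using S1(3) c0 by eventually_elim auto
  then obtain S2 where S2: "S2 \<in> sets borel" "S2 \<subseteq> ?J" "AE t in lborel. t \<in> ?J \<longrightarrow> t \<in> S2"
    "\<And>t. t \<in> S2 \<Longrightarrow> t \<in> S1 \<and> B t t = c0 + 2 * (LINT r|lborel. indicator {0..t} r * F' r (F r))"
    by (rule AE_lborel_borel_set[OF J]) blast
  have i\<kappa>: "integrable lborel (\<lambda>t. F' t (F t))" using P.pairing_integrable[of 0] by simp
  \<comment> \<open>The density from \<open>distance_bound\<close>, cut to \<open>{0..T}\<close>
    because the constant 1 is not integrable on the line. Its indefinite integral is the modulus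
    \<open>m\<close> of \<open>continuous_rep_exists\<close>.\<close>
  define f where "f r = 16 * (indicator {0..T} r * (?dn (F' r) powr q + N (F r) powr p + 1))" for r
  have iF: "integrable lborel f"
  proof -
    have "integrable lborel (indicator {0..T} :: real \<Rightarrow> real)" using T by (intro integrable_real_indicator) auto
    moreover have "integrable lborel (\<lambda>r. indicator {0..T} r * (?dn (F' r) powr q + N (F r) powr p))"
      using integrable_mult_indicator[of "{0..T}" lborel "\<lambda>r. ?dn (F' r) powr q + N (F r) powr p"] P.ig P.ikq by simp
    ultimately have "integrable lborel (\<lambda>r. indicator {0..T} r * (?dn (F' r) powr q + N (F r) powr p) + indicator {0..T} r)"
      by simp
    then have "integrable lborel (\<lambda>r. 16 * (indicator {0..T} r * (?dn (F' r) powr q + N (F r) powr p) + indicator {0..T} r))"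
      by (rule integrable_mult_right)
    moreover have "f = (\<lambda>r. 16 * (indicator {0..T} r * (?dn (F' r) powr q + N (F r) powr p) + indicator {0..T} r))"
      by (simp add: f_def[abs_def] algebra_simps)
    ultimately show ?thesis by simp
  qed
  have dist: "(LINT x|?M. (norm (u t x - u s x))\<^sup>2) \<le> \<bar>(LINT r|lborel. indicator {0..t} r * f r) - (LINT r|lborel. indicator {0..s} r * f r)\<bar>"
    if st: "s \<in> S2" "t \<in> S2" for s t
  proof -
    have main: "(LINT x|?M. (norm (u t x - u s x))\<^sup>2) \<le> (LINT r|lborel. indicator {0..t} r * f r) - (LINT r|lborel. indicator {0..s} r * f r)"
      if st: "s \<in> S2" "t \<in> S2" and le: "s \<le> t" for s t
    proof -
      have S12: "r \<in> S1" if "r \<in> S2" for r using S2(4)[OF that] by blast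
      have deq: "(LINT x|?M. (norm (u a x - u b x))\<^sup>2) = B a a - 2 * B a b + B b b" if "a \<in> S2" "b \<in> S2" for a b
        unfolding B_def by (rule L2_dist_eq[OF uL[OF S12[OF that(1)]] uL[OF S12[OF that(2)]]])
      have "B t t - 2 * B t s + B s s \<le> 16 * (LINT r|lborel. indicator {s..t} r * (?dn (F' r) powr q + N (F r) powr p + 1))"
      proof (rule P.distance_bound[OF S2(1-3) _ _ _ st le])
        show "B t \<tau> - B s \<tau> = (LINT r|lborel. indicator {s..t} r * F' r (F \<tau>))"
          if "s \<in> S2" "t \<in> S2" "\<tau> \<in> S2" "s \<le> t" for s t \<tau>
          using that by (intro ft S12)
        show "B t t - B s s = 2 * (LINT r|lborel. indicator {s..t} r * F' r (F r))"
          if "s \<in> S2" "t \<in> S2" "s \<le> t" for s t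
          using S2(4)[OF that(1)] S2(4)[OF that(2)] indefinite_integral_diff[OF i\<kappa>, of s t] that S2(2) by force
        show "B t t - 2 * B t \<tau> + B \<tau> \<tau> \<le> 2 * (B t t - 2 * B t s + B s s) + 2 * (B \<tau> \<tau> - 2 * B \<tau> s + B s s)"
          if "s \<in> S2" "t \<in> S2" "\<tau> \<in> S2" for s t \<tau>
          using L2_dist_tri[OF uL[OF S12[OF that(2)]] uL[OF S12[OF that(1)]] uL[OF S12[OF that(3)]]]
          by (simp add: deq that sym[of s \<tau>])
      qed
      also have "\<dots> = (LINT r|lborel. indicator {s..t} r * f r)"
      proof -
        have "(LINT r|lborel. indicator {s..t} r * f r) = (LINT r|lborel. 16 * (indicator {s..t} r * (?dn (F' r) powr q + N (F r) powr p + 1)))"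
          using st S2(2) by (intro Bochner_Integration.integral_cong) (auto simp: f_def indicator_def)
        then show ?thesis by simp
      qed
      also have "\<dots> = (LINT r|lborel. indicator {0..t} r * f r) - (LINT r|lborel. indicator {0..s} r * f r)"
        using st S2(2) le by (intro indefinite_integral_diff[symmetric] iF) auto
      finally show ?thesis using deq[OF st(2,1)] by simp
    qed
    show ?thesis
    proof (cases "s \<le> t")
      case True
      then show ?thesis using main[OF st] by linarith
    next
      case False
      then show ?thesis using main[OF st(2,1)] by (simp add: norm_minus_commute)
    qed
  qed
  show "\<exists>c. is_continuous_rep \<Omega> T u c"
  proof (rule continuous_rep_exists[OF T S2(2,3) _ _ dist])
    show "continuous_on {0..T} (\<lambda>t. LINT r|lborel. indicator {0..t} r * f r)"
      using indefinite_integral_continuous[OF iF] by (rule continuous_on_subset) simp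
    show "u t \<in> Lp 2 ?M" if "t \<in> S2" for t using S2(4)[OF that] uL by blast
  qed
  have F'0: "F' t (F t) = 0" if "t \<notin> ?J" for t using that S0(2) by (auto simp: F'_def)
  have AEk: "AE t in lborel. t \<in> ?J \<longrightarrow> u' t (u t) = F' t (F t)"
    using S1(3) by eventually_elim (use S10 in \<open>auto simp: F'_def F_def\<close>)
  note conv = integral_lebesgue_on_eq_lborel[OF J P.meas(4) AEk F'0]
  show "integrable (lebesgue_on ?J) (\<lambda>t. u' t (u t))" using conv(2) i\<kappa> by blast
  assume c: "is_continuous_rep \<Omega> T u c"
  interpret L: seminormed "Lp 2 ?M :: (real^'d \<Rightarrow> real^'l) set" "Lp_norm 2 ?M" by (rule seminormed_Lp) simp
  have cL: "\<And>t. t \<in> {0..T} \<Longrightarrow> c t \<in> Lp 2 ?M"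
    and ccont: "\<And>t. t \<in> {0..T} \<Longrightarrow> ((\<lambda>s. Lp_norm 2 ?M (c s - c t)) \<longlongrightarrow> 0) (at t within {0..T})"
    and cAE: "AE t in lebesgue_on ?J. AE x in ?M. u t x = c t x"
    using c by (auto simp: is_continuous_rep_def)
  have nc: "continuous_on {0..T} (\<lambda>t. Lp_norm 2 ?M (c t))"
    unfolding continuous_on_def
  proof
    fix t assume t: "t \<in> {0..T}"
    have "((\<lambda>s. Lp_norm 2 ?M (c s) - Lp_norm 2 ?M (c t)) \<longlongrightarrow> 0) (at t within {0..T})"
      by (rule Lim_null_comparison[OF _ ccont[OF t]])
        (use L.N_reverse_tri cL t in \<open>auto simp: eventually_at_filter\<close>)
    then show "((\<lambda>t. Lp_norm 2 ?M (c t)) \<longlongrightarrow> Lp_norm 2 ?M (c t)) (at t within {0..T})"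
      by (simp add: LIM_zero_iff)
  qed
  define \<phi> where "\<phi> t = c0 + 2 * (LINT r|lborel. indicator {0..t} r * F' r (F r))" for t
  have \<phi>c: "continuous_on {0..T} \<phi>"
    unfolding \<phi>_def using indefinite_integral_continuous[OF i\<kappa>]
    by (intro continuous_intros) (auto intro: continuous_on_subset)
  have "AE t in lborel. t \<in> ?J \<longrightarrow> (AE x in ?M. u t x = c t x)"
    using cAE by (simp add: AE_restrict_space_iff AE_completion_iff)
  with S2(3) have "AE t in lborel. t \<in> ?J \<longrightarrow> (Lp_norm 2 ?M (c t))\<^sup>2 = \<phi> t"
  proof eventually_elim
    case (elim t)
    show ?case
    proof
      assume t: "t \<in> ?J"
      then have tS: "t \<in> S2" using elim by blast
      have "Lp_norm 2 ?M (c t) = Lp_norm 2 ?M (u t)"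
        using elim t cL[of t] uL[of t] S2(4)[OF tS]
        by (intro Lp_norm_cong_AE) (auto simp: Lp_measurable elim: eventually_mono)
      then have "(Lp_norm 2 ?M (c t))\<^sup>2 = B t t" by (simp add: Lp_norm_square B_def power2_norm_eq_inner)
      then show "(Lp_norm 2 ?M (c t))\<^sup>2 = \<phi> t" using S2(4)[OF tS] by (simp add: \<phi>_def)
    qed
  qed
  \<comment> \<open>Both sides are continuous on the closed interval, so the almost everywhere
    identity reaches the end points 0 and \<open>T\<close>.\<close>
  then have eq: "(Lp_norm 2 ?M (c t))\<^sup>2 = \<phi> t" if "t \<in> {0..T}" for t
    using nc \<phi>c that by (intro continuous_eq_if_AE_eq[OF T]) (auto intro!: continuous_intros)
  have "\<phi> T - \<phi> 0 = 2 * (LINT r|lborel. indicator {0..T} r * F' r (F r))"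
    using indefinite_integral_diff[OF i\<kappa>, of 0 T] T by (simp add: \<phi>_def)
  also have "(LINT r|lborel. indicator {0..T} r * F' r (F r)) = (LINT r|lborel. F' r (F r))"
  proof (rule Bochner_Integration.integral_cong)
    show "indicator {0..T} r * F' r (F r) = F' r (F r)" for r
      using F'0[of r] by (cases "r \<in> ?J") auto
  qed simp
  finally show "(LINT t|lebesgue_on ?J. u' t (u t))
       = (1/2) * (Lp_norm 2 ?M (c T))\<^sup>2 - (1/2) * (Lp_norm 2 ?M (c 0))\<^sup>2"
    using eq[of T] eq[of 0] T conv(1) by simp
qed

section \<open>Extended integrals\<close>

lemma ext_integral_eq_integral:
  assumes g: "g \<in> borel_measurable M" and f: "integrable M f" and eq: "AE x in M. g x = ereal (f x)"
  shows "ext_integral M g = ereal (LINT x|M. f x)"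
proof -
  have p: "(\<integral>\<^sup>+x. e2ennreal (g x) \<partial>M) = (\<integral>\<^sup>+x. ennreal (f x) \<partial>M)"
    by (rule nn_integral_cong_AE) (use eq in eventually_elim, simp add: ennreal.abs_eq[symmetric] e2ennreal_def ennreal_def)
  have n: "(\<integral>\<^sup>+x. e2ennreal (- g x) \<partial>M) = (\<integral>\<^sup>+x. ennreal (- f x) \<partial>M)"
    by (rule nn_integral_cong_AE) (use eq in eventually_elim, simp add: e2ennreal_def ennreal_def)
  have fin: "(\<integral>\<^sup>+x. ennreal (f x) \<partial>M) < \<infinity>" "(\<integral>\<^sup>+x. ennreal (- f x) \<partial>M) < \<infinity>"
    using f by (auto simp: real_integrable_def top.not_eq_extremum)
  have "ext_integral M g = enn2ereal (\<integral>\<^sup>+x. ennreal (f x) \<partial>M) - enn2ereal (\<integral>\<^sup>+x. ennreal (- f x) \<partial>M)"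
    unfolding ext_integral_def has_integrable_pos_part_def using g fin by (simp add: p n)
  also have "\<dots> = ereal (enn2real (\<integral>\<^sup>+x. ennreal (f x) \<partial>M)) - ereal (enn2real (\<integral>\<^sup>+x. ennreal (- f x) \<partial>M))"
    using fin by (simp add: enn2ereal_ennreal[symmetric] ennreal_enn2real)
  finally show ?thesis using real_lebesgue_integral_def[OF f] by simp
qed

text \<open>Finiteness excludes the default value \<infinity> as well as an infinite negative part,
  so the integrand is almost everywhere real and integrable in the usual sense.\<close>

lemma ext_integral_finiteD:
  assumes "\<bar>ext_integral M g\<bar> \<noteq> \<infinity>"
  shows "g \<in> borel_measurable M" "integrable M (\<lambda>x. real_of_ereal (g x))"
    "AE x in M. g x = ereal (real_of_ereal (g x))"
    "ext_integral M g = ereal (LINT x|M. real_of_ereal (g x))"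
proof -
  have gm: "g \<in> borel_measurable M" and pos: "(\<integral>\<^sup>+x. e2ennreal (g x) \<partial>M) < \<infinity>"
    using assms unfolding ext_integral_def has_integrable_pos_part_def by (auto split: if_splits)
  then have "ext_integral M g = enn2ereal (\<integral>\<^sup>+x. e2ennreal (g x) \<partial>M) - enn2ereal (\<integral>\<^sup>+x. e2ennreal (- g x) \<partial>M)"
    unfolding ext_integral_def has_integrable_pos_part_def by simp
  then have neg: "(\<integral>\<^sup>+x. e2ennreal (- g x) \<partial>M) < \<infinity>"
    using assms pos by (cases "\<integral>\<^sup>+x. e2ennreal (- g x) \<partial>M"; cases "\<integral>\<^sup>+x. e2ennreal (g x) \<partial>M")
      (auto simp: top_ereal_def enn2ereal_top)
  note [measurable] = gm
  show "g \<in> borel_measurable M" by fact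
  have e: "e2ennreal y = top \<longleftrightarrow> y = \<infinity>" for y :: ereal
    by (cases y) (auto simp: e2ennreal_neg)
  have "AE x in M. e2ennreal (g x) \<noteq> \<infinity>" by (rule nn_integral_PInf_AE) (use pos in auto)
  moreover have "AE x in M. e2ennreal (- g x) \<noteq> \<infinity>" by (rule nn_integral_PInf_AE) (use neg in auto)
  ultimately show ae: "AE x in M. g x = ereal (real_of_ereal (g x))"
  proof eventually_elim
    case (elim x)
    then have "g x \<noteq> \<infinity>" "g x \<noteq> - \<infinity>" by (auto simp: e ereal_uminus_eq_reorder)
    then show ?case by (cases "g x") auto
  qed
  have p: "(\<integral>\<^sup>+x. ennreal (real_of_ereal (g x)) \<partial>M) \<le> (\<integral>\<^sup>+x. e2ennreal (g x) \<partial>M)"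
    by (rule nn_integral_mono_AE, use ae in eventually_elim) (metis e2ennreal_ereal order_refl)
  have n: "(\<integral>\<^sup>+x. ennreal (- real_of_ereal (g x)) \<partial>M) \<le> (\<integral>\<^sup>+x. e2ennreal (- g x) \<partial>M)"
    by (rule nn_integral_mono_AE, use ae in eventually_elim) (metis e2ennreal_ereal order_refl uminus_ereal.simps(1))
  show i: "integrable M (\<lambda>x. real_of_ereal (g x))"
    unfolding real_integrable_def using p n pos neg by (auto simp: top_unique)
  show "ext_integral M g = ereal (LINT x|M. real_of_ereal (g x))"
    by (rule ext_integral_eq_integral[OF gm i ae])
qed

lemma has_integrable_pos_part_bound:
  assumes "has_integrable_pos_part M g"
  obtains r where "integrable M r" "\<And>t. 0 \<le> r t" "AE t in M. g t \<le> ereal (r t)"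
proof -
  have m: "(\<lambda>s. max 0 (g s)) \<in> borel_measurable M" and fin: "(\<integral>\<^sup>+s. e2ennreal (g s) \<partial>M) < \<infinity>"
    using assms by (auto simp: has_integrable_pos_part_def)
  have eq: "e2ennreal (g s) = e2ennreal (max 0 (g s))" for s
    by (simp add: e2ennreal_def max_def)
  have m' [measurable]: "(\<lambda>s. e2ennreal (g s)) \<in> borel_measurable M"
    unfolding eq using m by measurable
  have ae: "AE s in M. e2ennreal (g s) \<noteq> \<infinity>"
    using fin by (intro nn_integral_PInf_AE) auto
  define r where "r s = enn2real (e2ennreal (g s))" for s
  have rm [measurable]: "r \<in> borel_measurable M" unfolding r_def[abs_def] by measurable
  have "(\<integral>\<^sup>+s. ennreal (r s) \<partial>M) = (\<integral>\<^sup>+s. e2ennreal (g s) \<partial>M)"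
    by (rule nn_integral_cong_AE, use ae in eventually_elim) (simp add: r_def ennreal_enn2real top.not_eq_extremum)
  then have "integrable M r"
    using fin by (intro integrableI_nonneg) (auto simp: r_def)
  moreover have "AE s in M. g s \<le> ereal (r s)"
    using ae
  proof eventually_elim
    case (elim s)
    show ?case
    proof (cases "0 \<le> g s")
      case True
      then have "g s = enn2ereal (e2ennreal (g s))" by (simp add: enn2ereal_e2ennreal)
      also have "\<dots> = ereal (r s)"
        using elim by (cases "e2ennreal (g s)") (auto simp: r_def enn2ereal_ennreal)
      finally show ?thesis by simp
    next
      case False
      moreover have "0 \<le> ereal (r s)" by (simp add: r_def)
      ultimately show ?thesis by (meson le_cases order_trans)
    qed
  qed
  ultimately show ?thesis by (intro that[of r]) (auto simp: r_def)
qed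

lemma borel_measurable_lebesgue_on_AE_ereal:
  fixes g :: "real \<Rightarrow> ereal"
  assumes J: "J \<in> sets borel" and h: "h \<in> borel_measurable (lebesgue_on J)" and ae: "AE t in lebesgue_on J. g t = h t"
  shows "g \<in> borel_measurable (lebesgue_on J)"
proof (rule measurableI)
  fix A :: "ereal set" assume A: "A \<in> sets borel"
  have JL: "J \<in> sets lebesgue" using J by simp
  have "h -` A \<inter> space (lebesgue_on J) \<in> sets (lebesgue_on J)" by (rule measurable_sets[OF h A])
  then have B: "h -` A \<inter> J \<in> sets lebesgue" using JL by (simp add: sets_restrict_space_iff)
  have "AE t in lebesgue. t \<in> J \<longrightarrow> g t = h t" using ae JL by (simp add: AE_restrict_space_iff)
  then have "AE t in lebesgue. t \<in> h -` A \<inter> J \<longleftrightarrow> t \<in> g -` A \<inter> J" by eventually_elim auto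
  then have "g -` A \<inter> J \<in> sets lebesgue" by (rule completion.in_sets_AE[OF _ B]) auto
  then show "g -` A \<inter> space (lebesgue_on J) \<in> sets (lebesgue_on J)"
    using JL by (simp add: sets_restrict_space_iff)
qed simp

section \<open>Joint measurability\<close>

text \<open>For the completed measures this needs more than Borel measurability of the projection:
  the cylinder over a null set has to be null.\<close>

lemma snd_measurable_lebesgue:
  "snd \<in> (lebesgue :: (real \<times> 'a::euclidean_space) measure) \<rightarrow>\<^sub>M lebesgue"
proof (rule completion.measurable_completion2)
  show sm: "snd \<in> (lebesgue :: (real \<times> 'a) measure) \<rightarrow>\<^sub>M lborel"
    by (rule measurable_completion) (simp add: borel_prod[symmetric])
  show "null_sets lborel \<subseteq> null_sets (distr (lebesgue :: (real \<times> 'a) measure) lborel snd)"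
  proof
    fix A :: "'a set" assume A: "A \<in> null_sets lborel"
    have "UNIV \<times> A \<in> null_sets (lborel \<Otimes>\<^sub>M lborel :: (real \<times> 'a) measure)"
      using null_setsD1[OF A] null_setsD2[OF A]
      by (intro null_setsI) (simp_all add: lborel.emeasure_pair_measure_Times)
    then have "UNIV \<times> A \<in> null_sets (lebesgue :: (real \<times> 'a) measure)"
      unfolding lborel_prod by (rule null_sets_completionI)
    moreover have "snd -` A \<inter> space (lebesgue :: (real \<times> 'a) measure) = UNIV \<times> A" by auto
    ultimately show "A \<in> null_sets (distr (lebesgue :: (real \<times> 'a) measure) lborel snd)"
      using null_setsD2[OF A] by (subst null_sets_distr_iff[OF sm]) auto
  qed
qed

lemma joint_measurable_lebesgue_on:
  fixes Z :: "real \<times> 'a::euclidean_space \<Rightarrow> 'b::topological_space"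
  assumes "Z \<in> borel_measurable (borel \<Otimes>\<^sub>M lebesgue_on \<Omega>)"
  shows "Z \<in> borel_measurable (lebesgue_on (J \<times> \<Omega>))"
proof -
  have f: "fst \<in> lebesgue_on (J \<times> \<Omega>) \<rightarrow>\<^sub>M (borel :: real measure)"
    by (intro measurable_restrict_space1 measurable_completion) (simp add: borel_prod[symmetric])
  have s: "snd \<in> lebesgue_on (J \<times> \<Omega>) \<rightarrow>\<^sub>M lebesgue_on \<Omega>"
    by (intro measurable_restrict_space3 snd_measurable_lebesgue) auto
  show ?thesis using measurable_compose[OF measurable_Pair[OF f s] assms] by simp
qed

text \<open>Lebesgue measure on a product is the completion of the product measure, so Tonelli is
  applied to a Borel version \<open>A'\<close> that agrees with the function almost everywhere on
  almost every slice.\<close>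

lemma tonelli_lebesgue_on:
  fixes A :: "real \<times> 'a::euclidean_space \<Rightarrow> ennreal"
  assumes J: "J \<in> sets borel" and \<Omega>: "\<Omega> \<in> sets borel"
    and A: "A \<in> borel_measurable (lebesgue_on (J \<times> \<Omega>))"
  obtains I where "I \<in> borel_measurable borel" "AE t in lborel. t \<in> J \<longrightarrow> (\<integral>\<^sup>+x. A (t, x) \<partial>lebesgue_on \<Omega>) = I t"
    "(\<integral>\<^sup>+t. I t \<partial>lborel) = (\<integral>\<^sup>+y. A y \<partial>lebesgue_on (J \<times> \<Omega>))"
proof -
  have Q: "J \<times> \<Omega> \<in> sets borel" using J \<Omega> by (simp add: borel_prod[symmetric])
  define A0 where "A0 y = A y * indicator (J \<times> \<Omega>) y" for y
  have "A0 \<in> borel_measurable lebesgue"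
    unfolding A0_def using A Q by (subst (asm) borel_measurable_restrict_space_iff_ennreal) auto
  then obtain A' where A': "A' \<in> borel_measurable lborel" "AE y in lborel. A0 y = A' y"
    using completion_ex_borel_measurable by blast
  have A'm [measurable]: "A' \<in> borel_measurable (lborel \<Otimes>\<^sub>M lborel)" using A'(1) by (simp add: lborel_prod)
  have "AE y in lborel \<Otimes>\<^sub>M lborel. A0 y = A' y" unfolding lborel_prod by (rule A'(2))
  then have ae: "AE t in lborel. AE x in lborel. A0 (t, x) = A' (t, x)" by (rule lborel_pair.AE_pair)
  define I where "I t = (\<integral>\<^sup>+x. A' (t, x) \<partial>lborel)" for t
  have Im: "I \<in> borel_measurable borel" unfolding I_def by measurable
  moreover have "AE t in lborel. t \<in> J \<longrightarrow> (\<integral>\<^sup>+x. A (t, x) \<partial>lebesgue_on \<Omega>) = I t"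
    using ae
  proof eventually_elim
    case (elim t)
    show ?case
    proof
      assume t: "t \<in> J"
      have "(\<integral>\<^sup>+x. A (t, x) \<partial>lebesgue_on \<Omega>) = (\<integral>\<^sup>+x. A (t, x) * indicator \<Omega> x \<partial>lebesgue)"
        using \<Omega> by (subst nn_integral_restrict_space) auto
      also have "\<dots> = (\<integral>\<^sup>+x. A0 (t, x) \<partial>lborel)"
        using t by (subst nn_integral_completion) (auto simp: A0_def indicator_def intro!: nn_integral_cong)
      also have "\<dots> = I t" unfolding I_def by (rule nn_integral_cong_AE[OF elim])
      finally show "(\<integral>\<^sup>+x. A (t, x) \<partial>lebesgue_on \<Omega>) = I t" .
    qed
  qed
  moreover have "(\<integral>\<^sup>+t. I t \<partial>lborel) = (\<integral>\<^sup>+y. A y \<partial>lebesgue_on (J \<times> \<Omega>))"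
  proof -
    have "(\<integral>\<^sup>+t. I t \<partial>lborel) = (\<integral>\<^sup>+y. A' y \<partial>lborel)"
      unfolding I_def by (subst lborel.nn_integral_fst[OF A'm]) (simp add: lborel_prod)
    also have "\<dots> = (\<integral>\<^sup>+y. A0 y \<partial>lborel)" using A'(2) by (intro nn_integral_cong_AE) auto
    also have "\<dots> = (\<integral>\<^sup>+y. A0 y \<partial>lebesgue)" by (simp add: nn_integral_completion)
    also have "\<dots> = (\<integral>\<^sup>+y. A y \<partial>lebesgue_on (J \<times> \<Omega>))"
      unfolding A0_def using Q by (subst nn_integral_restrict_space) auto
    finally show ?thesis .
  qed
  ultimately show ?thesis by (rule that)
qed

text \<open>For each \<open>t\<close> the index of the approximation is chosen measurably such that the errors are
  summable; this gives convergence for almost every \<open>x\<close>.\<close>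

lemma (in seminormed) joint_representative:
  fixes F :: "real \<Rightarrow> 'a \<Rightarrow> 'b" and W :: "('a \<Rightarrow> 'b) \<Rightarrow> 'c \<Rightarrow> 'e::euclidean_space"
  assumes F: "borel_limit X N F" and p: "0 < p"
    and Wm: "\<And>y. y \<in> X \<Longrightarrow> W y \<in> borel_measurable M"
    and Wle: "\<And>y z. y \<in> X \<Longrightarrow> z \<in> X \<Longrightarrow> (\<integral>\<^sup>+x. ennreal (norm (W y x - W z x) powr p) \<partial>M) \<le> ennreal (N (y - z) powr p)"
  obtains Z where "Z \<in> borel_measurable (borel \<Otimes>\<^sub>M M)" "\<And>t. AE x in M. Z (t, x) = W (F t) x"
proof -
  obtain s where s: "\<And>n. borel_simple X (s n)" "\<And>t. (\<lambda>n. N (s n t - F t)) \<longlonglongrightarrow> 0"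
    using F by (auto simp: borel_limit_def)
  note FX = borel_limit_memD[OF F]
  have sX: "s n t \<in> X" for n t using s(1)[of n] by (auto simp: borel_simple_def)
  define P where "P j t n \<longleftrightarrow> N (F t - s n t) powr p < (1 / 2) ^ j" for j :: nat and t n
  have exP: "\<exists>n. P j t n" for j t
  proof -
    have "(\<lambda>n. N (F t - s n t) powr p) \<longlonglongrightarrow> 0 powr p"
      using s(2)[of t] p nonneg[OF diff_mem[OF FX sX]] N_minus_commute[OF sX FX]
      by (intro tendsto_powr' tendsto_const) auto
    then have "\<forall>\<^sub>F n in sequentially. N (F t - s n t) powr p < (1 / 2) ^ j"
      using p by (intro order_tendstoD) auto
    then show ?thesis unfolding P_def using eventually_happens sequentially_bot by blast
  qed
  \<comment> \<open>The least admissible index is measurable in \<open>t\<close> because each set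
    \<open>{t. P j t n}\<close> is Borel.\<close>
  define k where "k j t = (LEAST n. P j t n)" for j t
  have kP: "P j t (k j t)" for j t unfolding k_def using exP by (rule LeastI_ex)
  have Pm: "{t. P j t n} \<in> sets borel" for j n
  proof -
    have "(\<lambda>t. N (F t - s n t) powr p) \<in> borel_measurable borel"
      using borel_limit_norm_diff[OF F s(1)] by measurable
    then show ?thesis unfolding P_def by (simp add: borel_measurable_iff_less)
  qed
  have km: "k j \<in> borel \<rightarrow>\<^sub>M count_space UNIV" for j
    unfolding k_def using Pm by (intro measurable_Least) (simp add: pred_def)
  define D where "D = (\<Union>n. range (s n))"
  have D: "countable D" "D \<subseteq> X" using sX by (auto simp: D_def) (use s(1) in \<open>auto simp: borel_simple_def countable_finite\<close>)
  define \<sigma> where "\<sigma> j t = s (k j t) t" for j t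
  have \<sigma>m: "\<sigma> j \<in> borel \<rightarrow>\<^sub>M count_space D" for j
  proof -
    have "s n \<in> borel \<rightarrow>\<^sub>M count_space D" for n
      using borel_simple_vimage[OF s(1)] by (intro measurableI) (auto simp: D_def)
    then show ?thesis unfolding \<sigma>_def
      by (rule measurable_compose_countable'[where I = UNIV]) (use km in auto)
  qed
  have \<sigma>X: "\<sigma> j t \<in> X" for j t by (simp add: \<sigma>_def sX)
  \<comment> \<open>\<open>\<sigma> j\<close> takes countably many values, so \<open>Y j\<close> is
    jointly measurable although \<open>W y\<close> is known to be measurable only for each fixed
    \<open>y\<close>.\<close>
  define Y where "Y j y = W (\<sigma> j (fst y)) (snd y)" for j y
  have Ym [measurable]: "Y j \<in> borel_measurable (borel \<Otimes>\<^sub>M M)" for j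
    unfolding Y_def
  proof (rule measurable_compose_countable'[where I = D])
    show "(\<lambda>y. \<sigma> j (fst y)) \<in> borel \<Otimes>\<^sub>M M \<rightarrow>\<^sub>M count_space D"
      by (rule measurable_compose[OF measurable_fst \<sigma>m])
    show "(\<lambda>y. W i (snd y)) \<in> borel_measurable (borel \<Otimes>\<^sub>M M)" if "i \<in> D" for i
      using that D(2) by (intro measurable_compose[OF measurable_snd Wm]) auto
  qed (rule D(1))
  define Z where "Z y = lim (\<lambda>j. Y j y)" for y
  have Zm: "Z \<in> borel_measurable (borel \<Otimes>\<^sub>M M)" unfolding Z_def by measurable
  have "AE x in M. Z (t, x) = W (F t) x" for t
  proof -
    have [measurable]: "W (\<sigma> j t) \<in> borel_measurable M" "W (F t) \<in> borel_measurable M" for j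
      using Wm \<sigma>X FX by auto
    have "(\<integral>\<^sup>+x. (\<Sum>j. ennreal (norm (W (\<sigma> j t) x - W (F t) x) powr p)) \<partial>M)
        = (\<Sum>j. \<integral>\<^sup>+x. ennreal (norm (W (\<sigma> j t) x - W (F t) x) powr p) \<partial>M)"
      by (rule nn_integral_suminf) measurable
    also have "\<dots> \<le> (\<Sum>j. ennreal ((1 / 2) ^ j))"
    proof (rule suminf_le)
      fix j
      have "(\<integral>\<^sup>+x. ennreal (norm (W (\<sigma> j t) x - W (F t) x) powr p) \<partial>M) \<le> ennreal (N (\<sigma> j t - F t) powr p)"
        by (rule Wle[OF \<sigma>X FX])
      also have "\<dots> \<le> ennreal ((1 / 2) ^ j)"
        using kP[of j t] N_minus_commute[OF \<sigma>X FX, of j t t] by (intro ennreal_leI) (simp add: P_def \<sigma>_def)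
      finally show "(\<integral>\<^sup>+x. ennreal (norm (W (\<sigma> j t) x - W (F t) x) powr p) \<partial>M) \<le> ennreal ((1 / 2) ^ j)" .
    qed auto
    also have "\<dots> = ennreal (\<Sum>j. (1 / 2) ^ j)"
      by (rule suminf_ennreal2) (auto intro: summable_geometric)
    also have "\<dots> < \<infinity>" by simp
    finally have "AE x in M. (\<Sum>j. ennreal (norm (W (\<sigma> j t) x - W (F t) x) powr p)) \<noteq> \<infinity>"
      by (intro nn_integral_PInf_AE) auto
    then show ?thesis
    proof eventually_elim
      case (elim x)
      have "summable (\<lambda>j. norm (W (\<sigma> j t) x - W (F t) x) powr p)"
        using elim by (intro summable_suminf_not_top) (auto simp: infinity_ennreal_def)
      then have l: "(\<lambda>j. norm (W (\<sigma> j t) x - W (F t) x) powr p) \<longlonglongrightarrow> 0" by (rule summable_LIMSEQ_zero)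
      have "(\<lambda>j. (norm (W (\<sigma> j t) x - W (F t) x) powr p) powr (1 / p)) \<longlonglongrightarrow> 0 powr (1 / p)"
        using p by (intro tendsto_powr' l tendsto_const) auto
      then have "(\<lambda>j. norm (W (\<sigma> j t) x - W (F t) x)) \<longlonglongrightarrow> 0" using p by (simp add: powr_powr)
      then have "(\<lambda>j. W (\<sigma> j t) x) \<longlonglongrightarrow> W (F t) x"
        by (simp add: tendsto_norm_zero_iff LIM_zero_iff)
      then show ?case by (simp add: Z_def Y_def limI)
    qed
  qed
  with Zm show ?thesis by (rule that)
qed

text \<open>Inserting the jointly measurable version \<open>Z\<close> makes the integrand measurable
  on the cylinder, and Tonelli for its positive and negative parts gives measurability in time.
  Replacing \<open>v t\<close> by \<open>Z\<close> changes only null sets in space, which the slice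
  integrals do not see.\<close>

lemma slice_integral_measurable:
  fixes g :: "real \<Rightarrow> real^'d \<Rightarrow> 'b::euclidean_space \<Rightarrow> ereal" and v :: "real \<Rightarrow> real^'d \<Rightarrow> 'b"
  assumes J: "J \<in> sets borel" and \<Omega>: "\<Omega> \<in> sets borel"
    and g: "(\<lambda>((t, x), z). g t x z) \<in> borel_measurable (lebesgue_on (J \<times> \<Omega>) \<Otimes>\<^sub>M borel)"
    and Z: "Z \<in> borel_measurable (borel \<Otimes>\<^sub>M lebesgue_on \<Omega>)"
    and Zv: "AE t in lborel. t \<in> J \<longrightarrow> (AE x in lebesgue_on \<Omega>. Z (t, x) = v t x)"
    and fin: "AE t in lborel. t \<in> J \<longrightarrow> \<bar>slice_integral \<Omega> g t (v t)\<bar> \<noteq> \<infinity>"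
  obtains h where "h \<in> borel_measurable borel" "AE t in lborel. t \<in> J \<longrightarrow> slice_integral \<Omega> g t (v t) = ereal (h t)"
proof -
  let ?Q = "J \<times> \<Omega>"
  have Zm: "Z \<in> borel_measurable (lebesgue_on ?Q)" by (rule joint_measurable_lebesgue_on[OF Z])
  have "(\<lambda>y. (y, Z y)) \<in> lebesgue_on ?Q \<rightarrow>\<^sub>M lebesgue_on ?Q \<Otimes>\<^sub>M borel"
    using Zm by (intro measurable_Pair) auto
  from measurable_compose[OF this g]
  have gm [measurable]: "(\<lambda>y. g (fst y) (snd y) (Z y)) \<in> borel_measurable (lebesgue_on ?Q)"
    by (simp add: split_beta)
  obtain I1 where I1 [measurable]: "I1 \<in> borel_measurable borel"
    "AE t in lborel. t \<in> J \<longrightarrow> (\<integral>\<^sup>+x. e2ennreal (g t x (Z (t, x))) \<partial>lebesgue_on \<Omega>) = I1 t"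
    using tonelli_lebesgue_on[OF J \<Omega>, of "\<lambda>y. e2ennreal (g (fst y) (snd y) (Z y))"] by auto
  obtain I2 where I2 [measurable]: "I2 \<in> borel_measurable borel"
    "AE t in lborel. t \<in> J \<longrightarrow> (\<integral>\<^sup>+x. e2ennreal (- g t x (Z (t, x))) \<partial>lebesgue_on \<Omega>) = I2 t"
    using tonelli_lebesgue_on[OF J \<Omega>, of "\<lambda>y. e2ennreal (- g (fst y) (snd y) (Z y))"] by auto
  define h where "h t = real_of_ereal (enn2ereal (I1 t) - enn2ereal (I2 t))" for t
  have "h \<in> borel_measurable borel" unfolding h_def by measurable
  moreover have "AE t in lborel. t \<in> J \<longrightarrow> slice_integral \<Omega> g t (v t) = ereal (h t)"
    using I1(2) I2(2) Zv fin
  proof eventually_elim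
    case (elim t)
    show ?case
    proof
      assume t: "t \<in> J"
      have ae: "AE x in lebesgue_on \<Omega>. Z (t, x) = v t x" using elim t by blast
      have f: "\<bar>slice_integral \<Omega> g t (v t)\<bar> \<noteq> \<infinity>" using elim(4) t by (rule mp)
      have "(\<integral>\<^sup>+x. e2ennreal (g t x (v t x)) \<partial>lebesgue_on \<Omega>) = I1 t"
      proof -
        have "(\<integral>\<^sup>+x. e2ennreal (g t x (v t x)) \<partial>lebesgue_on \<Omega>) = (\<integral>\<^sup>+x. e2ennreal (g t x (Z (t, x))) \<partial>lebesgue_on \<Omega>)"
          by (rule nn_integral_cong_AE) (use ae in eventually_elim, simp)
        then show ?thesis using elim(1) t by simp
      qed
      moreover have "(\<integral>\<^sup>+x. e2ennreal (- g t x (v t x)) \<partial>lebesgue_on \<Omega>) = I2 t"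
      proof -
        have "(\<integral>\<^sup>+x. e2ennreal (- g t x (v t x)) \<partial>lebesgue_on \<Omega>) = (\<integral>\<^sup>+x. e2ennreal (- g t x (Z (t, x))) \<partial>lebesgue_on \<Omega>)"
          by (rule nn_integral_cong_AE) (use ae in eventually_elim, simp)
        then show ?thesis using elim(2) t by simp
      qed
      ultimately have "slice_integral \<Omega> g t (v t) = enn2ereal (I1 t) - enn2ereal (I2 t)"
        using f unfolding slice_integral_def ext_integral_def by (auto split: if_splits)
      then show "slice_integral \<Omega> g t (v t) = ereal (h t)"
        using f by (auto simp: h_def ereal_real)
    qed
  qed
  ultimately show ?thesis by (rule that)
qed

text \<open>Sections of a function measurable for the completion are measurable only at almost every
  \<open>t\<close>, where they agree almost everywhere with sections of a Borel function.\<close>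

lemma slices_measurable:
  fixes w :: "real \<times> 'a::euclidean_space \<Rightarrow> 'b::euclidean_space"
  assumes J: "J \<in> sets borel" and \<Omega>: "\<Omega> \<in> sets borel"
    and w: "w \<in> borel_measurable (lebesgue_on (J \<times> \<Omega>))"
  shows "AE t in lborel. t \<in> J \<longrightarrow> (\<lambda>x. w (t, x)) \<in> borel_measurable (lebesgue_on \<Omega>)"
proof -
  have Q: "J \<times> \<Omega> \<in> sets lebesgue" using J \<Omega> by (simp add: borel_prod[symmetric])
  have "AE t in lborel. t \<in> J \<longrightarrow> (\<lambda>x. w (t, x) \<bullet> b) \<in> borel_measurable (lebesgue_on \<Omega>)" for b
  proof -
    define W where "W y = (if y \<in> J \<times> \<Omega> then w y \<bullet> b else 0)" for y
    have "W \<in> borel_measurable lebesgue"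
      unfolding W_def[abs_def] using w by (intro borel_measurable_if_I[OF _ Q]) auto
    then obtain W' where W': "W' \<in> borel_measurable lborel" "AE y in lborel. W y = W' y"
      using completion_ex_borel_measurable_real by blast
    have W'm [measurable]: "W' \<in> borel_measurable (lborel \<Otimes>\<^sub>M lborel)" using W'(1) by (simp add: lborel_prod)
    have "AE y in lborel \<Otimes>\<^sub>M lborel. W y = W' y" unfolding lborel_prod by (rule W'(2))
    then have "AE t in lborel. AE x in lborel. W (t, x) = W' (t, x)" by (rule lborel_pair.AE_pair)
    then show ?thesis
    proof eventually_elim
      case (elim t)
      show ?case
      proof
        assume t: "t \<in> J"
        have m: "(\<lambda>x. W' (t, x)) \<in> borel_measurable lebesgue" by (rule measurable_completion) measurable
        have "AE x in lebesgue. W' (t, x) = (if x \<in> \<Omega> then w (t, x) \<bullet> b else 0)"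
          using AE_completion[OF elim] by eventually_elim (use t in \<open>simp add: W_def\<close>)
        from borel_measurable_AE[OF m this]
        show "(\<lambda>x. w (t, x) \<bullet> b) \<in> borel_measurable (lebesgue_on \<Omega>)" by (rule borel_measurable_if_D)
      qed
    qed
  qed
  then have "AE t in lborel. \<forall>b\<in>Basis. t \<in> J \<longrightarrow> (\<lambda>x. w (t, x) \<bullet> b) \<in> borel_measurable (lebesgue_on \<Omega>)"
    by (intro AE_finite_allI) auto
  then show ?thesis
    by eventually_elim (auto intro: borel_measurable_euclidean_space[THEN iffD2])
qed

text \<open>In \<open>assumption_A\<close> the function \<open>ws\<close> is given on the cylinder
  and not as a Bochner function; this provides its slices together with an integrable bound in
  time.\<close>

lemma Lp_product_slices:
  fixes w :: "real \<times> 'a::euclidean_space \<Rightarrow> 'b::euclidean_space"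
  assumes J: "J \<in> sets borel" and \<Omega>: "\<Omega> \<in> sets borel" and w: "w \<in> Lp q (lebesgue_on (J \<times> \<Omega>))"
  obtains r where "integrable (lebesgue_on J) r"
    "AE t in lebesgue_on J. (\<lambda>x. w (t, x)) \<in> Lp q (lebesgue_on \<Omega>) \<and> (LINT x|lebesgue_on \<Omega>. norm (w (t, x)) powr q) = r t"
proof -
  have wm [measurable]: "w \<in> borel_measurable (lebesgue_on (J \<times> \<Omega>))" and fin: "(\<integral>\<^sup>+y. ennreal (norm (w y) powr q) \<partial>lebesgue_on (J \<times> \<Omega>)) < \<infinity>"
    using w by (auto simp: Lp_def)
  have "(\<lambda>y. ennreal (norm (w y) powr q)) \<in> borel_measurable (lebesgue_on (J \<times> \<Omega>))" by measurable
  then obtain I where I: "I \<in> borel_measurable borel"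
    "AE t in lborel. t \<in> J \<longrightarrow> (\<integral>\<^sup>+x. ennreal (norm (w (t, x)) powr q) \<partial>lebesgue_on \<Omega>) = I t"
    "(\<integral>\<^sup>+t. I t \<partial>lborel) = (\<integral>\<^sup>+y. ennreal (norm (w y) powr q) \<partial>lebesgue_on (J \<times> \<Omega>))"
    by (rule tonelli_lebesgue_on[OF J \<Omega>])
  note [measurable] = I(1)
  have Ifin: "AE t in lborel. I t \<noteq> \<infinity>" using I(3) fin by (intro nn_integral_PInf_AE) auto
  define r where "r t = enn2real (I t)" for t
  have rm [measurable]: "r \<in> borel_measurable borel" unfolding r_def[abs_def] by measurable
  have "(\<integral>\<^sup>+t. ennreal (r t) \<partial>lborel) = (\<integral>\<^sup>+t. I t \<partial>lborel)"
    by (rule nn_integral_cong_AE, use Ifin in eventually_elim) (simp add: r_def ennreal_enn2real top.not_eq_extremum)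
  then have "integrable lborel r" using I(3) fin by (intro integrableI_nonneg) (auto simp: r_def)
  then have ir: "integrable (lebesgue_on J) r"
    using integrable_restrict_space[of J lebesgue r] J integrable_mult_indicator[of J lebesgue r] integrable_completion[of r lborel] by simp
  have "AE t in lborel. t \<in> J \<longrightarrow> ((\<lambda>x. w (t, x)) \<in> Lp q (lebesgue_on \<Omega>) \<and> (LINT x|lebesgue_on \<Omega>. norm (w (t, x)) powr q) = r t)"
    using I(2) Ifin slices_measurable[OF J \<Omega> wm]
  proof eventually_elim
    case (elim t)
    show ?case
    proof
      assume t: "t \<in> J"
      then have [measurable]: "(\<lambda>x. w (t, x)) \<in> borel_measurable (lebesgue_on \<Omega>)" using elim by blast
      have eq: "(\<integral>\<^sup>+x. ennreal (norm (w (t, x)) powr q) \<partial>lebesgue_on \<Omega>) = I t" using elim t by blast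
      have "(\<lambda>x. w (t, x)) \<in> Lp q (lebesgue_on \<Omega>)"
        using eq elim(2) by (simp add: Lp_def top.not_eq_extremum)
      moreover have "(LINT x|lebesgue_on \<Omega>. norm (w (t, x)) powr q) = r t"
        unfolding r_def eq[symmetric] by (rule integral_eq_nn_integral) auto
      ultimately show "(\<lambda>x. w (t, x)) \<in> Lp q (lebesgue_on \<Omega>) \<and> (LINT x|lebesgue_on \<Omega>. norm (w (t, x)) powr q) = r t" by blast
    qed
  qed
  then have "AE t in lebesgue_on J. (\<lambda>x. w (t, x)) \<in> Lp q (lebesgue_on \<Omega>) \<and> (LINT x|lebesgue_on \<Omega>. norm (w (t, x)) powr q) = r t"
    using J AE_completion by (subst AE_restrict_space_iff) auto
  with ir show ?thesis by (rule that)
qed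

section \<open>Integrability in time of Bochner norms and dual pairings\<close>

context seminormed
begin

lemma bochner_Lp_integrable_norm:
  assumes J: "J \<in> sets borel" and f: "f \<in> bochner_Lp r J X N"
  shows "integrable (lebesgue_on J) (\<lambda>t. N (f t) powr r)"
proof -
  obtain S where S: "S \<in> sets borel" "S \<subseteq> J" "AE t in lborel. t \<in> J \<longrightarrow> t \<in> S" "\<And>t. t \<in> S \<Longrightarrow> f t \<in> X"
    "\<And>S'. S' \<in> sets borel \<Longrightarrow> S' \<subseteq> S \<Longrightarrow> borel_limit X N (cut S' f)"
    "\<And>S'. S' \<in> sets borel \<Longrightarrow> S' \<subseteq> S \<Longrightarrow> integrable lborel (\<lambda>t. N (cut S' f t) powr r)"
    by (rule bochner_Lp_borel_limit[OF J f]) blast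
  have i: "integrable lborel (\<lambda>t. N (cut S f t) powr r)" using S(6)[OF S(1)] by simp
  show ?thesis
  proof (subst integral_lebesgue_on_eq_lborel(2)[OF J])
    show "(\<lambda>t. N (cut S f t) powr r) \<in> borel_measurable borel" using borel_measurable_integrable[OF i] by simp
    show "AE t in lborel. t \<in> J \<longrightarrow> N (f t) powr r = N (cut S f t) powr r"
      using S(3) by eventually_elim auto
    show "N (cut S f t) powr r = 0" if "t \<notin> J" for t using that S(2) N_zero by auto
  qed (rule i)
qed

lemma bochner_pairing_integrable:
  assumes J: "J \<in> sets borel" and pq: "1 < p" "1 < q" "1 / p + 1 / q = 1"
    and v: "v \<in> bochner_Lp p J X N" and \<xi>: "\<xi> \<in> bochner_Lp q J (dual_space X N) (dual_norm X N)"
  shows "integrable (lebesgue_on J) (\<lambda>t. \<xi> t (v t))"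
proof -
  interpret D: seminormed "dual_space X N" "dual_norm X N" by (rule seminormed_dual)
  obtain S1 where S1: "S1 \<in> sets borel" "S1 \<subseteq> J" "AE t in lborel. t \<in> J \<longrightarrow> t \<in> S1" "\<And>t. t \<in> S1 \<Longrightarrow> v t \<in> X"
    "\<And>S'. S' \<in> sets borel \<Longrightarrow> S' \<subseteq> S1 \<Longrightarrow> borel_limit X N (cut S' v)"
    "\<And>S'. S' \<in> sets borel \<Longrightarrow> S' \<subseteq> S1 \<Longrightarrow> integrable lborel (\<lambda>t. N (cut S' v t) powr p)"
    by (rule bochner_Lp_borel_limit[OF J v]) blast
  obtain S2 where S2: "S2 \<in> sets borel" "S2 \<subseteq> J" "AE t in lborel. t \<in> J \<longrightarrow> t \<in> S2" "\<And>t. t \<in> S2 \<Longrightarrow> \<xi> t \<in> dual_space X N"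
    "\<And>S'. S' \<in> sets borel \<Longrightarrow> S' \<subseteq> S2 \<Longrightarrow> borel_limit (dual_space X N) (dual_norm X N) (cut S' \<xi>)"
    "\<And>S'. S' \<in> sets borel \<Longrightarrow> S' \<subseteq> S2 \<Longrightarrow> integrable lborel (\<lambda>t. dual_norm X N (cut S' \<xi> t) powr q)"
    by (rule D.bochner_Lp_borel_limit[OF J \<xi>]) blast
  define F where "F = cut S1 v"
  define F' where "F' = cut S2 \<xi>"
  have F: "borel_limit X N F" "integrable lborel (\<lambda>t. N (F t) powr p)"
    unfolding F_def using S1(5,6)[OF S1(1)] by auto
  have F': "borel_limit (dual_space X N) (dual_norm X N) F'" "integrable lborel (\<lambda>t. dual_norm X N (F' t) powr q)"
    unfolding F'_def using S2(5,6)[OF S2(1)] by auto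
  have m: "(\<lambda>t. F' t (F t)) \<in> borel_measurable borel" by (rule borel_limit_pairing_diag[OF F(1) F'(1)])
  have "\<bar>F' t (F t)\<bar> \<le> dual_norm X N (F' t) powr q + N (F t) powr p" for t
    using dual_norm_bound[OF D.borel_limit_memD[OF F'(1)] borel_limit_memD[OF F(1)], of t t]
      young_le[OF pq D.nonneg[OF D.borel_limit_memD[OF F'(1)]] nonneg[OF borel_limit_memD[OF F(1)]], of t t] by linarith
  then have i: "integrable lborel (\<lambda>t. F' t (F t))"
    using m by (intro Bochner_Integration.integrable_bound[OF Bochner_Integration.integrable_add[OF F'(2) F(2)]])
      (auto intro!: AE_I2 order_trans[OF _ abs_ge_self])
  show ?thesis
  proof (subst integral_lebesgue_on_eq_lborel(2)[OF J m])
    show "AE t in lborel. t \<in> J \<longrightarrow> \<xi> t (v t) = F' t (F t)"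
      using S1(3) S2(3) by eventually_elim (auto simp: F_def F'_def)
    show "F' t (F t) = 0" if "t \<notin> J" for t using that S2(2) by (auto simp: F'_def)
  qed (rule i)
qed

end

text \<open>Supplies the Lipschitz premise of \<open>joint_representative\<close> for the identity
  and for the weak gradient.\<close>

lemma W1p_nn_integral_le:
  fixes y z :: "real^'d \<Rightarrow> real^'l"
  assumes op: "open \<Omega>" and bd: "bounded \<Omega>" and p: "1 \<le> p" and y: "y \<in> W1p \<Omega> p" and z: "z \<in> W1p \<Omega> p"
  shows "(\<integral>\<^sup>+x. ennreal (norm (y x - z x) powr p) \<partial>lebesgue_on \<Omega>) \<le> ennreal (W1p_norm \<Omega> p (y - z) powr p)"
    and "(\<integral>\<^sup>+x. ennreal (norm (weak_grad \<Omega> p y x - weak_grad \<Omega> p z x) powr p) \<partial>lebesgue_on \<Omega>)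
        \<le> ennreal (W1p_norm \<Omega> p (y - z) powr p)"
proof -
  let ?M = "lebesgue_on \<Omega>"
  interpret V: seminormed "W1p \<Omega> p :: (real^'d \<Rightarrow> real^'l) set" "W1p_norm \<Omega> p" by (rule seminormed_W1p[OF op bd p])
  have yz: "y - z \<in> W1p \<Omega> p" by (rule V.diff_mem[OF y z])
  have eqf: "y - z = (\<lambda>x. 1 *\<^sub>R y x + (-1) *\<^sub>R z x)" by auto
  note np = W1p_norm_powr[OF op bd p, of "y - z"]
  have nn: "0 \<le> (LINT x|?M. norm (f x) powr p)" for f :: "real^'d \<Rightarrow> 'c::euclidean_space"
    by (rule integral_nonneg_AE) simp
  have "(\<integral>\<^sup>+x. ennreal (norm (y x - z x) powr p) \<partial>?M) = ennreal (LINT x|?M. norm ((y - z) x) powr p)"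
    using nn_integral_eq_integral[OF Lp_integrable[OF W1p_imp_Lp[OF op bd p yz]]] by simp
  also have "\<dots> \<le> ennreal (W1p_norm \<Omega> p (y - z) powr p)"
    using nn[of "weak_grad \<Omega> p (y - z)"] by (intro ennreal_leI) (simp add: np)
  finally show "(\<integral>\<^sup>+x. ennreal (norm (y x - z x) powr p) \<partial>?M) \<le> ennreal (W1p_norm \<Omega> p (y - z) powr p)" .
  have "(\<integral>\<^sup>+x. ennreal (norm (weak_grad \<Omega> p y x - weak_grad \<Omega> p z x) powr p) \<partial>?M)
      = (\<integral>\<^sup>+x. ennreal (norm (weak_grad \<Omega> p (y - z) x) powr p) \<partial>?M)"
    by (rule nn_integral_cong_AE, use W1p_lin(2)[OF op bd p y z, of 1 "-1"] in eventually_elim)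
      (unfold eqf, simp)
  also have "\<dots> = ennreal (LINT x|?M. norm (weak_grad \<Omega> p (y - z) x) powr p)"
    using nn_integral_eq_integral[OF Lp_integrable[OF weak_grad_spec(1)[OF op bd p yz]]] by simp
  also have "\<dots> \<le> ennreal (W1p_norm \<Omega> p (y - z) powr p)"
    using nn[of "y - z"] by (intro ennreal_leI) (simp add: np)
  finally show "(\<integral>\<^sup>+x. ennreal (norm (weak_grad \<Omega> p y x - weak_grad \<Omega> p z x) powr p) \<partial>?M)
        \<le> ennreal (W1p_norm \<Omega> p (y - z) powr p)" .
qed

section \<open>Lower bounds from the conjugate integrand\<close>

lemma fenchel_young_integrand:
  "ereal (\<zeta> \<bullet> z) - g t x z \<le> integrand_conj g t x \<zeta>"
  unfolding integrand_conj_def by (rule SUP_upper) simp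

text \<open>Fenchel-Young with the fixed dual element \<open>z\<close> bounds the integrand from
  below by \<open>z x \<bullet> v x\<close> minus the conjugate at \<open>z x\<close>; Young's
  inequality then estimates the product by powers whose time integrals are finite.\<close>

lemma slice_lower_bound:
  fixes g :: "real \<Rightarrow> real^'d \<Rightarrow> 'b::euclidean_space \<Rightarrow> ereal"
  assumes pq: "1 < p" "1 < q" "1 / p + 1 / q = 1"
    and v: "v \<in> Lp p (lebesgue_on \<Omega>)" and z: "z \<in> Lp q (lebesgue_on \<Omega>)"
    and fin: "\<bar>slice_integral \<Omega> g t v\<bar> \<noteq> \<infinity>"
    and conj: "slice_integral \<Omega> (integrand_conj g) t z \<le> ereal r" and r: "0 \<le> r"
  shows "- ((LINT x|lebesgue_on \<Omega>. norm (z x) powr q) + (LINT x|lebesgue_on \<Omega>. norm (v x) powr p) + r)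
     \<le> real_of_ereal (slice_integral \<Omega> g t v)"
proof -
  let ?M = "lebesgue_on \<Omega>"
  define a where "a x = real_of_ereal (g t x (v x))" for x
  define b where "b x = integrand_conj g t x (z x)" for x
  note A = ext_integral_finiteD[OF fin[unfolded slice_integral_def]]
  have aeq: "AE x in ?M. g t x (v x) = ereal (a x)" and ia: "integrable ?M a"
    and sa: "slice_integral \<Omega> g t v = ereal (LINT x|?M. a x)"
    using A(2-4) by (auto simp: a_def[abs_def] slice_integral_def)
  have b1: "b \<in> borel_measurable ?M" "(\<integral>\<^sup>+x. e2ennreal (b x) \<partial>?M) < \<infinity>"
    using conj unfolding slice_integral_def ext_integral_def has_integrable_pos_part_def b_def[abs_def]
    by (auto split: if_splits)
  note [measurable] = Lp_measurable[OF v] Lp_measurable[OF z] b1(1)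
  have izv: "integrable ?M (\<lambda>x. norm (z x) powr q + norm (v x) powr p)"
    using Lp_integrable[OF v] Lp_integrable[OF z] by simp
  have zv: "\<bar>z x \<bullet> v x\<bar> \<le> norm (z x) powr q + norm (v x) powr p" for x
    using Cauchy_Schwarz_ineq2[of "z x" "v x"] young_le[OF pq, of "norm (z x)" "norm (v x)"] by simp
  have i: "integrable ?M (\<lambda>x. z x \<bullet> v x)"
    by (rule Bochner_Integration.integrable_bound[OF izv]) (use zv in \<open>auto intro!: AE_I2 order_trans[OF _ abs_ge_self]\<close>)
  have lb: "AE x in ?M. ereal (z x \<bullet> v x - a x) \<le> b x"
    using aeq
  proof eventually_elim
    case (elim x)
    then show ?case using fenchel_young_integrand[of "z x" "v x" g t x] by (simp add: b_def)
  qed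
  have "(\<integral>\<^sup>+x. e2ennreal (- b x) \<partial>?M) \<le> (\<integral>\<^sup>+x. ennreal \<bar>z x \<bullet> v x - a x\<bar> \<partial>?M)"
  proof (rule nn_integral_mono_AE, use lb in eventually_elim)
    case (elim x)
    then have "- b x \<le> ereal \<bar>z x \<bullet> v x - a x\<bar>"
      by (cases "b x") auto
    from e2ennreal_mono[OF this] show ?case by (simp add: e2ennreal_ereal)
  qed
  also have "\<dots> < \<infinity>"
    using Bochner_Integration.integrable_diff[OF i ia] by (simp add: integrable_iff_bounded)
  \<comment> \<open>The hypothesis bounds the integral of the conjugate from above only.
    Fenchel-Young excludes the value -\<infinity>, so it is a number that can be compared with the
    other integrals.\<close>
  finally have b2: "(\<integral>\<^sup>+x. e2ennreal (- b x) \<partial>?M) < \<infinity>" .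
  have "ext_integral ?M b = enn2ereal (\<integral>\<^sup>+x. e2ennreal (b x) \<partial>?M) - enn2ereal (\<integral>\<^sup>+x. e2ennreal (- b x) \<partial>?M)"
    unfolding ext_integral_def has_integrable_pos_part_def using b1 by simp
  also have "\<bar>\<dots>\<bar> \<noteq> \<infinity>"
    using b1(2) b2 by (cases "\<integral>\<^sup>+x. e2ennreal (b x) \<partial>?M"; cases "\<integral>\<^sup>+x. e2ennreal (- b x) \<partial>?M") auto
  finally have bf: "\<bar>ext_integral ?M b\<bar> \<noteq> \<infinity>" .
  note Bf = ext_integral_finiteD[OF bf]
  have "(LINT x|?M. z x \<bullet> v x) - (LINT x|?M. a x) = (LINT x|?M. z x \<bullet> v x - a x)"
    using i ia by simp
  also have "\<dots> \<le> (LINT x|?M. real_of_ereal (b x))"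
  proof (rule integral_mono_AE)
    show "AE x in ?M. z x \<bullet> v x - a x \<le> real_of_ereal (b x)"
      using lb Bf(3) by eventually_elim (metis ereal_less_eq(3))
  qed (use i ia Bf(2) in auto)
  also have "\<dots> \<le> r"
    using conj Bf(4) by (simp add: slice_integral_def b_def[abs_def])
  finally have 1: "(LINT x|?M. z x \<bullet> v x) - r \<le> (LINT x|?M. a x)" by simp
  have "\<bar>LINT x|?M. z x \<bullet> v x\<bar> \<le> (LINT x|?M. \<bar>z x \<bullet> v x\<bar>)" by (rule integral_abs_bound)
  also have "\<dots> \<le> (LINT x|?M. norm (z x) powr q + norm (v x) powr p)"
    using i izv zv by (intro integral_mono) auto
  also have "\<dots> = (LINT x|?M. norm (z x) powr q) + (LINT x|?M. norm (v x) powr p)"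
    using Lp_integrable[OF v] Lp_integrable[OF z] by simp
  finally show ?thesis using 1 sa by simp
qed

section \<open>The value of the functional at the solution\<close>

text \<open>The subgradient inequality says precisely that the supremum in the conjugate is attained
  at \<open>v\<close>.\<close>

lemma fenchel_conj_subdifferential:
  assumes "seminormed X N" and \<xi>: "\<xi> \<in> subdifferential X N G v" and v: "v \<in> X"
  shows "fenchel_conj X G \<xi> = ereal (\<xi> v) - G v"
proof -
  interpret seminormed X N by fact
  have \<xi>D: "\<xi> \<in> dual_space X N" and fin: "\<bar>G v\<bar> \<noteq> \<infinity>" and le: "\<And>w. w \<in> X \<Longrightarrow> G v + ereal (\<xi> (w - v)) \<le> G w"
    using \<xi> by (auto simp: subdifferential_def)
  obtain a where a: "G v = ereal a" using fin by (cases "G v") auto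
  show ?thesis unfolding fenchel_conj_def
  proof (rule antisym)
    show "(SUP w\<in>X. ereal (\<xi> w) - G w) \<le> ereal (\<xi> v) - G v"
    proof (rule SUP_least)
      fix w assume w: "w \<in> X"
      show "ereal (\<xi> w) - G w \<le> ereal (\<xi> v) - G v"
        using le[OF w] dual_diff[OF \<xi>D w v] a by (cases "G w") auto
    qed
    show "ereal (\<xi> v) - G v \<le> (SUP w\<in>X. ereal (\<xi> w) - G w)" using v by (rule SUP_upper)
  qed
qed

lemma ereal_sum_diff_finite:
  fixes a b :: ereal
  assumes "\<bar>a + b - ereal c\<bar> \<noteq> \<infinity>" shows "\<bar>a\<bar> \<noteq> \<infinity>" "\<bar>b\<bar> \<noteq> \<infinity>"
  using assms by (cases a; cases b; simp)+

lemma energy_at_solution: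
  fixes \<Omega> \<Gamma>\<^sub>D :: "(real^'d) set"
    and p q T :: real
    and f :: "real \<Rightarrow> (real^'d \<Rightarrow> real^'l) \<Rightarrow> real"
    and u0 :: "real^'d \<Rightarrow> real^'l"
    and \<phi> :: "real \<Rightarrow> real^'d \<Rightarrow> real^'d^'l \<Rightarrow> ereal"
    and \<psi> :: "real \<Rightarrow> real^'d \<Rightarrow> real^'l \<Rightarrow> ereal"
    and u :: "real \<Rightarrow> real^'d \<Rightarrow> real^'l"
  defines "E \<equiv> energy \<Omega> p \<phi> \<psi> f"
  assumes dom: "bounded_lipschitz_domain \<Omega>"
    and p1: "1 < p" and pq1: "1 / p + 1 / q = 1" and T: "0 < T"
    and A: "assumption_A \<Omega> \<Gamma>\<^sub>D p q T \<phi> \<psi>"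
    and f: "f \<in> bochner_Lp_Vdual \<Omega> \<Gamma>\<^sub>D p q {0<..<T}"
    and u0: "u0 \<in> Lp 2 (lebesgue_on \<Omega>)"
    and sol: "is_flow_solution \<Omega> \<Gamma>\<^sub>D p q T E u0 u"
  shows "BEN_functional \<Omega> \<Gamma>\<^sub>D p q T E u0 u = ereal ((1/2) * (Lp_norm 2 (lebesgue_on \<Omega>) u0)\<^sup>2)"
proof -
  define X where "X = (W1p_D \<Omega> \<Gamma>\<^sub>D p :: (real^'d \<Rightarrow> real^'l) set)"
  define N where "N = (W1p_norm \<Omega> p :: (real^'d \<Rightarrow> real^'l) \<Rightarrow> real)"
  let ?J = "{0<..<T}" and ?M = "lebesgue_on \<Omega>"
  let ?L = "lebesgue_on ?J"
  have op: "open \<Omega>" and bd: "bounded \<Omega>" using dom by (auto simp: bounded_lipschitz_domain_def)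
  have p1': "1 \<le> p" using p1 by simp
  have q1: "1 < q"
  proof -
    have "1 / q = 1 - 1 / p" using pq1 by simp
    moreover have "0 < 1 - 1 / p" "1 - 1 / p < 1" using p1 by auto
    ultimately have "0 < 1 / q" "1 / q < 1" by auto
    then show ?thesis by (cases "q > 0") (auto simp: field_simps)
  qed
  note pq = p1 q1 pq1
  have J: "?J \<in> sets borel" and \<Omega>b: "\<Omega> \<in> sets borel" using op by auto
  have VD: "seminormed (W1p_D \<Omega> \<Gamma>\<^sub>D p :: (real^'d \<Rightarrow> real^'l) set) (W1p_norm \<Omega> p)"
    by (rule seminormed_W1p_D[OF op bd p1' finite_boundary_measure[OF dom]])
  interpret V: seminormed X N using VD by (simp add: X_def N_def)
  have XW: "v \<in> W1p \<Omega> p" if "v \<in> X" for v using that by (simp add: X_def W1p_D_def)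
  define u' where "u' = time_derivative \<Omega> \<Gamma>\<^sub>D p q T u"
  have uW: "u \<in> W_space \<Omega> \<Gamma>\<^sub>D p q T"
    and sub: "AE t in ?L. - u' t \<in> subdifferential X N (E t) (u t)"
    and init: "AE x in ?M. value_at \<Omega> T u 0 x = u0 x"
    using sol by (auto simp: is_flow_solution_def u'_def X_def N_def)
  have uB: "u \<in> bochner_Lp_V \<Omega> \<Gamma>\<^sub>D p p ?J" using uW by (simp add: W_space_def)
  have d: "is_time_derivative \<Omega> \<Gamma>\<^sub>D p q T u u'"
    unfolding u'_def time_derivative_def using uW
    by (intro someI_ex[of "is_time_derivative \<Omega> \<Gamma>\<^sub>D p q T u"]) (simp add: W_space_def)
  note ibp = integration_by_parts[OF VD pq T uB d]
  have u'B: "u' \<in> bochner_Lp q ?J (dual_space X N) (dual_norm X N)"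
    using d by (simp add: is_time_derivative_def X_def N_def)
  have fB: "f \<in> bochner_Lp q ?J (dual_space X N) (dual_norm X N)" using f by (simp add: X_def N_def)
  have uB': "u \<in> bochner_Lp p ?J X N" using uB by (simp add: X_def N_def)
  have uX: "AE t in ?L. u t \<in> X" and u'D: "AE t in ?L. u' t \<in> dual_space X N"
    using uB' u'B by (auto simp: bochner_Lp_def)
  obtain us zs ws where
    us: "us \<in> bochner_Lp p ?J X N"
    and zs: "zs \<in> bochner_Lp q ?J (Lp q ?M) (Lp_norm q ?M)"
    and ws: "(\<lambda>(t, x). ws t x) \<in> Lp q (lebesgue_on (?J \<times> \<Omega>))"
    and p\<phi>: "has_integrable_pos_part ?L (\<lambda>t. slice_integral \<Omega> \<phi> t (weak_grad \<Omega> p (us t)))"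
    and p\<psi>: "has_integrable_pos_part ?L (\<lambda>t. slice_integral \<Omega> \<psi> t (us t))"
    and c\<phi>: "has_integrable_pos_part ?L (\<lambda>t. slice_integral \<Omega> (integrand_conj \<phi>) t (zs t))"
    and c\<psi>: "has_integrable_pos_part ?L (\<lambda>t. slice_integral \<Omega> (integrand_conj \<psi>) t (ws t))"
    and g\<phi>: "convex_normal_integrand (?J \<times> \<Omega>) \<phi>" and g\<psi>: "convex_normal_integrand (?J \<times> \<Omega>) \<psi>"
    using A unfolding assumption_A_def X_def N_def by blast
  have usX: "AE t in ?L. us t \<in> X" using us by (auto simp: bochner_Lp_def)
  have zsL: "AE t in ?L. zs t \<in> Lp q ?M" using zs by (auto simp: bochner_Lp_def)
  interpret Lq: seminormed "Lp q ?M :: (real^'d \<Rightarrow> real^'d^'l) set" "Lp_norm q ?M"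
    by (rule seminormed_Lp) (use q1 in simp)
  have E_eq: "E t v = slice_integral \<Omega> \<phi> t (weak_grad \<Omega> p v) + slice_integral \<Omega> \<psi> t v - ereal (f t v)" for t v
    by (simp add: E_def energy_def)
  \<comment> \<open>In extended arithmetic infinite summands never cancel to a finite value, so the
    finite energy at \<open>u t\<close> forces both slice integrals to be finite.\<close>
  have fin: "AE t in ?L. \<bar>slice_integral \<Omega> \<phi> t (weak_grad \<Omega> p (u t))\<bar> \<noteq> \<infinity> \<and> \<bar>slice_integral \<Omega> \<psi> t (u t)\<bar> \<noteq> \<infinity>"
    using sub
  proof eventually_elim
    case (elim t)
    then have "\<bar>E t (u t)\<bar> \<noteq> \<infinity>" by (simp add: subdifferential_def)
    from ereal_sum_diff_finite[OF this[unfolded E_eq]] show ?case by blast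
  qed
  have toL: "AE t in lborel. t \<in> ?J \<longrightarrow> P t" if "AE t in ?L. P t" for P
    using that by (simp add: AE_restrict_space_iff AE_completion_iff)
  have frL: "AE t in ?L. P t" if "AE t in lborel. t \<in> ?J \<longrightarrow> P t" for P
    using that by (simp add: AE_restrict_space_iff AE_completion)
  obtain S where S: "S \<in> sets borel" "S \<subseteq> ?J" "AE t in lborel. t \<in> ?J \<longrightarrow> t \<in> S"
    "\<And>S'. S' \<in> sets borel \<Longrightarrow> S' \<subseteq> S \<Longrightarrow> borel_limit X N (cut S' u)"
    by (rule V.bochner_Lp_borel_limit[OF J uB']) blast
  have Fl: "borel_limit X N (cut S u)" using S(4)[OF S(1)] by simp
  have p0: "0 < p" using p1 by simp
  \<comment> \<open>The gradient of \<open>u\<close> is chosen separately at each time; this version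
    is jointly measurable and can be inserted into \<open>\<phi>\<close>.\<close>
  obtain Z1 where Z1: "Z1 \<in> borel_measurable (borel \<Otimes>\<^sub>M ?M)" "\<And>t. AE x in ?M. Z1 (t, x) = weak_grad \<Omega> p (cut S u t) x"
  proof (rule V.joint_representative[OF Fl p0, of "weak_grad \<Omega> p" ?M])
    show "weak_grad \<Omega> p y \<in> borel_measurable ?M" if "y \<in> X" for y
      by (rule Lp_measurable[OF weak_grad_spec(1)[OF op bd p1' XW[OF that]]])
    show "(\<integral>\<^sup>+x. ennreal (norm (weak_grad \<Omega> p y x - weak_grad \<Omega> p z x) powr p) \<partial>?M) \<le> ennreal (N (y - z) powr p)"
      if "y \<in> X" "z \<in> X" for y z
      using W1p_nn_integral_le(2)[OF op bd p1' XW[OF that(1)] XW[OF that(2)]] by (simp add: N_def)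
  qed blast
  obtain Z2 where Z2: "Z2 \<in> borel_measurable (borel \<Otimes>\<^sub>M ?M)" "\<And>t. AE x in ?M. Z2 (t, x) = cut S u t x"
  proof (rule V.joint_representative[OF Fl p0, of "\<lambda>y. y" ?M])
    show "y \<in> borel_measurable ?M" if "y \<in> X" for y
      by (rule Lp_measurable[OF W1p_imp_Lp[OF op bd p1' XW[OF that]]])
    show "(\<integral>\<^sup>+x. ennreal (norm (y x - z x) powr p) \<partial>?M) \<le> ennreal (N (y - z) powr p)"
      if "y \<in> X" "z \<in> X" for y z
      using W1p_nn_integral_le(1)[OF op bd p1' XW[OF that(1)] XW[OF that(2)]] by (simp add: N_def)
  qed blast
  obtain h1 where h1: "h1 \<in> borel_measurable borel"
    "AE t in lborel. t \<in> ?J \<longrightarrow> slice_integral \<Omega> \<phi> t (weak_grad \<Omega> p (u t)) = ereal (h1 t)"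
  proof (rule slice_integral_measurable[OF J \<Omega>b _ Z1(1)])
    show "(\<lambda>((t, x), z). \<phi> t x z) \<in> borel_measurable (lebesgue_on (?J \<times> \<Omega>) \<Otimes>\<^sub>M borel)"
      using g\<phi> by (simp add: convex_normal_integrand_def)
    show "AE t in lborel. t \<in> ?J \<longrightarrow> (AE x in ?M. Z1 (t, x) = weak_grad \<Omega> p (u t) x)"
      using S(3)
    proof eventually_elim
      case (elim t)
      then show ?case using Z1(2)[of t] by auto
    qed
    show "AE t in lborel. t \<in> ?J \<longrightarrow> \<bar>slice_integral \<Omega> \<phi> t (weak_grad \<Omega> p (u t))\<bar> \<noteq> \<infinity>"
      using toL[OF fin] by eventually_elim auto
  qed blast
  obtain h2 where h2: "h2 \<in> borel_measurable borel"
    "AE t in lborel. t \<in> ?J \<longrightarrow> slice_integral \<Omega> \<psi> t (u t) = ereal (h2 t)"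
  proof (rule slice_integral_measurable[OF J \<Omega>b _ Z2(1)])
    show "(\<lambda>((t, x), z). \<psi> t x z) \<in> borel_measurable (lebesgue_on (?J \<times> \<Omega>) \<Otimes>\<^sub>M borel)"
      using g\<psi> by (simp add: convex_normal_integrand_def)
    show "AE t in lborel. t \<in> ?J \<longrightarrow> (AE x in ?M. Z2 (t, x) = u t x)"
      using S(3)
    proof eventually_elim
      case (elim t)
      then show ?case using Z2(2)[of t] by auto
    qed
    show "AE t in lborel. t \<in> ?J \<longrightarrow> \<bar>slice_integral \<Omega> \<psi> t (u t)\<bar> \<noteq> \<infinity>"
      using toL[OF fin] by eventually_elim auto
  qed blast
  have ifu: "integrable ?L (\<lambda>t. f t (u t))" by (rule V.bochner_pairing_integrable[OF J pq uB' fB])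
  have ifs: "integrable ?L (\<lambda>t. f t (us t))" by (rule V.bochner_pairing_integrable[OF J pq us fB])
  have ius: "integrable ?L (\<lambda>t. u' t (us t))" by (rule V.bochner_pairing_integrable[OF J pq us u'B])
  have iuu: "integrable ?L (\<lambda>t. u' t (u t))" by (rule ibp(2))
  define a where "a t = h1 t + h2 t - f t (u t)" for t
  have E_a: "AE t in ?L. E t (u t) = ereal (a t)"
    using frL[OF h1(2)] frL[OF h2(2)] by eventually_elim (simp add: E_eq a_def)
  have am: "a \<in> borel_measurable ?L"
  proof -
    have [measurable]: "h1 \<in> borel_measurable ?L" "h2 \<in> borel_measurable ?L"
      using h1(1) h2(1) by (auto intro!: measurable_restrict_space1 measurable_completion)
    have [measurable]: "(\<lambda>t. f t (u t)) \<in> borel_measurable ?L" using ifu by auto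
    show ?thesis unfolding a_def[abs_def] by measurable
  qed
  obtain r1 where r1: "integrable ?L r1" "\<And>t. 0 \<le> r1 t" "AE t in ?L. slice_integral \<Omega> \<phi> t (weak_grad \<Omega> p (us t)) \<le> ereal (r1 t)"
    by (rule has_integrable_pos_part_bound[OF p\<phi>]) blast
  obtain r2 where r2: "integrable ?L r2" "\<And>t. 0 \<le> r2 t" "AE t in ?L. slice_integral \<Omega> \<psi> t (us t) \<le> ereal (r2 t)"
    by (rule has_integrable_pos_part_bound[OF p\<psi>]) blast
  obtain r3 where r3: "integrable ?L r3" "\<And>t. 0 \<le> r3 t" "AE t in ?L. slice_integral \<Omega> (integrand_conj \<phi>) t (zs t) \<le> ereal (r3 t)"
    by (rule has_integrable_pos_part_bound[OF c\<phi>]) blast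
  obtain r4 where r4: "integrable ?L r4" "\<And>t. 0 \<le> r4 t" "AE t in ?L. slice_integral \<Omega> (integrand_conj \<psi>) t (ws t) \<le> ereal (r4 t)"
    by (rule has_integrable_pos_part_bound[OF c\<psi>]) blast
  obtain rw where rw: "integrable ?L rw"
    "AE t in ?L. (\<lambda>x. ws t x) \<in> Lp q ?M \<and> (LINT x|?M. norm (ws t x) powr q) = rw t"
    by (rule Lp_product_slices[OF J \<Omega>b ws]) auto
  have rz: "integrable ?L (\<lambda>t. Lp_norm q ?M (zs t) powr q)" by (rule Lq.bochner_Lp_integrable_norm[OF J zs])
  have ru: "integrable ?L (\<lambda>t. N (u t) powr p)" by (rule V.bochner_Lp_integrable_norm[OF J uB'])
  \<comment> \<open>The conjugates at \<open>zs\<close> and \<open>ws\<close> bound the two slice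
    integrals from below. The p-th power of the norm of V splits exactly into the gradient term for
    \<open>\<phi>\<close> and the function term for \<open>\<psi>\<close>.\<close>
  have lower: "AE t in ?L. - (Lp_norm q ?M (zs t) powr q + rw t + N (u t) powr p + r3 t + r4 t) \<le> h1 t + h2 t"
    using frL[OF h1(2)] frL[OF h2(2)] r3(3) r4(3) rw(2) uX zsL
  proof eventually_elim
    case (elim t)
    note W = XW[OF elim(6)]
    have z: "(LINT x|?M. norm (zs t x) powr q) = Lp_norm q ?M (zs t) powr q"
      using q1 by (subst Lp_norm_powr) auto
    have n: "N (u t) powr p = (LINT x|?M. norm (u t x) powr p) + (LINT x|?M. norm (weak_grad \<Omega> p (u t) x) powr p)"
      unfolding N_def by (rule W1p_norm_powr[OF op bd p1'])
    have "- ((LINT x|?M. norm (zs t x) powr q) + (LINT x|?M. norm (weak_grad \<Omega> p (u t) x) powr p) + r3 t)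
        \<le> real_of_ereal (slice_integral \<Omega> \<phi> t (weak_grad \<Omega> p (u t)))"
      using elim by (intro slice_lower_bound[OF pq weak_grad_spec(1)[OF op bd p1' W]] r3(2)) auto
    moreover have "- ((LINT x|?M. norm (ws t x) powr q) + (LINT x|?M. norm (u t x) powr p) + r4 t)
        \<le> real_of_ereal (slice_integral \<Omega> \<psi> t (u t))"
      using elim by (intro slice_lower_bound[OF pq W1p_imp_Lp[OF op bd p1' W]] r4(2)) auto
    ultimately show ?case using elim z n by simp
  qed
  \<comment> \<open>The subgradient inequality at \<open>u t\<close> is tested with the competitor
    \<open>us t\<close>, whose energy has an integrable majorant.\<close>
  have upper: "AE t in ?L. a t \<le> r1 t + r2 t - f t (us t) + u' t (us t) - u' t (u t)"
    using sub E_a r1(3) r2(3) uX usX u'D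
  proof eventually_elim
    case (elim t)
    have "E t (u t) + ereal ((- u' t) (us t - u t)) \<le> E t (us t)"
      using elim(1,6) by (simp add: subdifferential_def)
    also have "E t (us t) \<le> ereal (r1 t) + ereal (r2 t) - ereal (f t (us t))"
      unfolding E_eq using elim by (intro ereal_minus_mono add_mono) auto
    finally have "a t + - u' t (us t - u t) \<le> r1 t + r2 t - f t (us t)" using elim(2) by simp
    then show ?case using V.dual_diff[OF elim(7,6,5)] by simp
  qed
  have ia: "integrable ?L a"
  proof (rule Bochner_Integration.integrable_bound[OF _ am])
    let ?b = "\<lambda>t. Lp_norm q ?M (zs t) powr q + rw t + N (u t) powr p + r3 t + r4 t"
    let ?c = "\<lambda>t. r1 t + r2 t - f t (us t) + u' t (us t) - u' t (u t)"
    show "integrable ?L (\<lambda>t. \<bar>?b t\<bar> + \<bar>f t (u t)\<bar> + \<bar>?c t\<bar>)"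
      using rz rw(1) ru r1(1) r2(1) r3(1) r4(1) ifu ifs ius iuu by (intro Bochner_Integration.integrable_add integrable_abs Bochner_Integration.integrable_diff)
    show "AE t in ?L. norm (a t) \<le> norm (\<bar>?b t\<bar> + \<bar>f t (u t)\<bar> + \<bar>?c t\<bar>)"
      using lower upper
    proof eventually_elim
      case (elim t)
      have "- \<bar>?b t\<bar> - \<bar>f t (u t)\<bar> \<le> a t" using elim(1) abs_ge_self[of "?b t"] abs_ge_self[of "f t (u t)"] unfolding a_def by linarith
      moreover have "a t \<le> \<bar>?c t\<bar>" using elim(2) abs_ge_self[of "?c t"] by linarith
      ultimately have "\<bar>a t\<bar> \<le> \<bar>?b t\<bar> + \<bar>f t (u t)\<bar> + \<bar>?c t\<bar>" by linarith
      then show ?case unfolding real_norm_def by (rule order_trans[OF _ abs_ge_self])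
    qed
  qed
  have conj_b: "AE t in ?L. fenchel_conj X (E t) (- u' t) = ereal (- u' t (u t) - a t)"
    using sub E_a uX
  proof eventually_elim
    case (elim t)
    show ?case using fenchel_conj_subdifferential[OF V.seminormed_axioms elim(1,3)] elim(2) by simp
  qed
  have ib: "integrable ?L (\<lambda>t. - u' t (u t) - a t)" using iuu ia by simp
  \<comment> \<open>\<open>ext_integral\<close> assigns \<infinity> to a non-measurable integrand,
    so measurability is transferred from the real version \<open>a\<close>, using completeness of
    Lebesgue measure.\<close>
  have mE: "(\<lambda>t. E t (u t)) \<in> borel_measurable ?L"
    by (rule borel_measurable_lebesgue_on_AE_ereal[OF J _ E_a]) (use am in measurable)
  have mC: "(\<lambda>t. fenchel_conj X (E t) (- u' t)) \<in> borel_measurable ?L"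
    by (rule borel_measurable_lebesgue_on_AE_ereal[OF J _ conj_b]) (use borel_measurable_integrable[OF ib] in measurable)
  have e1: "ext_integral ?L (\<lambda>t. E t (u t)) = ereal (LINT t|?L. a t)"
    by (rule ext_integral_eq_integral[OF mE ia E_a])
  have e2: "ext_integral ?L (\<lambda>t. fenchel_conj X (E t) (- u' t)) = ereal (LINT t|?L. - u' t (u t) - a t)"
    by (rule ext_integral_eq_integral[OF mC ib conj_b])
  have rep: "is_continuous_rep \<Omega> T u (value_at \<Omega> T u)"
    unfolding value_at_def by (rule someI_ex[OF ibp(1)])
  have c0: "value_at \<Omega> T u 0 \<in> Lp 2 ?M" using rep T by (auto simp: is_continuous_rep_def)
  have n0: "Lp_norm 2 ?M (value_at \<Omega> T u 0) = Lp_norm 2 ?M u0"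
    by (rule Lp_norm_cong_AE[OF Lp_measurable[OF c0] Lp_measurable[OF u0] init])
  \<comment> \<open>The energy \<open>a\<close> cancels between the two integrals and only the
    pairing with the time derivative remains.\<close>
  have "(LINT t|?L. a t) + (LINT t|?L. - u' t (u t) - a t) = - (LINT t|?L. u' t (u t))"
    using iuu ia by simp
  also have "\<dots> = (1/2) * (Lp_norm 2 ?M u0)\<^sup>2 - (1/2) * (Lp_norm 2 ?M (value_at \<Omega> T u T))\<^sup>2"
    using ibp(3)[OF rep] n0 by simp
  finally have sum: "(LINT t|?L. a t) + (LINT t|?L. - u' t (u t) - a t)
      + (1/2) * (Lp_norm 2 ?M (value_at \<Omega> T u T))\<^sup>2 = (1/2) * (Lp_norm 2 ?M u0)\<^sup>2" by simp
  show ?thesis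
    unfolding BEN_functional_def u'_def[symmetric] X_def[symmetric] e1 e2 using init sum by simp
qed

theorem theorem4p5:
  fixes \<Omega> \<Gamma>\<^sub>D \<Gamma>\<^sub>N :: "(real^'d) set"
    and p q T :: real
    and \<phi> :: "real \<Rightarrow> real^'d \<Rightarrow> real^'d^'l \<Rightarrow> ereal"
    and \<psi> :: "real \<Rightarrow> real^'d \<Rightarrow> real^'l \<Rightarrow> ereal"
    and f :: "real \<Rightarrow> (real^'d \<Rightarrow> real^'l) \<Rightarrow> real"
    and u0 :: "real^'d \<Rightarrow> real^'l"
    and u :: "real \<Rightarrow> real^'d \<Rightarrow> real^'l"
  defines "E \<equiv> energy \<Omega> p \<phi> \<psi> f"
  defines "\<E> \<equiv> BEN_functional \<Omega> \<Gamma>\<^sub>D p q T E u0"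
  assumes "bounded_lipschitz_domain \<Omega>"
    and "boundary_partition \<Omega> \<Gamma>\<^sub>D \<Gamma>\<^sub>N"
    and "1 < p" and "p \<ge> 2 * real CARD('d) / (real CARD('d) + 2)" and "1 / p + 1 / q = 1"
    and "0 < T"
    and "assumption_A \<Omega> \<Gamma>\<^sub>D p q T \<phi> \<psi>"
    and "f \<in> bochner_Lp_Vdual \<Omega> \<Gamma>\<^sub>D p q {0<..<T}"
    and "u0 \<in> Lp 2 (lebesgue_on \<Omega>)"
    and "is_flow_solution \<Omega> \<Gamma>\<^sub>D p q T E u0 u"
  shows "\<bar>\<E> u\<bar> \<noteq> \<infinity> \<and>
    (\<forall>v \<in> W_space \<Omega> \<Gamma>\<^sub>D p q T. rho_squared \<E> u v = eta_squared \<Omega> \<E> u0 v)"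
proof -
  have sol: "is_flow_solution \<Omega> \<Gamma>\<^sub>D p q T (energy \<Omega> p \<phi> \<psi> f) u0 u" using assms(12) unfolding assms(1) .
  have "\<E> u = ereal ((1/2) * (Lp_norm 2 (lebesgue_on \<Omega>) u0)\<^sup>2)"
    unfolding assms(1,2) by (rule energy_at_solution[OF assms(3,5,7,8,9,10,11) sol])
  then show ?thesis by (simp add: rho_squared_def eta_squared_def)
qed

end
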